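(* Let $H$ be a locally Frobenius Hopf algebra over a field $k$ and let $L$ and $M$ be two coherent left $H$-modules. Then the $H$-module $L\otimes M$ is pseudo-coherent.
   Context: $k$ is a field, $\otimes=\otimes_k$; all algebras, modules and homomorphisms are unital. For left $H$-modules $L,M$ over a Hopf algebra $H$, $L\otimes M$ has the diagonal action $h\cdot(\ell\otimes m)=\sum_i h_i'\ell\otimes h_i''m$, where $\psi(h)=\sum_i h'_i\otimes h''_i$ is the coproduct. A module is pseudo-coherent if every finitely generated submodule is finitely presented, and coherent if it is finitely generated and pseudo-coherent. For a finite dimensional Hopf algebra $R$ with counit $\epsilon$, the spaces of left and right integrals are $\{h\in R:\forall y\in R,\ yh=\epsilon(y)h\}$ and $\{h\in R:\forall y\in R,\ hy=\epsilon(y)h\}$; $R$ is unimodular if these coincide, and involutive if the square of the antipode is the identity. Shape: $(\Lambda,\preccurlyeq,\lambda_0)$ is an infinite partially ordered set such that any two elements have a common upper bound, $\lambda_0$ is a unique initial element, and for every $\lambda\in\Lambda$ there is $\lambda'\in\Lambda$ with $\lambda\preccurlyeq\lambda'$, $\lambda\ne\lambda'$. A Hopf algebra $H$ over $k$ is a locally Frobenius Hopf algebra (of shape $\Lambda$) if there is a $\Lambda$-directed system of finite dimensional subHopf algebras $H(\lambda)\subseteq H$ ($\lambda\in\Lambda$), with proper inclusions $H(\lambda')\hookrightarrow H(\lambda'')$ for $\lambda'\preccurlyeq\lambda''$, $\lambda'\ne\lambda''$, such that $H(\lambda_0)=k$, $H=\bigcup_{\lambda\in\Lambda}H(\lambda)$,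 and each $H(\lambda)$ is involutive and unimodular. *)

theory Defs
  imports "HOL-Algebra.Module" "HOL-Algebra.QuotRing"
begin

section \<open>Left modules over a not necessarily commutative ring\<close>

text \<open>
  The locale \<^locale>\<open>module\<close> requires a commutative ring of scalars.  The record type
  \<open>('r, 'm) module\<close> is reused here, as in HOL-Algebra; its ring multiplication and unit are
  irrelevant for modules and are set to \<^const>\<open>undefined\<close> in the constructions below.
\<close>

locale left_module = R?: ring R + M?: abelian_group M
  for R :: "('r, 'z) ring_scheme" (structure) and M :: "('r, 'm, 'y) module_scheme" (structure) +
  assumes lsmult_closed:
      "\<lbrakk>a \<in> carrier R; x \<in> carrier M\<rbrakk> \<Longrightarrow> a \<odot>\<^bsub>M\<^esub> x \<in> carrier M"
    and lsmult_l_distr: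
      "\<lbrakk>a \<in> carrier R; b \<in> carrier R; x \<in> carrier M\<rbrakk> \<Longrightarrow>
        (a \<oplus>\<^bsub>R\<^esub> b) \<odot>\<^bsub>M\<^esub> x = a \<odot>\<^bsub>M\<^esub> x \<oplus>\<^bsub>M\<^esub> b \<odot>\<^bsub>M\<^esub> x"
    and lsmult_r_distr:
      "\<lbrakk>a \<in> carrier R; x \<in> carrier M; y \<in> carrier M\<rbrakk> \<Longrightarrow>
        a \<odot>\<^bsub>M\<^esub> (x \<oplus>\<^bsub>M\<^esub> y) = a \<odot>\<^bsub>M\<^esub> x \<oplus>\<^bsub>M\<^esub> a \<odot>\<^bsub>M\<^esub> y"
    and lsmult_assoc:
      "\<lbrakk>a \<in> carrier R; b \<in> carrier R; x \<in> carrier M\<rbrakk> \<Longrightarrow>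
        (a \<otimes>\<^bsub>R\<^esub> b) \<odot>\<^bsub>M\<^esub> x = a \<odot>\<^bsub>M\<^esub> (b \<odot>\<^bsub>M\<^esub> x)"
    and lsmult_one:
      "x \<in> carrier M \<Longrightarrow> \<one>\<^bsub>R\<^esub> \<odot>\<^bsub>M\<^esub> x = x"

definition module_homs ::
  "('r, 'z) ring_scheme \<Rightarrow> ('r, 'm, 'y) module_scheme \<Rightarrow> ('r, 'n, 'x) module_scheme \<Rightarrow> ('m \<Rightarrow> 'n) set"
  where "module_homs R M N =
    {f \<in> carrier M \<rightarrow> carrier N.
       (\<forall>x\<in>carrier M. \<forall>y\<in>carrier M. f (x \<oplus>\<^bsub>M\<^esub> y) = f x \<oplus>\<^bsub>N\<^esub> f y) \<and>
       (\<forall>a\<in>carrier R. \<forall>x\<in>carrier M. f (a \<odot>\<^bsub>M\<^esub> x) = a \<odot>\<^bsub>N\<^esub> f x)}"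

definition finitely_generated ::
  "('r, 'z) ring_scheme \<Rightarrow> ('r, 'm, 'y) module_scheme \<Rightarrow> bool"
  where "finitely_generated R M \<longleftrightarrow>
    (\<exists>S. finite S \<and> S \<subseteq> carrier M \<and>
      carrier M = {(\<Oplus>\<^bsub>M\<^esub>s\<in>S. c s \<odot>\<^bsub>M\<^esub> s) | c. c \<in> S \<rightarrow> carrier R})"

definition free_module :: "('r, 'z) ring_scheme \<Rightarrow> nat \<Rightarrow> ('r, nat \<Rightarrow> 'r) module"
  where "free_module R n =
    \<lparr>carrier = {..<n} \<rightarrow>\<^sub>E carrier R, mult = undefined, one = undefined,
     zero = (\<lambda>i\<in>{..<n}. \<zero>\<^bsub>R\<^esub>),
     add = (\<lambda>x y. \<lambda>i\<in>{..<n}. x i \<oplus>\<^bsub>R\<^esub> y i),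
     smult = (\<lambda>a x. \<lambda>i\<in>{..<n}. a \<otimes>\<^bsub>R\<^esub> x i)\<rparr>"

definition finitely_presented ::
  "('r, 'z) ring_scheme \<Rightarrow> ('r, 'm, 'y) module_scheme \<Rightarrow> bool"
  where "finitely_presented R M \<longleftrightarrow>
    (\<exists>n. \<exists>\<phi> \<in> module_homs R (free_module R n) M.
       \<phi> ` carrier (free_module R n) = carrier M \<and>
       finitely_generated R
         ((free_module R n)\<lparr>carrier := a_kernel (free_module R n) M \<phi>\<rparr>))"

definition pseudo_coherent ::
  "('r, 'z) ring_scheme \<Rightarrow> ('r, 'm, 'y) module_scheme \<Rightarrow> bool"
  where "pseudo_coherent R M \<longleftrightarrow> left_module R M \<and>
    (\<forall>N. submodule N R M \<longrightarrow> finitely_generated R (M\<lparr>carrier := N\<rparr>) \<longrightarrow>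
       finitely_presented R (M\<lparr>carrier := N\<rparr>))"

definition coherent ::
  "('r, 'z) ring_scheme \<Rightarrow> ('r, 'm, 'y) module_scheme \<Rightarrow> bool"
  where "coherent R M \<longleftrightarrow> finitely_generated R M \<and> pseudo_coherent R M"

definition quotient_module ::
  "('r, 'm, 'y) module_scheme \<Rightarrow> 'm set \<Rightarrow> ('r, 'm set) module"
  where "quotient_module M N =
    \<lparr>carrier = a_rcosets\<^bsub>M\<^esub> N, mult = undefined, one = undefined,
     zero = N, add = set_add M,
     smult = (\<lambda>a X. \<Union>x\<in>X. N +>\<^bsub>M\<^esub> (a \<odot>\<^bsub>M\<^esub> x))\<rparr>"


section \<open>Tensor products over a field\<close>

text \<open>
  \<open>V \<otimes> W\<close> is the free \<open>k\<close>-module on \<open>carrier V \<times> carrier W\<close> (finitely supported functions)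
  modulo the submodule generated by the bilinearity relations.
\<close>

definition free_on :: "('k, 'z) ring_scheme \<Rightarrow> 'a set \<Rightarrow> ('k, 'a \<Rightarrow> 'k) module"
  where "free_on k A =
    \<lparr>carrier = {f. range f \<subseteq> carrier k \<and> finite {x. f x \<noteq> \<zero>\<^bsub>k\<^esub>} \<and> {x. f x \<noteq> \<zero>\<^bsub>k\<^esub>} \<subseteq> A},
     mult = undefined, one = undefined,
     zero = (\<lambda>x. \<zero>\<^bsub>k\<^esub>),
     add = (\<lambda>f g x. f x \<oplus>\<^bsub>k\<^esub> g x),
     smult = (\<lambda>a f x. a \<otimes>\<^bsub>k\<^esub> f x)\<rparr>"

definition single :: "('k, 'z) ring_scheme \<Rightarrow> 'a \<Rightarrow> 'a \<Rightarrow> 'k"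
  where "single k x = (\<lambda>y. if y = x then \<one>\<^bsub>k\<^esub> else \<zero>\<^bsub>k\<^esub>)"

definition tensor_gens ::
  "('k, 'z) ring_scheme \<Rightarrow> ('k, 'v, 'x) module_scheme \<Rightarrow> ('k, 'w, 'y) module_scheme \<Rightarrow>
    ('v \<times> 'w \<Rightarrow> 'k) set"
  where "tensor_gens k V W =
    (let F = free_on k (carrier V \<times> carrier W); \<delta> = (\<lambda>v w. single k (v, w)) in
      {\<delta> (v \<oplus>\<^bsub>V\<^esub> v') w \<ominus>\<^bsub>F\<^esub> (\<delta> v w \<oplus>\<^bsub>F\<^esub> \<delta> v' w) | v v' w.
          v \<in> carrier V \<and> v' \<in> carrier V \<and> w \<in> carrier W} \<union>
      {\<delta> v (w \<oplus>\<^bsub>W\<^esub> w') \<ominus>\<^bsub>F\<^esub> (\<delta> v w \<oplus>\<^bsub>F\<^esub> \<delta> v w') | v w w'.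
          v \<in> carrier V \<and> w \<in> carrier W \<and> w' \<in> carrier W} \<union>
      {\<delta> (a \<odot>\<^bsub>V\<^esub> v) w \<ominus>\<^bsub>F\<^esub> a \<odot>\<^bsub>F\<^esub> \<delta> v w | a v w.
          a \<in> carrier k \<and> v \<in> carrier V \<and> w \<in> carrier W} \<union>
      {\<delta> v (a \<odot>\<^bsub>W\<^esub> w) \<ominus>\<^bsub>F\<^esub> a \<odot>\<^bsub>F\<^esub> \<delta> v w | a v w.
          a \<in> carrier k \<and> v \<in> carrier V \<and> w \<in> carrier W})"

definition tensor_rels ::
  "('k, 'z) ring_scheme \<Rightarrow> ('k, 'v, 'x) module_scheme \<Rightarrow> ('k, 'w, 'y) module_scheme \<Rightarrow>
    ('v \<times> 'w \<Rightarrow> 'k) set"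
  where "tensor_rels k V W =
    \<Inter>{N. submodule N k (free_on k (carrier V \<times> carrier W)) \<and> tensor_gens k V W \<subseteq> N}"

definition tensor_prod ::
  "('k, 'z) ring_scheme \<Rightarrow> ('k, 'v, 'x) module_scheme \<Rightarrow> ('k, 'w, 'y) module_scheme \<Rightarrow>
    ('k, ('v \<times> 'w \<Rightarrow> 'k) set) module"
  where "tensor_prod k V W =
    quotient_module (free_on k (carrier V \<times> carrier W)) (tensor_rels k V W)"

definition pure_tensor ::
  "('k, 'z) ring_scheme \<Rightarrow> ('k, 'v, 'x) module_scheme \<Rightarrow> ('k, 'w, 'y) module_scheme \<Rightarrow>
    'v \<Rightarrow> 'w \<Rightarrow> ('v \<times> 'w \<Rightarrow> 'k) set"
  where "pure_tensor k V W v w =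
    tensor_rels k V W +>\<^bsub>free_on k (carrier V \<times> carrier W)\<^esub> single k (v, w)"

text \<open>
  The linear map \<open>V \<otimes> W \<rightarrow> U\<close> induced by a bilinear map \<open>b\<close>, i.e. with \<open>v \<otimes> w \<mapsto> b v w\<close>.  For
  bilinear \<open>b\<close> all representatives of a coset have the same image, so that the image of the
  coset is a singleton; otherwise the value is unspecified.
\<close>

definition tensor_lift ::
  "('k, 'z) ring_scheme \<Rightarrow> ('k, 'u, 'y) module_scheme \<Rightarrow> ('v \<Rightarrow> 'w \<Rightarrow> 'u) \<Rightarrow>
    ('v \<times> 'w \<Rightarrow> 'k) set \<Rightarrow> 'u"
  where "tensor_lift k U b t =
    the_elem ((\<lambda>f. \<Oplus>\<^bsub>U\<^esub>p\<in>{p. f p \<noteq> \<zero>\<^bsub>k\<^esub>}. f p \<odot>\<^bsub>U\<^esub> b (fst p) (snd p)) ` t)"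

text \<open>The map \<open>f \<otimes> g\<close> with values in \<open>V \<otimes> W\<close>.\<close>

definition tensor_map ::
  "('k, 'z) ring_scheme \<Rightarrow> ('k, 'v, 'x) module_scheme \<Rightarrow> ('k, 'w, 'y) module_scheme \<Rightarrow>
    ('a \<Rightarrow> 'v) \<Rightarrow> ('b \<Rightarrow> 'w) \<Rightarrow> ('a \<times> 'b \<Rightarrow> 'k) set \<Rightarrow> ('v \<times> 'w \<Rightarrow> 'k) set"
  where "tensor_map k V W f g =
    tensor_lift k (tensor_prod k V W) (\<lambda>a b. pure_tensor k V W (f a) (g b))"

text \<open>The canonical isomorphism \<open>(U \<otimes> V) \<otimes> W \<rightarrow> U \<otimes> (V \<otimes> W)\<close>.\<close>

definition tensor_assoc ::
  "('k, 'z) ring_scheme \<Rightarrow> ('k, 'u, 'p) module_scheme \<Rightarrow> ('k, 'v, 'x) module_scheme \<Rightarrow>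
    ('k, 'w, 'y) module_scheme \<Rightarrow>
    (('u \<times> 'v \<Rightarrow> 'k) set \<times> 'w \<Rightarrow> 'k) set \<Rightarrow> ('u \<times> ('v \<times> 'w \<Rightarrow> 'k) set \<Rightarrow> 'k) set"
  where "tensor_assoc k U V W =
    (let T = tensor_prod k U (tensor_prod k V W) in
      tensor_lift k T (\<lambda>t w.
        tensor_lift k T (\<lambda>u v.
          pure_tensor k U (tensor_prod k V W) u (pure_tensor k V W v w)) t))"


section \<open>Associative algebras and Hopf algebras\<close>

text \<open>
  The locale \<^locale>\<open>algebra\<close> requires a commutative multiplication, hence the following variant.
\<close>

locale assoc_algebra = module k A + ring A
  for k :: "('k, 'z) ring_scheme" and A :: "('k, 'a, 'y) module_scheme" +
  assumes smult_mult_left: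
      "\<lbrakk>c \<in> carrier k; x \<in> carrier A; y \<in> carrier A\<rbrakk> \<Longrightarrow>
        (c \<odot>\<^bsub>A\<^esub> x) \<otimes>\<^bsub>A\<^esub> y = c \<odot>\<^bsub>A\<^esub> (x \<otimes>\<^bsub>A\<^esub> y)"
    and smult_mult_right:
      "\<lbrakk>c \<in> carrier k; x \<in> carrier A; y \<in> carrier A\<rbrakk> \<Longrightarrow>
        x \<otimes>\<^bsub>A\<^esub> (c \<odot>\<^bsub>A\<^esub> y) = c \<odot>\<^bsub>A\<^esub> (x \<otimes>\<^bsub>A\<^esub> y)"

record ('k, 'h) hopf = "('k, 'h) module" +
  comult :: "'h \<Rightarrow> ('h \<times> 'h \<Rightarrow> 'k) set"
  counit :: "'h \<Rightarrow> 'k"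
  antipode :: "'h \<Rightarrow> 'h"

text \<open>The product \<open>(a \<otimes> b) (c \<otimes> d) = a c \<otimes> b d\<close> of \<open>A \<otimes> A\<close>.\<close>

definition tensor_mult ::
  "('k, 'z) ring_scheme \<Rightarrow> ('k, 'a, 'y) module_scheme \<Rightarrow>
    ('a \<times> 'a \<Rightarrow> 'k) set \<Rightarrow> ('a \<times> 'a \<Rightarrow> 'k) set \<Rightarrow> ('a \<times> 'a \<Rightarrow> 'k) set"
  where "tensor_mult k A s t =
    tensor_lift k (tensor_prod k A A) (\<lambda>a b.
      tensor_lift k (tensor_prod k A A) (\<lambda>c d.
        pure_tensor k A A (a \<otimes>\<^bsub>A\<^esub> c) (b \<otimes>\<^bsub>A\<^esub> d)) t) s"

text \<open>A field regarded as a module over itself.\<close>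

definition self_module :: "('k, 'z) ring_scheme \<Rightarrow> ('k, 'k) module"
  where "self_module k =
    \<lparr>carrier = carrier k, mult = mult k, one = one k, zero = zero k, add = add k,
     smult = mult k\<rparr>"

locale hopf_algebra = field k + assoc_algebra k H
  for k :: "('k, 'z) ring_scheme" and H :: "('k, 'h, 'y) hopf_scheme" +
  assumes comult_linear: "comult H \<in> module_homs k H (tensor_prod k H H)"
    and counit_linear: "counit H \<in> module_homs k H (self_module k)"
    and antipode_linear: "antipode H \<in> module_homs k H H"
    and coassoc:
      "h \<in> carrier H \<Longrightarrow>
        tensor_assoc k H H H (tensor_map k (tensor_prod k H H) H (comult H) id (comult H h)) =
        tensor_map k H (tensor_prod k H H) id (comult H) (comult H h)"
    and counit_left:
      "h \<in> carrier H \<Longrightarrow> tensor_lift k H (\<lambda>a b. counit H a \<odot>\<^bsub>H\<^esub> b) (comult H h) = h"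
    and counit_right:
      "h \<in> carrier H \<Longrightarrow> tensor_lift k H (\<lambda>a b. counit H b \<odot>\<^bsub>H\<^esub> a) (comult H h) = h"
    and comult_mult:
      "\<lbrakk>g \<in> carrier H; h \<in> carrier H\<rbrakk> \<Longrightarrow>
        comult H (g \<otimes>\<^bsub>H\<^esub> h) = tensor_mult k H (comult H g) (comult H h)"
    and comult_one: "comult H \<one>\<^bsub>H\<^esub> = pure_tensor k H H \<one>\<^bsub>H\<^esub> \<one>\<^bsub>H\<^esub>"
    and counit_mult:
      "\<lbrakk>g \<in> carrier H; h \<in> carrier H\<rbrakk> \<Longrightarrow>
        counit H (g \<otimes>\<^bsub>H\<^esub> h) = counit H g \<otimes>\<^bsub>k\<^esub> counit H h"
    and counit_one: "counit H \<one>\<^bsub>H\<^esub> = \<one>\<^bsub>k\<^esub>"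
    and antipode_left:
      "h \<in> carrier H \<Longrightarrow>
        tensor_lift k H (\<lambda>a b. antipode H a \<otimes>\<^bsub>H\<^esub> b) (comult H h) = counit H h \<odot>\<^bsub>H\<^esub> \<one>\<^bsub>H\<^esub>"
    and antipode_right:
      "h \<in> carrier H \<Longrightarrow>
        tensor_lift k H (\<lambda>a b. a \<otimes>\<^bsub>H\<^esub> antipode H b) (comult H h) = counit H h \<odot>\<^bsub>H\<^esub> \<one>\<^bsub>H\<^esub>"

text \<open>
  A subHopf algebra is given by its carrier \<open>A\<close>.  The last condition is \<open>\<psi>(A) \<subseteq> A \<otimes> A\<close>, where
  \<open>A \<otimes> A\<close> is identified with its image in \<open>H \<otimes> H\<close>; the canonical map is injective as \<open>k\<close> is a
  field.
\<close>

definition sub_hopf_algebra ::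
  "('k, 'z) ring_scheme \<Rightarrow> ('k, 'h, 'y) hopf_scheme \<Rightarrow> 'h set \<Rightarrow> bool"
  where "sub_hopf_algebra k H A \<longleftrightarrow>
    submodule A k H \<and> \<one>\<^bsub>H\<^esub> \<in> A \<and> (\<forall>a\<in>A. \<forall>b\<in>A. a \<otimes>\<^bsub>H\<^esub> b \<in> A) \<and>
    (\<forall>a\<in>A. antipode H a \<in> A) \<and>
    (\<forall>a\<in>A. comult H a \<in>
       tensor_map k H H id id ` carrier (tensor_prod k (H\<lparr>carrier := A\<rparr>) (H\<lparr>carrier := A\<rparr>)))"

text \<open>
  The following notions do not refer to the coproduct, and are applied to subHopf algebras
  \<open>H\<lparr>carrier := A\<rparr>\<close> below (whose \<^const>\<open>comult\<close> component still takes values in \<open>H \<otimes> H\<close>).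
\<close>

definition left_integrals :: "('k, 'h, 'y) hopf_scheme \<Rightarrow> 'h set"
  where "left_integrals R =
    {h \<in> carrier R. \<forall>y\<in>carrier R. y \<otimes>\<^bsub>R\<^esub> h = counit R y \<odot>\<^bsub>R\<^esub> h}"

definition right_integrals :: "('k, 'h, 'y) hopf_scheme \<Rightarrow> 'h set"
  where "right_integrals R =
    {h \<in> carrier R. \<forall>y\<in>carrier R. h \<otimes>\<^bsub>R\<^esub> y = counit R y \<odot>\<^bsub>R\<^esub> h}"

definition unimodular :: "('k, 'h, 'y) hopf_scheme \<Rightarrow> bool"
  where "unimodular R \<longleftrightarrow> left_integrals R = right_integrals R"

definition involutive :: "('k, 'h, 'y) hopf_scheme \<Rightarrow> bool"
  where "involutive R \<longleftrightarrow> (\<forall>h\<in>carrier R. antipode R (antipode R h) = h)"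

definition shape :: "'i set \<Rightarrow> ('i \<Rightarrow> 'i \<Rightarrow> bool) \<Rightarrow> 'i \<Rightarrow> bool"
  where "shape \<Lambda> leq i0 \<longleftrightarrow>
    infinite \<Lambda> \<and> reflp_on \<Lambda> leq \<and> antisymp_on \<Lambda> leq \<and> transp_on \<Lambda> leq \<and>
    (\<forall>\<mu>\<in>\<Lambda>. \<forall>\<nu>\<in>\<Lambda>. \<exists>\<kappa>\<in>\<Lambda>. leq \<mu> \<kappa> \<and> leq \<nu> \<kappa>) \<and>
    i0 \<in> \<Lambda> \<and> (\<forall>\<mu>\<in>\<Lambda>. leq i0 \<mu>) \<and>
    (\<forall>\<mu>\<in>\<Lambda>. \<exists>\<nu>\<in>\<Lambda>. leq \<mu> \<nu> \<and> \<mu> \<noteq> \<nu>)"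

definition locally_frobenius_hopf_algebra ::
  "('k, 'z) ring_scheme \<Rightarrow> ('k, 'h, 'y) hopf_scheme \<Rightarrow> 'i set \<Rightarrow> ('i \<Rightarrow> 'i \<Rightarrow> bool) \<Rightarrow> 'i \<Rightarrow> bool"
  where "locally_frobenius_hopf_algebra k H \<Lambda> leq i0 \<longleftrightarrow>
    hopf_algebra k H \<and> shape \<Lambda> leq i0 \<and>
    (\<exists>K :: 'i \<Rightarrow> 'h set.
      (\<forall>\<mu>\<in>\<Lambda>. sub_hopf_algebra k H (K \<mu>) \<and> finitely_generated k (H\<lparr>carrier := K \<mu>\<rparr>)) \<and>
      (\<forall>\<mu>\<in>\<Lambda>. \<forall>\<nu>\<in>\<Lambda>. leq \<mu> \<nu> \<and> \<mu> \<noteq> \<nu> \<longrightarrow> K \<mu> \<subset> K \<nu>) \<and>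
      K i0 = {a \<odot>\<^bsub>H\<^esub> \<one>\<^bsub>H\<^esub> | a. a \<in> carrier k} \<and>
      carrier H = (\<Union>\<mu>\<in>\<Lambda>. K \<mu>) \<and>
      (\<forall>\<mu>\<in>\<Lambda>. involutive (H\<lparr>carrier := K \<mu>\<rparr>) \<and> unimodular (H\<lparr>carrier := K \<mu>\<rparr>)))"


section \<open>Tensor products of modules over a Hopf algebra\<close>

definition restrict_scalars ::
  "('k, 'h, 'y) module_scheme \<Rightarrow> ('h, 'l, 'x) module_scheme \<Rightarrow> ('k, 'l) module"
  where "restrict_scalars H L =
    \<lparr>carrier = carrier L, mult = undefined, one = undefined, zero = zero L, add = add L,
     smult = (\<lambda>a x. (a \<odot>\<^bsub>H\<^esub> \<one>\<^bsub>H\<^esub>) \<odot>\<^bsub>L\<^esub> x)\<rparr>"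

text \<open>\<open>L \<otimes> M\<close> with the diagonal action \<open>h (l \<otimes> m) = \<Sum> h' l \<otimes> h'' m\<close>.\<close>

definition diagonal_tensor ::
  "('k, 'z) ring_scheme \<Rightarrow> ('k, 'h, 'y) hopf_scheme \<Rightarrow>
    ('h, 'l, 'x) module_scheme \<Rightarrow> ('h, 'm, 'w) module_scheme \<Rightarrow>
    ('h, ('l \<times> 'm \<Rightarrow> 'k) set) module"
  where "diagonal_tensor k H L M =
    (let V = restrict_scalars H L; W = restrict_scalars H M; T = tensor_prod k V W in
      \<lparr>carrier = carrier T, mult = undefined, one = undefined, zero = zero T, add = add T,
       smult = (\<lambda>h t.
         tensor_lift k T (\<lambda>h' h''. tensor_map k V W (smult L h') (smult M h'') t)
           (comult H h))\<rparr>)"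

end

theory Submission
  imports Defs
begin

text \<open>
  Since \<open>H\<close> is the union of involutive subHopf algebras, \<open>S\<^sup>2 = id\<close> on \<open>H\<close>.  Let \<open>B \<subseteq> A\<close> be finite
  dimensional subHopf algebras of \<open>H\<close>.

  First, there are \<open>y\<^sub>i \<in> A\<close> and right \<open>B\<close>-linear \<open>\<pi>\<^sub>i : H \<rightarrow> B\<close> with \<open>x = \<Sum> y\<^sub>i \<pi>\<^sub>i(x)\<close> for \<open>x \<in> A\<close>.  To see this, let
  \<open>e\<close> be a maximal idempotent among the maps \<open>h \<mapsto> \<Sum> y\<^sub>i \<pi>\<^sub>i(h)\<close>; it is nonzero because \<open>B\<close> is
  self-injective.  For the diagonal right action of \<open>B\<close>, the submodule \<open>e A \<otimes> A + A \<otimes> e A\<close> of \<open>A \<otimes> A\<close> is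
  projective, and \<open>A \<otimes> A\<close> is isomorphic to the direct sum of \<open>n = dim A\<close> copies of \<open>A\<close>.  By maximality
  of \<open>e\<close>, a projective summand of the latter embeds in the sum of \<open>n\<close> copies of \<open>e A\<close>, and counting
  dimensions gives \<open>e A = A\<close>.

  Secondly, let \<open>L\<close> have generators \<open>l\<^sub>t\<close> with finitely many defining relations whose entries lie in \<open>B\<close>.
  Every right \<open>B\<close>-linear \<open>\<pi> : H \<rightarrow> B\<close> induces a linear map \<open>\<Omega>\<close> of \<open>L \<otimes> M\<close> with \<open>\<Omega>(h s) = \<pi>(h) s\<close> for
  \<open>s \<in> (\<Sum> B l\<^sub>t) \<otimes> M\<close>.  If \<open>g\<^sub>1, \<dots>, g\<^sub>r\<close> are such elements and \<open>\<Sum> h\<^sub>j g\<^sub>j = 0\<close>, then \<open>\<Sum> \<pi>(h\<^sub>j) g\<^sub>j = 0\<close>.  With \<open>A\<close>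
  containing all \<open>h\<^sub>j\<close>, the first step writes \<open>(h\<^sub>j)\<close> as a combination of relations with entries in \<open>B\<close>,
  and these form a finite dimensional space.
\<close>

section \<open>Linear maps\<close>

text \<open>The generators of a kernel must be fixed before a kernel element is given, whereas A
  grows with that element. Projecting by right B-linear maps \<pi> removes this dependence: the
  projected relations have entries in B and form one finite dimensional space. The map \<Omega> is
  well defined on L because \<pi> commutes with right multiplication by the entries of the defining
  relations. Both claims about A \<otimes> A rest on the untwisting x \<otimes> z \<mapsto> \<Sum> x
  S(z') \<otimes> z'', which turns the diagonal action into multiplication on one factor. Untwisting
  onto the other factor, and the retraction of H onto B, use the skew identities \<Sum> S(h'') h' =
  \<epsilon>(h) = \<Sum> h'' S(h'); this is where involutivity enters. With p = dim e A and 0 < p <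
  n, the submodule e A \<otimes> A + A \<otimes> e A has dimension n p + p (n - p), more than the
  dimension n p of n copies of e A. The strict inequality is the reason why e must be nonzero. The
  complements (1 - e) A can be cancelled because an endomorphism of such a complement that factors
  through a projective module is nilpotent.\<close>

lemma module_homsI:
  assumes "\<And>x. x \<in> carrier V \<Longrightarrow> f x \<in> carrier U"
    and "\<And>x y. x \<in> carrier V \<Longrightarrow> y \<in> carrier V \<Longrightarrow> f (x \<oplus>\<^bsub>V\<^esub> y) = f x \<oplus>\<^bsub>U\<^esub> f y"
    and "\<And>a x. a \<in> carrier R \<Longrightarrow> x \<in> carrier V \<Longrightarrow> f (a \<odot>\<^bsub>V\<^esub> x) = a \<odot>\<^bsub>U\<^esub> f x"
  shows "f \<in> module_homs R V U"
  using assms by (auto simp: module_homs_def)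

lemma module_homsD:
  assumes "f \<in> module_homs R V U"
  shows "x \<in> carrier V \<Longrightarrow> f x \<in> carrier U"
    and "x \<in> carrier V \<Longrightarrow> y \<in> carrier V \<Longrightarrow> f (x \<oplus>\<^bsub>V\<^esub> y) = f x \<oplus>\<^bsub>U\<^esub> f y"
    and "a \<in> carrier R \<Longrightarrow> x \<in> carrier V \<Longrightarrow> f (a \<odot>\<^bsub>V\<^esub> x) = a \<odot>\<^bsub>U\<^esub> f x"
  using assms by (auto simp: module_homs_def)

lemma hom_zero_minus:
  assumes "abelian_group V" "abelian_group U" "f \<in> module_homs R V U"
  shows "f \<zero>\<^bsub>V\<^esub> = \<zero>\<^bsub>U\<^esub>"
    and "x \<in> carrier V \<Longrightarrow> f (\<ominus>\<^bsub>V\<^esub> x) = \<ominus>\<^bsub>U\<^esub> f x"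
    and "x \<in> carrier V \<Longrightarrow> y \<in> carrier V \<Longrightarrow> f (x \<ominus>\<^bsub>V\<^esub> y) = f x \<ominus>\<^bsub>U\<^esub> f y"
proof -
  interpret V: abelian_group V by fact
  interpret U: abelian_group U by fact
  note f = module_homsD[OF assms(3)]
  have "f \<zero>\<^bsub>V\<^esub> \<oplus>\<^bsub>U\<^esub> f \<zero>\<^bsub>V\<^esub> = f \<zero>\<^bsub>V\<^esub>" using f(2)[of "\<zero>\<^bsub>V\<^esub>" "\<zero>\<^bsub>V\<^esub>"] by simp
  then show z: "f \<zero>\<^bsub>V\<^esub> = \<zero>\<^bsub>U\<^esub>"
    using U.add.l_cancel_one f(1)[of "\<zero>\<^bsub>V\<^esub>"] by auto
  have m: "f (\<ominus>\<^bsub>V\<^esub> x) = \<ominus>\<^bsub>U\<^esub> f x" if "x \<in> carrier V" for x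
  proof -
    have "f (\<ominus>\<^bsub>V\<^esub> x) \<oplus>\<^bsub>U\<^esub> f x = \<zero>\<^bsub>U\<^esub>" using f(2)[of "\<ominus>\<^bsub>V\<^esub> x" x] that z by (simp add: V.l_neg)
    then show ?thesis using that f(1) by (metis U.minus_equality V.a_inv_closed)
  qed
  then show "x \<in> carrier V \<Longrightarrow> f (\<ominus>\<^bsub>V\<^esub> x) = \<ominus>\<^bsub>U\<^esub> f x" .
  show "x \<in> carrier V \<Longrightarrow> y \<in> carrier V \<Longrightarrow> f (x \<ominus>\<^bsub>V\<^esub> y) = f x \<ominus>\<^bsub>U\<^esub> f y"
    by (simp add: a_minus_def m f)
qed

lemma hom_finsum:
  assumes "abelian_group V" "abelian_group U" "f \<in> module_homs R V U"
    and "finite I" "\<And>i. i \<in> I \<Longrightarrow> g i \<in> carrier V"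
  shows "f (finsum V g I) = (\<Oplus>\<^bsub>U\<^esub>i\<in>I. f (g i))"
proof -
  interpret V: abelian_group V by fact
  interpret U: abelian_group U by fact
  note f = module_homsD[OF assms(3)]
  from assms(4,5) show ?thesis
  proof induction
    case empty
    then show ?case using hom_zero_minus[OF assms(1-3)] by simp
  next
    case (insert x F)
    then have "g \<in> F \<rightarrow> carrier V" by auto
    with insert show ?case by (simp add: f Pi_def)
  qed
qed

lemma module_abelian: "module R V \<Longrightarrow> abelian_group V"
  by (simp add: module_def)

section \<open>Bilinear maps and closure rules for linear maps\<close>

definition bilin ::
  "('k, 'z) ring_scheme \<Rightarrow> ('k, 'v, 'x) module_scheme \<Rightarrow> ('k, 'w, 'y) module_scheme \<Rightarrow>
    ('k, 'u, 'p) module_scheme \<Rightarrow> ('v \<Rightarrow> 'w \<Rightarrow> 'u) \<Rightarrow> bool"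
  where "bilin R V W U b \<longleftrightarrow>
    (\<forall>v\<in>carrier V. (\<lambda>w. b v w) \<in> module_homs R W U) \<and>
    (\<forall>w\<in>carrier W. (\<lambda>v. b v w) \<in> module_homs R V U)"

lemma bilinI:
  assumes "\<And>v. v \<in> carrier V \<Longrightarrow> (\<lambda>w. b v w) \<in> module_homs R W U"
    and "\<And>w. w \<in> carrier W \<Longrightarrow> (\<lambda>v. b v w) \<in> module_homs R V U"
  shows "bilin R V W U b"
  using assms by (auto simp: bilin_def)

lemma bilinD:
  assumes "bilin R V W U b"
  shows "v \<in> carrier V \<Longrightarrow> (\<lambda>w. b v w) \<in> module_homs R W U"
    and "w \<in> carrier W \<Longrightarrow> (\<lambda>v. b v w) \<in> module_homs R V U"
  using assms by (auto simp: bilin_def)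

lemma bilin_closed: "bilin R V W U b \<Longrightarrow> v \<in> carrier V \<Longrightarrow> w \<in> carrier W \<Longrightarrow> b v w \<in> carrier U"
  using bilinD(1) module_homsD(1) by fast

lemma bilin_cong:
  assumes "bilin R V W U b" "\<And>v w. v \<in> carrier V \<Longrightarrow> w \<in> carrier W \<Longrightarrow> b' v w = b v w"
    "module R V" "module R W"
  shows "bilin R V W U b'"
proof -
  interpret V: module R V by fact
  interpret W: module R W by fact
  note b = assms(1)[unfolded bilin_def]
  show ?thesis
    by (rule bilinI; rule module_homsI)
      (use b assms(2) in \<open>auto simp: module_homs_def Pi_iff\<close>)
qed

named_theorems lin_intros

lemma lin_id [lin_intros]: "(\<lambda>x. x) \<in> module_homs R V V"
  by (simp add: module_homs_def)

lemma lin_comp: "g \<in> module_homs R W U \<Longrightarrow> f \<in> module_homs R V W \<Longrightarrow> (\<lambda>x. g (f x)) \<in> module_homs R V U"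
  by (auto simp: module_homs_def Pi_iff)

lemma lin_bil_l:
  "bilin R V W U b \<Longrightarrow> w \<in> carrier W \<Longrightarrow> f \<in> module_homs R Z V \<Longrightarrow> (\<lambda>x. b (f x) w) \<in> module_homs R Z U"
  by (drule bilinD(2)) (auto intro: lin_comp)

lemma lin_bil_r:
  "bilin R V W U b \<Longrightarrow> v \<in> carrier V \<Longrightarrow> f \<in> module_homs R Z W \<Longrightarrow> (\<lambda>x. b v (f x)) \<in> module_homs R Z U"
  by (drule bilinD(1)) (auto intro: lin_comp)

lemma lin_add [lin_intros]:
  assumes "module R U" "f \<in> module_homs R V U" "g \<in> module_homs R V U"
  shows "(\<lambda>x. f x \<oplus>\<^bsub>U\<^esub> g x) \<in> module_homs R V U"
proof -
  interpret U: module R U by fact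
  show ?thesis using assms(2,3) by (auto simp: module_homs_def Pi_iff U.smult_r_distr U.M.a_ac)
qed

lemma lin_uminus:
  assumes "module R U" "f \<in> module_homs R V U"
  shows "(\<lambda>x. \<ominus>\<^bsub>U\<^esub> f x) \<in> module_homs R V U"
proof -
  interpret U: module R U by fact
  show ?thesis using assms(2) by (auto simp: module_homs_def Pi_iff U.smult_r_minus U.M.minus_add)
qed

lemma lin_minus [lin_intros]:
  assumes "module R U" "f \<in> module_homs R V U" "g \<in> module_homs R V U"
  shows "(\<lambda>x. f x \<ominus>\<^bsub>U\<^esub> g x) \<in> module_homs R V U"
  unfolding a_minus_def by (intro lin_add lin_uminus assms)

lemma lin_zero:
  assumes "module R U" "module R V"
  shows "(\<lambda>x. \<zero>\<^bsub>U\<^esub>) \<in> module_homs R V U"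
proof -
  interpret U: module R U by fact
  show ?thesis by (auto simp: module_homs_def Pi_iff)
qed

lemma lin_finsum [lin_intros]:
  assumes "module R U" "finite I" "\<And>i. i \<in> I \<Longrightarrow> f i \<in> module_homs R V U" "module R V"
  shows "(\<lambda>x. \<Oplus>\<^bsub>U\<^esub>i\<in>I. f i x) \<in> module_homs R V U"
  using assms(2,3)
proof (induction rule: finite_induct)
  case empty
  interpret U: module R U by fact
  show ?case by (simp add: lin_zero assms)
next
  case (insert i I)
  interpret U: module R U by fact
  interpret V: module R V by fact
  let ?g = "\<lambda>x. f i x \<oplus>\<^bsub>U\<^esub> (\<Oplus>\<^bsub>U\<^esub>i\<in>I. f i x)"
  have "?g \<in> module_homs R V U" using insert by (intro lin_add assms(1)) auto
  moreover have "(\<Oplus>\<^bsub>U\<^esub>i\<in>insert i I. f i x) = ?g x" if "x \<in> carrier V" for x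
    using insert.hyps insert.prems that by (subst U.M.finsum_insert) (auto dest: module_homsD)
  ultimately show ?case by (auto simp: module_homs_def Pi_iff)
qed

lemma lin_smult [lin_intros]:
  assumes "module R U" "c \<in> carrier R" "f \<in> module_homs R V U"
  shows "(\<lambda>x. c \<odot>\<^bsub>U\<^esub> f x) \<in> module_homs R V U"
proof -
  interpret U: module R U by fact
  show ?thesis using assms(2,3)
    by (auto simp: module_homs_def Pi_iff U.smult_r_distr simp flip: U.smult_assoc1) (simp add: U.R.m_comm)
qed

lemma lin_smult_l [lin_intros]:
  assumes "module R U" "u \<in> carrier U" "f \<in> module_homs R V (self_module R)"
  shows "(\<lambda>x. f x \<odot>\<^bsub>U\<^esub> u) \<in> module_homs R V U"
proof -
  interpret U: module R U by fact
  show ?thesis using assms(2,3)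
    by (auto simp: module_homs_def Pi_iff self_module_def U.smult_l_distr U.smult_assoc1)
qed

lemma self_module_simps [simp]:
  "carrier (self_module R) = carrier R" "add (self_module R) = add R" "zero (self_module R) = zero R"
  "smult (self_module R) = mult R" "a_inv (self_module R) = a_inv R"
  "finsum (self_module R) f I = finsum R f I"
proof -
  show "a_inv (self_module R) = a_inv R" by (rule ext) (simp add: a_inv_def m_inv_def self_module_def)
  show "finsum (self_module R) f I = finsum R f I" by (simp add: finsum_def finprod_def self_module_def)
qed (simp_all add: self_module_def)

lemma (in cring) self_module: "module R (self_module R)"
proof (rule moduleI)
  show "abelian_group (self_module R)"
  proof (rule abelian_groupI)
    show "\<exists>y\<in>carrier (self_module R). y \<oplus>\<^bsub>self_module R\<^esub> x = \<zero>\<^bsub>self_module R\<^esub>"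
      if "x \<in> carrier (self_module R)" for x
      using that by (intro bexI[of _ "\<ominus> x"]) (auto simp: l_neg)
  qed (auto simp: a_ac)
qed (simp_all add: l_distr r_distr m_assoc is_cring)

section \<open>Tensor products\<close>

subsection \<open>Free modules and quotients\<close>

lemma free_on_simps:
  "zero (free_on R A) = (\<lambda>x. \<zero>\<^bsub>R\<^esub>)"
  "add (free_on R A) f g = (\<lambda>x. f x \<oplus>\<^bsub>R\<^esub> g x)"
  "smult (free_on R A) a f = (\<lambda>x. a \<otimes>\<^bsub>R\<^esub> f x)"
  by (simp_all add: free_on_def)

lemma free_on_carrier:
  "f \<in> carrier (free_on R A) \<longleftrightarrow>
    (\<forall>x. f x \<in> carrier R) \<and> finite {x. f x \<noteq> \<zero>\<^bsub>R\<^esub>} \<and> (\<forall>x. x \<notin> A \<longrightarrow> f x = \<zero>\<^bsub>R\<^esub>)"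
  by (auto simp: free_on_def)

lemma (in cring) free_on_closed:
  assumes "f \<in> carrier (free_on R A)"
  shows "g \<in> carrier (free_on R A) \<Longrightarrow> (\<lambda>x. f x \<oplus> g x) \<in> carrier (free_on R A)"
    and "c \<in> carrier R \<Longrightarrow> (\<lambda>x. c \<otimes> f x) \<in> carrier (free_on R A)"
    and "(\<lambda>x. \<ominus> f x) \<in> carrier (free_on R A)"
proof -
  have f: "finite {x. f x \<noteq> \<zero>}" "\<And>x. f x \<in> carrier R" "\<And>x. x \<notin> A \<Longrightarrow> f x = \<zero>"
    using assms by (auto simp: free_on_carrier)
  show "(\<lambda>x. f x \<oplus> g x) \<in> carrier (free_on R A)" if "g \<in> carrier (free_on R A)"
  proof -
    have g: "finite {x. g x \<noteq> \<zero>}" "\<And>x. g x \<in> carrier R" "\<And>x. x \<notin> A \<Longrightarrow> g x = \<zero>"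
      using that by (auto simp: free_on_carrier)
    have "finite {x. f x \<oplus> g x \<noteq> \<zero>}"
      by (rule finite_subset[OF _ finite_UnI[OF f(1) g(1)]]) auto
    then show ?thesis using f g by (simp add: free_on_carrier)
  qed
  show "(\<lambda>x. c \<otimes> f x) \<in> carrier (free_on R A)" if "c \<in> carrier R"
  proof -
    have "finite {x. c \<otimes> f x \<noteq> \<zero>}"
      by (rule finite_subset[OF _ f(1)]) (use that in auto)
    then show ?thesis using f that by (simp add: free_on_carrier)
  qed
  have "finite {x. \<ominus> f x \<noteq> \<zero>}"
    by (rule finite_subset[OF _ f(1)]) auto
  then show "(\<lambda>x. \<ominus> f x) \<in> carrier (free_on R A)" using f by (simp add: free_on_carrier)
qed

lemma (in cring) free_on_module: "module R (free_on R A)"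
proof -
  have *: "f x \<in> carrier R" if "f \<in> carrier (free_on R A)" for f x
    using that by (simp add: free_on_carrier)
  have "abelian_group (free_on R A)"
  proof (rule abelian_groupI, goal_cases)
    case (6 x)
    then show ?case
      by (intro bexI[of _ "\<lambda>i. \<ominus> x i"]) (simp_all add: free_on_simps free_on_closed l_neg *)
  next
    case 2
    show ?case by (simp add: free_on_simps free_on_carrier)
  qed (simp_all add: free_on_simps free_on_closed a_assoc a_comm a_lcomm *)
  then show ?thesis
    by (rule moduleI[OF is_cring]) (simp_all add: free_on_simps free_on_closed l_distr r_distr m_assoc *)
qed

lemma (in cring) single_closed: "x \<in> A \<Longrightarrow> single R x \<in> carrier (free_on R A)"
  by (auto simp: free_on_carrier single_def)

text \<open>Scalar multiplication on the quotient is defined as a union over all representatives of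
  a coset. Since N is a submodule, all cosets in that union coincide. After this, everything about
  the quotient is decided on representatives.\<close>

lemma quotient_module_rep:
  assumes "module R F" "submodule N R F"
  shows "carrier (quotient_module F N) = (\<lambda>f. N +>\<^bsub>F\<^esub> f) ` carrier F"
    and "f \<in> carrier F \<Longrightarrow> g \<in> carrier F \<Longrightarrow>
      (N +>\<^bsub>F\<^esub> f) \<oplus>\<^bsub>quotient_module F N\<^esub> (N +>\<^bsub>F\<^esub> g) = N +>\<^bsub>F\<^esub> (f \<oplus>\<^bsub>F\<^esub> g)"
    and "a \<in> carrier R \<Longrightarrow> f \<in> carrier F \<Longrightarrow>
      a \<odot>\<^bsub>quotient_module F N\<^esub> (N +>\<^bsub>F\<^esub> f) = N +>\<^bsub>F\<^esub> (a \<odot>\<^bsub>F\<^esub> f)"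
    and "\<zero>\<^bsub>quotient_module F N\<^esub> = N +>\<^bsub>F\<^esub> \<zero>\<^bsub>F\<^esub>"
    and "f \<in> carrier F \<Longrightarrow> g \<in> carrier F \<Longrightarrow> N +>\<^bsub>F\<^esub> f = N +>\<^bsub>F\<^esub> g \<longleftrightarrow> f \<ominus>\<^bsub>F\<^esub> g \<in> N"
    and "f \<in> carrier F \<Longrightarrow> g \<in> N +>\<^bsub>F\<^esub> f \<longleftrightarrow> g \<in> carrier F \<and> g \<ominus>\<^bsub>F\<^esub> f \<in> N"
proof -
  interpret F: module R F by fact
  interpret N: submodule N R F by fact
  interpret N: abelian_subgroup N F
    by (rule abelian_subgroupI3[OF additive_subgroup.intro[OF N.subgroup_axioms] F.abelian_group_axioms])
  show "carrier (quotient_module F N) = (\<lambda>f. N +>\<^bsub>F\<^esub> f) ` carrier F"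
    by (auto simp: quotient_module_def A_RCOSETS_def')
  show "f \<in> carrier F \<Longrightarrow> g \<in> carrier F \<Longrightarrow>
      (N +>\<^bsub>F\<^esub> f) \<oplus>\<^bsub>quotient_module F N\<^esub> (N +>\<^bsub>F\<^esub> g) = N +>\<^bsub>F\<^esub> (f \<oplus>\<^bsub>F\<^esub> g)"
    by (simp add: quotient_module_def N.a_rcos_sum)
  show "\<zero>\<^bsub>quotient_module F N\<^esub> = N +>\<^bsub>F\<^esub> \<zero>\<^bsub>F\<^esub>"
    by (simp add: quotient_module_def N.a_rcos_const)
  show mem: "g \<in> N +>\<^bsub>F\<^esub> f \<longleftrightarrow> g \<in> carrier F \<and> g \<ominus>\<^bsub>F\<^esub> f \<in> N" if "f \<in> carrier F" for f g
    unfolding a_minus_def using N.a_rcos_module[OF that] N.a_elemrcos_carrier[OF that] by blast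
  show eq: "N +>\<^bsub>F\<^esub> f = N +>\<^bsub>F\<^esub> g \<longleftrightarrow> f \<ominus>\<^bsub>F\<^esub> g \<in> N" if "f \<in> carrier F" "g \<in> carrier F" for f g
    using mem[OF that(2), of f] that N.a_repr_independence'[of f g] N.a_repr_independenceD[of f g] by metis
  assume a: "a \<in> carrier R" "f \<in> carrier F"
  have "N +>\<^bsub>F\<^esub> (a \<odot>\<^bsub>F\<^esub> x) = N +>\<^bsub>F\<^esub> (a \<odot>\<^bsub>F\<^esub> f)" if "x \<in> N +>\<^bsub>F\<^esub> f" for x
  proof -
    have x: "x \<in> carrier F" "x \<ominus>\<^bsub>F\<^esub> f \<in> N" using mem[OF a(2)] that by auto
    have "a \<odot>\<^bsub>F\<^esub> x \<ominus>\<^bsub>F\<^esub> a \<odot>\<^bsub>F\<^esub> f = a \<odot>\<^bsub>F\<^esub> (x \<ominus>\<^bsub>F\<^esub> f)"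
      using a x by (simp add: a_minus_def F.smult_r_distr F.smult_r_minus)
    then show ?thesis using a x by (simp add: eq)
  qed
  moreover have "f \<in> N +>\<^bsub>F\<^esub> f" using a by (simp add: N.a_rcos_self)
  ultimately have "(\<Union>x\<in>N +>\<^bsub>F\<^esub> f. N +>\<^bsub>F\<^esub> (a \<odot>\<^bsub>F\<^esub> x)) = N +>\<^bsub>F\<^esub> (a \<odot>\<^bsub>F\<^esub> f)"
    by blast
  then show "a \<odot>\<^bsub>quotient_module F N\<^esub> (N +>\<^bsub>F\<^esub> f) = N +>\<^bsub>F\<^esub> (a \<odot>\<^bsub>F\<^esub> f)"
    by (simp add: quotient_module_def)
qed

lemma quotient_is_module:
  assumes "module R F" "submodule N R F"
  shows "module R (quotient_module F N)"
proof -
  interpret F: module R F by fact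
  note q = quotient_module_rep(1-4)[OF assms]
  have "abelian_group (quotient_module F N)"
  proof (rule abelian_groupI, goal_cases)
    case (6 x)
    then obtain f where f: "f \<in> carrier F" "x = N +>\<^bsub>F\<^esub> f" by (auto simp: q)
    have "(N +>\<^bsub>F\<^esub> (\<ominus>\<^bsub>F\<^esub> f)) \<oplus>\<^bsub>quotient_module F N\<^esub> x = \<zero>\<^bsub>quotient_module F N\<^esub>"
      using f by (simp add: q F.M.l_neg)
    then show ?case
      using f by (auto simp: q(1))
  next
    case (3 x y z)
    then obtain f g h where "x = N +>\<^bsub>F\<^esub> f" "y = N +>\<^bsub>F\<^esub> g" "z = N +>\<^bsub>F\<^esub> h"
      "f \<in> carrier F" "g \<in> carrier F" "h \<in> carrier F"
      by (auto simp: q(1))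
    then show ?case by (simp add: q F.M.a_assoc)
  next
    case (4 x y)
    then obtain f g where "x = N +>\<^bsub>F\<^esub> f" "y = N +>\<^bsub>F\<^esub> g" "f \<in> carrier F" "g \<in> carrier F"
      by (auto simp: q(1))
    then show ?case by (simp add: q F.M.a_comm)
  qed (auto simp: q)
  then show ?thesis
  proof (rule moduleI[OF F.R.is_cring], goal_cases)
    case (3 a x y)
    then obtain f g where "x = N +>\<^bsub>F\<^esub> f" "y = N +>\<^bsub>F\<^esub> g" "f \<in> carrier F" "g \<in> carrier F"
      by (auto simp: q(1))
    with 3 show ?case by (simp add: q F.smult_r_distr)
  qed (auto simp: q F.smult_l_distr F.smult_assoc1)
qed

lemma (in abelian_group) minus_eq_zero_iff:
  "x \<in> carrier G \<Longrightarrow> y \<in> carrier G \<Longrightarrow> x \<ominus> y = \<zero> \<longleftrightarrow> x = y"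
  by (metis a_inv_closed minus_eq minus_equality minus_minus r_neg)

subsection \<open>The universal property\<close>

text \<open>The expression that \<open>tensor_lift\<close> evaluates on a representative, isolated
  as a linear map on the free module so that it can be shown to kill the tensor relations.\<close>

definition free_lift ::
  "('k, 'z) ring_scheme \<Rightarrow> ('k, 'u, 'y) module_scheme \<Rightarrow> ('a \<Rightarrow> 'u) \<Rightarrow> ('a \<Rightarrow> 'k) \<Rightarrow> 'u"
  where "free_lift R U b f = (\<Oplus>\<^bsub>U\<^esub>p\<in>{p. f p \<noteq> \<zero>\<^bsub>R\<^esub>}. f p \<odot>\<^bsub>U\<^esub> b p)"

text \<open>The support of a sum or of a multiple may shrink, so linearity is verified over one
  finite set that contains all the supports involved.\<close>

lemma free_lift_superset:
  assumes "module R U" "f \<in> carrier (free_on R A)" "\<And>p. p \<in> A \<Longrightarrow> b p \<in> carrier U"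
    and "finite X" "{p. f p \<noteq> \<zero>\<^bsub>R\<^esub>} \<subseteq> X" "X \<subseteq> A"
  shows "free_lift R U b f = (\<Oplus>\<^bsub>U\<^esub>p\<in>X. f p \<odot>\<^bsub>U\<^esub> b p)"
proof -
  interpret U: module R U by fact
  show ?thesis
    unfolding free_lift_def
    using assms by (intro U.M.add.finprod_mono_neutral_cong_left) (auto simp: free_on_carrier)
qed

lemma free_lift_hom:
  assumes "module R U" "\<And>p. p \<in> A \<Longrightarrow> b p \<in> carrier U"
  shows "free_lift R U b \<in> module_homs R (free_on R A) U"
proof (rule module_homsI)
  interpret U: module R U by fact
  note sup = free_lift_superset[OF assms(1) _ assms(2)]
  have c: "f p \<odot>\<^bsub>U\<^esub> b p \<in> carrier U" if "f \<in> carrier (free_on R A)" "p \<in> A" for f p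
    using that assms(2) by (simp add: free_on_carrier)
  have supp: "finite {p. f p \<noteq> \<zero>\<^bsub>R\<^esub>}" "{p. f p \<noteq> \<zero>\<^bsub>R\<^esub>} \<subseteq> A" "f p \<in> carrier R"
    if "f \<in> carrier (free_on R A)" for f p
    using that by (auto simp: free_on_carrier)
  show "free_lift R U b f \<in> carrier U" if "f \<in> carrier (free_on R A)" for f
    unfolding free_lift_def using supp[OF that] by (intro U.M.finsum_closed) (auto intro!: c that)
  show "free_lift R U b (f \<oplus>\<^bsub>free_on R A\<^esub> g) = free_lift R U b f \<oplus>\<^bsub>U\<^esub> free_lift R U b g"
    if f: "f \<in> carrier (free_on R A)" and g: "g \<in> carrier (free_on R A)" for f g
  proof -
    let ?X = "{p. f p \<noteq> \<zero>\<^bsub>R\<^esub>} \<union> {p. g p \<noteq> \<zero>\<^bsub>R\<^esub>}"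
    have X: "finite ?X" "?X \<subseteq> A" using supp f g by auto
    have fg: "f \<oplus>\<^bsub>free_on R A\<^esub> g \<in> carrier (free_on R A)"
      using f g by (simp add: free_on_simps U.R.free_on_closed)
    have "free_lift R U b (f \<oplus>\<^bsub>free_on R A\<^esub> g) = (\<Oplus>\<^bsub>U\<^esub>p\<in>?X. (f p \<oplus>\<^bsub>R\<^esub> g p) \<odot>\<^bsub>U\<^esub> b p)"
      by (subst sup[OF fg _ X(1) _ X(2)]) (auto simp: free_on_simps)
    also have "\<dots> = (\<Oplus>\<^bsub>U\<^esub>p\<in>?X. f p \<odot>\<^bsub>U\<^esub> b p \<oplus>\<^bsub>U\<^esub> g p \<odot>\<^bsub>U\<^esub> b p)"
      using X supp(3)[OF f] supp(3)[OF g] assms(2)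
      by (intro U.M.finsum_cong') (auto intro!: U.smult_l_distr c[OF f] c[OF g])
    also have "\<dots> = (\<Oplus>\<^bsub>U\<^esub>p\<in>?X. f p \<odot>\<^bsub>U\<^esub> b p) \<oplus>\<^bsub>U\<^esub> (\<Oplus>\<^bsub>U\<^esub>p\<in>?X. g p \<odot>\<^bsub>U\<^esub> b p)"
      using X by (intro U.M.finsum_addf) (auto intro!: c[OF f] c[OF g])
    also have "\<dots> = free_lift R U b f \<oplus>\<^bsub>U\<^esub> free_lift R U b g"
      using sup[OF f _ X(1) _ X(2)] sup[OF g _ X(1) _ X(2)] by simp
    finally show ?thesis .
  qed
  show "free_lift R U b (a \<odot>\<^bsub>free_on R A\<^esub> f) = a \<odot>\<^bsub>U\<^esub> free_lift R U b f"
    if a: "a \<in> carrier R" and f: "f \<in> carrier (free_on R A)" for a f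
  proof -
    let ?X = "{p. f p \<noteq> \<zero>\<^bsub>R\<^esub>}"
    have X: "finite ?X" "?X \<subseteq> A" using supp f by auto
    have fg: "a \<odot>\<^bsub>free_on R A\<^esub> f \<in> carrier (free_on R A)"
      using f a by (simp add: free_on_simps U.R.free_on_closed)
    have "free_lift R U b (a \<odot>\<^bsub>free_on R A\<^esub> f) = (\<Oplus>\<^bsub>U\<^esub>p\<in>?X. (a \<otimes>\<^bsub>R\<^esub> f p) \<odot>\<^bsub>U\<^esub> b p)"
      by (subst sup[OF fg _ X(1) _ X(2)]) (use a in \<open>auto simp: free_on_simps\<close>)
    also have "\<dots> = (\<Oplus>\<^bsub>U\<^esub>p\<in>?X. a \<odot>\<^bsub>U\<^esub> (f p \<odot>\<^bsub>U\<^esub> b p))"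
      using X supp(3)[OF f] assms(2) a
      by (intro U.M.finsum_cong') (auto intro!: U.smult_assoc1 c[OF f])
    also have "\<dots> = a \<odot>\<^bsub>U\<^esub> free_lift R U b f"
      unfolding free_lift_def using X a by (intro U.finsum_smult_ldistr[symmetric]) (auto intro!: c[OF f])
    finally show ?thesis .
  qed
qed

lemma free_lift_single:
  assumes "module R U" "b p \<in> carrier U"
  shows "free_lift R U b (single R p) = b p"
proof -
  interpret U: module R U by fact
  show ?thesis
  \<comment> \<open>Over the zero ring \<open>single\<close> has empty support and the sum is empty,
    but then the module is zero as well.\<close>
  proof (cases "\<one>\<^bsub>R\<^esub> = \<zero>\<^bsub>R\<^esub>")
    case True
    then have "b p = \<zero>\<^bsub>U\<^esub>" using U.smult_one[OF assms(2)] U.smult_l_null[OF assms(2)] by simp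
    moreover have "{q. single R p q \<noteq> \<zero>\<^bsub>R\<^esub>} = {}" using True by (auto simp: single_def)
    ultimately show ?thesis unfolding free_lift_def by simp
  next
    case False
    then have "{q. single R p q \<noteq> \<zero>\<^bsub>R\<^esub>} = {p}" by (auto simp: single_def)
    then show ?thesis unfolding free_lift_def using assms(2) by (simp add: single_def)
  qed
qed

lemma tensor_gens_closed:
  assumes "module R V" "module R W"
  shows "tensor_gens R V W \<subseteq> carrier (free_on R (carrier V \<times> carrier W))"
proof -
  interpret V: module R V by fact
  interpret W: module R W by fact
  interpret F: module R "free_on R (carrier V \<times> carrier W)" by (rule V.R.free_on_module)
  show ?thesis
    unfolding tensor_gens_def Let_def
    by (auto intro!: F.M.minus_closed F.M.a_closed F.smult_closed V.R.single_closed)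
qed

lemma tensor_rels:
  assumes "module R V" "module R W"
  shows "submodule (tensor_rels R V W) R (free_on R (carrier V \<times> carrier W))"
    and "tensor_gens R V W \<subseteq> tensor_rels R V W"
    and "submodule N R (free_on R (carrier V \<times> carrier W)) \<Longrightarrow> tensor_gens R V W \<subseteq> N \<Longrightarrow>
      tensor_rels R V W \<subseteq> N"
proof -
  interpret V: module R V by fact
  let ?F = "free_on R (carrier V \<times> carrier W)"
  interpret F: module R ?F by (rule V.R.free_on_module)
  show "submodule (tensor_rels R V W) R ?F"
  proof (rule F.submoduleI)
    have "submodule (carrier ?F) R ?F" by (rule F.carrier_is_submodule)
    then show "tensor_rels R V W \<subseteq> carrier ?F"
      using tensor_gens_closed[OF assms] unfolding tensor_rels_def by blast
    show "\<zero>\<^bsub>?F\<^esub> \<in> tensor_rels R V W"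
      unfolding tensor_rels_def
    proof (rule InterI)
      fix N assume "N \<in> {N. submodule N R ?F \<and> tensor_gens R V W \<subseteq> N}"
      then have "subgroup N (add_monoid ?F)" by (simp add: submodule_def)
      then show "\<zero>\<^bsub>?F\<^esub> \<in> N" using subgroup.one_closed by fastforce
    qed
  qed (auto simp: tensor_rels_def intro: F.submoduleE)
qed (auto simp: tensor_rels_def)

lemma tensor_module:
  assumes "module R V" "module R W"
  shows "module R (tensor_prod R V W)"
  unfolding tensor_prod_def using assms
  by (intro quotient_is_module cring.free_on_module tensor_rels(1)) (auto simp: module_def)

lemma kernel_submodule:
  assumes "module R F" "module R U" "f \<in> module_homs R F U"
  shows "submodule {x \<in> carrier F. f x = \<zero>\<^bsub>U\<^esub>} R F"
proof -
  interpret F: module R F by fact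
  interpret U: module R U by fact
  note z = hom_zero_minus[OF F.abelian_group_axioms U.abelian_group_axioms assms(3)]
  show ?thesis
    by (rule F.submoduleI) (auto simp: z module_homsD[OF assms(3)])
qed

text \<open>Bilinearity of b says that its linear extension to the free module kills
  \<open>tensor_gens\<close>, hence by minimality all of \<open>tensor_rels\<close>. The extension
  is therefore constant on each coset, and the \<open>the_elem\<close> in \<open>tensor_lift\<close>
  meets a singleton.\<close>

lemma
  assumes "module R V" "module R W" "module R U" "bilin R V W U b"
  shows tensor_lift_hom: "tensor_lift R U b \<in> module_homs R (tensor_prod R V W) U"
    and tensor_lift_pure: "v \<in> carrier V \<Longrightarrow> w \<in> carrier W \<Longrightarrow>
      tensor_lift R U b (pure_tensor R V W v w) = b v w"
proof -
  interpret V: module R V by fact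
  interpret W: module R W by fact
  interpret U: module R U by fact
  let ?F = "free_on R (carrier V \<times> carrier W)" and ?N = "tensor_rels R V W"
  let ?b = "\<lambda>p. b (fst p) (snd p)"
  interpret F: module R ?F by (rule V.R.free_on_module)
  have b: "?b p \<in> carrier U" if "p \<in> carrier V \<times> carrier W" for p
    using that bilin_closed[OF assms(4)] by auto
  note b1 = module_homsD[OF bilinD(1)[OF assms(4)]] and b2 = module_homsD[OF bilinD(2)[OF assms(4)]]
  have ev: "free_lift R U ?b \<in> module_homs R ?F U"
    by (rule free_lift_hom[OF assms(3)]) (rule b)
  note evD = module_homsD[OF ev]
    and evm = hom_zero_minus[OF F.abelian_group_axioms U.abelian_group_axioms ev]
  have evs: "free_lift R U ?b (single R (v, w)) = b v w" if "v \<in> carrier V" "w \<in> carrier W" for v w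
    using free_lift_single[OF assms(3), of ?b "(v, w)"] b[of "(v, w)"] that by simp
  have "tensor_gens R V W \<subseteq> {x \<in> carrier ?F. free_lift R U ?b x = \<zero>\<^bsub>U\<^esub>}"
    using tensor_gens_closed[OF assms(1,2)] unfolding tensor_gens_def Let_def
    by (auto simp: evm evD evs V.R.single_closed b1 b2 U.M.minus_eq_zero_iff)
  then have "?N \<subseteq> {x \<in> carrier ?F. free_lift R U ?b x = \<zero>\<^bsub>U\<^esub>}"
    by (intro tensor_rels(3) kernel_submodule F.module_axioms assms ev)
  then have N: "x \<in> ?N \<Longrightarrow> free_lift R U ?b x = \<zero>\<^bsub>U\<^esub>" for x by auto
  note q = quotient_module_rep[OF F.module_axioms tensor_rels(1)[OF assms(1,2)], folded tensor_prod_def]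
  have lift: "tensor_lift R U b (?N +>\<^bsub>?F\<^esub> f) = free_lift R U ?b f" if f: "f \<in> carrier ?F" for f
  proof -
    have "free_lift R U ?b g = free_lift R U ?b f" if "g \<in> ?N +>\<^bsub>?F\<^esub> f" for g
    proof -
      have g: "g \<in> carrier ?F" "g \<ominus>\<^bsub>?F\<^esub> f \<in> ?N" using q(6)[OF f] that by auto
      have "free_lift R U ?b g \<ominus>\<^bsub>U\<^esub> free_lift R U ?b f = \<zero>\<^bsub>U\<^esub>"
        using N[OF g(2)] evm(3)[OF g(1) f] by simp
      then show ?thesis using evD(1) f g by (simp add: U.M.minus_eq_zero_iff)
    qed
    moreover have "f \<in> ?N +>\<^bsub>?F\<^esub> f"
      using q(6)[OF f, of f] f subgroup.one_closed[OF submodule.axioms(1)[OF tensor_rels(1)[OF assms(1,2)]]]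
      by (simp add: a_minus_def F.M.r_neg)
    ultimately have "free_lift R U ?b ` (?N +>\<^bsub>?F\<^esub> f) = {free_lift R U ?b f}" by blast
    moreover have "tensor_lift R U b t = the_elem (free_lift R U ?b ` t)" for t
      by (simp add: tensor_lift_def free_lift_def[abs_def])
    ultimately show ?thesis by simp
  qed
  show "tensor_lift R U b \<in> module_homs R (tensor_prod R V W) U"
  proof (rule module_homsI)
    fix x assume "x \<in> carrier (tensor_prod R V W)"
    then obtain f where f: "f \<in> carrier ?F" "x = ?N +>\<^bsub>?F\<^esub> f" unfolding q(1) by blast
    then show "tensor_lift R U b x \<in> carrier U" by (simp only: lift evD)
    show "tensor_lift R U b (a \<odot>\<^bsub>tensor_prod R V W\<^esub> x) = a \<odot>\<^bsub>U\<^esub> tensor_lift R U b x"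
      if "a \<in> carrier R" for a
      using that f by (simp only: lift evD q(3) F.smult_closed)
    show "tensor_lift R U b (x \<oplus>\<^bsub>tensor_prod R V W\<^esub> y) = tensor_lift R U b x \<oplus>\<^bsub>U\<^esub> tensor_lift R U b y"
      if "y \<in> carrier (tensor_prod R V W)" for y
    proof -
      obtain g where "g \<in> carrier ?F" "y = ?N +>\<^bsub>?F\<^esub> g" using \<open>y \<in> _\<close> unfolding q(1) by blast
      then show ?thesis using f by (simp only: lift evD q(2) F.M.a_closed)
    qed
  qed
  show "tensor_lift R U b (pure_tensor R V W v w) = b v w" if "v \<in> carrier V" "w \<in> carrier W"
    using that by (simp add: pure_tensor_def lift V.R.single_closed evs)
qed

lemma pure_tensor_relations:
  defines "F \<equiv> \<lambda>R V W. free_on R (carrier V \<times> carrier W)"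
  shows "v \<in> carrier V \<Longrightarrow> v' \<in> carrier V \<Longrightarrow> w \<in> carrier W \<Longrightarrow>
      single R (v \<oplus>\<^bsub>V\<^esub> v', w) \<ominus>\<^bsub>F R V W\<^esub> (single R (v, w) \<oplus>\<^bsub>F R V W\<^esub> single R (v', w))
        \<in> tensor_gens R V W"
    and "v \<in> carrier V \<Longrightarrow> w \<in> carrier W \<Longrightarrow> w' \<in> carrier W \<Longrightarrow>
      single R (v, w \<oplus>\<^bsub>W\<^esub> w') \<ominus>\<^bsub>F R V W\<^esub> (single R (v, w) \<oplus>\<^bsub>F R V W\<^esub> single R (v, w'))
        \<in> tensor_gens R V W"
    and "a \<in> carrier R \<Longrightarrow> v \<in> carrier V \<Longrightarrow> w \<in> carrier W \<Longrightarrow>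
      single R (a \<odot>\<^bsub>V\<^esub> v, w) \<ominus>\<^bsub>F R V W\<^esub> a \<odot>\<^bsub>F R V W\<^esub> single R (v, w) \<in> tensor_gens R V W"
    and "a \<in> carrier R \<Longrightarrow> v \<in> carrier V \<Longrightarrow> w \<in> carrier W \<Longrightarrow>
      single R (v, a \<odot>\<^bsub>W\<^esub> w) \<ominus>\<^bsub>F R V W\<^esub> a \<odot>\<^bsub>F R V W\<^esub> single R (v, w) \<in> tensor_gens R V W"
  unfolding tensor_gens_def Let_def F_def by blast+

lemma pure_bilin:
  assumes "module R V" "module R W"
  shows "bilin R V W (tensor_prod R V W) (pure_tensor R V W)"
proof -
  interpret V: module R V by fact
  interpret W: module R W by fact
  let ?F = "free_on R (carrier V \<times> carrier W)" and ?N = "tensor_rels R V W"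
  interpret F: module R ?F by (rule V.R.free_on_module)
  note q = quotient_module_rep[OF F.module_axioms tensor_rels(1)[OF assms], folded tensor_prod_def]
  note s = V.R.single_closed
  have g: "x \<in> tensor_gens R V W \<Longrightarrow> x \<in> ?N" for x using tensor_rels(2)[OF assms] by blast
  have eq: "f \<ominus>\<^bsub>?F\<^esub> h \<in> tensor_gens R V W \<Longrightarrow> f \<in> carrier ?F \<Longrightarrow> h \<in> carrier ?F \<Longrightarrow>
    ?N +>\<^bsub>?F\<^esub> f = ?N +>\<^bsub>?F\<^esub> h" for f h
    using q(5) g by blast
  show ?thesis
  proof (rule bilinI; rule module_homsI)
    show "pure_tensor R V W v w \<in> carrier (tensor_prod R V W)"
      if "v \<in> carrier V" "w \<in> carrier W" for v w
      using that by (auto simp: pure_tensor_def q(1) s)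
    then show "pure_tensor R V W v w \<in> carrier (tensor_prod R V W)"
      if "w \<in> carrier W" "v \<in> carrier V" for v w
      using that by blast
    show "pure_tensor R V W v (w \<oplus>\<^bsub>W\<^esub> w') =
      pure_tensor R V W v w \<oplus>\<^bsub>tensor_prod R V W\<^esub> pure_tensor R V W v w'"
      if "v \<in> carrier V" "w \<in> carrier W" "w' \<in> carrier W" for v w w'
      unfolding pure_tensor_def using that
      by (subst q(2)) (simp_all add: s pure_tensor_relations eq)
    show "pure_tensor R V W (v \<oplus>\<^bsub>V\<^esub> v') w =
      pure_tensor R V W v w \<oplus>\<^bsub>tensor_prod R V W\<^esub> pure_tensor R V W v' w"
      if "w \<in> carrier W" "v \<in> carrier V" "v' \<in> carrier V" for v v' w
      unfolding pure_tensor_def using that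
      by (subst q(2)) (simp_all add: s pure_tensor_relations eq)
    show "pure_tensor R V W v (a \<odot>\<^bsub>W\<^esub> w) = a \<odot>\<^bsub>tensor_prod R V W\<^esub> pure_tensor R V W v w"
      if "v \<in> carrier V" "a \<in> carrier R" "w \<in> carrier W" for v w a
      unfolding pure_tensor_def using that
      by (subst q(3)) (simp_all add: s pure_tensor_relations eq)
    show "pure_tensor R V W (a \<odot>\<^bsub>V\<^esub> v) w = a \<odot>\<^bsub>tensor_prod R V W\<^esub> pure_tensor R V W v w"
      if "w \<in> carrier W" "a \<in> carrier R" "v \<in> carrier V" for v w a
      unfolding pure_tensor_def using that
      by (subst q(3)) (simp_all add: s pure_tensor_relations eq)
  qed
qed

lemma pure_closed:
  "module R V \<Longrightarrow> module R W \<Longrightarrow> v \<in> carrier V \<Longrightarrow> w \<in> carrier W \<Longrightarrow>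
    pure_tensor R V W v w \<in> carrier (tensor_prod R V W)"
  using bilin_closed[OF pure_bilin] by metis

text \<open>Sums suffice: when X is closed under scalars, a multiple of a pure tensor is again pure
  with first factor in X. With X = Y = A the set plays the role of A \<otimes> A inside H \<otimes>
  H, and statements about it are proved by induction with two cases.\<close>

inductive_set tensor_span ::
  "('k, 'z) ring_scheme \<Rightarrow> ('k, 'v, 'x) module_scheme \<Rightarrow> ('k, 'w, 'y) module_scheme \<Rightarrow>
    'v set \<Rightarrow> 'w set \<Rightarrow> ('v \<times> 'w \<Rightarrow> 'k) set set"
  for R V W X Y where
    pure: "v \<in> X \<Longrightarrow> w \<in> Y \<Longrightarrow> pure_tensor R V W v w \<in> tensor_span R V W X Y"
  | add: "s \<in> tensor_span R V W X Y \<Longrightarrow> t \<in> tensor_span R V W X Y \<Longrightarrow>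
      s \<oplus>\<^bsub>tensor_prod R V W\<^esub> t \<in> tensor_span R V W X Y"

lemma tensor_span_closed:
  assumes "module R V" "module R W" "X \<subseteq> carrier V" "Y \<subseteq> carrier W" "t \<in> tensor_span R V W X Y"
  shows "t \<in> carrier (tensor_prod R V W)"
proof -
  interpret T: module R "tensor_prod R V W" by (intro tensor_module assms)
  show ?thesis using assms(5) by induction (use assms in \<open>auto intro!: T.M.a_closed pure_closed\<close>)
qed

lemma tensor_span_carrier:
  assumes "module R V" "module R W"
  shows "carrier (tensor_prod R V W) = tensor_span R V W (carrier V) (carrier W)"
proof
  interpret V: module R V by fact
  interpret W: module R W by fact
  let ?F = "free_on R (carrier V \<times> carrier W)" and ?N = "tensor_rels R V W"
  interpret F: module R ?F by (rule V.R.free_on_module)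
  note q = quotient_module_rep[OF F.module_axioms tensor_rels(1)[OF assms], folded tensor_prod_def]
  note pb = module_homsD[OF bilinD(2)[OF pure_bilin[OF assms]]]
  have "?N +>\<^bsub>?F\<^esub> f \<in> tensor_span R V W (carrier V) (carrier W)"
    if "finite X" "{p. f p \<noteq> \<zero>\<^bsub>R\<^esub>} \<subseteq> X" "f \<in> carrier ?F" for X f
    using that
  proof (induction X arbitrary: f rule: finite_induct)
    case empty
    then have f: "f = \<zero>\<^bsub>?F\<^esub>" by (auto simp: free_on_simps)
    \<comment> \<open>There is no clause for zero in \<open>tensor_span\<close>; zero is obtained as
      a pure tensor.\<close>
    have "pure_tensor R V W \<zero>\<^bsub>V\<^esub> \<zero>\<^bsub>W\<^esub> = \<zero>\<^bsub>tensor_prod R V W\<^esub>"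
      using hom_zero_minus(1)[OF _ _ bilinD(2)[OF pure_bilin[OF assms]], of "\<zero>\<^bsub>W\<^esub>"]
        V.abelian_group_axioms module_abelian[OF tensor_module[OF assms]] by auto
    then show ?case using f q(4) tensor_span.pure[of "\<zero>\<^bsub>V\<^esub>" "carrier V" "\<zero>\<^bsub>W\<^esub>" "carrier W" R V W] by simp
  next
    case (insert p X)
    show ?case
    proof (cases "f p = \<zero>\<^bsub>R\<^esub>")
      case True
      then show ?thesis using insert by auto
    next
      case False
      then have p: "p \<in> carrier V \<times> carrier W" "f p \<in> carrier R"
        using insert.prems(2) unfolding free_on_carrier by blast+
      obtain v w where vw: "p = (v, w)" by force
      let ?g = "f(p := \<zero>\<^bsub>R\<^esub>)"
      have fin: "finite {x. f x \<noteq> \<zero>\<^bsub>R\<^esub>}" using insert.prems(2) by (auto simp: free_on_carrier)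
      have "finite {x. ?g x \<noteq> \<zero>\<^bsub>R\<^esub>}" by (rule finite_subset[OF _ fin]) auto
      then have g: "?g \<in> carrier ?F" using insert.prems(2) by (auto simp: free_on_carrier)
      have "f = f p \<odot>\<^bsub>?F\<^esub> single R p \<oplus>\<^bsub>?F\<^esub> ?g"
      proof (rule ext)
        fix x
        have "f x \<in> carrier R" using insert.prems(2) unfolding free_on_carrier by blast
        then show "f x = (f p \<odot>\<^bsub>?F\<^esub> single R p \<oplus>\<^bsub>?F\<^esub> ?g) x"
          using p(2) by (simp add: free_on_simps single_def)
      qed
      then have "?N +>\<^bsub>?F\<^esub> f = f p \<odot>\<^bsub>tensor_prod R V W\<^esub> pure_tensor R V W v w
          \<oplus>\<^bsub>tensor_prod R V W\<^esub> (?N +>\<^bsub>?F\<^esub> ?g)"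
        using g p by (simp add: q(2,3) V.R.single_closed pure_tensor_def flip: vw)
      also have "f p \<odot>\<^bsub>tensor_prod R V W\<^esub> pure_tensor R V W v w = pure_tensor R V W (f p \<odot>\<^bsub>V\<^esub> v) w"
        using p vw by (simp add: pb)
      also have "pure_tensor R V W (f p \<odot>\<^bsub>V\<^esub> v) w \<oplus>\<^bsub>tensor_prod R V W\<^esub> (?N +>\<^bsub>?F\<^esub> ?g)
        \<in> tensor_span R V W (carrier V) (carrier W)"
      proof (intro tensor_span.intros insert.IH g)
        show "{q. ?g q \<noteq> \<zero>\<^bsub>R\<^esub>} \<subseteq> X" using insert.prems(1) by auto
      qed (use p vw in auto)
      finally show ?thesis .
    qed
  qed
  then show "carrier (tensor_prod R V W) \<subseteq> tensor_span R V W (carrier V) (carrier W)"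
    by (auto simp: q(1) free_on_carrier)
  show "tensor_span R V W (carrier V) (carrier W) \<subseteq> carrier (tensor_prod R V W)"
    using tensor_span_closed[OF assms] by blast
qed

lemma tensor_span_ext:
  assumes "module R V" "module R W" "X \<subseteq> carrier V" "Y \<subseteq> carrier W"
    and "f \<in> module_homs R (tensor_prod R V W) U" "g \<in> module_homs R (tensor_prod R V W) U"
    and "\<And>v w. v \<in> X \<Longrightarrow> w \<in> Y \<Longrightarrow> f (pure_tensor R V W v w) = g (pure_tensor R V W v w)"
    and "t \<in> tensor_span R V W X Y"
  shows "f t = g t"
  using assms(8)
proof induction
  case (add s t)
  then show ?case using tensor_span_closed[OF assms(1-4)]
      module_homsD(2)[OF assms(5)] module_homsD(2)[OF assms(6)] by simp
qed (rule assms)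

lemma tensor_ext:
  assumes "module R V" "module R W"
    and "f \<in> module_homs R (tensor_prod R V W) U" "g \<in> module_homs R (tensor_prod R V W) U"
    and "\<And>v w. v \<in> carrier V \<Longrightarrow> w \<in> carrier W \<Longrightarrow> f (pure_tensor R V W v w) = g (pure_tensor R V W v w)"
    and "t \<in> carrier (tensor_prod R V W)"
  shows "f t = g t"
  using tensor_span_ext[OF assms(1,2) _ _ assms(3,4,5)] assms(6) tensor_span_carrier[OF assms(1,2)] by blast

lemma lin_lift [lin_intros]:
  assumes "module R V" "module R W" "module R U" "bilin R V W U b" "f \<in> module_homs R Z (tensor_prod R V W)"
  shows "(\<lambda>x. tensor_lift R U b (f x)) \<in> module_homs R Z U"
  by (rule lin_comp[OF tensor_lift_hom[OF assms(1-4)] assms(5)])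

text \<open>Both sides of each linearity law are linear in the tensor t, so they are compared on
  pure tensors, where the assumption on b applies. The lemma is what makes inner sums linear in the
  outer variables.\<close>

lemma lin_lift_param:
  assumes "module R V" "module R W" "module R U" "t \<in> carrier (tensor_prod R V W)" "module R Z"
    and "\<And>x. x \<in> carrier Z \<Longrightarrow> bilin R V W U (b x)"
    and "\<And>v w. v \<in> carrier V \<Longrightarrow> w \<in> carrier W \<Longrightarrow> (\<lambda>x. b x v w) \<in> module_homs R Z U"
  shows "(\<lambda>x. tensor_lift R U (b x) t) \<in> module_homs R Z U"
proof -
  interpret U: module R U by fact
  interpret Z: module R Z by fact
  let ?T = "tensor_prod R V W"
  note L = tensor_lift_hom[OF assms(1-3) assms(6)]
  note P = tensor_lift_pure[OF assms(1-3) assms(6)]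
  note bz = module_homsD[OF assms(7)]
  show ?thesis
  proof (rule module_homsI)
    show "tensor_lift R U (b x) t \<in> carrier U" if "x \<in> carrier Z" for x
      using L[OF that] assms(4) by (rule module_homsD)
    show "tensor_lift R U (b (x \<oplus>\<^bsub>Z\<^esub> y)) t = tensor_lift R U (b x) t \<oplus>\<^bsub>U\<^esub> tensor_lift R U (b y) t"
      if "x \<in> carrier Z" "y \<in> carrier Z" for x y
      by (rule tensor_ext[OF assms(1,2) L _ _ assms(4)])
        (use that in \<open>auto intro!: lin_add L assms simp: P bz\<close>)
    show "tensor_lift R U (b (a \<odot>\<^bsub>Z\<^esub> x)) t = a \<odot>\<^bsub>U\<^esub> tensor_lift R U (b x) t"
      if "a \<in> carrier R" "x \<in> carrier Z" for a x
      by (rule tensor_ext[OF assms(1,2) L _ _ assms(4)])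
        (use that in \<open>auto intro!: lin_smult L assms simp: P bz\<close>)
  qed
qed

lemma tensor_lift_cong:
  assumes "module R V" "module R W" "module R U" "bilin R V W U b" "t \<in> carrier (tensor_prod R V W)"
    and "\<And>v w. v \<in> carrier V \<Longrightarrow> w \<in> carrier W \<Longrightarrow> b' v w = b v w"
  shows "tensor_lift R U b' t = tensor_lift R U b t"
  by (rule tensor_ext[OF assms(1,2) tensor_lift_hom tensor_lift_hom])
    (use assms bilin_cong[OF assms(4,6,1,2)] in \<open>auto simp: tensor_lift_pure\<close>)

lemma tensor_map_hom:
  assumes "module R V" "module R W" "module R V'" "module R W'" "f \<in> module_homs R V V'" "g \<in> module_homs R W W'"
  shows "tensor_map R V' W' f g \<in> module_homs R (tensor_prod R V W) (tensor_prod R V' W')"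
    and "v \<in> carrier V \<Longrightarrow> w \<in> carrier W \<Longrightarrow>
      tensor_map R V' W' f g (pure_tensor R V W v w) = pure_tensor R V' W' (f v) (g w)"
proof -
  have b: "bilin R V W (tensor_prod R V' W') (\<lambda>a b. pure_tensor R V' W' (f a) (g b))"
    using assms by (intro bilinI lin_bil_l[OF pure_bilin] lin_bil_r[OF pure_bilin]) (auto dest: module_homsD)
  show "tensor_map R V' W' f g \<in> module_homs R (tensor_prod R V W) (tensor_prod R V' W')"
    unfolding tensor_map_def by (intro tensor_lift_hom tensor_module assms b)
  show "v \<in> carrier V \<Longrightarrow> w \<in> carrier W \<Longrightarrow>
      tensor_map R V' W' f g (pure_tensor R V W v w) = pure_tensor R V' W' (f v) (g w)"
    unfolding tensor_map_def by (intro tensor_lift_pure tensor_module assms b)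
qed

section \<open>Dual systems\<close>

lemma (in abelian_group) a_inv_zero [simp]: "\<ominus> \<zero> = \<zero>"
  by (metis minus_equality l_zero zero_closed)

text \<open>A submodule N maximal among those that contain W and avoid s is a complement of the line
  k s; the functional reads off the coefficient of s. No finiteness is assumed of V, hence Zorn's
  lemma.\<close>

lemma (in field) functional_separation:
  assumes "module R V" "submodule W R V" "s \<in> carrier V" "s \<notin> W"
  obtains f where "f \<in> module_homs R V (self_module R)" "\<And>w. w \<in> W \<Longrightarrow> f w = \<zero>" "f s = \<one>"
proof -
  interpret V: module R V by fact
  note subE = V.submoduleE
  let ?C = "{N. submodule N R V \<and> W \<subseteq> N \<and> s \<notin> N}"
  have "\<exists>N\<in>?C. \<forall>X\<in>?C. N \<subseteq> X \<longrightarrow> X = N"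
  proof (rule subset_Zorn_nonempty)
    show "?C \<noteq> {}" using assms by auto
    fix \<C> assume \<C>: "\<C> \<noteq> {}" "subset.chain ?C \<C>"
    then have sub: "submodule N R V \<and> W \<subseteq> N \<and> s \<notin> N" if "N \<in> \<C>" for N
      using that by (auto simp: subset_chain_def)
    have ch: "X \<subseteq> Y \<or> Y \<subseteq> X" if "X \<in> \<C>" "Y \<in> \<C>" for X Y
      using that \<C>(2) by (auto simp: subset_chain_def)
    have "submodule (\<Union>\<C>) R V"
    proof (rule V.submoduleI)
      show "\<Union>\<C> \<subseteq> carrier V" using sub subE(1) by blast
      obtain N where N: "N \<in> \<C>" using \<C>(1) by blast
      then have "\<zero>\<^bsub>V\<^esub> \<in> N"
        using sub[OF N] subgroup.one_closed[of N "add_monoid V"] by (simp add: submodule_def)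
      then show "\<zero>\<^bsub>V\<^esub> \<in> \<Union>\<C>" using N by blast
    next
      fix a b assume "a \<in> \<Union>\<C>" "b \<in> \<Union>\<C>"
      then obtain X Y where XY: "X \<in> \<C>" "Y \<in> \<C>" "a \<in> X" "b \<in> Y" by blast
      then obtain Z where "Z \<in> \<C>" "a \<in> Z" "b \<in> Z" using ch[OF XY(1,2)] by blast
      then show "a \<oplus>\<^bsub>V\<^esub> b \<in> \<Union>\<C>" using sub subE(5) by blast
    qed (use sub subE(3,4) in blast)+
    then show "\<Union>\<C> \<in> ?C" using sub \<C>(1) by blast
  qed
  then obtain N where NC: "N \<in> ?C" "\<forall>X\<in>?C. N \<subseteq> X \<longrightarrow> X = N" by (rule bexE)
  then have N: "submodule N R V" "W \<subseteq> N" "s \<notin> N" by simp_all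
  have max: "X = N" if "submodule X R V" "s \<notin> X" "N \<subseteq> X" for X
    using NC(2) that N(2) by auto
  have NV: "x \<in> N \<Longrightarrow> x \<in> carrier V" for x using subE(1)[OF N(1)] by blast
  have N0: "\<zero>\<^bsub>V\<^esub> \<in> N"
    using N(1) subgroup.one_closed[of N "add_monoid V"] by (simp add: submodule_def)
  have inv_c: "inv a \<in> carrier R" "inv a \<otimes> a = \<one>" if "a \<in> carrier R" "a \<noteq> \<zero>" for a
    using that field_Units by auto
  have s0: "a = \<zero>" if "a \<in> carrier R" "a \<odot>\<^bsub>V\<^esub> s \<in> N" for a
  proof (rule ccontr)
    assume a: "a \<noteq> \<zero>"
    then have "inv a \<odot>\<^bsub>V\<^esub> (a \<odot>\<^bsub>V\<^esub> s) \<in> N" using that inv_c subE(4)[OF N(1)] by blast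
    then show False using that a inv_c[of a] N(3) assms(3) by (simp flip: V.smult_assoc1)
  qed
  have ex: "\<exists>a\<in>carrier R. v \<ominus>\<^bsub>V\<^esub> a \<odot>\<^bsub>V\<^esub> s \<in> N" if v: "v \<in> carrier V" for v
  proof (cases "v \<in> N")
    case True
    then show ?thesis using assms(3) v by (intro bexI[of _ \<zero>]) (auto simp: a_minus_def)
  next
    case False
    \<comment> \<open>If v is outside N, maximality forces s into N + k v. The coefficient of v in s
      is nonzero because s is outside N, and its inverse is the wanted coordinate of v.\<close>
    let ?X = "{n \<oplus>\<^bsub>V\<^esub> a \<odot>\<^bsub>V\<^esub> v | n a. n \<in> N \<and> a \<in> carrier R}"
    have "submodule ?X R V"
    proof (rule V.submoduleI)
      show "?X \<subseteq> carrier V" using v NV by auto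
      show "\<zero>\<^bsub>V\<^esub> \<in> ?X" using N0 v by (intro CollectI exI[of _ "\<zero>\<^bsub>V\<^esub>"] exI[of _ \<zero>]) auto
    next
      fix x assume "x \<in> ?X"
      then obtain n a where x: "n \<in> N" "a \<in> carrier R" "x = n \<oplus>\<^bsub>V\<^esub> a \<odot>\<^bsub>V\<^esub> v" by blast
      show "\<ominus>\<^bsub>V\<^esub> x \<in> ?X"
        using x v NV[OF x(1)] subE(3)[OF N(1) x(1)]
        by (intro CollectI exI[of _ "\<ominus>\<^bsub>V\<^esub> n"] exI[of _ "\<ominus> a"]) (simp add: V.smult_l_minus V.M.minus_add)
      show "b \<odot>\<^bsub>V\<^esub> x \<in> ?X" if "b \<in> carrier R" for b
        using x v NV[OF x(1)] subE(4)[OF N(1) that x(1)] that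
        by (intro CollectI exI[of _ "b \<odot>\<^bsub>V\<^esub> n"] exI[of _ "b \<otimes> a"]) (simp add: V.smult_r_distr V.smult_assoc1)
      fix y assume "y \<in> ?X"
      then obtain m b where y: "m \<in> N" "b \<in> carrier R" "y = m \<oplus>\<^bsub>V\<^esub> b \<odot>\<^bsub>V\<^esub> v" by blast
      show "x \<oplus>\<^bsub>V\<^esub> y \<in> ?X"
        using x y v NV[OF x(1)] NV[OF y(1)] subE(5)[OF N(1) x(1) y(1)]
        by (intro CollectI exI[of _ "n \<oplus>\<^bsub>V\<^esub> m"] exI[of _ "a \<oplus> b"]) (simp add: V.smult_l_distr V.M.a_ac)
    qed
    moreover have "N \<subseteq> ?X"
    proof
      fix n assume "n \<in> N"
      then show "n \<in> ?X" using v NV by (intro CollectI exI[of _ n] exI[of _ \<zero>]) auto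
    qed
    moreover have "v \<in> ?X" using v N0 by (intro CollectI exI[of _ "\<zero>\<^bsub>V\<^esub>"] exI[of _ \<one>]) auto
    ultimately have "s \<in> ?X" using max[of ?X] False by blast
    then obtain n a where na: "n \<in> N" "a \<in> carrier R" "s = n \<oplus>\<^bsub>V\<^esub> a \<odot>\<^bsub>V\<^esub> v" by blast
    have a: "a \<noteq> \<zero>" using na N(3) v NV by auto
    note i = inv_c[OF na(2) a]
    have "inv a \<odot>\<^bsub>V\<^esub> s = inv a \<odot>\<^bsub>V\<^esub> n \<oplus>\<^bsub>V\<^esub> v"
      using na v NV[OF na(1)] i by (simp add: V.smult_r_distr flip: V.smult_assoc1)
    then have "v \<ominus>\<^bsub>V\<^esub> inv a \<odot>\<^bsub>V\<^esub> s = \<ominus>\<^bsub>V\<^esub> (inv a \<odot>\<^bsub>V\<^esub> n)"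
      using v NV[OF na(1)] i(1) by (simp add: a_minus_def V.M.minus_add V.M.a_ac V.M.r_neg1 V.M.r_neg2 V.M.r_neg)
    moreover have "\<ominus>\<^bsub>V\<^esub> (inv a \<odot>\<^bsub>V\<^esub> n) \<in> N" using subE(3,4)[OF N(1)] i(1) na(1) by blast
    ultimately show ?thesis using i(1) by (intro bexI[of _ "inv a"]) simp_all
  qed
  define f where "f = (\<lambda>v. SOME a. a \<in> carrier R \<and> v \<ominus>\<^bsub>V\<^esub> a \<odot>\<^bsub>V\<^esub> s \<in> N)"
  have f: "f v \<in> carrier R" "v \<ominus>\<^bsub>V\<^esub> f v \<odot>\<^bsub>V\<^esub> s \<in> N" if "v \<in> carrier V" for v
    using ex[OF that] unfolding f_def by (auto intro: someI2)
  have fI: "f v = a" if v: "v \<in> carrier V" "a \<in> carrier R" "v \<ominus>\<^bsub>V\<^esub> a \<odot>\<^bsub>V\<^esub> s \<in> N" for v a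
  proof -
    have "\<ominus>\<^bsub>V\<^esub> (v \<ominus>\<^bsub>V\<^esub> f v \<odot>\<^bsub>V\<^esub> s) \<oplus>\<^bsub>V\<^esub> (v \<ominus>\<^bsub>V\<^esub> a \<odot>\<^bsub>V\<^esub> s) \<in> N"
      using subE(3,5)[OF N(1)] f[OF v(1)] v(3) by blast
    also have "\<ominus>\<^bsub>V\<^esub> (v \<ominus>\<^bsub>V\<^esub> f v \<odot>\<^bsub>V\<^esub> s) \<oplus>\<^bsub>V\<^esub> (v \<ominus>\<^bsub>V\<^esub> a \<odot>\<^bsub>V\<^esub> s) = (f v \<ominus> a) \<odot>\<^bsub>V\<^esub> s"
      using v f(1)[OF v(1)] assms(3)
      by (simp add: a_minus_def V.smult_l_distr V.smult_l_minus V.M.minus_add V.M.a_ac V.M.r_neg1 V.M.r_neg2)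
    finally show ?thesis using s0[of "f v \<ominus> a"] f(1)[OF v(1)] v(2) by (simp add: minus_eq_zero_iff)
  qed
  show ?thesis
  proof (rule that)
    show "f \<in> module_homs R V (self_module R)"
    proof (rule module_homsI)
      fix x assume x: "x \<in> carrier V"
      then show "f x \<in> carrier (self_module R)" using f by simp
      show "f (a \<odot>\<^bsub>V\<^esub> x) = a \<odot>\<^bsub>self_module R\<^esub> f x" if "a \<in> carrier R" for a
      proof (simp, rule fI)
        have "a \<odot>\<^bsub>V\<^esub> x \<ominus>\<^bsub>V\<^esub> (a \<otimes> f x) \<odot>\<^bsub>V\<^esub> s = a \<odot>\<^bsub>V\<^esub> (x \<ominus>\<^bsub>V\<^esub> f x \<odot>\<^bsub>V\<^esub> s)"
          using x f(1)[OF x] that assms(3) by (simp add: a_minus_def V.smult_r_distr V.smult_r_minus V.smult_assoc1)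
        then show "a \<odot>\<^bsub>V\<^esub> x \<ominus>\<^bsub>V\<^esub> (a \<otimes> f x) \<odot>\<^bsub>V\<^esub> s \<in> N"
          using f(2)[OF x] subE(4)[OF N(1)] that by simp
      qed (use that x f(1)[OF x] in auto)
      show "f (x \<oplus>\<^bsub>V\<^esub> y) = f x \<oplus>\<^bsub>self_module R\<^esub> f y" if y: "y \<in> carrier V" for y
      proof (simp, rule fI)
        have "x \<oplus>\<^bsub>V\<^esub> y \<ominus>\<^bsub>V\<^esub> (f x \<oplus> f y) \<odot>\<^bsub>V\<^esub> s = (x \<ominus>\<^bsub>V\<^esub> f x \<odot>\<^bsub>V\<^esub> s) \<oplus>\<^bsub>V\<^esub> (y \<ominus>\<^bsub>V\<^esub> f y \<odot>\<^bsub>V\<^esub> s)"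
          using x y f(1)[OF x] f(1)[OF y] assms(3)
          by (simp add: a_minus_def V.smult_l_distr V.M.minus_add V.M.a_ac)
        then show "x \<oplus>\<^bsub>V\<^esub> y \<ominus>\<^bsub>V\<^esub> (f x \<oplus> f y) \<odot>\<^bsub>V\<^esub> s \<in> N"
          using f(2)[OF x] f(2)[OF y] subE(5)[OF N(1)] by simp
      qed (use that x y f(1)[OF x] f(1)[OF y] in auto)
    qed
    show "f w = \<zero>" if "w \<in> W" for w
      using that N(2) NV assms(3) by (intro fI) (auto simp: a_minus_def)
    show "f s = \<one>" using assms(3) N0 by (intro fI) (auto simp: a_minus_def V.M.r_neg)
  qed
qed

text \<open>The functionals certify that the family is linearly independent, so that some space has
  dimension at least \<open>card I\<close>. Being defined on all of V, they restrict to subspaces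
  and can be composed with linear maps, which makes transporting independent families easy.\<close>

definition dual_sys ::
  "('k, 'z) ring_scheme \<Rightarrow> ('k, 'v, 'x) module_scheme \<Rightarrow> 'i set \<Rightarrow> ('i \<Rightarrow> 'v) \<Rightarrow> ('i \<Rightarrow> 'v \<Rightarrow> 'k) \<Rightarrow> bool"
  where "dual_sys R V I a \<phi> \<longleftrightarrow> finite I \<and>
    (\<forall>i\<in>I. a i \<in> carrier V \<and> \<phi> i \<in> module_homs R V (self_module R)) \<and>
    (\<forall>i\<in>I. \<forall>j\<in>I. \<phi> i (a j) = (if i = j then \<one>\<^bsub>R\<^esub> else \<zero>\<^bsub>R\<^esub>))"

lemma dual_sysD:
  assumes "dual_sys R V I a \<phi>"
  shows "finite I" "i \<in> I \<Longrightarrow> a i \<in> carrier V" "i \<in> I \<Longrightarrow> \<phi> i \<in> module_homs R V (self_module R)"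
    "i \<in> I \<Longrightarrow> x \<in> carrier V \<Longrightarrow> \<phi> i x \<in> carrier R"
    "i \<in> I \<Longrightarrow> j \<in> I \<Longrightarrow> \<phi> i (a j) = (if i = j then \<one>\<^bsub>R\<^esub> else \<zero>\<^bsub>R\<^esub>)"
proof -
  show \<phi>: "\<phi> i \<in> module_homs R V (self_module R)" if "i \<in> I" for i
    using assms that by (simp add: dual_sys_def)
  show "\<phi> i x \<in> carrier R" if "i \<in> I" "x \<in> carrier V"
    using module_homsD(1)[OF \<phi>[OF that(1)] that(2)] by simp
qed (use assms in \<open>simp_all add: dual_sys_def\<close>)

definition lin_span ::
  "('k, 'z) ring_scheme \<Rightarrow> ('k, 'v, 'x) module_scheme \<Rightarrow> 'i set \<Rightarrow> ('i \<Rightarrow> 'v) \<Rightarrow> 'v set"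
  where "lin_span R V I w = {(\<Oplus>\<^bsub>V\<^esub>i\<in>I. c i \<odot>\<^bsub>V\<^esub> w i) | c. \<forall>i\<in>I. c i \<in> carrier R}"

lemma lin_span_submodule:
  assumes "module R V" "finite I" "\<And>i. i \<in> I \<Longrightarrow> w i \<in> carrier V"
  shows "submodule (lin_span R V I w) R V"
proof -
  interpret V: module R V by fact
  show ?thesis
  proof (rule V.submoduleI)
    show "lin_span R V I w \<subseteq> carrier V"
      using assms by (auto simp: lin_span_def intro!: V.M.finsum_closed)
    have "(\<Oplus>\<^bsub>V\<^esub>i\<in>I. \<zero>\<^bsub>R\<^esub> \<odot>\<^bsub>V\<^esub> w i) = (\<Oplus>\<^bsub>V\<^esub>i\<in>I. \<zero>\<^bsub>V\<^esub>)"
      using assms by (intro V.M.finsum_cong') auto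
    then show "\<zero>\<^bsub>V\<^esub> \<in> lin_span R V I w"
      unfolding lin_span_def by (intro CollectI exI[of _ "\<lambda>i. \<zero>\<^bsub>R\<^esub>"]) simp
  next
    fix x assume "x \<in> lin_span R V I w"
    then obtain c where c: "\<forall>i\<in>I. c i \<in> carrier R" "x = (\<Oplus>\<^bsub>V\<^esub>i\<in>I. c i \<odot>\<^bsub>V\<^esub> w i)"
      by (auto simp: lin_span_def)
    show sm: "b \<odot>\<^bsub>V\<^esub> x \<in> lin_span R V I w" if "b \<in> carrier R" for b
    proof -
      have "b \<odot>\<^bsub>V\<^esub> x = (\<Oplus>\<^bsub>V\<^esub>i\<in>I. b \<odot>\<^bsub>V\<^esub> (c i \<odot>\<^bsub>V\<^esub> w i))"
        unfolding c(2) using assms c(1) that by (intro V.finsum_smult_ldistr) auto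
      also have "\<dots> = (\<Oplus>\<^bsub>V\<^esub>i\<in>I. (b \<otimes>\<^bsub>R\<^esub> c i) \<odot>\<^bsub>V\<^esub> w i)"
        using assms c(1) that by (intro V.M.finsum_cong') (auto simp: V.smult_assoc1)
      finally show ?thesis unfolding lin_span_def using c(1) that
        by (intro CollectI exI[of _ "\<lambda>i. b \<otimes>\<^bsub>R\<^esub> c i"]) auto
    qed
    have xc: "x \<in> carrier V" using c assms by (auto intro!: V.M.finsum_closed)
    then have "\<ominus>\<^bsub>V\<^esub> x = (\<ominus>\<^bsub>R\<^esub> \<one>\<^bsub>R\<^esub>) \<odot>\<^bsub>V\<^esub> x" by (simp add: V.smult_l_minus)
    then show "\<ominus>\<^bsub>V\<^esub> x \<in> lin_span R V I w" using sm[of "\<ominus>\<^bsub>R\<^esub> \<one>\<^bsub>R\<^esub>"] by simp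
    fix y assume "y \<in> lin_span R V I w"
    then obtain d where d: "\<forall>i\<in>I. d i \<in> carrier R" "y = (\<Oplus>\<^bsub>V\<^esub>i\<in>I. d i \<odot>\<^bsub>V\<^esub> w i)"
      by (auto simp: lin_span_def)
    have "x \<oplus>\<^bsub>V\<^esub> y = (\<Oplus>\<^bsub>V\<^esub>i\<in>I. c i \<odot>\<^bsub>V\<^esub> w i \<oplus>\<^bsub>V\<^esub> d i \<odot>\<^bsub>V\<^esub> w i)"
      unfolding c d using assms c(1) d(1) by (intro V.M.finsum_addf[symmetric]) auto
    also have "\<dots> = (\<Oplus>\<^bsub>V\<^esub>i\<in>I. (c i \<oplus>\<^bsub>R\<^esub> d i) \<odot>\<^bsub>V\<^esub> w i)"
      using assms c(1) d(1) by (intro V.M.finsum_cong') (auto simp: V.smult_l_distr)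
    finally show "x \<oplus>\<^bsub>V\<^esub> y \<in> lin_span R V I w" unfolding lin_span_def using c(1) d(1)
      by (intro CollectI exI[of _ "\<lambda>i. c i \<oplus>\<^bsub>R\<^esub> d i"]) auto
  qed
qed

lemma lin_span_incl:
  assumes "module R V" "finite I" "\<And>i. i \<in> I \<Longrightarrow> w i \<in> carrier V" "i \<in> I"
  shows "w i \<in> lin_span R V I w"
proof -
  interpret V: module R V by fact
  have "(\<Oplus>\<^bsub>V\<^esub>j\<in>I. (if i = j then \<one>\<^bsub>R\<^esub> else \<zero>\<^bsub>R\<^esub>) \<odot>\<^bsub>V\<^esub> w j) = (\<Oplus>\<^bsub>V\<^esub>j\<in>I. if i = j then w j else \<zero>\<^bsub>V\<^esub>)"
    using assms by (intro V.M.finsum_cong') auto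
  also have "\<dots> = w i" using assms by (intro V.M.finsum_singleton) auto
  finally show ?thesis unfolding lin_span_def
    by (intro CollectI exI[of _ "\<lambda>j. if i = j then \<one>\<^bsub>R\<^esub> else \<zero>\<^bsub>R\<^esub>"]) auto
qed

lemma lin_span_least:
  assumes "module R V" "submodule N R V" "finite I" "\<And>i. i \<in> I \<Longrightarrow> w i \<in> N"
  shows "lin_span R V I w \<subseteq> N"
proof -
  interpret V: module R V by fact
  note subE = V.submoduleE[OF assms(2)]
  have z: "\<zero>\<^bsub>V\<^esub> \<in> N" using assms(2) subgroup.one_closed[of N "add_monoid V"] by (simp add: submodule_def)
  have "(\<Oplus>\<^bsub>V\<^esub>i\<in>J. c i \<odot>\<^bsub>V\<^esub> w i) \<in> N" if "finite J" "J \<subseteq> I" "\<forall>i\<in>J. c i \<in> carrier R" for J c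
    using that
  proof induction
    case (insert x F)
    then have "c x \<odot>\<^bsub>V\<^esub> w x \<oplus>\<^bsub>V\<^esub> (\<Oplus>\<^bsub>V\<^esub>i\<in>F. c i \<odot>\<^bsub>V\<^esub> w i) \<in> N"
      using assms(4) by (intro subE(5) subE(4)) auto
    moreover have "(\<lambda>i. c i \<odot>\<^bsub>V\<^esub> w i) \<in> F \<rightarrow> carrier V" "c x \<odot>\<^bsub>V\<^esub> w x \<in> carrier V"
      using insert.prems assms(4) subE(1) by (auto intro!: V.smult_closed)
    ultimately show ?case using insert.hyps by simp
  qed (simp add: z)
  from this[OF assms(3)] show ?thesis by (auto simp: lin_span_def)
qed

lemma dual_sys_expand:
  assumes "module R V" "dual_sys R V I a \<phi>" "x \<in> lin_span R V I a"
  shows "(\<Oplus>\<^bsub>V\<^esub>i\<in>I. \<phi> i x \<odot>\<^bsub>V\<^esub> a i) = x"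
proof -
  interpret V: module R V by fact
  note D = dual_sysD[OF assms(2)]
  obtain c where c: "\<forall>i\<in>I. c i \<in> carrier R" "x = (\<Oplus>\<^bsub>V\<^esub>i\<in>I. c i \<odot>\<^bsub>V\<^esub> a i)"
    using assms(3) by (auto simp: lin_span_def)
  have "\<phi> i x = c i" if i: "i \<in> I" for i
  proof -
    have "\<phi> i x = (\<Oplus>\<^bsub>R\<^esub>j\<in>I. \<phi> i (c j \<odot>\<^bsub>V\<^esub> a j))"
      unfolding c(2) using hom_finsum[OF V.abelian_group_axioms module_abelian[OF V.R.self_module] D(3)[OF i] D(1)]
        c(1) D(2) by simp
    also have "\<dots> = (\<Oplus>\<^bsub>R\<^esub>j\<in>I. if i = j then c j else \<zero>\<^bsub>R\<^esub>)"
      using c(1) i D by (intro V.R.finsum_cong') (auto simp: module_homsD(3)[OF D(3)])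
    also have "\<dots> = c i" using i D(1) c(1) by (intro V.R.finsum_singleton) auto
    finally show ?thesis .
  qed
  then show ?thesis unfolding c(2) using c(1) D by (intro V.M.finsum_cong') auto
qed

text \<open>Gaussian elimination, by induction on J. Subtracting multiples of one pivot
  \<open>a i0\<close> removes \<open>w j\<close> from all other vectors. The functionals stay dual
  to the new vectors because those with i different from i0 vanish at the pivot.\<close>

lemma (in field) dual_sys_card_le:
  assumes "module R V" "finite J"
    and "dual_sys R V I a \<phi>" "\<And>i. i \<in> I \<Longrightarrow> a i \<in> lin_span R V J w" "\<And>j. j \<in> J \<Longrightarrow> w j \<in> carrier V"
  shows "card I \<le> card J"
  using assms(2-)
proof (induction J arbitrary: I a \<phi> rule: finite_induct)
  case empty
  interpret V: module R V by fact
  have "i \<notin> I" for i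
  proof
    assume i: "i \<in> I"
    then have "a i = \<zero>\<^bsub>V\<^esub>" using empty(2)[OF i] by (simp add: lin_span_def)
    then have "\<phi> i (a i) = \<zero>"
      using hom_zero_minus(1)[OF V.abelian_group_axioms module_abelian[OF self_module] dual_sysD(3)[OF empty(1) i]] by simp
    then show False using dual_sysD(5)[OF empty(1) i i] by simp
  qed
  then have "I = {}" by blast
  then show ?case by simp
next
  case (insert j J)
  interpret V: module R V by fact
  note D = dual_sysD[OF insert.prems(1)]
  have "\<forall>i\<in>I. \<exists>c. (\<forall>l\<in>insert j J. c l \<in> carrier R) \<and> a i = (\<Oplus>\<^bsub>V\<^esub>l\<in>insert j J. c l \<odot>\<^bsub>V\<^esub> w l)"
    using insert.prems(2) unfolding lin_span_def by blast
  from bchoice[OF this] obtain c where c_ac: "\<forall>i\<in>I. (\<forall>l\<in>insert j J. c i l \<in> carrier R) \<and>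
      a i = (\<Oplus>\<^bsub>V\<^esub>l\<in>insert j J. c i l \<odot>\<^bsub>V\<^esub> w l)" ..
  then have c: "c i l \<in> carrier R" if "i \<in> I" "l \<in> insert j J" for i l using that by blast
  have ac: "a i = (\<Oplus>\<^bsub>V\<^esub>l\<in>insert j J. c i l \<odot>\<^bsub>V\<^esub> w l)" if "i \<in> I" for i using c_ac that by blast
  have w: "w j \<in> carrier V" "\<And>l. l \<in> J \<Longrightarrow> w l \<in> carrier V" using insert.prems(3) by auto
  have sum: "(\<Oplus>\<^bsub>V\<^esub>l\<in>insert j J. d l \<odot>\<^bsub>V\<^esub> w l) = d j \<odot>\<^bsub>V\<^esub> w j \<oplus>\<^bsub>V\<^esub> (\<Oplus>\<^bsub>V\<^esub>l\<in>J. d l \<odot>\<^bsub>V\<^esub> w l)"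
    if "\<And>l. l \<in> insert j J \<Longrightarrow> d l \<in> carrier R" for d
    using insert.hyps w that by (intro V.M.finsum_insert) auto
  have sumc: "(\<Oplus>\<^bsub>V\<^esub>l\<in>J. d l \<odot>\<^bsub>V\<^esub> w l) \<in> carrier V" if "\<And>l. l \<in> J \<Longrightarrow> d l \<in> carrier R" for d
    using w that by (intro V.M.finsum_closed) auto
  show ?case
  proof (cases "\<forall>i\<in>I. c i j = \<zero>")
    case True
    have "a i \<in> lin_span R V J w" if "i \<in> I" for i
    proof -
      have "a i = (\<Oplus>\<^bsub>V\<^esub>l\<in>J. c i l \<odot>\<^bsub>V\<^esub> w l)"
        using ac[OF that] sum[of "c i"] sumc[of "c i"] c[OF that] True that w by simp
      then show ?thesis unfolding lin_span_def using c[OF that] by blast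
    qed
    then have "card I \<le> card J" using insert.IH[OF insert.prems(1)] w by blast
    then show ?thesis using insert.hyps by simp
  next
    case False
    then obtain i0 where i0: "i0 \<in> I" "c i0 j \<noteq> \<zero>" by blast
    then have inv: "inv (c i0 j) \<in> carrier R" "inv (c i0 j) \<otimes> c i0 j = \<one>"
      using c[OF i0(1), of j] field_Units by auto
    define r where "r = (\<lambda>i. c i j \<otimes> inv (c i0 j))"
    define a' where "a' = (\<lambda>i. a i \<ominus>\<^bsub>V\<^esub> r i \<odot>\<^bsub>V\<^esub> a i0)"
    have r: "r i \<in> carrier R" if "i \<in> I" for i using c[OF that, of j] inv by (simp add: r_def)
    have "dual_sys R V (I - {i0}) a' \<phi>"
      unfolding dual_sys_def
    proof (intro conjI ballI)
      fix i assume i: "i \<in> I - {i0}"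
      show "a' i \<in> carrier V" using i D(2) i0(1) r by (simp add: a'_def)
      show "\<phi> i \<in> module_homs R V (self_module R)" using i D(3) by blast
      fix l assume l: "l \<in> I - {i0}"
      note h = hom_zero_minus[OF V.abelian_group_axioms module_abelian[OF self_module] D(3)[of i]]
      have "\<phi> i (a' l) = \<phi> i (a l) \<ominus>\<^bsub>self_module R\<^esub> \<phi> i (r l \<odot>\<^bsub>V\<^esub> a i0)"
        unfolding a'_def using i l i0 D(2) r by (intro h(3)) auto
      also have "\<phi> i (r l \<odot>\<^bsub>V\<^esub> a i0) = \<zero>"
        using module_homsD(3)[OF D(3)[of i], of "r l" "a i0"] i l i0 D(2) r D(5)[of i i0] by auto
      finally show "\<phi> i (a' l) = (if i = l then \<one> else \<zero>)" using D(5)[of i l] i l by (simp add: a_minus_def)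
    qed (use D(1) in simp)
    moreover have "a' i \<in> lin_span R V J w" if i: "i \<in> I - {i0}" for i
    proof -
      let ?d = "\<lambda>l. c i l \<ominus> r i \<otimes> c i0 l"
      have iI: "i \<in> I" using i by blast
      have d: "?d l \<in> carrier R" if "l \<in> insert j J" for l using c[OF iI that] c[OF i0(1) that] r[OF iI] by simp
      have dj: "?d j = \<zero>" using c[OF iI, of j] inv c[OF i0(1), of j]
        by (simp add: r_def m_assoc a_minus_def r_neg)
      have "(\<Oplus>\<^bsub>V\<^esub>l\<in>insert j J. ?d l \<odot>\<^bsub>V\<^esub> w l) =
          (\<Oplus>\<^bsub>V\<^esub>l\<in>insert j J. c i l \<odot>\<^bsub>V\<^esub> w l \<oplus>\<^bsub>V\<^esub> (\<ominus> r i) \<odot>\<^bsub>V\<^esub> (c i0 l \<odot>\<^bsub>V\<^esub> w l))"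
        using c[OF iI] c[OF i0(1)] insert.prems(3) r[OF iI]
        by (intro V.M.finsum_cong') (auto simp: a_minus_def V.smult_l_distr V.smult_l_minus V.smult_assoc1)
      also have "\<dots> = a i \<oplus>\<^bsub>V\<^esub> (\<Oplus>\<^bsub>V\<^esub>l\<in>insert j J. (\<ominus> r i) \<odot>\<^bsub>V\<^esub> (c i0 l \<odot>\<^bsub>V\<^esub> w l))"
        unfolding ac[OF iI] using c[OF iI] c[OF i0(1)] insert.prems(3) r[OF iI]
        by (intro V.M.finsum_addf) auto
      also have "(\<Oplus>\<^bsub>V\<^esub>l\<in>insert j J. (\<ominus> r i) \<odot>\<^bsub>V\<^esub> (c i0 l \<odot>\<^bsub>V\<^esub> w l)) = (\<ominus> r i) \<odot>\<^bsub>V\<^esub> a i0"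
        unfolding ac[OF i0(1)] using c[OF i0(1)] insert.prems(3) r[OF iI] insert.hyps(1)
        by (intro V.finsum_smult_ldistr[symmetric]) auto
      also have "a i \<oplus>\<^bsub>V\<^esub> (\<ominus> r i) \<odot>\<^bsub>V\<^esub> a i0 = a' i"
        using D(2)[OF i0(1)] r[OF iI] by (simp add: a'_def a_minus_def V.smult_l_minus)
      finally have "a' i = (\<Oplus>\<^bsub>V\<^esub>l\<in>J. ?d l \<odot>\<^bsub>V\<^esub> w l)"
        using sum[of ?d, OF d] sumc[of ?d, OF d] dj w by simp
      then show ?thesis unfolding lin_span_def using d by (intro CollectI exI[of _ ?d]) auto
    qed
    ultimately have "card (I - {i0}) \<le> card J" using w by (intro insert.IH) auto
    then show ?thesis using insert.hyps i0(1) D(1) by (simp add: card_Diff_singleton)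
  qed
qed

text \<open>The cardinality bound yields a longest extension inside A. It spans A, since a vector
  outside its span comes with a separating functional and would lengthen the system. Because the
  first p vectors are kept, the result is a basis of A adapted to a given subspace.\<close>

lemma (in field) dual_basis_extend:
  assumes "module R V" "submodule A R V" "finite J" "\<And>j. j \<in> J \<Longrightarrow> w j \<in> carrier V" "A \<subseteq> lin_span R V J w"
    and "dual_sys R V {..<p::nat} a \<phi>" "\<And>i. i < p \<Longrightarrow> a i \<in> A"
  obtains n a' \<phi>' where "p \<le> n" "dual_sys R V {..<n} a' \<phi>'" "\<And>i. i < n \<Longrightarrow> a' i \<in> A"
    "\<And>i. i < p \<Longrightarrow> a' i = a i" "\<And>x. x \<in> A \<Longrightarrow> (\<Oplus>\<^bsub>V\<^esub>i\<in>{..<n}. \<phi>' i x \<odot>\<^bsub>V\<^esub> a' i) = x"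
proof -
  interpret V: module R V by fact
  define P where "P = (\<lambda>n. \<exists>a' \<phi>'. p \<le> n \<and> dual_sys R V {..<n} a' \<phi>' \<and> (\<forall>i<n. a' i \<in> A) \<and> (\<forall>i<p. a' i = a i))"
  have P0: "P p" using assms(6,7) unfolding P_def by (intro exI[of _ a] exI[of _ \<phi>]) simp
  have Pb: "n \<le> card J" if "P n" for n
  proof -
    obtain a' \<phi>' where a': "dual_sys R V {..<n} a' \<phi>'" "\<forall>i<n. a' i \<in> A"
      using \<open>P n\<close> unfolding P_def by (elim exE) auto
    then have "card {..<n} \<le> card J"
      using assms(5) by (intro dual_sys_card_le[OF assms(1,3) a'(1) _ assms(4)]) auto
    then show ?thesis by simp
  qed
  then obtain n where n: "P n" "\<And>m. P m \<Longrightarrow> m \<le> n"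
    using ex_has_greatest_nat[of P p "\<lambda>n. n" "Suc (card J)"] P0 by (auto simp: less_Suc_eq_le)
  then obtain a' \<phi>' where a': "p \<le> n" "dual_sys R V {..<n} a' \<phi>'" "\<And>i. i < n \<Longrightarrow> a' i \<in> A" "\<And>i. i < p \<Longrightarrow> a' i = a i"
    unfolding P_def by (elim exE) auto
  note D = dual_sysD[OF a'(2)]
  have "x \<in> lin_span R V {..<n} a'" if x: "x \<in> A" for x
  proof (rule ccontr)
    assume nx: "x \<notin> lin_span R V {..<n} a'"
    have xV: "x \<in> carrier V" using x V.submoduleE(1)[OF assms(2)] by blast
    have sub: "submodule (lin_span R V {..<n} a') R V" using D by (intro lin_span_submodule V.module_axioms) auto
    obtain f where f: "f \<in> module_homs R V (self_module R)"
      "\<And>w. w \<in> lin_span R V {..<n} a' \<Longrightarrow> f w = \<zero>" "f x = \<one>"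
      using functional_separation[OF assms(1) sub xV nx] by blast
    have fa: "f (a' i) = \<zero>" if "i < n" for i
      using that D by (intro f(2) lin_span_incl V.module_axioms) auto
    have fc: "y \<in> carrier V \<Longrightarrow> f y \<in> carrier R" for y using module_homsD(1)[OF f(1)] by simp
    define b where "b = (\<lambda>i. if i = n then x else a' i)"
    \<comment> \<open>f vanishes on the old vectors and is 1 at x. Subtracting \<phi>' i x times f
      therefore changes no old value and makes the value at x zero.\<close>
    define \<psi> where "\<psi> = (\<lambda>i. if i = n then f else (\<lambda>y. \<phi>' i y \<ominus>\<^bsub>self_module R\<^esub> \<phi>' i x \<odot>\<^bsub>self_module R\<^esub> f y))"
    have "dual_sys R V {..<Suc n} b \<psi>"
      unfolding dual_sys_def
    proof (intro conjI ballI)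
      fix i assume i: "i \<in> {..<Suc n}"
      show "b i \<in> carrier V" using i D(2) xV by (auto simp: b_def)
      show "\<psi> i \<in> module_homs R V (self_module R)"
      proof (cases "i = n")
        case False
        then have "i \<in> {..<n}" using i by auto
        then show ?thesis using False f(1) D(3,4) xV
          by (simp only: \<psi>_def if_False) (intro lin_minus lin_smult self_module; simp)
      qed (simp add: \<psi>_def f)
      fix j assume j: "j \<in> {..<Suc n}"
      show "\<psi> i (b j) = (if i = j then \<one> else \<zero>)"
        using i j D(4)[of i x] D(5)[of i j] fa[of j] f(3) xV
        by (auto simp: \<psi>_def b_def less_Suc_eq a_minus_def r_neg)
    qed auto
    moreover have "\<forall>i<Suc n. b i \<in> A" "\<forall>i<p. b i = a i" using a' x by (auto simp: b_def less_Suc_eq)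
    ultimately have "P (Suc n)" using a'(1) unfolding P_def by (intro exI[of _ b] exI[of _ \<psi>]) simp
    then show False using n(2) by fastforce
  qed
  then show thesis using that[OF a'(1-4)] dual_sys_expand[OF assms(1) a'(2)] by blast
qed

lemma (in field) dual_basis:
  assumes "module R V" "submodule A R V" "finite J" "\<And>j. j \<in> J \<Longrightarrow> w j \<in> carrier V" "A \<subseteq> lin_span R V J w"
  obtains n a \<phi> where "dual_sys R V {..<n::nat} a \<phi>" "\<And>i. i < n \<Longrightarrow> a i \<in> A"
    "\<And>x. x \<in> A \<Longrightarrow> (\<Oplus>\<^bsub>V\<^esub>i\<in>{..<n}. \<phi> i x \<odot>\<^bsub>V\<^esub> a i) = x"
  using dual_basis_extend[OF assms, of 0] by (auto simp: dual_sys_def)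

section \<open>Sweedler calculus\<close>

lemma tensor_lift_comp:
  assumes "module R V" "module R W" "module R U" "module R U'" "bilin R V W U b"
    and "g \<in> module_homs R U U'" "t \<in> carrier (tensor_prod R V W)"
  shows "g (tensor_lift R U b t) = tensor_lift R U' (\<lambda>v w. g (b v w)) t"
proof -
  have b: "bilin R V W U' (\<lambda>v w. g (b v w))"
    using assms(5) by (intro bilinI lin_comp[OF assms(6)]) (auto dest: bilinD)
  show ?thesis
    by (rule tensor_ext[OF assms(1,2) lin_comp[OF assms(6) tensor_lift_hom] tensor_lift_hom _ assms(7)])
      (use assms b in \<open>auto simp: tensor_lift_pure\<close>)
qed

definition trilin ::
  "('k, 'z) ring_scheme \<Rightarrow> ('k, 'v, 'x) module_scheme \<Rightarrow> ('k, 'u, 'p) module_scheme \<Rightarrow>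
    ('v \<Rightarrow> 'v \<Rightarrow> 'v \<Rightarrow> 'u) \<Rightarrow> bool"
  where "trilin R V U f \<longleftrightarrow>
    (\<forall>x\<in>carrier V. \<forall>y\<in>carrier V. (\<lambda>z. f x y z) \<in> module_homs R V U \<and>
      (\<lambda>z. f x z y) \<in> module_homs R V U \<and> (\<lambda>z. f z x y) \<in> module_homs R V U)"

lemma trilinI:
  assumes "\<And>x y. x \<in> carrier V \<Longrightarrow> y \<in> carrier V \<Longrightarrow> (\<lambda>z. f x y z) \<in> module_homs R V U"
    and "\<And>x y. x \<in> carrier V \<Longrightarrow> y \<in> carrier V \<Longrightarrow> (\<lambda>z. f x z y) \<in> module_homs R V U"
    and "\<And>x y. x \<in> carrier V \<Longrightarrow> y \<in> carrier V \<Longrightarrow> (\<lambda>z. f z x y) \<in> module_homs R V U"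
  shows "trilin R V U f"
  using assms by (simp add: trilin_def)

lemma trilinD:
  assumes "trilin R V U f" "x \<in> carrier V" "y \<in> carrier V"
  shows "(\<lambda>z. f x y z) \<in> module_homs R V U" "(\<lambda>z. f x z y) \<in> module_homs R V U"
    "(\<lambda>z. f z x y) \<in> module_homs R V U"
  using assms by (simp_all add: trilin_def)

lemma trilin_bilin:
  assumes "trilin R V U f" "x \<in> carrier V"
  shows "bilin R V V U (\<lambda>y z. f x y z)" "bilin R V V U (\<lambda>y z. f y x z)" "bilin R V V U (\<lambda>y z. f y z x)"
  using assms by (auto intro!: bilinI simp: trilin_def)

declare lin_id [simp]

text \<open>The Sweedler sum \<Sum> b(h', h''). Iterated coproducts are written as nested sums, so
  every Hopf algebra computation becomes a chain of equalities between bilinear maps under this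
  operator.\<close>

definition sw ::
  "('k, 'z) ring_scheme \<Rightarrow> ('k, 'h, 'y) hopf_scheme \<Rightarrow> ('k, 'u, 'p) module_scheme \<Rightarrow>
    ('h \<Rightarrow> 'h \<Rightarrow> 'u) \<Rightarrow> 'h \<Rightarrow> 'u"
  where "sw k H U b h = tensor_lift k U b (comult H h)"

locale hopf = hopf_algebra k H
  for k :: "('k, 'z) ring_scheme" and H :: "('k, 'h, 'y) hopf_scheme"
begin

abbreviation mul (infixl "\<bullet>" 70) where "x \<bullet> y \<equiv> x \<otimes>\<^bsub>H\<^esub> y"
abbreviation unit ("\<one>\<^sub>H") where "\<one>\<^sub>H \<equiv> \<one>\<^bsub>H\<^esub>"
abbreviation "S \<equiv> antipode H"
abbreviation "\<epsilon> \<equiv> counit H"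
abbreviation "HH \<equiv> tensor_prod k H H"
abbreviation pure_HH (infixl "\<boxtimes>" 72) where "x \<boxtimes> y \<equiv> pure_tensor k H H x y"
abbreviation "SW \<equiv> sw k H"

lemma H_module: "module k H" by (rule module_axioms)
lemma H_ring: "ring H" by unfold_locales
lemma k_module: "module k (self_module k)"
  by (rule cring.self_module) unfold_locales
lemma k_field: "field k" by unfold_locales

lemmas k_rules = ring.ring_simprules[OF field.is_ring[OF k_field]]

lemma
  assumes "x \<in> carrier H" "y \<in> carrier H"
  shows H_closed: "x \<bullet> y \<in> carrier H" and H_add_closed: "x \<oplus>\<^bsub>H\<^esub> y \<in> carrier H"
    and H_l_one: "\<one>\<^sub>H \<bullet> x = x" and H_r_one: "x \<bullet> \<one>\<^sub>H = x"
    and H_assoc: "z \<in> carrier H \<Longrightarrow> x \<bullet> y \<bullet> z = x \<bullet> (y \<bullet> z)"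
    and H_l_distr: "z \<in> carrier H \<Longrightarrow> (x \<oplus>\<^bsub>H\<^esub> y) \<bullet> z = x \<bullet> z \<oplus>\<^bsub>H\<^esub> y \<bullet> z"
    and H_r_distr: "z \<in> carrier H \<Longrightarrow> z \<bullet> (x \<oplus>\<^bsub>H\<^esub> y) = z \<bullet> x \<oplus>\<^bsub>H\<^esub> z \<bullet> y"
  using assms by (simp_all add: ring.ring_simprules[OF H_ring])

lemma H_one_closed: "\<one>\<^sub>H \<in> carrier H"
  using monoid.one_closed[OF ring.is_monoid[OF H_ring]] .

lemma H_ab: "abelian_group H" by (rule module_abelian[OF H_module])

lemma k_comm: "x \<in> carrier k \<Longrightarrow> y \<in> carrier k \<Longrightarrow> x \<otimes>\<^bsub>k\<^esub> y = y \<otimes>\<^bsub>k\<^esub> x"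
  by (rule cring.cring_simprules(14)[OF module.axioms(1)[OF H_module]])

lemma HH_module: "module k HH" by (intro tensor_module H_module)

sublocale HHM: module k HH by (rule HH_module)

lemma mul_bilin: "bilin k H H H (\<otimes>\<^bsub>H\<^esub>)"
  by (intro bilinI module_homsI)
    (auto simp: H_closed H_add_closed H_l_distr H_r_distr smult_mult_left smult_mult_right)

lemma HH_bilin: "bilin k H H HH (pure_tensor k H H)"
  by (intro pure_bilin H_module)

lemma S_closed: "x \<in> carrier H \<Longrightarrow> S x \<in> carrier H"
  using module_homsD(1)[OF antipode_linear] .

lemma eps_closed: "x \<in> carrier H \<Longrightarrow> \<epsilon> x \<in> carrier k"
  using module_homsD(1)[OF counit_linear] by simp

lemma comult_closed: "x \<in> carrier H \<Longrightarrow> comult H x \<in> carrier HH"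
  using module_homsD(1)[OF comult_linear] .

lemma pure_HH_closed: "x \<in> carrier H \<Longrightarrow> y \<in> carrier H \<Longrightarrow> x \<boxtimes> y \<in> carrier HH"
  by (rule pure_closed[OF H_module H_module])

lemma lin_mul_l: "c \<in> carrier H \<Longrightarrow> f \<in> module_homs k Z H \<Longrightarrow> (\<lambda>x. f x \<bullet> c) \<in> module_homs k Z H"
  by (rule lin_bil_l[OF mul_bilin])

lemma lin_mul_r: "c \<in> carrier H \<Longrightarrow> f \<in> module_homs k Z H \<Longrightarrow> (\<lambda>x. c \<bullet> f x) \<in> module_homs k Z H"
  by (rule lin_bil_r[OF mul_bilin])

lemma lin_HH_l: "c \<in> carrier H \<Longrightarrow> f \<in> module_homs k Z H \<Longrightarrow> (\<lambda>x. f x \<boxtimes> c) \<in> module_homs k Z HH"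
  by (rule lin_bil_l[OF HH_bilin])

lemma lin_HH_r: "c \<in> carrier H \<Longrightarrow> f \<in> module_homs k Z H \<Longrightarrow> (\<lambda>x. c \<boxtimes> f x) \<in> module_homs k Z HH"
  by (rule lin_bil_r[OF HH_bilin])

lemma sw_closed:
  assumes "module k U" "bilin k H H U b" "h \<in> carrier H"
  shows "SW U b h \<in> carrier U"
  unfolding sw_def
  by (rule module_homsD(1)[OF tensor_lift_hom[OF H_module H_module assms(1,2)] comult_closed[OF assms(3)]])

lemma sw_hom:
  assumes "module k U" "bilin k H H U b"
  shows "SW U b \<in> module_homs k H U"
  unfolding sw_def by (intro lin_comp[OF tensor_lift_hom comult_linear] H_module assms)

lemma lin_sw_arg:
  assumes "module k U" "bilin k H H U b" "f \<in> module_homs k Z H"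
  shows "(\<lambda>x. SW U b (f x)) \<in> module_homs k Z U"
  by (rule lin_comp[OF sw_hom[OF assms(1,2)] assms(3)])

lemma lin_sw_param:
  assumes "module k U" "module k Z" "h \<in> carrier H"
    and "\<And>x. x \<in> carrier Z \<Longrightarrow> bilin k H H U (b x)"
    and "\<And>v w. v \<in> carrier H \<Longrightarrow> w \<in> carrier H \<Longrightarrow> (\<lambda>x. b x v w) \<in> module_homs k Z U"
  shows "(\<lambda>x. SW U (b x) h) \<in> module_homs k Z U"
  unfolding sw_def
  by (rule lin_lift_param[OF H_module H_module assms(1) comult_closed[OF assms(3)] assms(2)])
    (use assms in auto)

lemmas hopf_lin = lin_mul_l lin_mul_r lin_HH_l lin_HH_r lin_comp[OF antipode_linear] lin_comp[OF counit_linear]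
  lin_sw_arg lin_sw_param lin_intros bilinI trilinI

declare H_closed [simp] H_one_closed [simp] S_closed [simp] eps_closed [simp] comult_closed [simp]
  pure_HH_closed [simp] H_module [simp] k_module [simp] HH_module [simp]

lemma sw_comp:
  assumes "module k U" "module k U'" "bilin k H H U b" "g \<in> module_homs k U U'" "h \<in> carrier H"
  shows "g (SW U b h) = SW U' (\<lambda>v w. g (b v w)) h"
  unfolding sw_def using assms by (intro tensor_lift_comp[OF H_module H_module]) auto

lemma sw_cong:
  assumes "module k U" "bilin k H H U b" "h \<in> carrier H"
    and "\<And>v w. v \<in> carrier H \<Longrightarrow> w \<in> carrier H \<Longrightarrow> b' v w = b v w"
  shows "SW U b' h = SW U b h"
  unfolding sw_def using assms by (intro tensor_lift_cong[OF H_module H_module]) auto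

text \<open>A trilinear f induces a linear map on H \<otimes> (H \<otimes> H). Applied to the two
  sides of the coassociativity axiom, it produces the two bracketings of the triple sum.\<close>

lemma sw_coassoc:
  assumes U: "module k U" and f: "trilin k H U f" and h: "h \<in> carrier H"
  shows "SW U (\<lambda>a b. SW U (\<lambda>c d. f c d b) a) h = SW U (\<lambda>a b. SW U (\<lambda>c d. f a c d) b) h"
proof -
  let ?T = "tensor_prod k H HH" and ?T' = "tensor_prod k HH H"
  have T: "module k ?T" "module k ?T'" by (intro tensor_module H_module HH_module)+
  note tri = trilin_bilin[OF f]
  let ?g = "\<lambda>a t. tensor_lift k U (\<lambda>c d. f a c d) t"
  have g: "bilin k H HH U ?g"
    by (intro bilinI lin_lift_param[OF H_module H_module] lin_lift[OF H_module H_module]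
        lin_id H_module HH_module U tri) (auto simp: trilinD[OF f])
  let ?\<Lambda> = "tensor_lift k U ?g"
  note \<Lambda> = tensor_lift_hom[OF H_module HH_module U g] and \<Lambda>p = tensor_lift_pure[OF H_module HH_module U g]
  have bT: "bilin k H H ?T (\<lambda>u v. pure_tensor k H HH u (v \<boxtimes> w))" if "w \<in> carrier H" for w
    using that by (intro bilinI lin_bil_l[OF pure_bilin] lin_bil_r[OF pure_bilin] lin_HH_l lin_id) auto
  let ?q = "\<lambda>t w. tensor_lift k ?T (\<lambda>u v. pure_tensor k H HH u (v \<boxtimes> w)) t"
  have q: "bilin k HH H ?T ?q"
    by (intro bilinI lin_lift_param[OF H_module H_module] lin_lift[OF H_module H_module] T bT lin_id
        lin_bil_r[OF pure_bilin] lin_HH_r) auto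
  have as: "tensor_assoc k H H H = tensor_lift k ?T ?q"
    by (simp add: tensor_assoc_def Let_def)
  note ash = tensor_lift_hom[OF HH_module H_module T(1) q, folded as]
  have asp: "tensor_assoc k H H H (pure_tensor k HH H t w) = ?q t w" if "t \<in> carrier HH" "w \<in> carrier H" for t w
    using tensor_lift_pure[OF HH_module H_module T(1) q] that by (simp add: as)
  have b1: "bilin k H H ?T' (\<lambda>a b. pure_tensor k HH H (comult H a) (id b))"
    by (intro bilinI lin_bil_l[OF pure_bilin] lin_bil_r[OF pure_bilin] lin_comp[OF comult_linear])
     (auto simp: lin_id)
  have b2: "bilin k H H ?T (\<lambda>a b. pure_tensor k H HH (id a) (comult H b))"
    by (intro bilinI lin_bil_l[OF pure_bilin] lin_bil_r[OF pure_bilin] lin_comp[OF comult_linear])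
     (auto simp: lin_id)
  have "?\<Lambda> (tensor_map k H HH id (comult H) (comult H h)) =
      tensor_lift k U (\<lambda>a b. ?\<Lambda> (pure_tensor k H HH (id a) (comult H b))) (comult H h)"
    unfolding tensor_map_def using h
    by (intro tensor_lift_comp[OF H_module H_module T(1) U b2 \<Lambda>]) simp
  also have "\<dots> = tensor_lift k U (\<lambda>a b. SW U (\<lambda>c d. f a c d) b) (comult H h)"
    using h by (intro tensor_lift_cong H_module U bilinI lin_sw_arg lin_sw_param tri lin_id)
      (auto simp: \<Lambda>p sw_def trilinD[OF f])
  finally have 1: "?\<Lambda> (tensor_map k H HH id (comult H) (comult H h)) = SW U (\<lambda>a b. SW U (\<lambda>c d. f a c d) b) h"
    by (simp add: sw_def)
  have \<Lambda>as: "(\<lambda>t. ?\<Lambda> (tensor_assoc k H H H t)) \<in> module_homs k ?T' U"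
    by (rule lin_comp[OF \<Lambda> ash])
  have "?\<Lambda> (tensor_assoc k H H H (tensor_map k HH H (comult H) id (comult H h))) =
      tensor_lift k U (\<lambda>a b. ?\<Lambda> (tensor_assoc k H H H (pure_tensor k HH H (comult H a) (id b)))) (comult H h)"
    unfolding tensor_map_def using h
    by (intro tensor_lift_comp[OF H_module H_module T(2) U b1 \<Lambda>as]) simp
  also have "\<dots> = tensor_lift k U (\<lambda>a b. SW U (\<lambda>c d. f c d b) a) (comult H h)"
  proof (rule tensor_lift_cong[OF H_module H_module U])
    show "bilin k H H U (\<lambda>a b. SW U (\<lambda>c d. f c d b) a)"
      by (intro H_module U bilinI lin_sw_arg lin_sw_param tri lin_id) (auto simp: trilinD[OF f])
    fix a b assume ab: "a \<in> carrier H" "b \<in> carrier H"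
    have "?\<Lambda> (tensor_assoc k H H H (pure_tensor k HH H (comult H a) (id b))) = ?\<Lambda> (?q (comult H a) b)"
      using ab by (simp add: asp)
    also have "\<dots> = tensor_lift k U (\<lambda>u v. ?\<Lambda> (pure_tensor k H HH u (v \<boxtimes> b))) (comult H a)"
      using ab by (intro tensor_lift_comp[OF H_module H_module T(1) U bT \<Lambda>]) simp_all
    also have "\<dots> = tensor_lift k U (\<lambda>u v. f u v b) (comult H a)"
      using ab by (intro tensor_lift_cong[OF H_module H_module U tri(3)])
        (auto simp: \<Lambda>p tensor_lift_pure[OF H_module H_module U tri(1)])
    finally show "?\<Lambda> (tensor_assoc k H H H (pure_tensor k HH H (comult H a) (id b))) = SW U (\<lambda>c d. f c d b) a"
      by (simp add: sw_def)
  qed (use h in simp)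
  finally show ?thesis using 1 coassoc[OF h] by (simp add: sw_def)
qed

text \<open>With h fixed, both sides are values at \<open>comult H g\<close> of linear maps on H
  \<otimes> H, and these maps agree on pure tensors.\<close>

lemma sw_swap:
  assumes "module k U" "g \<in> carrier H" "h \<in> carrier H"
    and "\<And>a b. a \<in> carrier H \<Longrightarrow> b \<in> carrier H \<Longrightarrow> bilin k H H U (F a b)"
    and "\<And>c d. c \<in> carrier H \<Longrightarrow> d \<in> carrier H \<Longrightarrow> bilin k H H U (\<lambda>a b. F a b c d)"
  shows "SW U (\<lambda>a b. SW U (\<lambda>c d. F a b c d) h) g = SW U (\<lambda>c d. SW U (\<lambda>a b. F a b c d) g) h"
proof -
  have b: "bilin k H H U (\<lambda>a b. SW U (\<lambda>c d. F a b c d) h)"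
    using assms(3,4) bilinD[OF assms(5)] bilinD[OF assms(4)] by (intro bilinI lin_sw_param assms(1) H_module) auto
  have p: "(\<lambda>t. tensor_lift k U (\<lambda>c d. tensor_lift k U (\<lambda>a b. F a b c d) t) (comult H h)) \<in> module_homs k HH U"
    by (intro lin_lift_param[OF H_module H_module] lin_lift[OF H_module H_module] lin_id bilinI assms HH_module)
      (use assms(3) bilinD[OF assms(4)] in auto)
  show ?thesis
    unfolding sw_def[of k H U _ g]
    unfolding sw_def[of k H U "\<lambda>c d. tensor_lift k U (\<lambda>a b. F a b c d) (comult H g)"]
    by (rule tensor_ext[OF H_module H_module tensor_lift_hom[OF H_module H_module assms(1) b] p])
      (use assms b in \<open>auto simp: tensor_lift_pure sw_def intro!: tensor_lift_cong[symmetric] assms\<close>)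
qed

lemma sw_counit:
  assumes U: "module k U" and f: "f \<in> module_homs k H U" and h: "h \<in> carrier H"
  shows "SW U (\<lambda>a b. \<epsilon> a \<odot>\<^bsub>U\<^esub> f b) h = f h" "SW U (\<lambda>a b. \<epsilon> b \<odot>\<^bsub>U\<^esub> f a) h = f h"
proof -
  have "f (SW H (\<lambda>a b. \<epsilon> a \<odot>\<^bsub>H\<^esub> b) h) = SW U (\<lambda>a b. f (\<epsilon> a \<odot>\<^bsub>H\<^esub> b)) h"
    using U f h by (intro sw_comp bilinI hopf_lin) auto
  also have "\<dots> = SW U (\<lambda>a b. \<epsilon> a \<odot>\<^bsub>U\<^esub> f b) h"
    using U h module_homsD[OF f] by (intro sw_cong bilinI hopf_lin lin_comp[OF f]) auto
  finally show "SW U (\<lambda>a b. \<epsilon> a \<odot>\<^bsub>U\<^esub> f b) h = f h"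
    using counit_left[OF h] by (simp add: sw_def)
  have "f (SW H (\<lambda>a b. \<epsilon> b \<odot>\<^bsub>H\<^esub> a) h) = SW U (\<lambda>a b. f (\<epsilon> b \<odot>\<^bsub>H\<^esub> a)) h"
    using U f h by (intro sw_comp bilinI hopf_lin) auto
  also have "\<dots> = SW U (\<lambda>a b. \<epsilon> b \<odot>\<^bsub>U\<^esub> f a) h"
    using U h module_homsD[OF f] by (intro sw_cong bilinI hopf_lin lin_comp[OF f]) auto
  finally show "SW U (\<lambda>a b. \<epsilon> b \<odot>\<^bsub>U\<^esub> f a) h = f h"
    using counit_right[OF h] by (simp add: sw_def)
qed

lemma sw_one:
  assumes "module k U" "bilin k H H U b"
  shows "SW U b \<one>\<^sub>H = b \<one>\<^sub>H \<one>\<^sub>H"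
  unfolding sw_def comult_one using assms by (simp add: tensor_lift_pure)

lemma sw_mult:
  assumes U: "module k U" and b: "bilin k H H U b" and gh: "g \<in> carrier H" "h \<in> carrier H"
  shows "SW U b (g \<bullet> h) = SW U (\<lambda>x y. SW U (\<lambda>c d. b (x \<bullet> c) (y \<bullet> d)) h) g"
proof -
  note L = tensor_lift_hom[OF H_module H_module U b] and P = tensor_lift_pure[OF H_module H_module U b]
  let ?m = "\<lambda>x y. tensor_lift k HH (\<lambda>c d. (x \<bullet> c) \<boxtimes> (y \<bullet> d)) (comult H h)"
  have bi: "bilin k H H HH (\<lambda>c d. (x \<bullet> c) \<boxtimes> (y \<bullet> d))" if "x \<in> carrier H" "y \<in> carrier H" for x y
    using that by (intro bilinI hopf_lin) auto
  have m: "bilin k H H HH ?m"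
    using gh by (intro bilinI lin_lift_param[OF H_module H_module] bi hopf_lin) auto
  have "SW U b (g \<bullet> h) = tensor_lift k U b (tensor_lift k HH ?m (comult H g))"
    unfolding sw_def comult_mult[OF gh] tensor_mult_def ..
  also have "\<dots> = tensor_lift k U (\<lambda>x y. tensor_lift k U b (?m x y)) (comult H g)"
    using gh by (intro tensor_lift_comp[OF H_module H_module HH_module U m L]) auto
  also have "\<dots> = SW U (\<lambda>x y. SW U (\<lambda>c d. b (x \<bullet> c) (y \<bullet> d)) h) g"
    unfolding sw_def[of k H U _ g]
  proof (rule tensor_lift_cong[OF H_module H_module U])
    show "bilin k H H U (\<lambda>x y. SW U (\<lambda>c d. b (x \<bullet> c) (y \<bullet> d)) h)"
      using U gh by (intro hopf_lin lin_bil_l[OF b] lin_bil_r[OF b]) auto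
    fix v w assume vw: "v \<in> carrier H" "w \<in> carrier H"
    have "tensor_lift k U b (?m v w) = tensor_lift k U (\<lambda>c d. tensor_lift k U b ((v \<bullet> c) \<boxtimes> (w \<bullet> d))) (comult H h)"
      using gh vw by (intro tensor_lift_comp[OF H_module H_module HH_module U bi L]) auto
    also have "\<dots> = SW U (\<lambda>c d. b (v \<bullet> c) (w \<bullet> d)) h"
      unfolding sw_def using U gh vw
      by (intro tensor_lift_cong hopf_lin lin_bil_l[OF b] lin_bil_r[OF b]) (auto simp: P)
    finally show "tensor_lift k U b (?m v w) = SW U (\<lambda>c d. b (v \<bullet> c) (w \<bullet> d)) h" .
  qed (use gh in simp)
  finally show ?thesis .
qed

lemma sw_antipode:
  assumes U: "module k U" and f: "f \<in> module_homs k H U" and h: "h \<in> carrier H"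
  shows "SW U (\<lambda>a b. f (S a \<bullet> b)) h = \<epsilon> h \<odot>\<^bsub>U\<^esub> f \<one>\<^sub>H" "SW U (\<lambda>a b. f (a \<bullet> S b)) h = \<epsilon> h \<odot>\<^bsub>U\<^esub> f \<one>\<^sub>H"
proof -
  have "f (SW H (\<lambda>a b. S a \<bullet> b) h) = SW U (\<lambda>a b. f (S a \<bullet> b)) h"
    using U f h by (intro sw_comp hopf_lin) auto
  then show "SW U (\<lambda>a b. f (S a \<bullet> b)) h = \<epsilon> h \<odot>\<^bsub>U\<^esub> f \<one>\<^sub>H"
    using antipode_left[OF h] module_homsD(3)[OF f] h by (simp add: sw_def)
  have "f (SW H (\<lambda>a b. a \<bullet> S b) h) = SW U (\<lambda>a b. f (a \<bullet> S b)) h"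
    using U f h by (intro sw_comp hopf_lin) auto
  then show "SW U (\<lambda>a b. f (a \<bullet> S b)) h = \<epsilon> h \<odot>\<^bsub>U\<^esub> f \<one>\<^sub>H"
    using antipode_right[OF h] module_homsD(3)[OF f] h by (simp add: sw_def)
qed

text \<open>A bilinear map that inverts the coproduct up to the counit can be cancelled inside iterated
  coproducts.  The instances are \<open>S a b\<close>, \<open>a S b\<close> and, for involutive antipodes, \<open>S b a\<close>, \<open>b S a\<close>.\<close>

definition cancelling :: "('h \<Rightarrow> 'h \<Rightarrow> 'h) \<Rightarrow> bool"
  where "cancelling m \<longleftrightarrow> bilin k H H H m \<and> (\<forall>h\<in>carrier H. SW H m h = \<epsilon> h \<odot>\<^bsub>H\<^esub> \<one>\<^sub>H)"

lemma cancelling_S: "cancelling (\<lambda>a b. S a \<bullet> b)" "cancelling (\<lambda>a b. a \<bullet> S b)"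
  unfolding cancelling_def using antipode_left antipode_right
  by (auto simp: sw_def intro!: hopf_lin)

lemma sw_cancel:
  assumes m: "cancelling m" and U: "module k U" and f: "f \<in> module_homs k H U" and h: "h \<in> carrier H"
  shows "SW U (\<lambda>a b. f (m a b)) h = \<epsilon> h \<odot>\<^bsub>U\<^esub> f \<one>\<^sub>H"
proof -
  have b: "bilin k H H H m" using m by (simp add: cancelling_def)
  have "f (SW H m h) = SW U (\<lambda>a b. f (m a b)) h" using U f h b by (intro sw_comp) auto
  then show ?thesis using m module_homsD(3)[OF f] h by (simp add: cancelling_def)
qed

text \<open>In the triple coproduct h1 \<otimes> h2 \<otimes> h3 the map m contracts h1 and h2 to
  the counit, which h3 then absorbs. The two conclusions differ only in the bracketing of the triple
  coproduct.\<close>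

lemma sw_cancel12:
  assumes m: "cancelling m" and U: "module k U" and f: "bilin k H H U f" and h: "h \<in> carrier H"
  shows "SW U (\<lambda>a b. SW U (\<lambda>c d. f (m c d) b) a) h = f \<one>\<^sub>H h"
    and "SW U (\<lambda>a b. SW U (\<lambda>c d. f (m a c) d) b) h = f \<one>\<^sub>H h"
proof -
  have b: "bilin k H H H m" using m by (simp add: cancelling_def)
  note lb = lin_bil_l[OF f] lin_bil_r[OF f] lin_bil_l[OF b] lin_bil_r[OF b]
  have "SW U (\<lambda>a b. SW U (\<lambda>c d. f (m c d) b) a) h = SW U (\<lambda>a b. \<epsilon> a \<odot>\<^bsub>U\<^esub> f \<one>\<^sub>H b) h"
    using U h by (intro sw_cong hopf_lin lb sw_cancel[OF m]) (auto simp: bilin_closed[OF f])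
  also have "\<dots> = f \<one>\<^sub>H h" using U h by (intro sw_counit lin_bil_r[OF f]) (auto intro: lin_id)
  finally show 1: "SW U (\<lambda>a b. SW U (\<lambda>c d. f (m c d) b) a) h = f \<one>\<^sub>H h" .
  have "SW U (\<lambda>a b. SW U (\<lambda>c d. f (m c d) b) a) h = SW U (\<lambda>a b. SW U (\<lambda>c d. f (m a c) d) b) h"
    using U h by (intro sw_coassoc hopf_lin lb) (auto simp: bilin_closed[OF b])
  then show "SW U (\<lambda>a b. SW U (\<lambda>c d. f (m a c) d) b) h = f \<one>\<^sub>H h" using 1 by simp
qed

lemma sw_cancel23:
  assumes m: "cancelling m" and U: "module k U" and f: "bilin k H H U f" and h: "h \<in> carrier H"
  shows "SW U (\<lambda>a b. SW U (\<lambda>c d. f a (m c d)) b) h = f h \<one>\<^sub>H"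
    and "SW U (\<lambda>a b. SW U (\<lambda>c d. f c (m d b)) a) h = f h \<one>\<^sub>H"
proof -
  have b: "bilin k H H H m" using m by (simp add: cancelling_def)
  note lb = lin_bil_l[OF f] lin_bil_r[OF f] lin_bil_l[OF b] lin_bil_r[OF b]
  have "SW U (\<lambda>a b. SW U (\<lambda>c d. f a (m c d)) b) h = SW U (\<lambda>a b. \<epsilon> b \<odot>\<^bsub>U\<^esub> f a \<one>\<^sub>H) h"
    using U h by (intro sw_cong hopf_lin lb sw_cancel[OF m]) (auto simp: bilin_closed[OF f])
  also have "\<dots> = f h \<one>\<^sub>H" using U h by (intro sw_counit lin_bil_l[OF f]) (auto intro: lin_id)
  finally show 1: "SW U (\<lambda>a b. SW U (\<lambda>c d. f a (m c d)) b) h = f h \<one>\<^sub>H" .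
  have "SW U (\<lambda>a b. SW U (\<lambda>c d. f c (m d b)) a) h = SW U (\<lambda>a b. SW U (\<lambda>c d. f a (m c d)) b) h"
    using U h by (intro sw_coassoc hopf_lin lb) (auto simp: bilin_closed[OF b])
  then show "SW U (\<lambda>a b. SW U (\<lambda>c d. f c (m d b)) a) h = f h \<one>\<^sub>H" using 1 by simp
qed

end

lemma (in abelian_monoid) finsum_swap:
  assumes "finite I" "finite J" "\<And>i j. i \<in> I \<Longrightarrow> j \<in> J \<Longrightarrow> f i j \<in> carrier G"
  shows "(\<Oplus>i\<in>I. \<Oplus>j\<in>J. f i j) = (\<Oplus>j\<in>J. \<Oplus>i\<in>I. f i j)"
  using assms(1,3)
proof (induction I rule: finite_induct)
  case (insert x F)
  have "(\<Oplus>j\<in>J. \<Oplus>i\<in>insert x F. f i j) = (\<Oplus>j\<in>J. f x j \<oplus> (\<Oplus>i\<in>F. f i j))"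
    using insert by (intro finsum_cong') auto
  also have "\<dots> = (\<Oplus>j\<in>J. f x j) \<oplus> (\<Oplus>j\<in>J. \<Oplus>i\<in>F. f i j)"
    using insert.prems by (intro finsum_addf) auto
  finally show ?case using insert by (simp add: Pi_def)
qed simp

section \<open>Convolution, the antipode, and subHopf algebras\<close>

context hopf
begin

lemma sw_finsum:
  assumes "module k U" "finite I" "\<And>i. i \<in> I \<Longrightarrow> bilin k H H U (F i)" "h \<in> carrier H"
  shows "SW U (\<lambda>a b. \<Oplus>\<^bsub>U\<^esub>i\<in>I. F i a b) h = (\<Oplus>\<^bsub>U\<^esub>i\<in>I. SW U (F i) h)"
proof -
  interpret U: module k U by fact
  have b: "bilin k H H U (\<lambda>a b. \<Oplus>\<^bsub>U\<^esub>i\<in>I. F i a b)"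
    using bilinD[OF assms(3)] by (intro hopf_lin assms) auto
  have c: "(\<lambda>i. F i v w) \<in> I \<rightarrow> carrier U" if "v \<in> carrier H" "w \<in> carrier H" for v w
    using bilin_closed[OF assms(3)] that by blast
  show ?thesis
    unfolding sw_def
  proof (rule tensor_ext[OF H_module H_module tensor_lift_hom[OF H_module H_module assms(1) b] _ _ comult_closed[OF assms(4)]])
    show "(\<lambda>t. \<Oplus>\<^bsub>U\<^esub>i\<in>I. tensor_lift k U (F i) t) \<in> module_homs k HH U"
      by (intro lin_finsum[OF assms(1,2)] tensor_lift_hom H_module HH_module assms(1)) (rule assms(3))
    fix v w assume vw: "v \<in> carrier H" "w \<in> carrier H"
    have "(\<Oplus>\<^bsub>U\<^esub>i\<in>I. tensor_lift k U (F i) (v \<boxtimes> w)) = (\<Oplus>\<^bsub>U\<^esub>i\<in>I. F i v w)"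
      by (rule U.M.finsum_cong'[OF refl c[OF vw]]) (rule tensor_lift_pure[OF H_module H_module assms(1) assms(3) vw])
    then show "tensor_lift k U (\<lambda>a b. \<Oplus>\<^bsub>U\<^esub>i\<in>I. F i a b) (v \<boxtimes> w) =
      (\<Oplus>\<^bsub>U\<^esub>i\<in>I. tensor_lift k U (F i) (v \<boxtimes> w))"
      using tensor_lift_pure[OF H_module H_module assms(1) b vw] by simp
  qed
qed

text \<open>The identity is invertible for convolution, with inverse S. Expanding F h as \<Sum>
  F(h1) h2 S(h3) and contracting the first two factors by the hypothesis solves for F.\<close>

lemma convolution_unique:
  assumes F: "F \<in> module_homs k H H" and c: "c \<in> carrier H"
    and inv: "\<And>h. h \<in> carrier H \<Longrightarrow> SW H (\<lambda>a b. F a \<bullet> b) h = \<epsilon> h \<odot>\<^bsub>H\<^esub> c"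
    and h: "h \<in> carrier H"
  shows "F h = c \<bullet> S h"
proof -
  note Fc = module_homsD(1)[OF F] and lF = lin_comp[OF F]
  have "F h = SW H (\<lambda>a b. SW H (\<lambda>c d. F c \<bullet> (d \<bullet> S b)) a) h"
    using sw_cancel23(2)[OF cancelling_S(2) H_module _ h, of "\<lambda>a z. F a \<bullet> z"] Fc h
    by (simp add: H_r_one bilinI lin_mul_r lin_mul_l lF)
  also have "\<dots> = SW H (\<lambda>a b. \<epsilon> a \<odot>\<^bsub>H\<^esub> (c \<bullet> S b)) h"
  proof (rule sw_cong)
    fix a b assume ab: "a \<in> carrier H" "b \<in> carrier H"
    have "SW H (\<lambda>c d. F c \<bullet> (d \<bullet> S b)) a = SW H (\<lambda>c d. (F c \<bullet> d) \<bullet> S b) a"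
      using ab by (intro sw_cong hopf_lin lF) (auto simp: H_assoc Fc)
    also have "\<dots> = SW H (\<lambda>c d. F c \<bullet> d) a \<bullet> S b"
      using ab by (intro sw_comp[symmetric, where g="\<lambda>x. x \<bullet> S b"] hopf_lin lF) (auto simp: Fc)
    finally show "SW H (\<lambda>c d. F c \<bullet> (d \<bullet> S b)) a = \<epsilon> a \<odot>\<^bsub>H\<^esub> (c \<bullet> S b)"
      using ab c by (simp add: inv smult_mult_left)
  qed (use h c in \<open>auto intro!: hopf_lin\<close>)
  also have "\<dots> = c \<bullet> S h" using h c by (intro sw_counit hopf_lin) auto
  finally show ?thesis .
qed

text \<open>Uniqueness is used twice. The sum \<Sum> S(x1 y1) x2 y2 is the antipode identity for the
  product x y; as a function of y it forces \<Sum> S(x1 y) x2 = \<epsilon>(x) S(y), and this, as a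
  function of x, forces the claim.\<close>

lemma S_mult:
  assumes x: "x \<in> carrier H" and y: "y \<in> carrier H"
  shows "S (x \<bullet> y) = S y \<bullet> S x"
proof -
  have 1: "SW H (\<lambda>y1 y2. SW H (\<lambda>x1 x2. S (x1 \<bullet> y1) \<bullet> x2) x \<bullet> y2) y = \<epsilon> y \<odot>\<^bsub>H\<^esub> (\<epsilon> x \<odot>\<^bsub>H\<^esub> \<one>\<^sub>H)"
    if xy: "x \<in> carrier H" "y \<in> carrier H" for x y
  proof -
    have "SW H (\<lambda>y1 y2. SW H (\<lambda>x1 x2. S (x1 \<bullet> y1) \<bullet> x2) x \<bullet> y2) y
        = SW H (\<lambda>y1 y2. SW H (\<lambda>x1 x2. S (x1 \<bullet> y1) \<bullet> (x2 \<bullet> y2)) x) y"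
    proof (rule sw_cong)
      fix v w assume vw: "v \<in> carrier H" "w \<in> carrier H"
      have "SW H (\<lambda>x1 x2. S (x1 \<bullet> v) \<bullet> x2) x \<bullet> w = SW H (\<lambda>x1 x2. (S (x1 \<bullet> v) \<bullet> x2) \<bullet> w) x"
        using vw xy by (intro sw_comp[where g="\<lambda>x. x \<bullet> w"] hopf_lin) auto
      also have "\<dots> = SW H (\<lambda>x1 x2. S (x1 \<bullet> v) \<bullet> (x2 \<bullet> w)) x"
        using vw xy by (intro sw_cong hopf_lin) (auto simp: H_assoc)
      finally show "SW H (\<lambda>x1 x2. S (x1 \<bullet> v) \<bullet> x2) x \<bullet> w = SW H (\<lambda>x1 x2. S (x1 \<bullet> v) \<bullet> (x2 \<bullet> w)) x" .
    qed (use xy in \<open>auto intro!: hopf_lin\<close>)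
    also have "\<dots> = SW H (\<lambda>x1 x2. SW H (\<lambda>y1 y2. S (x1 \<bullet> y1) \<bullet> (x2 \<bullet> y2)) y) x"
      using xy by (intro sw_swap hopf_lin) auto
    also have "\<dots> = SW H (\<lambda>a b. S a \<bullet> b) (x \<bullet> y)"
      using xy by (intro sw_mult[symmetric] hopf_lin) auto
    also have "\<dots> = \<epsilon> (x \<bullet> y) \<odot>\<^bsub>H\<^esub> \<one>\<^sub>H"
      using xy antipode_left[of "x \<bullet> y"] by (simp add: sw_def)
    also have "\<dots> = \<epsilon> y \<odot>\<^bsub>H\<^esub> (\<epsilon> x \<odot>\<^bsub>H\<^esub> \<one>\<^sub>H)"
      using xy by (simp add: counit_mult module.smult_assoc1[OF H_module, symmetric]
          cring.cring_simprules(14)[OF module.axioms(1)[OF H_module]])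
    finally show ?thesis .
  qed
  have 2: "SW H (\<lambda>x1 x2. S (x1 \<bullet> y) \<bullet> x2) x = \<epsilon> x \<odot>\<^bsub>H\<^esub> S y"
    if "x \<in> carrier H" "y \<in> carrier H" for x y
  proof -
    have "SW H (\<lambda>x1 x2. S (x1 \<bullet> y) \<bullet> x2) x = (\<epsilon> x \<odot>\<^bsub>H\<^esub> \<one>\<^sub>H) \<bullet> S y"
      using that by (intro convolution_unique[where F="\<lambda>y. SW H (\<lambda>x1 x2. S (x1 \<bullet> y) \<bullet> x2) x"] 1 hopf_lin)
        (auto simp: module.smult_closed[OF H_module])
    then show ?thesis using that by (simp add: smult_mult_left H_l_one)
  qed
  show ?thesis
    using x y by (intro convolution_unique[where F="\<lambda>x. S (x \<bullet> y)"] 2 hopf_lin) auto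
qed

lemma S_one: "S \<one>\<^sub>H = \<one>\<^sub>H"
proof -
  have "SW H (\<lambda>a b. S a \<bullet> b) \<one>\<^sub>H = S \<one>\<^sub>H \<bullet> \<one>\<^sub>H" by (intro sw_one hopf_lin) auto
  then show ?thesis using antipode_left[of "\<one>\<^sub>H"]
    by (simp add: sw_def counit_one H_r_one module.smult_one[OF H_module])
qed

text \<open>Compared with \<open>sub_hopf_algebra\<close>, the coproduct condition uses sums of pure
  tensors in H \<otimes> H with both factors in A. In this form Sweedler components of elements of A
  can be taken in A.\<close>

definition subhopf :: "'h set \<Rightarrow> bool"
  where "subhopf A \<longleftrightarrow> submodule A k H \<and> \<one>\<^sub>H \<in> A \<and> (\<forall>a\<in>A. \<forall>b\<in>A. a \<bullet> b \<in> A) \<and> (\<forall>a\<in>A. S a \<in> A) \<and>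
    (\<forall>a\<in>A. comult H a \<in> tensor_span k H H A A)"

lemma sub_hopf_algebra_subhopf:
  assumes "sub_hopf_algebra k H A"
  shows "subhopf A"
proof -
  have sub: "submodule A k H" using assms by (simp add: sub_hopf_algebra_def)
  let ?A = "H\<lparr>carrier := A\<rparr>"
  have A: "module k ?A" by (rule submodule.submodule_is_module[OF sub H_module])
  have AH: "x \<in> A \<Longrightarrow> x \<in> carrier H" for x using module.submoduleE(1)[OF H_module sub] by blast
  have i: "id \<in> module_homs k ?A H" by (auto simp: module_homs_def AH)
  note tm = tensor_map_hom[OF A A H_module H_module i i]
  have "tensor_map k H H id id t \<in> tensor_span k H H A A" if "t \<in> carrier (tensor_prod k ?A ?A)" for t
  proof -
    have "t \<in> tensor_span k ?A ?A A A" using that tensor_span_carrier[OF A A] by simp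
    then show ?thesis
    proof induction
      case (pure v w)
      then have "tensor_map k H H id id (pure_tensor k ?A ?A v w) = v \<boxtimes> w" using tm(2) by simp
      then show ?case using pure by (simp only: tensor_span.pure)
    next
      case (add s t)
      have "s \<in> carrier (tensor_prod k ?A ?A)" "t \<in> carrier (tensor_prod k ?A ?A)"
        using add.hyps tensor_span_carrier[OF A A] by simp_all
      then show ?case using add.IH module_homsD(2)[OF tm(1)] by (simp only: tensor_span.add)
    qed
  qed
  moreover have "\<exists>t\<in>carrier (tensor_prod k ?A ?A). comult H a = tensor_map k H H id id t" if "a \<in> A" for a
    using assms that unfolding sub_hopf_algebra_def by blast
  ultimately have "comult H a \<in> tensor_span k H H A A" if "a \<in> A" for a
    using that by metis
  then show ?thesis using assms unfolding subhopf_def sub_hopf_algebra_def by blast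
qed

lemma subhopfD:
  assumes "subhopf A"
  shows "submodule A k H" "\<one>\<^sub>H \<in> A" "x \<in> A \<Longrightarrow> y \<in> A \<Longrightarrow> x \<bullet> y \<in> A" "x \<in> A \<Longrightarrow> S x \<in> A"
    "x \<in> A \<Longrightarrow> x \<in> carrier H" "x \<in> A \<Longrightarrow> y \<in> A \<Longrightarrow> x \<oplus>\<^bsub>H\<^esub> y \<in> A" "a \<in> carrier k \<Longrightarrow> x \<in> A \<Longrightarrow> a \<odot>\<^bsub>H\<^esub> x \<in> A"
  using assms module.submoduleE[OF H_module, of A] by (auto simp: subhopf_def)

text \<open>The coproduct of h is a sum of pure tensors with factors in A, so the two bilinear maps
  need to agree only there. Right B-linearity is applied to Sweedler components through this
  lemma.\<close>

lemma sw_sub_cong: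
  assumes "subhopf A" "module k U" "bilin k H H U b" "bilin k H H U b'" "h \<in> A"
    and "\<And>v w. v \<in> A \<Longrightarrow> w \<in> A \<Longrightarrow> b v w = b' v w"
  shows "SW U b h = SW U b' h"
proof -
  have A: "A \<subseteq> carrier H" using subhopfD(5)[OF assms(1)] by blast
  show ?thesis
    unfolding sw_def
    by (rule tensor_span_ext[OF H_module H_module A A tensor_lift_hom tensor_lift_hom])
      (use assms A in \<open>auto simp: subhopf_def tensor_lift_pure subset_iff\<close>)
qed

lemma sw_sub_closed:
  assumes "subhopf A" "module k U" "bilin k H H U b" "h \<in> A"
    and "\<And>v w. v \<in> A \<Longrightarrow> w \<in> A \<Longrightarrow> b v w \<in> N" "\<And>v w. v \<in> N \<Longrightarrow> w \<in> N \<Longrightarrow> v \<oplus>\<^bsub>U\<^esub> w \<in> N"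
  shows "SW U b h \<in> N"
proof -
  have A: "A \<subseteq> carrier H" using subhopfD(5)[OF assms(1)] by blast
  note L = tensor_lift_hom[OF H_module H_module assms(2,3)]
  have "tensor_lift k U b t \<in> N" if "t \<in> tensor_span k H H A A" for t
    using that
  proof induction
    case (pure v w)
    then show ?case using assms A by (auto simp: tensor_lift_pure subset_iff)
  next
    case (add s t)
    then show ?case using module_homsD(2)[OF L] tensor_span_closed[OF H_module H_module A A] assms(6) by simp
  qed
  then show ?thesis unfolding sw_def using assms by (auto simp: subhopf_def)
qed

end

section \<open>Involutive antipodes, and the retraction onto a finite dimensional subHopf
  algebra\<close>

locale inv_hopf = hopf k H
  for k :: "('k, 'z) ring_scheme" and H :: "('k, 'h, 'y) hopf_scheme" +
  assumes S_S: "h \<in> carrier H \<Longrightarrow> antipode H (antipode H h) = h"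
begin

text \<open>S reverses products and squares to the identity, so S(S(a) b) = S(b) a and S(a S(b)) = b
  S(a). Applying S to the two antipode identities gives the claims.\<close>

lemma cancelling_skew: "cancelling (\<lambda>a b. S b \<bullet> a)" "cancelling (\<lambda>a b. b \<bullet> S a)"
proof -
  have "SW H (\<lambda>a b. S b \<bullet> a) h = \<epsilon> h \<odot>\<^bsub>H\<^esub> \<one>\<^sub>H" if h: "h \<in> carrier H" for h
  proof -
    have "SW H (\<lambda>a b. S b \<bullet> a) h = SW H (\<lambda>a b. S (S a \<bullet> b)) h"
      using h by (intro sw_cong hopf_lin) (auto simp: S_mult S_S)
    also have "\<dots> = \<epsilon> h \<odot>\<^bsub>H\<^esub> S \<one>\<^sub>H" using h by (intro sw_antipode hopf_lin) auto
    finally show ?thesis by (simp add: S_one)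
  qed
  moreover have "SW H (\<lambda>a b. b \<bullet> S a) h = \<epsilon> h \<odot>\<^bsub>H\<^esub> \<one>\<^sub>H" if h: "h \<in> carrier H" for h
  proof -
    have "SW H (\<lambda>a b. b \<bullet> S a) h = SW H (\<lambda>a b. S (a \<bullet> S b)) h"
      using h by (intro sw_cong hopf_lin) (auto simp: S_mult S_S)
    also have "\<dots> = \<epsilon> h \<odot>\<^bsub>H\<^esub> S \<one>\<^sub>H" using h by (intro sw_antipode hopf_lin) auto
    finally show ?thesis by (simp add: S_one)
  qed
  ultimately show "cancelling (\<lambda>a b. S b \<bullet> a)" "cancelling (\<lambda>a b. b \<bullet> S a)"
    by (auto simp: cancelling_def intro!: hopf_lin)
qed

definition rlin :: "'h set \<Rightarrow> ('h \<Rightarrow> 'h) \<Rightarrow> bool"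
  where "rlin B \<pi> \<longleftrightarrow> \<pi> \<in> module_homs k H H \<and> (\<forall>h\<in>carrier H. \<forall>b\<in>B. \<pi> (h \<bullet> b) = \<pi> h \<bullet> b)"

text \<open>A finite-dimensional subHopf algebra \<open>B\<close> is self-injective: the identity of \<open>B\<close> extends to a
  right \<open>B\<close>-linear map on \<open>H\<close>.  The extension is a partial trace over \<open>B\<close>; its \<open>B\<close>-linearity comes from the
  cyclic invariance of the trace.\<close>

lemma retraction:
  assumes B: "subhopf B" and e: "dual_sys k H {..<n::nat} e \<phi>" and eB: "\<And>i. i < n \<Longrightarrow> e i \<in> B"
    and ex: "\<And>x. x \<in> B \<Longrightarrow> (\<Oplus>\<^bsub>H\<^esub>i\<in>{..<n}. \<phi> i x \<odot>\<^bsub>H\<^esub> e i) = x"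
  obtains \<rho> where "rlin B \<rho>" "\<And>h. h \<in> carrier H \<Longrightarrow> \<rho> h \<in> B" "\<And>b. b \<in> B \<Longrightarrow> \<rho> b = b"
proof -
  note BD = subhopfD[OF B]
  note D = dual_sysD[OF e]
  have fsB: "finsum H g I \<in> B" if "finite I" "\<And>i. i \<in> I \<Longrightarrow> g i \<in> B" for g and I :: "nat set"
    using that
  proof (induction I rule: finite_induct)
    case empty
    have "\<zero>\<^bsub>H\<^esub> \<in> B" using BD(7)[of "\<zero>\<^bsub>k\<^esub>", OF _ BD(2)] by (simp add: smult_l_null)
    then show ?case by simp
  next
    case (insert x F)
    have "g \<in> F \<rightarrow> carrier H" "g x \<in> carrier H" using insert.prems BD(5) by auto
    then show ?case using insert BD(6) by simp
  qed
  \<comment> \<open>A linear projection of H onto B, available because the coordinate functionals of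
    the basis live on all of H. It is not B-linear; averaging it by the trace below repairs
    this.\<close>
  define q where "q = (\<lambda>h. \<Oplus>\<^bsub>H\<^esub>i\<in>{..<n}. \<phi> i h \<odot>\<^bsub>H\<^esub> e i)"
  have q_lin: "q \<in> module_homs k H H"
    unfolding q_def by (intro lin_finsum lin_smult_l H_module) (use D in auto)
  have qB: "q h \<in> B" if "h \<in> carrier H" for h
    unfolding q_def by (intro fsB) (use that D BD eB in auto)
  have qc: "q h \<in> carrier H" if "h \<in> carrier H" for h using qB[OF that] BD(5) by blast
  have q_id: "q b = b" if "b \<in> B" for b unfolding q_def by (rule ex[OF that])
  have eH: "e i \<in> carrier H" if "i < n" for i using eB[OF that] BD(5) by blast
  have \<phi>l: "\<phi> i \<in> module_homs k H (self_module k)" if "i < n" for i using D(3) that by simp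
  have \<phi>c: "\<phi> i x \<in> carrier k" if "i < n" "x \<in> carrier H" for i x using D(4) that by simp
  \<comment> \<open>With x expanded into x1, x2, x3 this is \<Sum> \<psi>(q(h S(x2)) x1) x3. Setting
    \<psi> = \<phi> i and x = e i and summing over i takes the trace over B, which defines \<rho>
    below.\<close>
  define U where "U = (\<lambda>h \<psi> x. SW H (\<lambda>a b. SW H (\<lambda>c d. \<psi> (q (h \<bullet> S c) \<bullet> a) \<odot>\<^bsub>H\<^esub> d) b) x)"
  define Lin where "Lin = module_homs k H (self_module k)"
  have LinD: "\<psi> x \<in> carrier k" if "\<psi> \<in> Lin" "x \<in> carrier H" for \<psi> x
    using module_homsD(1)[of \<psi> k H "self_module k"] that by (simp add: Lin_def)
  have LinC: "(\<lambda>x. \<psi> (f x)) \<in> module_homs k Z (self_module k)" if "\<psi> \<in> Lin" "f \<in> module_homs k Z H"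
    for \<psi> f and Z :: "('k, 'h, 'y) hopf_scheme"
    using that lin_comp unfolding Lin_def by blast
  have LinT: "(\<lambda>y. \<psi> (y \<bullet> s)) \<in> Lin" if "\<psi> \<in> Lin" "s \<in> carrier H" for \<psi> s
    unfolding Lin_def using that by (intro LinC hopf_lin) auto
  have \<phi>L: "\<phi> i \<in> Lin" if "i < n" for i using \<phi>l[OF that] by (simp add: Lin_def)
  note lin = hopf_lin LinC lin_comp[OF q_lin]
  note cl = LinD qc smult_closed
  have U_h: "(\<lambda>h. U (f h) \<psi> x) \<in> module_homs k Z H" if "\<psi> \<in> Lin" "x \<in> carrier H" "f \<in> module_homs k Z H" "module k Z"
    for \<psi> x f and Z :: "('k, 'h, 'y) hopf_scheme"
    unfolding U_def using that module_homsD(1)[OF that(3)] by (intro lin) (auto simp: cl)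
  have U_x: "(\<lambda>x. U h \<psi> (f x)) \<in> module_homs k Z H" if "\<psi> \<in> Lin" "h \<in> carrier H" "f \<in> module_homs k Z H"
    for \<psi> h f and Z :: "('k, 'h, 'y) hopf_scheme"
    unfolding U_def using that by (intro lin) (auto simp: cl)
  have Uc: "U h \<psi> x \<in> carrier H" if "\<psi> \<in> Lin" "h \<in> carrier H" "x \<in> carrier H" for \<psi> h x
    using module_homsD(1)[OF U_x[OF that(1,2) lin_id]] that(3) by simp
  have UB: "U h \<psi> x \<in> B" if "\<psi> \<in> Lin" "h \<in> carrier H" "x \<in> B" for \<psi> h x
    unfolding U_def using that BD(5,6,7)
    by (intro sw_sub_closed[OF B H_module] lin) (auto simp: cl)
  \<comment> \<open>Since q has values in B and the components of x lie in B, only the restriction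
    of \<psi> to B matters. This is needed because expansion in the basis e is valid only on
    B.\<close>
  have U_cong: "U h \<psi> x = U h \<psi>' x"
    if "\<psi> \<in> Lin" "\<psi>' \<in> Lin" "h \<in> carrier H" "x \<in> B" "\<And>y. y \<in> B \<Longrightarrow> \<psi> y = \<psi>' y" for h \<psi> \<psi>' x
    unfolding U_def using that BD
    by (intro sw_sub_cong[OF B H_module] lin sw_cong) (auto simp: cl qB)
  define \<rho> where "\<rho> = (\<lambda>h. \<Oplus>\<^bsub>H\<^esub>i\<in>{..<n}. U h (\<phi> i) (e i))"
  have \<rho>_lin: "\<rho> \<in> module_homs k H H"
    unfolding \<rho>_def by (intro lin_finsum U_h H_module) (auto simp: \<phi>L eH)
  note lr = lin_comp[OF \<rho>_lin]
  have \<rho>B: "\<rho> h \<in> B" if "h \<in> carrier H" for h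
    unfolding \<rho>_def by (intro fsB UB) (use that \<phi>L eB in auto)
  have \<rho>c: "\<rho> h \<in> carrier H" if "h \<in> carrier H" for h using \<rho>B[OF that] BD(5) by blast
  \<comment> \<open>For b in B the projection q disappears, as b S(x2) stays in B. Then S(x2) x1
    cancels by the skew antipode identity, and the sum over i is the basis expansion of b.\<close>
  have \<rho>_id: "\<rho> b = b" if b: "b \<in> B" for b
  proof -
    have "U b (\<phi> i) (e i) = \<phi> i b \<odot>\<^bsub>H\<^esub> e i" if i: "i < n" for i
    proof -
      have bH: "b \<in> carrier H" using b BD by blast
      have "U b (\<phi> i) (e i) = SW H (\<lambda>a t. SW H (\<lambda>c d. \<phi> i (b \<bullet> (S c \<bullet> a)) \<odot>\<^bsub>H\<^esub> d) t) (e i)"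
        unfolding U_def using i BD(3,4,5) eB[OF i] \<phi>L[OF i] bH b
        by (intro sw_sub_cong[OF B H_module] lin) (auto simp: cl q_id H_assoc)
      also have "\<dots> = \<phi> i (b \<bullet> \<one>\<^sub>H) \<odot>\<^bsub>H\<^esub> e i"
        using i eH bH \<phi>L[OF i]
        by (intro sw_cancel12(2)[OF cancelling_skew(1) H_module, where f="\<lambda>y d. \<phi> i (b \<bullet> y) \<odot>\<^bsub>H\<^esub> d"] lin)
          (auto simp: cl)
      finally show ?thesis using bH by (simp add: H_r_one)
    qed
    then have "\<rho> b = (\<Oplus>\<^bsub>H\<^esub>i\<in>{..<n}. \<phi> i b \<odot>\<^bsub>H\<^esub> e i)"
      unfolding \<rho>_def using b BD(5) \<phi>c eH by (intro M.finsum_cong') auto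
    then show ?thesis using ex[OF b] by simp
  qed
  \<comment> \<open>Expanding the coproduct of x c' on the right gives S(x2 c3) = S(c3) S(x2) inside
    q and c2 S(c1) at the end of the argument of \<psi>. The latter cancels by the skew identity,
    and the remaining sum is the left side.\<close>
  have shift: "SW H (\<lambda>c1 c2. U (h \<bullet> S c1) \<psi> x \<bullet> c2) c = SW H (\<lambda>c1 c'. U h (\<lambda>y. \<psi> (y \<bullet> S c1)) (x \<bullet> c')) c"
    if h: "h \<in> carrier H" and x: "x \<in> carrier H" and c: "c \<in> carrier H" and \<psi>: "\<psi> \<in> Lin" for h x c \<psi>
  proof -
    let ?G = "\<lambda>x1 x2 x3 c1 c2 c3 c4. \<psi> (q (h \<bullet> (S c3 \<bullet> S x2)) \<bullet> (x1 \<bullet> (c2 \<bullet> S c1))) \<odot>\<^bsub>H\<^esub> (x3 \<bullet> c4)"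
    let ?K = "\<lambda>x1 x2 x3 c3 c4. \<psi> (q (h \<bullet> (S c3 \<bullet> S x2)) \<bullet> x1) \<odot>\<^bsub>H\<^esub> (x3 \<bullet> c4)"
    have "SW H (\<lambda>c1 c2. U (h \<bullet> S c1) \<psi> x \<bullet> c2) c
        = SW H (\<lambda>c1 c2. SW H (\<lambda>x1 x'. SW H (\<lambda>x2 x3. ?K x1 x2 x3 c1 c2) x') x) c"
    proof (rule sw_cong)
      fix c1 c2 assume cc: "c1 \<in> carrier H" "c2 \<in> carrier H"
      have "U (h \<bullet> S c1) \<psi> x \<bullet> c2 =
        SW H (\<lambda>a b. SW H (\<lambda>c d. \<psi> (q (h \<bullet> S c1 \<bullet> S c) \<bullet> a) \<odot>\<^bsub>H\<^esub> d) b \<bullet> c2) x"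
        unfolding U_def using h x \<psi> cc by (intro sw_comp[where g="\<lambda>z. z \<bullet> c2"] lin) (auto simp: cl)
      also have "\<dots> = SW H (\<lambda>x1 x'. SW H (\<lambda>x2 x3. ?K x1 x2 x3 c1 c2) x') x"
      proof (rule sw_cong)
        fix a b assume ab: "a \<in> carrier H" "b \<in> carrier H"
        have "SW H (\<lambda>c d. \<psi> (q (h \<bullet> S c1 \<bullet> S c) \<bullet> a) \<odot>\<^bsub>H\<^esub> d) b \<bullet> c2 =
          SW H (\<lambda>c d. (\<psi> (q (h \<bullet> S c1 \<bullet> S c) \<bullet> a) \<odot>\<^bsub>H\<^esub> d) \<bullet> c2) b"
          using h ab \<psi> cc by (intro sw_comp[where g="\<lambda>z. z \<bullet> c2"] lin) (auto simp: cl)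
        also have "\<dots> = SW H (\<lambda>x2 x3. ?K a x2 x3 c1 c2) b"
          using h ab \<psi> cc by (intro sw_cong lin) (auto simp: cl H_assoc smult_mult_left)
        finally show "SW H (\<lambda>c d. \<psi> (q (h \<bullet> S c1 \<bullet> S c) \<bullet> a) \<odot>\<^bsub>H\<^esub> d) b \<bullet> c2 =
          SW H (\<lambda>x2 x3. ?K a x2 x3 c1 c2) b" .
      qed (use h x \<psi> cc in \<open>auto intro!: lin simp: cl\<close>)
      finally show "U (h \<bullet> S c1) \<psi> x \<bullet> c2 = SW H (\<lambda>x1 x'. SW H (\<lambda>x2 x3. ?K x1 x2 x3 c1 c2) x') x" .
    qed (use h x \<psi> c in \<open>auto intro!: lin simp: cl\<close>)
    also have "\<dots> = SW H (\<lambda>c1 c'. SW H (\<lambda>c2 c''. SW H (\<lambda>x1 x'. SW H (\<lambda>x2 x3.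
         SW H (\<lambda>c3 c4. ?G x1 x2 x3 c1 c2 c3 c4) c'') x') x) c') c"
    proof -
      let ?f = "\<lambda>y c''. SW H (\<lambda>x1 x'. SW H (\<lambda>x2 x3.
         SW H (\<lambda>c3 c4. \<psi> (q (h \<bullet> (S c3 \<bullet> S x2)) \<bullet> (x1 \<bullet> y)) \<odot>\<^bsub>H\<^esub> (x3 \<bullet> c4)) c'') x') x"
      have "SW H (\<lambda>c1 c'. SW H (\<lambda>c2 c''. ?f (c2 \<bullet> S c1) c'') c') c = ?f \<one>\<^sub>H c"
        using h x \<psi> c
        by (intro sw_cancel12(2)[OF cancelling_skew(2) H_module, where f="?f"] lin) (auto simp: cl)
      also have "\<dots> = SW H (\<lambda>x1 x'. SW H (\<lambda>c3 c4. SW H (\<lambda>x2 x3. ?K x1 x2 x3 c3 c4) x') c) x"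
      proof (rule sw_cong)
        fix x1 x' assume xx: "x1 \<in> carrier H" "x' \<in> carrier H"
        have "SW H (\<lambda>x2 x3. SW H (\<lambda>c3 c4. \<psi> (q (h \<bullet> (S c3 \<bullet> S x2)) \<bullet> (x1 \<bullet> \<one>\<^sub>H)) \<odot>\<^bsub>H\<^esub> (x3 \<bullet> c4)) c) x' =
          SW H (\<lambda>x2 x3. SW H (\<lambda>c3 c4. ?K x1 x2 x3 c3 c4) c) x'"
          using xx by (simp add: H_r_one)
        also have "\<dots> = SW H (\<lambda>c3 c4. SW H (\<lambda>x2 x3. ?K x1 x2 x3 c3 c4) x') c"
          using h xx \<psi> c by (intro sw_swap lin) (auto simp: cl)
        finally show "SW H (\<lambda>x2 x3. SW H (\<lambda>c3 c4. \<psi> (q (h \<bullet> (S c3 \<bullet> S x2)) \<bullet> (x1 \<bullet> \<one>\<^sub>H)) \<odot>\<^bsub>H\<^esub> (x3 \<bullet> c4)) c) x'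
          = SW H (\<lambda>c3 c4. SW H (\<lambda>x2 x3. ?K x1 x2 x3 c3 c4) x') c" .
      qed (use h x \<psi> c in \<open>auto intro!: lin simp: cl\<close>)
      also have "\<dots> = SW H (\<lambda>c3 c4. SW H (\<lambda>x1 x'. SW H (\<lambda>x2 x3. ?K x1 x2 x3 c3 c4) x') x) c"
        using h x \<psi> c by (intro sw_swap lin) (auto simp: cl)
      finally show ?thesis by (rule sym)
    qed
    also have "\<dots> = SW H (\<lambda>c1 c'. U h (\<lambda>y. \<psi> (y \<bullet> S c1)) (x \<bullet> c')) c"
    proof (rule sw_cong)
      fix c1 c' assume cc: "c1 \<in> carrier H" "c' \<in> carrier H"
      have "U h (\<lambda>y. \<psi> (y \<bullet> S c1)) (x \<bullet> c') = SW H (\<lambda>x1 x'. SW H (\<lambda>c2 c''.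
          SW H (\<lambda>c d. \<psi> (q (h \<bullet> S c) \<bullet> (x1 \<bullet> c2) \<bullet> S c1) \<odot>\<^bsub>H\<^esub> d) (x' \<bullet> c'')) c') x"
        unfolding U_def using h x \<psi> cc by (intro sw_mult lin) (auto simp: cl)
      also have "\<dots> = SW H (\<lambda>x1 x'. SW H (\<lambda>c2 c''. SW H (\<lambda>x2 x3.
          SW H (\<lambda>c3 c4. ?G x1 x2 x3 c1 c2 c3 c4) c'') x') c') x"
      proof (intro sw_cong)
        fix x1 x' c2 c'' assume xx: "x1 \<in> carrier H" "x' \<in> carrier H" "c2 \<in> carrier H" "c'' \<in> carrier H"
        have "SW H (\<lambda>c d. \<psi> (q (h \<bullet> S c) \<bullet> (x1 \<bullet> c2) \<bullet> S c1) \<odot>\<^bsub>H\<^esub> d) (x' \<bullet> c'') =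
          SW H (\<lambda>x2 x3. SW H (\<lambda>c3 c4. \<psi> (q (h \<bullet> S (x2 \<bullet> c3)) \<bullet> (x1 \<bullet> c2) \<bullet> S c1) \<odot>\<^bsub>H\<^esub> (x3 \<bullet> c4)) c'') x'"
          using h xx \<psi> cc by (intro sw_mult lin) (auto simp: cl)
        also have "\<dots> = SW H (\<lambda>x2 x3. SW H (\<lambda>c3 c4. ?G x1 x2 x3 c1 c2 c3 c4) c'') x'"
          using h xx \<psi> cc by (intro sw_cong lin) (auto simp: cl S_mult H_assoc)
        finally show "SW H (\<lambda>c d. \<psi> (q (h \<bullet> S c) \<bullet> (x1 \<bullet> c2) \<bullet> S c1) \<odot>\<^bsub>H\<^esub> d) (x' \<bullet> c'') =
          SW H (\<lambda>x2 x3. SW H (\<lambda>c3 c4. ?G x1 x2 x3 c1 c2 c3 c4) c'') x'" .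
      qed (use h x \<psi> cc in \<open>auto intro!: lin simp: cl\<close>)
      also have "\<dots> = SW H (\<lambda>c2 c''. SW H (\<lambda>x1 x'. SW H (\<lambda>x2 x3.
          SW H (\<lambda>c3 c4. ?G x1 x2 x3 c1 c2 c3 c4) c'') x') x) c'"
        using h x \<psi> cc by (intro sw_swap lin) (auto simp: cl)
      finally show "SW H (\<lambda>c2 c''. SW H (\<lambda>x1 x'. SW H (\<lambda>x2 x3.
          SW H (\<lambda>c3 c4. ?G x1 x2 x3 c1 c2 c3 c4) c'') x') x) c' = U h (\<lambda>y. \<psi> (y \<bullet> S c1)) (x \<bullet> c')" by (rule sym)
    next
      show "bilin k H H H (\<lambda>c1 c'. U h (\<lambda>y. \<psi> (y \<bullet> S c1)) (x \<bullet> c'))"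
        unfolding U_def using h x \<psi> by (intro lin) (auto simp: cl)
    qed (use c in auto)
    finally show ?thesis .
  qed
  \<comment> \<open>The rule tr(X Y) = tr(Y X) in coordinates: e i d is expanded in the basis, and
    the coefficients are absorbed by \<phi> j (y s d) = \<Sum> \<phi> i (y s) \<phi> j (e i d),
    which holds for y in B.\<close>
  have cyclic: "(\<Oplus>\<^bsub>H\<^esub>i\<in>{..<n}. U h (\<lambda>y. \<phi> i (y \<bullet> s)) (e i \<bullet> d)) =
      (\<Oplus>\<^bsub>H\<^esub>j\<in>{..<n}. U h (\<lambda>y. \<phi> j (y \<bullet> (s \<bullet> d))) (e j))"
    if h: "h \<in> carrier H" and s: "s \<in> B" and d: "d \<in> B" for h s d
  proof -
    have sd: "s \<in> carrier H" "d \<in> carrier H" using s d BD(5) by blast+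
    let ?\<psi> = "\<lambda>i y. \<phi> i (y \<bullet> s)"
    have \<psi>: "?\<psi> i \<in> Lin" if "i < n" for i using LinT[OF \<phi>L[OF that] sd(1)] .
    have c: "\<phi> j (e i \<bullet> d) \<in> carrier k" if "i < n" "j < n" for i j using that \<phi>c eH sd by simp
    have "U h (?\<psi> i) (e i \<bullet> d) = (\<Oplus>\<^bsub>H\<^esub>j\<in>{..<n}. \<phi> j (e i \<bullet> d) \<odot>\<^bsub>H\<^esub> U h (?\<psi> i) (e j))" if i: "i < n" for i
    proof -
      have "U h (?\<psi> i) (e i \<bullet> d) = U h (?\<psi> i) (\<Oplus>\<^bsub>H\<^esub>j\<in>{..<n}. \<phi> j (e i \<bullet> d) \<odot>\<^bsub>H\<^esub> e j)"
        using ex[OF BD(3)[OF eB[OF i] d]] by simp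
      also have "\<dots> = (\<Oplus>\<^bsub>H\<^esub>j\<in>{..<n}. U h (?\<psi> i) (\<phi> j (e i \<bullet> d) \<odot>\<^bsub>H\<^esub> e j))"
        using c i eH by (intro hom_finsum[OF H_ab H_ab U_x[OF \<psi>[OF i] h lin_id]]) auto
      also have "\<dots> = (\<Oplus>\<^bsub>H\<^esub>j\<in>{..<n}. \<phi> j (e i \<bullet> d) \<odot>\<^bsub>H\<^esub> U h (?\<psi> i) (e j))"
        using c i eH module_homsD(3)[OF U_x[OF \<psi>[OF i] h lin_id]] Uc[OF \<psi>[OF i] h]
        by (intro M.finsum_cong') auto
      finally show ?thesis .
    qed
    then have "(\<Oplus>\<^bsub>H\<^esub>i\<in>{..<n}. U h (?\<psi> i) (e i \<bullet> d)) =
        (\<Oplus>\<^bsub>H\<^esub>i\<in>{..<n}. \<Oplus>\<^bsub>H\<^esub>j\<in>{..<n}. \<phi> j (e i \<bullet> d) \<odot>\<^bsub>H\<^esub> U h (?\<psi> i) (e j))"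
      using c eH Uc[OF \<psi> h] by (intro M.finsum_cong') (auto intro!: M.finsum_closed)
    also have "\<dots> = (\<Oplus>\<^bsub>H\<^esub>j\<in>{..<n}. \<Oplus>\<^bsub>H\<^esub>i\<in>{..<n}. \<phi> j (e i \<bullet> d) \<odot>\<^bsub>H\<^esub> U h (?\<psi> i) (e j))"
      using c eH Uc[OF \<psi> h] by (intro M.finsum_swap) auto
    also have "\<dots> = (\<Oplus>\<^bsub>H\<^esub>j\<in>{..<n}. U h (\<lambda>y. \<phi> j (y \<bullet> (s \<bullet> d))) (e j))"
    proof (rule M.finsum_cong')
      fix j assume j': "j \<in> {..<n}"
      then have j: "j < n" by simp
      let ?\<chi> = "\<lambda>y. \<Oplus>\<^bsub>self_module k\<^esub>i\<in>{..<n}. \<phi> j (e i \<bullet> d) \<odot>\<^bsub>self_module k\<^esub> ?\<psi> i y"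
      have \<chi>: "?\<chi> \<in> Lin"
        unfolding Lin_def using c[OF _ j] \<psi> by (intro lin_finsum lin_smult k_module H_module) (auto simp: Lin_def)
      have \<chi>eq: "?\<chi> y = \<phi> j (y \<bullet> (s \<bullet> d))" if y: "y \<in> B" for y
      proof -
        have yH: "y \<in> carrier H" using y BD(5) by blast
        have "\<phi> j (y \<bullet> (s \<bullet> d)) = \<phi> j ((y \<bullet> s) \<bullet> d)" using yH sd by (simp add: H_assoc)
        also have "\<dots> = \<phi> j ((\<Oplus>\<^bsub>H\<^esub>i\<in>{..<n}. \<phi> i (y \<bullet> s) \<odot>\<^bsub>H\<^esub> e i) \<bullet> d)"
          using ex[OF BD(3)[OF y s]] by simp
        also have "\<dots> = (\<Oplus>\<^bsub>self_module k\<^esub>i\<in>{..<n}. \<phi> j ((\<phi> i (y \<bullet> s) \<odot>\<^bsub>H\<^esub> e i) \<bullet> d))"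
          using yH sd eH \<phi>c
          by (intro hom_finsum[OF H_ab module_abelian[OF k_module], where R=k and f="\<lambda>x. \<phi> j (x \<bullet> d)"]
              lin_comp[OF \<phi>l[OF j]] hopf_lin) auto
        also have "\<dots> = ?\<chi> y"
          using yH sd eH \<phi>c j module_homsD(3)[OF \<phi>l[OF j]]
          by (intro abelian_monoid.finsum_cong'[OF abelian_group.axioms(1)[OF module_abelian[OF k_module]]])
            (auto simp: smult_mult_left k_comm)
        finally show ?thesis by simp
      qed
      have "U h (\<lambda>y. \<phi> j (y \<bullet> (s \<bullet> d))) (e j) = U h ?\<chi> (e j)"
        by (rule U_cong[OF LinT[OF \<phi>L[OF j] H_closed[OF sd]] \<chi> h eB[OF j]]) (rule \<chi>eq[symmetric])
      also have "\<dots> = SW H (\<lambda>a b. \<Oplus>\<^bsub>H\<^esub>i\<in>{..<n}. SW H (\<lambda>c t. \<phi> j (e i \<bullet> d) \<odot>\<^bsub>H\<^esub> (?\<psi> i (q (h \<bullet> S c) \<bullet> a) \<odot>\<^bsub>H\<^esub> t)) b) (e j)"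
        unfolding U_def
      proof (rule sw_cong)
        fix a b assume ab: "a \<in> carrier H" "b \<in> carrier H"
        have "SW H (\<lambda>c t. ?\<chi> (q (h \<bullet> S c) \<bullet> a) \<odot>\<^bsub>H\<^esub> t) b =
          SW H (\<lambda>c t. \<Oplus>\<^bsub>H\<^esub>i\<in>{..<n}. \<phi> j (e i \<bullet> d) \<odot>\<^bsub>H\<^esub> (?\<psi> i (q (h \<bullet> S c) \<bullet> a) \<odot>\<^bsub>H\<^esub> t)) b"
        proof (rule sw_cong)
          fix c t assume ct: "c \<in> carrier H" "t \<in> carrier H"
          have "?\<chi> (q (h \<bullet> S c) \<bullet> a) \<odot>\<^bsub>H\<^esub> t =
            (\<Oplus>\<^bsub>H\<^esub>i\<in>{..<n}. (\<phi> j (e i \<bullet> d) \<odot>\<^bsub>self_module k\<^esub> ?\<psi> i (q (h \<bullet> S c) \<bullet> a)) \<odot>\<^bsub>H\<^esub> t)"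
            using ct ab h sd j \<phi>c c[OF _ j] qc
            by (intro hom_finsum[OF module_abelian[OF k_module] H_ab, where R=k and f="\<lambda>x. x \<odot>\<^bsub>H\<^esub> t"] lin_smult_l H_module lin_id)
              (auto simp: k_rules(5))
          also have "\<dots> = (\<Oplus>\<^bsub>H\<^esub>i\<in>{..<n}. \<phi> j (e i \<bullet> d) \<odot>\<^bsub>H\<^esub> (?\<psi> i (q (h \<bullet> S c) \<bullet> a) \<odot>\<^bsub>H\<^esub> t))"
            using ct ab h sd j \<phi>c c[OF _ j] qc by (intro M.finsum_cong') (auto simp: smult_assoc1)
          finally show "?\<chi> (q (h \<bullet> S c) \<bullet> a) \<odot>\<^bsub>H\<^esub> t =
            (\<Oplus>\<^bsub>H\<^esub>i\<in>{..<n}. \<phi> j (e i \<bullet> d) \<odot>\<^bsub>H\<^esub> (?\<psi> i (q (h \<bullet> S c) \<bullet> a) \<odot>\<^bsub>H\<^esub> t))" .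
        qed (use h ab \<psi> c[OF _ j] in \<open>auto intro!: lin lin_comp[OF \<phi>l] simp: cl \<phi>c sd\<close>)
        also have "\<dots> = (\<Oplus>\<^bsub>H\<^esub>i\<in>{..<n}. SW H (\<lambda>c t. \<phi> j (e i \<bullet> d) \<odot>\<^bsub>H\<^esub> (?\<psi> i (q (h \<bullet> S c) \<bullet> a) \<odot>\<^bsub>H\<^esub> t)) b)"
          using h ab c[OF _ j] by (intro sw_finsum) (auto intro!: lin lin_comp[OF \<phi>l] simp: cl \<phi>c sd)
        finally show "SW H (\<lambda>c t. ?\<chi> (q (h \<bullet> S c) \<bullet> a) \<odot>\<^bsub>H\<^esub> t) b =
          (\<Oplus>\<^bsub>H\<^esub>i\<in>{..<n}. SW H (\<lambda>c t. \<phi> j (e i \<bullet> d) \<odot>\<^bsub>H\<^esub> (?\<psi> i (q (h \<bullet> S c) \<bullet> a) \<odot>\<^bsub>H\<^esub> t)) b)" .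
      qed (use h eH j c[OF _ j] in \<open>auto intro!: lin lin_comp[OF \<phi>l] simp: cl \<phi>c sd\<close>)
      also have "\<dots> = (\<Oplus>\<^bsub>H\<^esub>i\<in>{..<n}. SW H (\<lambda>a b. SW H (\<lambda>c t. \<phi> j (e i \<bullet> d) \<odot>\<^bsub>H\<^esub> (?\<psi> i (q (h \<bullet> S c) \<bullet> a) \<odot>\<^bsub>H\<^esub> t)) b) (e j))"
        using h eH j c[OF _ j] by (intro sw_finsum) (auto intro!: lin lin_comp[OF \<phi>l] simp: cl \<phi>c sd)
      also have "\<dots> = (\<Oplus>\<^bsub>H\<^esub>i\<in>{..<n}. \<phi> j (e i \<bullet> d) \<odot>\<^bsub>H\<^esub> U h (?\<psi> i) (e j))"
      proof (rule M.finsum_cong')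
        fix i assume i': "i \<in> {..<n}"
        then have i: "i < n" by simp
        have sc: "(\<lambda>x. \<phi> j (e i \<bullet> d) \<odot>\<^bsub>H\<^esub> x) \<in> module_homs k H H"
          using c[OF i j] by (intro hopf_lin) auto
        have "\<phi> j (e i \<bullet> d) \<odot>\<^bsub>H\<^esub> U h (?\<psi> i) (e j) = SW H (\<lambda>a b. \<phi> j (e i \<bullet> d) \<odot>\<^bsub>H\<^esub>
            SW H (\<lambda>c t. ?\<psi> i (q (h \<bullet> S c) \<bullet> a) \<odot>\<^bsub>H\<^esub> t) b) (e j)"
          unfolding U_def using h eH[OF j] i
          by (intro sw_comp[OF _ _ _ sc]) (auto intro!: lin lin_comp[OF \<phi>l] simp: cl \<phi>c sd)
        also have "\<dots> = SW H (\<lambda>a b. SW H (\<lambda>c t. \<phi> j (e i \<bullet> d) \<odot>\<^bsub>H\<^esub> (?\<psi> i (q (h \<bullet> S c) \<bullet> a) \<odot>\<^bsub>H\<^esub> t)) b) (e j)"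
        proof (rule sw_cong)
          fix a b assume ab: "a \<in> carrier H" "b \<in> carrier H"
          show "\<phi> j (e i \<bullet> d) \<odot>\<^bsub>H\<^esub> SW H (\<lambda>c t. ?\<psi> i (q (h \<bullet> S c) \<bullet> a) \<odot>\<^bsub>H\<^esub> t) b =
            SW H (\<lambda>c t. \<phi> j (e i \<bullet> d) \<odot>\<^bsub>H\<^esub> (?\<psi> i (q (h \<bullet> S c) \<bullet> a) \<odot>\<^bsub>H\<^esub> t)) b"
            using h ab i by (intro sw_comp[OF _ _ _ sc]) (auto intro!: lin lin_comp[OF \<phi>l] simp: cl \<phi>c sd)
        qed (use h eH j c[OF i j] i in \<open>auto intro!: lin lin_comp[OF \<phi>l] simp: cl \<phi>c sd\<close>)
        finally show "SW H (\<lambda>a b. SW H (\<lambda>c t. \<phi> j (e i \<bullet> d) \<odot>\<^bsub>H\<^esub> (?\<psi> i (q (h \<bullet> S c) \<bullet> a) \<odot>\<^bsub>H\<^esub> t)) b) (e j) =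
          \<phi> j (e i \<bullet> d) \<odot>\<^bsub>H\<^esub> U h (?\<psi> i) (e j)" by (rule sym)
      qed (use c[OF _ j] Uc[OF \<psi> h] eH[OF j] in auto)
      finally show "(\<Oplus>\<^bsub>H\<^esub>i\<in>{..<n}. \<phi> j (e i \<bullet> d) \<odot>\<^bsub>H\<^esub> U h (?\<psi> i) (e j)) = U h (\<lambda>y. \<phi> j (y \<bullet> (s \<bullet> d))) (e j)"
        by (rule sym)
    qed (use Uc LinT[OF \<phi>L] eH sd h in auto)
    finally show ?thesis .
  qed
  have U_z: "(\<lambda>z. U h (\<lambda>y. \<phi> i (y \<bullet> f z)) x) \<in> module_homs k H H"
    if "i < n" "h \<in> carrier H" "x \<in> carrier H" "f \<in> module_homs k H H" for i h x f
    unfolding U_def using that module_homsD(1)[OF that(4)]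
    by (intro hopf_lin lin_comp[OF q_lin] lin_comp[OF \<phi>l[OF that(1)]] lin_comp[OF that(4)]) (auto simp: cl \<phi>c)
  \<comment> \<open>\<open>shift\<close> moves c inside the trace, splitting it into S(c1) and c'.
    Cyclicity brings these next to each other as S(c1) c', which collapses to the counit.\<close>
  have contract: "SW H (\<lambda>c1 c2. \<rho> (h \<bullet> S c1) \<bullet> c2) c = \<epsilon> c \<odot>\<^bsub>H\<^esub> \<rho> h" if h: "h \<in> carrier H" and c: "c \<in> B" for h c
  proof -
    have cH: "c \<in> carrier H" using c BD(5) by blast
    have b1: "bilin k H H H (\<lambda>c1 c2. U (h \<bullet> S c1) (\<phi> i) (e i) \<bullet> c2)" if "i < n" for i
      using that h eH by (intro hopf_lin U_h \<phi>L) (auto simp: Uc \<phi>L)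
    have b2: "bilin k H H H (\<lambda>c1 c'. U h (\<lambda>y. \<phi> i (y \<bullet> S c1)) (e i \<bullet> c'))" if "i < n" for i
      using that h eH by (intro hopf_lin U_z U_x LinT \<phi>L) auto
    have b3: "bilin k H H H (\<lambda>c1 c'. U h (\<lambda>y. \<phi> i (y \<bullet> (S c1 \<bullet> c'))) (e i))" if "i < n" for i
      using that h eH by (intro hopf_lin U_z) auto
    have "SW H (\<lambda>c1 c2. \<rho> (h \<bullet> S c1) \<bullet> c2) c =
      SW H (\<lambda>c1 c2. \<Oplus>\<^bsub>H\<^esub>i\<in>{..<n}. U (h \<bullet> S c1) (\<phi> i) (e i) \<bullet> c2) c"
    proof (rule sw_cong)
      fix v w assume "v \<in> carrier H" "w \<in> carrier H"
      then show "\<rho> (h \<bullet> S v) \<bullet> w = (\<Oplus>\<^bsub>H\<^esub>i\<in>{..<n}. U (h \<bullet> S v) (\<phi> i) (e i) \<bullet> w)"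
        unfolding \<rho>_def using h eH Uc \<phi>L
        by (intro hom_finsum[OF H_ab H_ab, where R=k and f="\<lambda>x. x \<bullet> w"] hopf_lin) auto
    qed (use b1 cH in \<open>auto intro!: hopf_lin bilinD[OF b1]\<close>)
    also have "\<dots> = (\<Oplus>\<^bsub>H\<^esub>i\<in>{..<n}. SW H (\<lambda>c1 c2. U (h \<bullet> S c1) (\<phi> i) (e i) \<bullet> c2) c)"
      using b1 cH by (intro sw_finsum) auto
    also have "\<dots> = (\<Oplus>\<^bsub>H\<^esub>i\<in>{..<n}. SW H (\<lambda>c1 c'. U h (\<lambda>y. \<phi> i (y \<bullet> S c1)) (e i \<bullet> c')) c)"
      using h eH cH \<phi>L b2 by (intro M.finsum_cong') (auto intro!: shift sw_closed)
    also have "\<dots> = SW H (\<lambda>c1 c'. \<Oplus>\<^bsub>H\<^esub>i\<in>{..<n}. U h (\<lambda>y. \<phi> i (y \<bullet> S c1)) (e i \<bullet> c')) c"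
      using b2 cH by (intro sw_finsum[symmetric]) auto
    also have "\<dots> = SW H (\<lambda>c1 c'. \<Oplus>\<^bsub>H\<^esub>i\<in>{..<n}. U h (\<lambda>y. \<phi> i (y \<bullet> (S c1 \<bullet> c'))) (e i)) c"
      using h BD(4) c
      by (intro sw_sub_cong[OF B H_module] cyclic) (auto intro!: hopf_lin bilinD[OF b2] bilinD[OF b3])
    also have "\<dots> = \<epsilon> c \<odot>\<^bsub>H\<^esub> (\<Oplus>\<^bsub>H\<^esub>i\<in>{..<n}. U h (\<lambda>y. \<phi> i (y \<bullet> \<one>\<^sub>H)) (e i))"
      using h eH cH
      by (intro sw_cancel[OF cancelling_S(1) H_module, where f="\<lambda>z. \<Oplus>\<^bsub>H\<^esub>i\<in>{..<n}. U h (\<lambda>y. \<phi> i (y \<bullet> z)) (e i)"]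
          lin_finsum U_z H_module) auto
    also have "(\<Oplus>\<^bsub>H\<^esub>i\<in>{..<n}. U h (\<lambda>y. \<phi> i (y \<bullet> \<one>\<^sub>H)) (e i)) = \<rho> h"
      unfolding \<rho>_def using h eH eB \<phi>L LinT[OF \<phi>L H_one_closed] Uc BD(5)
      by (intro M.finsum_cong') (auto intro!: U_cong simp: H_r_one)
    finally show ?thesis .
  qed
  \<comment> \<open>Writing c as \<Sum> c1 \<epsilon>(c2) and expanding \<epsilon>(c2) by
    \<open>contract\<close> turns the left side into \<Sum> \<rho>(h c1 S(c2)) c3. Cancelling c1
    S(c2) leaves the right side.\<close>
  have "\<rho> (h \<bullet> c) = \<rho> h \<bullet> c" if h: "h \<in> carrier H" and c: "c \<in> B" for h c
  proof -
    have cH: "c \<in> carrier H" using c BD(5) by blast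
    have "\<rho> (h \<bullet> c) = SW H (\<lambda>c1 c2. \<epsilon> c2 \<odot>\<^bsub>H\<^esub> \<rho> (h \<bullet> c1)) c"
      using h cH by (intro sw_counit(2)[symmetric, of H "\<lambda>x. \<rho> (h \<bullet> x)"] lr hopf_lin) auto
    also have "\<dots> = SW H (\<lambda>c1 c2. SW H (\<lambda>d1 d2. \<rho> (h \<bullet> (c1 \<bullet> S d1)) \<bullet> d2) c2) c"
    proof (rule sw_sub_cong[OF B H_module])
      fix v w assume vw: "v \<in> B" "w \<in> B"
      then have vwH: "v \<in> carrier H" "w \<in> carrier H" using BD(5) by blast+
      have "SW H (\<lambda>d1 d2. \<rho> (h \<bullet> (v \<bullet> S d1)) \<bullet> d2) w = SW H (\<lambda>d1 d2. \<rho> (h \<bullet> v \<bullet> S d1) \<bullet> d2) w"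
        using vwH h by (intro sw_cong lr hopf_lin) (auto simp: H_assoc \<rho>c)
      then show "\<epsilon> w \<odot>\<^bsub>H\<^esub> \<rho> (h \<bullet> v) = SW H (\<lambda>d1 d2. \<rho> (h \<bullet> (v \<bullet> S d1)) \<bullet> d2) w"
        using contract[of "h \<bullet> v" w] h vwH vw by simp
    qed (use h c in \<open>auto intro!: lr hopf_lin simp: \<rho>c\<close>)
    also have "\<dots> = \<rho> (h \<bullet> \<one>\<^sub>H) \<bullet> c"
      using h cH by (intro sw_cancel12(2)[OF cancelling_S(2) H_module, where f="\<lambda>y d. \<rho> (h \<bullet> y) \<bullet> d"] lr hopf_lin)
        (auto simp: \<rho>c)
    finally show ?thesis using h by (simp add: H_r_one)
  qed
  then show thesis using that[of \<rho>] \<rho>_lin \<rho>B \<rho>_id by (simp add: rlin_def)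
qed

end

section \<open>The diagonal right action on the tensor square\<close>

context inv_hopf
begin

definition dact :: "('h \<times> 'h \<Rightarrow> 'k) set \<Rightarrow> 'h \<Rightarrow> ('h \<times> 'h \<Rightarrow> 'k) set"
  where "dact t b = SW HH (\<lambda>b1 b2. tensor_lift k HH (\<lambda>x y. (x \<bullet> b1) \<boxtimes> (y \<bullet> b2)) t) b"

lemma dact_pure:
  assumes "x \<in> carrier H" "y \<in> carrier H" "b \<in> carrier H"
  shows "dact (x \<boxtimes> y) b = SW HH (\<lambda>b1 b2. (x \<bullet> b1) \<boxtimes> (y \<bullet> b2)) b"
  unfolding dact_def using assms
  by (intro sw_cong tensor_lift_pure[OF H_module H_module] hopf_lin) auto

lemma dact_bilin: "bilin k HH H HH dact"
proof (rule bilinI)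
  have b: "bilin k H H HH (\<lambda>b1 b2. tensor_lift k HH (\<lambda>x y. (x \<bullet> b1) \<boxtimes> (y \<bullet> b2)) t)" if "t \<in> carrier HH" for t
    using that by (intro hopf_lin lin_lift_param[OF H_module H_module]) auto
  show "(\<lambda>b. dact t b) \<in> module_homs k H HH" if "t \<in> carrier HH" for t
    unfolding dact_def by (intro sw_hom HH_module b that)
  show "(\<lambda>t. dact t b) \<in> module_homs k HH HH" if "b \<in> carrier H" for b
    unfolding dact_def using that by (intro lin_sw_param b lin_lift[OF H_module H_module] hopf_lin) auto
qed

lemma lin_dact_l: "c \<in> carrier H \<Longrightarrow> f \<in> module_homs k Z HH \<Longrightarrow> (\<lambda>x. dact (f x) c) \<in> module_homs k Z HH"
  by (rule lin_bil_l[OF dact_bilin])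

lemma lin_dact_r: "c \<in> carrier HH \<Longrightarrow> f \<in> module_homs k Z H \<Longrightarrow> (\<lambda>x. dact c (f x)) \<in> module_homs k Z HH"
  by (rule lin_bil_r[OF dact_bilin])

lemma dact_closed [simp]: "t \<in> carrier HH \<Longrightarrow> b \<in> carrier H \<Longrightarrow> dact t b \<in> carrier HH"
  by (rule bilin_closed[OF dact_bilin])

lemma dact_assoc:
  assumes "t \<in> carrier HH" "b \<in> carrier H" "c \<in> carrier H"
  shows "dact t (b \<bullet> c) = dact (dact t b) c"
proof (rule tensor_ext[OF H_module H_module _ _ _ assms(1), of _ HH])
  show "(\<lambda>t. dact t (b \<bullet> c)) \<in> module_homs k HH HH" using assms by (intro lin_dact_l lin_id) auto
  show "(\<lambda>t. dact (dact t b) c) \<in> module_homs k HH HH" using assms by (intro lin_dact_l lin_id) auto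
  fix x y assume xy: "x \<in> carrier H" "y \<in> carrier H"
  have "dact (x \<boxtimes> y) (b \<bullet> c) = SW HH (\<lambda>b1 b2. SW HH (\<lambda>c1 c2. (x \<bullet> (b1 \<bullet> c1)) \<boxtimes> (y \<bullet> (b2 \<bullet> c2))) c) b"
    using assms xy by (simp add: dact_pure) (intro sw_mult hopf_lin; simp)
  also have "\<dots> = SW HH (\<lambda>b1 b2. dact ((x \<bullet> b1) \<boxtimes> (y \<bullet> b2)) c) b"
  proof (rule sw_cong)
    fix v w assume vw: "v \<in> carrier H" "w \<in> carrier H"
    have "dact ((x \<bullet> v) \<boxtimes> (y \<bullet> w)) c = SW HH (\<lambda>c1 c2. ((x \<bullet> v) \<bullet> c1) \<boxtimes> ((y \<bullet> w) \<bullet> c2)) c"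
      using vw assms xy by (intro dact_pure) auto
    also have "\<dots> = SW HH (\<lambda>c1 c2. (x \<bullet> (v \<bullet> c1)) \<boxtimes> (y \<bullet> (w \<bullet> c2))) c"
      using vw assms xy by (intro sw_cong hopf_lin) (auto simp: H_assoc)
    finally show "SW HH (\<lambda>c1 c2. (x \<bullet> (v \<bullet> c1)) \<boxtimes> (y \<bullet> (w \<bullet> c2))) c = dact ((x \<bullet> v) \<boxtimes> (y \<bullet> w)) c"
      by (rule sym)
  qed (use assms xy in \<open>auto intro!: hopf_lin lin_dact_l\<close>)
  also have "\<dots> = dact (dact (x \<boxtimes> y) b) c"
    using assms xy by (simp add: dact_pure)
      (intro sw_comp[symmetric, where g="\<lambda>t. dact t c"] hopf_lin lin_dact_l; simp)
  finally show "dact (x \<boxtimes> y) (b \<bullet> c) = dact (dact (x \<boxtimes> y) b) c" .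
qed

definition rlinB :: "'h set \<Rightarrow> ('h \<Rightarrow> 'h) \<Rightarrow> bool"
  where "rlinB B \<pi> \<longleftrightarrow> rlin B \<pi> \<and> (\<forall>h\<in>carrier H. \<pi> h \<in> B)"

lemma rlinD:
  assumes "rlin B \<pi>"
  shows "\<pi> \<in> module_homs k H H" "h \<in> carrier H \<Longrightarrow> b \<in> B \<Longrightarrow> \<pi> (h \<bullet> b) = \<pi> h \<bullet> b"
    "h \<in> carrier H \<Longrightarrow> \<pi> h \<in> carrier H"
  using assms module_homsD(1)[of \<pi> k H H] by (auto simp: rlin_def)

text \<open>The untwisting x \<otimes> z \<mapsto> \<Sum> x S(z') \<otimes> z'', taken after \<pi>
  has been applied to z, with \<phi> evaluated on the first factor. \<open>omL\<close> below is the
  mirror image, built from z S(x'') and x'.\<close>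

definition omR :: "('h \<Rightarrow> 'k) \<Rightarrow> ('h \<Rightarrow> 'h) \<Rightarrow> ('h \<times> 'h \<Rightarrow> 'k) set \<Rightarrow> 'h"
  where "omR \<phi> \<pi> = tensor_lift k H (\<lambda>x z. SW H (\<lambda>b1 b2. \<phi> (x \<bullet> S b1) \<odot>\<^bsub>H\<^esub> b2) (\<pi> z))"

definition omL :: "('h \<Rightarrow> 'k) \<Rightarrow> ('h \<Rightarrow> 'h) \<Rightarrow> ('h \<times> 'h \<Rightarrow> 'k) set \<Rightarrow> 'h"
  where "omL \<phi> \<pi> = tensor_lift k H (\<lambda>x z. SW H (\<lambda>b1 b2. \<phi> (z \<bullet> S b2) \<odot>\<^bsub>H\<^esub> b1) (\<pi> x))"

lemma
  assumes \<phi>: "\<phi> \<in> module_homs k H (self_module k)" and \<pi>: "\<pi> \<in> module_homs k H H"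
  shows omR_hom: "omR \<phi> \<pi> \<in> module_homs k HH H"
    and omR_pure: "x \<in> carrier H \<Longrightarrow> z \<in> carrier H \<Longrightarrow>
      omR \<phi> \<pi> (x \<boxtimes> z) = SW H (\<lambda>b1 b2. \<phi> (x \<bullet> S b1) \<odot>\<^bsub>H\<^esub> b2) (\<pi> z)"
    and omL_hom: "omL \<phi> \<pi> \<in> module_homs k HH H"
    and omL_pure: "x \<in> carrier H \<Longrightarrow> z \<in> carrier H \<Longrightarrow>
      omL \<phi> \<pi> (x \<boxtimes> z) = SW H (\<lambda>b1 b2. \<phi> (z \<bullet> S b2) \<odot>\<^bsub>H\<^esub> b1) (\<pi> x)"
proof -
  have \<phi>c: "\<phi> x \<in> carrier k" if "x \<in> carrier H" for x using module_homsD(1)[OF \<phi> that] by simp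
  have \<pi>c: "\<pi> x \<in> carrier H" if "x \<in> carrier H" for x using module_homsD(1)[OF \<pi> that] .
  have b: "bilin k H H H (\<lambda>x z. SW H (\<lambda>b1 b2. \<phi> (x \<bullet> S b1) \<odot>\<^bsub>H\<^esub> b2) (\<pi> z))"
    by (intro hopf_lin lin_comp[OF \<phi>] \<pi>) (auto simp: \<phi>c \<pi>c)
  show "omR \<phi> \<pi> \<in> module_homs k HH H" unfolding omR_def by (intro tensor_lift_hom H_module b)
  show "omR \<phi> \<pi> (x \<boxtimes> z) = SW H (\<lambda>b1 b2. \<phi> (x \<bullet> S b1) \<odot>\<^bsub>H\<^esub> b2) (\<pi> z)" if "x \<in> carrier H" "z \<in> carrier H"
    unfolding omR_def by (rule tensor_lift_pure[OF H_module H_module H_module b that])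
  have b: "bilin k H H H (\<lambda>x z. SW H (\<lambda>b1 b2. \<phi> (z \<bullet> S b2) \<odot>\<^bsub>H\<^esub> b1) (\<pi> x))"
    by (intro hopf_lin lin_comp[OF \<phi>] \<pi>) (auto simp: \<phi>c \<pi>c)
  show "omL \<phi> \<pi> \<in> module_homs k HH H" unfolding omL_def by (intro tensor_lift_hom H_module b)
  show "omL \<phi> \<pi> (x \<boxtimes> z) = SW H (\<lambda>b1 b2. \<phi> (z \<bullet> S b2) \<odot>\<^bsub>H\<^esub> b1) (\<pi> x)" if "x \<in> carrier H" "z \<in> carrier H"
    unfolding omL_def by (rule tensor_lift_pure[OF H_module H_module H_module b that])
qed

text \<open>Acting by b inserts x b1 S(u b2) = x b1 S(b2) S(u), where the neighbours b1 and S(b2)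
  cancel and b3 remains on the right. The components of b lie in B, which lets them pass through
  \<pi>.\<close>

lemma omR_rlin:
  assumes B: "subhopf B" and \<phi>: "\<phi> \<in> module_homs k H (self_module k)" and \<pi>: "rlin B \<pi>"
    and t: "t \<in> carrier HH" and b: "b \<in> B"
  shows "omR \<phi> \<pi> (dact t b) = omR \<phi> \<pi> t \<bullet> b"
proof (rule tensor_ext[OF H_module H_module _ _ _ t, of _ H])
  note \<pi>l = rlinD(1)[OF \<pi>] and \<pi>c = rlinD(3)[OF \<pi>]
  note hom = omR_hom[OF \<phi> \<pi>l] and pure = omR_pure[OF \<phi> \<pi>l]
  have \<phi>c: "\<phi> x \<in> carrier k" if "x \<in> carrier H" for x using module_homsD(1)[OF \<phi> that] by simp
  have bH: "b \<in> carrier H" using b subhopfD[OF B] by blast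
  note lin = hopf_lin lin_comp[OF \<phi>] lin_comp[OF \<pi>l]
  show "(\<lambda>t. omR \<phi> \<pi> (dact t b)) \<in> module_homs k HH H" by (intro lin_comp[OF hom] lin_dact_l bH lin_id)
  show "(\<lambda>t. omR \<phi> \<pi> t \<bullet> b) \<in> module_homs k HH H" by (intro lin_mul_l hom bH)
  fix x z assume xz: "x \<in> carrier H" "z \<in> carrier H"
  let ?f = "\<lambda>y c. SW H (\<lambda>u v. \<phi> (x \<bullet> (y \<bullet> S u)) \<odot>\<^bsub>H\<^esub> (v \<bullet> c)) (\<pi> z)"
  have "omR \<phi> \<pi> (dact (x \<boxtimes> z) b) = SW H (\<lambda>b1 b2. omR \<phi> \<pi> ((x \<bullet> b1) \<boxtimes> (z \<bullet> b2))) b"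
    using xz bH by (simp add: dact_pure) (intro sw_comp hopf_lin hom; simp)
  also have "\<dots> = SW H (\<lambda>b1 b'. SW H (\<lambda>b2 b3. ?f (b1 \<bullet> S b2) b3) b') b"
  proof (rule sw_sub_cong[OF B H_module])
    fix b1 b' assume bb: "b1 \<in> B" "b' \<in> B"
    then have bbH: "b1 \<in> carrier H" "b' \<in> carrier H" using subhopfD[OF B] by blast+
    have "omR \<phi> \<pi> ((x \<bullet> b1) \<boxtimes> (z \<bullet> b')) = SW H (\<lambda>u v. \<phi> (x \<bullet> b1 \<bullet> S u) \<odot>\<^bsub>H\<^esub> v) (\<pi> z \<bullet> b')"
      using xz bb bbH rlinD(2)[OF \<pi>] by (simp add: pure)
    also have "\<dots> = SW H (\<lambda>u v. SW H (\<lambda>b2 b3. \<phi> (x \<bullet> b1 \<bullet> S (u \<bullet> b2)) \<odot>\<^bsub>H\<^esub> (v \<bullet> b3)) b') (\<pi> z)"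
      using xz bbH by (intro sw_mult lin) (auto simp: \<phi>c \<pi>c)
    also have "\<dots> = SW H (\<lambda>u v. SW H (\<lambda>b2 b3. \<phi> (x \<bullet> (b1 \<bullet> S b2 \<bullet> S u)) \<odot>\<^bsub>H\<^esub> (v \<bullet> b3)) b') (\<pi> z)"
      using xz bbH by (intro sw_cong lin) (auto simp: \<phi>c \<pi>c S_mult H_assoc smult_closed)
    also have "\<dots> = SW H (\<lambda>b2 b3. ?f (b1 \<bullet> S b2) b3) b'"
      using xz bbH by (intro sw_swap lin) (auto simp: \<phi>c \<pi>c)
    finally show "omR \<phi> \<pi> ((x \<bullet> b1) \<boxtimes> (z \<bullet> b')) = SW H (\<lambda>b2 b3. ?f (b1 \<bullet> S b2) b3) b'" .
  next
    show "bilin k H H H (\<lambda>b1 b2. omR \<phi> \<pi> ((x \<bullet> b1) \<boxtimes> (z \<bullet> b2)))"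
      using xz by (intro hopf_lin lin_comp[OF hom]) auto
  qed (use b xz in \<open>auto intro!: lin simp: \<phi>c \<pi>c smult_closed\<close>)
  also have "\<dots> = ?f \<one>\<^sub>H b"
    using xz bH by (intro sw_cancel12(2)[OF cancelling_S(2) H_module, where f="?f"] lin) (auto simp: \<phi>c \<pi>c)
  also have "\<dots> = SW H (\<lambda>u v. (\<phi> (x \<bullet> S u) \<odot>\<^bsub>H\<^esub> v) \<bullet> b) (\<pi> z)"
    using xz bH by (intro sw_cong lin) (auto simp: \<phi>c \<pi>c smult_mult_left H_l_one)
  also have "\<dots> = omR \<phi> \<pi> (x \<boxtimes> z) \<bullet> b"
    using xz bH by (simp add: pure) (intro sw_comp[symmetric, where g="\<lambda>x. x \<bullet> b"] lin; simp add: \<phi>c \<pi>c)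
  finally show "omR \<phi> \<pi> (dact (x \<boxtimes> z) b) = omR \<phi> \<pi> (x \<boxtimes> z) \<bullet> b" .
qed

text \<open>The same computation for the other factor. Here the neighbours are b3 and S(b2), in the
  opposite order of components, so the skew identity does the cancelling.\<close>

lemma omL_rlin:
  assumes B: "subhopf B" and \<phi>: "\<phi> \<in> module_homs k H (self_module k)" and \<pi>: "rlin B \<pi>"
    and t: "t \<in> carrier HH" and b: "b \<in> B"
  shows "omL \<phi> \<pi> (dact t b) = omL \<phi> \<pi> t \<bullet> b"
proof (rule tensor_ext[OF H_module H_module _ _ _ t, of _ H])
  note \<pi>l = rlinD(1)[OF \<pi>] and \<pi>c = rlinD(3)[OF \<pi>]
  note hom = omL_hom[OF \<phi> \<pi>l] and pure = omL_pure[OF \<phi> \<pi>l]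
  have \<phi>c: "\<phi> x \<in> carrier k" if "x \<in> carrier H" for x using module_homsD(1)[OF \<phi> that] by simp
  have bH: "b \<in> carrier H" using b subhopfD[OF B] by blast
  note lin = hopf_lin lin_comp[OF \<phi>] lin_comp[OF \<pi>l]
  show "(\<lambda>t. omL \<phi> \<pi> (dact t b)) \<in> module_homs k HH H" by (intro lin_comp[OF hom] lin_dact_l bH lin_id)
  show "(\<lambda>t. omL \<phi> \<pi> t \<bullet> b) \<in> module_homs k HH H" by (intro lin_mul_l hom bH)
  fix x z assume xz: "x \<in> carrier H" "z \<in> carrier H"
  let ?f = "\<lambda>c y. SW H (\<lambda>u v. \<phi> (z \<bullet> (y \<bullet> S v)) \<odot>\<^bsub>H\<^esub> (u \<bullet> c)) (\<pi> x)"
  have "omL \<phi> \<pi> (dact (x \<boxtimes> z) b) = SW H (\<lambda>b1 b2. omL \<phi> \<pi> ((x \<bullet> b1) \<boxtimes> (z \<bullet> b2))) b"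
    using xz bH by (simp add: dact_pure) (intro sw_comp hopf_lin hom; simp)
  also have "\<dots> = SW H (\<lambda>b' b3. SW H (\<lambda>b1 b2. ?f b1 (b3 \<bullet> S b2)) b') b"
  proof (rule sw_sub_cong[OF B H_module])
    fix b' b3 assume bb: "b' \<in> B" "b3 \<in> B"
    then have bbH: "b' \<in> carrier H" "b3 \<in> carrier H" using subhopfD[OF B] by blast+
    have "omL \<phi> \<pi> ((x \<bullet> b') \<boxtimes> (z \<bullet> b3)) = SW H (\<lambda>u v. \<phi> (z \<bullet> b3 \<bullet> S v) \<odot>\<^bsub>H\<^esub> u) (\<pi> x \<bullet> b')"
      using xz bb bbH rlinD(2)[OF \<pi>] by (simp add: pure)
    also have "\<dots> = SW H (\<lambda>u v. SW H (\<lambda>b1 b2. \<phi> (z \<bullet> b3 \<bullet> S (v \<bullet> b2)) \<odot>\<^bsub>H\<^esub> (u \<bullet> b1)) b') (\<pi> x)"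
      using xz bbH by (intro sw_mult lin) (auto simp: \<phi>c \<pi>c)
    also have "\<dots> = SW H (\<lambda>u v. SW H (\<lambda>b1 b2. \<phi> (z \<bullet> (b3 \<bullet> S b2 \<bullet> S v)) \<odot>\<^bsub>H\<^esub> (u \<bullet> b1)) b') (\<pi> x)"
      using xz bbH by (intro sw_cong lin) (auto simp: \<phi>c \<pi>c S_mult H_assoc smult_closed)
    also have "\<dots> = SW H (\<lambda>b1 b2. ?f b1 (b3 \<bullet> S b2)) b'"
      using xz bbH by (intro sw_swap lin) (auto simp: \<phi>c \<pi>c)
    finally show "omL \<phi> \<pi> ((x \<bullet> b') \<boxtimes> (z \<bullet> b3)) = SW H (\<lambda>b1 b2. ?f b1 (b3 \<bullet> S b2)) b'" .
  next
    show "bilin k H H H (\<lambda>b1 b2. omL \<phi> \<pi> ((x \<bullet> b1) \<boxtimes> (z \<bullet> b2)))"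
      using xz by (intro hopf_lin lin_comp[OF hom]) auto
  qed (use b xz in \<open>auto intro!: lin simp: \<phi>c \<pi>c smult_closed\<close>)
  also have "\<dots> = ?f b \<one>\<^sub>H"
    using xz bH by (intro sw_cancel23(2)[OF cancelling_skew(2) H_module, where f="?f"] lin) (auto simp: \<phi>c \<pi>c)
  also have "\<dots> = SW H (\<lambda>u v. (\<phi> (z \<bullet> S v) \<odot>\<^bsub>H\<^esub> u) \<bullet> b) (\<pi> x)"
    using xz bH by (intro sw_cong lin) (auto simp: \<phi>c \<pi>c smult_mult_left H_l_one)
  also have "\<dots> = omL \<phi> \<pi> (x \<boxtimes> z) \<bullet> b"
    using xz bH by (simp add: pure) (intro sw_comp[symmetric, where g="\<lambda>x. x \<bullet> b"] lin; simp add: \<phi>c \<pi>c)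
  finally show "omL \<phi> \<pi> (dact (x \<boxtimes> z) b) = omL \<phi> \<pi> (x \<boxtimes> z) \<bullet> b" .
qed

text \<open>The trivialisation \<open>x \<otimes> y\<close> of the diagonal action, summed over a basis of \<open>A\<close>.\<close>

lemma dact_basis_sum:
  assumes A: "subhopf A" and a: "dual_sys k H {..<n::nat} a \<phi>"
    and ax: "\<And>x. x \<in> A \<Longrightarrow> (\<Oplus>\<^bsub>H\<^esub>j\<in>{..<n}. \<phi> j x \<odot>\<^bsub>H\<^esub> a j) = x"
    and x: "x \<in> A" and \<beta>: "\<beta> \<in> A" and y: "y \<in> carrier H"
  shows "(\<Oplus>\<^bsub>HH\<^esub>j\<in>{..<n}. dact (a j \<boxtimes> y) (SW H (\<lambda>b1 b2. \<phi> j (x \<bullet> S b1) \<odot>\<^bsub>H\<^esub> b2) \<beta>)) = x \<boxtimes> (y \<bullet> \<beta>)"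
    and "(\<Oplus>\<^bsub>HH\<^esub>j\<in>{..<n}. dact (y \<boxtimes> a j) (SW H (\<lambda>b1 b2. \<phi> j (x \<bullet> S b2) \<odot>\<^bsub>H\<^esub> b1) \<beta>)) = (y \<bullet> \<beta>) \<boxtimes> x"
proof -
  note AD = subhopfD[OF A] and D = dual_sysD[OF a]
  have H: "x \<in> carrier H" "\<beta> \<in> carrier H" using x \<beta> AD by blast+
  have \<phi>l: "\<phi> j \<in> module_homs k H (self_module k)" if "j < n" for j using D(3) that by simp
  have \<phi>c: "\<phi> j z \<in> carrier k" if "j < n" "z \<in> carrier H" for j z using D(4) that by simp
  have aH: "a j \<in> carrier H" if "j < n" for j using D(2) that by simp
  note lin = hopf_lin lin_dact_l lin_dact_r
  have HHs: "c \<odot>\<^bsub>HH\<^esub> t \<in> carrier HH" if "c \<in> carrier k" "t \<in> carrier HH" for c t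
    using module.smult_closed[OF HH_module] that by blast
  \<comment> \<open>Recombines coordinates: with F = (\<lambda>z. dact (z \<boxtimes> y) b2) the sum
    over the basis replaces the numbers \<phi> j (x S(b1)) by the element x S(b1) itself, whose
    components then cancel against those of b2.\<close>
  have sum: "(\<Oplus>\<^bsub>HH\<^esub>j\<in>{..<n}. \<phi> j z \<odot>\<^bsub>HH\<^esub> F (a j)) = F z" if F: "F \<in> module_homs k H HH" and z: "z \<in> A" for F z
  proof -
    have "F z = F (\<Oplus>\<^bsub>H\<^esub>j\<in>{..<n}. \<phi> j z \<odot>\<^bsub>H\<^esub> a j)" using ax[OF z] by simp
    also have "\<dots> = (\<Oplus>\<^bsub>HH\<^esub>j\<in>{..<n}. F (\<phi> j z \<odot>\<^bsub>H\<^esub> a j))"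
      using z AD(5) \<phi>c aH by (intro hom_finsum[OF H_ab module_abelian[OF HH_module] F]) auto
    also have "\<dots> = (\<Oplus>\<^bsub>HH\<^esub>j\<in>{..<n}. \<phi> j z \<odot>\<^bsub>HH\<^esub> F (a j))"
      using z AD(5) \<phi>c aH module_homsD[OF F] HHs
      by (intro abelian_monoid.finsum_cong'[OF abelian_group.axioms(1)[OF module_abelian[OF HH_module]]]) auto
    finally show ?thesis by (rule sym)
  qed
  have "dact (a j \<boxtimes> y) (SW H (\<lambda>b1 b2. \<phi> j (x \<bullet> S b1) \<odot>\<^bsub>H\<^esub> b2) \<beta>) =
      SW HH (\<lambda>b1 b2. \<phi> j (x \<bullet> S b1) \<odot>\<^bsub>HH\<^esub> dact (a j \<boxtimes> y) b2) \<beta>" if j: "j < n" for j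
  proof -
    have "dact (a j \<boxtimes> y) (SW H (\<lambda>b1 b2. \<phi> j (x \<bullet> S b1) \<odot>\<^bsub>H\<^esub> b2) \<beta>) =
      SW HH (\<lambda>b1 b2. dact (a j \<boxtimes> y) (\<phi> j (x \<bullet> S b1) \<odot>\<^bsub>H\<^esub> b2)) \<beta>"
      using j H y aH by (intro sw_comp[where g="dact (a j \<boxtimes> y)"] lin lin_comp[OF \<phi>l[OF j]] bilinD(1)[OF dact_bilin]) (auto simp: \<phi>c)
    also have "\<dots> = SW HH (\<lambda>b1 b2. \<phi> j (x \<bullet> S b1) \<odot>\<^bsub>HH\<^esub> dact (a j \<boxtimes> y) b2) \<beta>"
      using j H y aH module_homsD(3)[OF bilinD(1)[OF dact_bilin]]
      by (intro sw_cong lin lin_comp[OF \<phi>l[OF j]]) (auto simp: \<phi>c)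
    finally show ?thesis .
  qed
  then have "(\<Oplus>\<^bsub>HH\<^esub>j\<in>{..<n}. dact (a j \<boxtimes> y) (SW H (\<lambda>b1 b2. \<phi> j (x \<bullet> S b1) \<odot>\<^bsub>H\<^esub> b2) \<beta>)) =
    (\<Oplus>\<^bsub>HH\<^esub>j\<in>{..<n}. SW HH (\<lambda>b1 b2. \<phi> j (x \<bullet> S b1) \<odot>\<^bsub>HH\<^esub> dact (a j \<boxtimes> y) b2) \<beta>)"
    using H y aH
    by (intro abelian_monoid.finsum_cong'[OF abelian_group.axioms(1)[OF module_abelian[OF HH_module]]])
      (auto intro!: sw_closed lin lin_comp[OF \<phi>l] simp: \<phi>c)
  also have "\<dots> = SW HH (\<lambda>b1 b2. \<Oplus>\<^bsub>HH\<^esub>j\<in>{..<n}. \<phi> j (x \<bullet> S b1) \<odot>\<^bsub>HH\<^esub> dact (a j \<boxtimes> y) b2) \<beta>"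
    using H y aH by (intro sw_finsum[symmetric]) (auto intro!: lin lin_comp[OF \<phi>l] simp: \<phi>c)
  also have "\<dots> = SW HH (\<lambda>b1 b2. SW HH (\<lambda>b3 b4. ((x \<bullet> (S b1 \<bullet> b3)) \<boxtimes> (y \<bullet> b4))) b2) \<beta>"
  proof (rule sw_sub_cong[OF A HH_module])
    fix b1 b2 assume bb: "b1 \<in> A" "b2 \<in> A"
    then have bbH: "b1 \<in> carrier H" "b2 \<in> carrier H" using AD by blast+
    have "(\<Oplus>\<^bsub>HH\<^esub>j\<in>{..<n}. \<phi> j (x \<bullet> S b1) \<odot>\<^bsub>HH\<^esub> dact (a j \<boxtimes> y) b2) = dact ((x \<bullet> S b1) \<boxtimes> y) b2"
      using bbH x bb AD y by (intro sum[of "\<lambda>z. dact (z \<boxtimes> y) b2"] lin) auto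
    also have "\<dots> = SW HH (\<lambda>b3 b4. ((x \<bullet> (S b1 \<bullet> b3)) \<boxtimes> (y \<bullet> b4))) b2"
      using bbH H y by (subst dact_pure; (intro sw_cong lin)?; simp add: H_assoc)
    finally show "(\<Oplus>\<^bsub>HH\<^esub>j\<in>{..<n}. \<phi> j (x \<bullet> S b1) \<odot>\<^bsub>HH\<^esub> dact (a j \<boxtimes> y) b2) =
      SW HH (\<lambda>b3 b4. ((x \<bullet> (S b1 \<bullet> b3)) \<boxtimes> (y \<bullet> b4))) b2" .
  qed (use H \<beta> aH y in \<open>auto intro!: lin lin_comp[OF \<phi>l] simp: \<phi>c HHs\<close>)
  also have "\<dots> = (x \<bullet> \<one>\<^sub>H) \<boxtimes> (y \<bullet> \<beta>)"
    using H y by (intro sw_cancel12(2)[OF cancelling_S(1) HH_module, where f="\<lambda>u v. (x \<bullet> u) \<boxtimes> (y \<bullet> v)"] lin) auto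
  finally show "(\<Oplus>\<^bsub>HH\<^esub>j\<in>{..<n}. dact (a j \<boxtimes> y) (SW H (\<lambda>b1 b2. \<phi> j (x \<bullet> S b1) \<odot>\<^bsub>H\<^esub> b2) \<beta>)) = x \<boxtimes> (y \<bullet> \<beta>)"
    using H by (simp add: H_r_one)
  have "dact (y \<boxtimes> a j) (SW H (\<lambda>b1 b2. \<phi> j (x \<bullet> S b2) \<odot>\<^bsub>H\<^esub> b1) \<beta>) =
      SW HH (\<lambda>b1 b2. \<phi> j (x \<bullet> S b2) \<odot>\<^bsub>HH\<^esub> dact (y \<boxtimes> a j) b1) \<beta>" if j: "j < n" for j
  proof -
    have "dact (y \<boxtimes> a j) (SW H (\<lambda>b1 b2. \<phi> j (x \<bullet> S b2) \<odot>\<^bsub>H\<^esub> b1) \<beta>) =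
      SW HH (\<lambda>b1 b2. dact (y \<boxtimes> a j) (\<phi> j (x \<bullet> S b2) \<odot>\<^bsub>H\<^esub> b1)) \<beta>"
      using j H y aH by (intro sw_comp[where g="dact (y \<boxtimes> a j)"] lin lin_comp[OF \<phi>l[OF j]] bilinD(1)[OF dact_bilin]) (auto simp: \<phi>c)
    also have "\<dots> = SW HH (\<lambda>b1 b2. \<phi> j (x \<bullet> S b2) \<odot>\<^bsub>HH\<^esub> dact (y \<boxtimes> a j) b1) \<beta>"
      using j H y aH module_homsD(3)[OF bilinD(1)[OF dact_bilin]]
      by (intro sw_cong lin lin_comp[OF \<phi>l[OF j]]) (auto simp: \<phi>c)
    finally show ?thesis .
  qed
  then have "(\<Oplus>\<^bsub>HH\<^esub>j\<in>{..<n}. dact (y \<boxtimes> a j) (SW H (\<lambda>b1 b2. \<phi> j (x \<bullet> S b2) \<odot>\<^bsub>H\<^esub> b1) \<beta>)) =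
    (\<Oplus>\<^bsub>HH\<^esub>j\<in>{..<n}. SW HH (\<lambda>b1 b2. \<phi> j (x \<bullet> S b2) \<odot>\<^bsub>HH\<^esub> dact (y \<boxtimes> a j) b1) \<beta>)"
    using H y aH
    by (intro abelian_monoid.finsum_cong'[OF abelian_group.axioms(1)[OF module_abelian[OF HH_module]]])
      (auto intro!: sw_closed lin lin_comp[OF \<phi>l] simp: \<phi>c)
  also have "\<dots> = SW HH (\<lambda>b1 b2. \<Oplus>\<^bsub>HH\<^esub>j\<in>{..<n}. \<phi> j (x \<bullet> S b2) \<odot>\<^bsub>HH\<^esub> dact (y \<boxtimes> a j) b1) \<beta>"
    using H y aH by (intro sw_finsum[symmetric]) (auto intro!: lin lin_comp[OF \<phi>l] simp: \<phi>c)
  also have "\<dots> = SW HH (\<lambda>b1 b2. SW HH (\<lambda>b3 b4. ((y \<bullet> b3) \<boxtimes> (x \<bullet> (S b2 \<bullet> b4)))) b1) \<beta>"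
  proof (rule sw_sub_cong[OF A HH_module])
    fix b1 b2 assume bb: "b1 \<in> A" "b2 \<in> A"
    then have bbH: "b1 \<in> carrier H" "b2 \<in> carrier H" using AD by blast+
    have "(\<Oplus>\<^bsub>HH\<^esub>j\<in>{..<n}. \<phi> j (x \<bullet> S b2) \<odot>\<^bsub>HH\<^esub> dact (y \<boxtimes> a j) b1) = dact (y \<boxtimes> (x \<bullet> S b2)) b1"
      using bbH x bb AD y by (intro sum[of "\<lambda>z. dact (y \<boxtimes> z) b1"] lin) auto
    also have "\<dots> = SW HH (\<lambda>b3 b4. ((y \<bullet> b3) \<boxtimes> (x \<bullet> (S b2 \<bullet> b4)))) b1"
      using bbH H y by (subst dact_pure; (intro sw_cong lin)?; simp add: H_assoc)
    finally show "(\<Oplus>\<^bsub>HH\<^esub>j\<in>{..<n}. \<phi> j (x \<bullet> S b2) \<odot>\<^bsub>HH\<^esub> dact (y \<boxtimes> a j) b1) =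
      SW HH (\<lambda>b3 b4. ((y \<bullet> b3) \<boxtimes> (x \<bullet> (S b2 \<bullet> b4)))) b1" .
  qed (use H \<beta> aH y in \<open>auto intro!: lin lin_comp[OF \<phi>l] simp: \<phi>c HHs\<close>)
  also have "\<dots> = (y \<bullet> \<beta>) \<boxtimes> (x \<bullet> \<one>\<^sub>H)"
    using H y by (intro sw_cancel23(2)[OF cancelling_skew(1) HH_module, where f="\<lambda>u v. (y \<bullet> u) \<boxtimes> (x \<bullet> v)"] lin) auto
  finally show "(\<Oplus>\<^bsub>HH\<^esub>j\<in>{..<n}. dact (y \<boxtimes> a j) (SW H (\<lambda>b1 b2. \<phi> j (x \<bullet> S b2) \<odot>\<^bsub>H\<^esub> b1) \<beta>)) = (y \<bullet> \<beta>) \<boxtimes> x"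
    using H by (simp add: H_r_one)
qed

end

section \<open>Projectivity over subHopf algebras\<close>

text \<open>Extended to a basis of W, the system would still have at most \<open>card J\<close>
  members; it already has that many, so nothing was added and it is a basis.\<close>

lemma (in field) full_dual_sys_spans:
  assumes V: "module R V" and W: "submodule W R V" and J: "finite J" "\<And>j. j \<in> J \<Longrightarrow> w j \<in> carrier V" "W \<subseteq> lin_span R V J w"
    and v: "dual_sys R V {..<m::nat} v \<psi>" "\<And>i. i < m \<Longrightarrow> v i \<in> W" and card: "card J \<le> m" and x: "x \<in> W"
  shows "x \<in> lin_span R V {..<m} v"
proof -
  obtain n a \<phi> where n: "m \<le> n" "dual_sys R V {..<n} a \<phi>" "\<And>i. i < n \<Longrightarrow> a i \<in> W"
    "\<And>i. i < m \<Longrightarrow> a i = v i" "\<And>x. x \<in> W \<Longrightarrow> (\<Oplus>\<^bsub>V\<^esub>i\<in>{..<n}. \<phi> i x \<odot>\<^bsub>V\<^esub> a i) = x"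
    using dual_basis_extend[OF V W J v] by blast
  have "card {..<n} \<le> card J"
    using J n by (intro dual_sys_card_le[OF V J(1) n(2) _ J(2)]) auto
  then have nm: "n = m" using card n(1) by simp
  interpret V: module R V by fact
  note D = dual_sysD[OF n(2)]
  have xV: "x \<in> carrier V" using V.submoduleE(1)[OF W] x by blast
  have "(\<Oplus>\<^bsub>V\<^esub>i\<in>{..<n}. \<phi> i x \<odot>\<^bsub>V\<^esub> a i) = (\<Oplus>\<^bsub>V\<^esub>i\<in>{..<m}. \<phi> i x \<odot>\<^bsub>V\<^esub> v i)"
    unfolding nm using D xV dual_sysD[OF v(1)] n(4) nm by (intro V.M.finsum_cong') auto
  then have "x = (\<Oplus>\<^bsub>V\<^esub>i\<in>{..<m}. \<phi> i x \<odot>\<^bsub>V\<^esub> v i)" using n(5)[OF x] by simp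
  moreover have "\<forall>i\<in>{..<m}. \<phi> i x \<in> carrier R" using D(4) xV nm by simp
  ultimately show ?thesis unfolding lin_span_def by (intro CollectI exI[of _ "\<lambda>i. \<phi> i x"] conjI)
qed

section \<open>Projective endomorphisms and idempotents for B inside A\<close>

locale hopf_pair = inv_hopf k H
  for k :: "('k, 'z) ring_scheme" and H :: "('k, 'h, 'y) hopf_scheme" +
  fixes A B :: "'h set" and m :: nat and w :: "nat \<Rightarrow> 'h"
  assumes A: "subhopf A" and B: "subhopf B" and BA: "B \<subseteq> A"
    and w_closed: "\<And>i. i < m \<Longrightarrow> w i \<in> carrier H" and A_span: "A \<subseteq> lin_span k H {..<m} w"
begin

lemmas AD = subhopfD[OF A] and BD = subhopfD[OF B]

lemma A_zero: "\<zero>\<^bsub>H\<^esub> \<in> A"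
  using AD(7)[of "\<zero>\<^bsub>k\<^esub>", OF _ AD(2)] by (simp add: smult_l_null)

lemma A_minus: "x \<in> A \<Longrightarrow> y \<in> A \<Longrightarrow> x \<ominus>\<^bsub>H\<^esub> y \<in> A"
  using module.submoduleE[OF H_module AD(1)] by (simp add: a_minus_def)

text \<open>The finite sums of maps factoring through the regular right module \<open>B\<close>; \<open>A\<close> is a
  projective right \<open>B\<close>-module as soon as one of them is the identity on \<open>A\<close>.\<close>

inductive proj_map :: "('h \<Rightarrow> 'h) \<Rightarrow> bool" where
  base: "y \<in> A \<Longrightarrow> rlinB B \<pi> \<Longrightarrow> proj_map (\<lambda>h. y \<bullet> \<pi> h)"
| add: "proj_map g \<Longrightarrow> proj_map g' \<Longrightarrow> proj_map (\<lambda>h. g h \<oplus>\<^bsub>H\<^esub> g' h)"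
| ext: "proj_map g \<Longrightarrow> (\<And>h. h \<in> carrier H \<Longrightarrow> g' h = g h) \<Longrightarrow> proj_map g'"

lemma rlinBD: "rlinB B \<pi> \<Longrightarrow> rlin B \<pi>" "rlinB B \<pi> \<Longrightarrow> h \<in> carrier H \<Longrightarrow> \<pi> h \<in> B"
  by (simp_all add: rlinB_def)

lemma proj_map_rlin: "proj_map g \<Longrightarrow> rlin B g"
proof (induction rule: proj_map.induct)
  case (base y \<pi>)
  note p = rlinD[OF rlinBD(1)[OF base(2)]]
  have "(\<lambda>h. y \<bullet> \<pi> h) \<in> module_homs k H H" using base AD(5) by (intro hopf_lin p) auto
  then show ?case using base AD(5) BD(5) p by (simp add: rlin_def H_assoc)
next
  case (add g g')
  then show ?case using BD(5) rlinD(3)[OF add.IH(1)] rlinD(3)[OF add.IH(2)]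
    by (simp add: rlin_def H_l_distr) (intro lin_add; simp)
next
  case (ext g g')
  have "g' \<in> module_homs k H H"
    using rlinD[OF ext.IH] ext.hyps(2) module_homsD[OF rlinD(1)[OF ext.IH]]
    by (intro module_homsI) (auto simp: H_add_closed smult_closed)
  then show ?case using ext BD(5) by (simp add: rlin_def)
qed

lemma proj_map_range: "proj_map g \<Longrightarrow> h \<in> carrier H \<Longrightarrow> g h \<in> A"
  by (induction rule: proj_map.induct) (use AD BA rlinBD in \<open>auto simp: subset_iff\<close>)

text \<open>On a generating map the composite is d (y \<pi> h) = d y \<pi> h, of the same shape.
  Since values of such maps lie in A, it is enough that d is additive and right B-linear there; d
  may be given by choice off A.\<close>

lemma proj_map_postcomp:
  assumes "proj_map g"
    and d: "\<And>x. x \<in> A \<Longrightarrow> d x \<in> A" "\<And>x y. x \<in> A \<Longrightarrow> y \<in> A \<Longrightarrow> d (x \<oplus>\<^bsub>H\<^esub> y) = d x \<oplus>\<^bsub>H\<^esub> d y"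
      "\<And>x b. x \<in> A \<Longrightarrow> b \<in> B \<Longrightarrow> d (x \<bullet> b) = d x \<bullet> b"
  shows "proj_map (\<lambda>h. d (g h))"
  using assms(1)
proof (induction rule: proj_map.induct)
  case (base y \<pi>)
  show ?case
    by (rule proj_map.ext[OF proj_map.base[OF d(1)[OF base(1)] base(2)]]) (use base d(3) rlinBD in auto)
next
  case (add g g')
  show ?case
    by (rule proj_map.ext[OF proj_map.add[OF add.IH]]) (use d(2) proj_map_range add.hyps in auto)
next
  case (ext g g')
  show ?case by (rule proj_map.ext[OF ext.IH]) (use ext.hyps in auto)
qed

definition idem :: "('h \<Rightarrow> 'h) \<Rightarrow> bool"
  where "idem e \<longleftrightarrow> proj_map e \<and> (\<forall>h\<in>carrier H. e (e h) = e h)"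

text \<open>For an idempotent e the fixed vectors form the image e A, so this says dim e A \<ge> p.
  A lower bound, and not an exact value, is the form in which p can be maximised over all
  idempotents.\<close>

definition fix_dim_ge :: "('h \<Rightarrow> 'h) \<Rightarrow> nat \<Rightarrow> bool"
  where "fix_dim_ge e p \<longleftrightarrow> (\<exists>a \<phi>. dual_sys k H {..<p} a \<phi> \<and> (\<forall>i<p. e (a i) = a i))"

lemma fix_dim_ge_bound:
  assumes "proj_map e" "fix_dim_ge e p"
  shows "p \<le> m"
proof -
  obtain a \<phi> where a: "dual_sys k H {..<p} a \<phi>" "\<forall>i<p. e (a i) = a i"
    using assms(2) by (auto simp: fix_dim_ge_def)
  have "a i \<in> A" if "i < p" for i
    using proj_map_range[OF assms(1), of "a i"] a(2) dual_sysD(2)[OF a(1)] that by simp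
  then have "card {..<p} \<le> card {..<m}"
    using w_closed A_span by (intro field.dual_sys_card_le[OF k_field H_module _ a(1)]) auto
  then show ?thesis by simp
qed

text \<open>The retraction onto B is such an idempotent. It fixes the unit, and the unit with the
  counit is a dual system of length 1. The final dimension count depends on this first
  vector.\<close>

lemma idem_exists: "\<exists>e. idem e \<and> fix_dim_ge e 1"
proof -
  have B_span: "B \<subseteq> lin_span k H {..<m} w" using BA A_span by blast
  obtain n e \<phi> where e: "dual_sys k H {..<n::nat} e \<phi>" "\<And>i. i < n \<Longrightarrow> e i \<in> B"
    "\<And>x. x \<in> B \<Longrightarrow> (\<Oplus>\<^bsub>H\<^esub>i\<in>{..<n}. \<phi> i x \<odot>\<^bsub>H\<^esub> e i) = x"
    using field.dual_basis[OF k_field H_module BD(1) finite_lessThan _ B_span] w_closed by auto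
  obtain \<rho> where \<rho>: "rlin B \<rho>" "\<And>h. h \<in> carrier H \<Longrightarrow> \<rho> h \<in> B" "\<And>b. b \<in> B \<Longrightarrow> \<rho> b = b"
    using retraction[OF B e] by blast
  have "proj_map (\<lambda>h. \<one>\<^sub>H \<bullet> \<rho> h)" using \<rho> AD(2) by (intro proj_map.base) (auto simp: rlinB_def)
  then have "proj_map \<rho>" by (rule proj_map.ext) (use \<rho> BD(5) in \<open>auto simp: H_l_one\<close>)
  then have "idem \<rho>" using \<rho> by (simp add: idem_def)
  moreover have "fix_dim_ge \<rho> 1"
    unfolding fix_dim_ge_def
    by (rule exI[of _ "\<lambda>_. \<one>\<^sub>H"], rule exI[of _ "\<lambda>_. \<epsilon>"])
      (use \<rho>(3)[OF BD(2)] in \<open>auto simp: dual_sys_def counit_linear counit_one\<close>)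
  ultimately show ?thesis by blast
qed

lemma funpow_proj_map:
  assumes "proj_map g"
  shows "rlin B (g ^^ N)" "x \<in> A \<Longrightarrow> (g ^^ N) x \<in> A" "h \<in> carrier H \<Longrightarrow> (g ^^ Suc N) h \<in> A"
proof -
  note g = rlinD[OF proj_map_rlin[OF assms]]
  show r: "rlin B (g ^^ N)" for N
  proof (induction N)
    case 0
    then show ?case by (simp add: rlin_def id_def)
  next
    case (Suc N)
    note IH = rlinD[OF Suc]
    have "(\<lambda>h. g ((g ^^ N) h)) \<in> module_homs k H H" by (intro lin_comp[OF g(1)] IH)
    then show ?case using IH g BD(5) by (simp add: rlin_def comp_def)
  qed
  show "(g ^^ N) x \<in> A" if "x \<in> A" for x
    using that AD(5) by (induction N) (auto intro: proj_map_range[OF assms])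
  show "(g ^^ Suc N) h \<in> A" if "h \<in> carrier H" for h
    using rlinD(3)[OF r that, of N] by (auto intro: proj_map_range[OF assms])
qed

text \<open>Fitting's lemma: a projective endomorphism annihilated by \<open>e\<close> on both sides is nilpotent, since the
  projection onto its stable image would enlarge the maximal idempotent \<open>e\<close>.\<close>

lemma nilpotent:
  assumes e: "idem e" and p: "fix_dim_ge e p" and max: "\<And>e' p'. idem e' \<Longrightarrow> fix_dim_ge e' p' \<Longrightarrow> p' \<le> p"
    and g: "proj_map g" and eg: "\<And>h. h \<in> carrier H \<Longrightarrow> e (g h) = \<zero>\<^bsub>H\<^esub>" "\<And>h. h \<in> carrier H \<Longrightarrow> g (e h) = \<zero>\<^bsub>H\<^esub>"
  shows "\<exists>N. \<forall>h\<in>carrier H. (g ^^ N) h = \<zero>\<^bsub>H\<^esub>"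
proof -
  have eP: "proj_map e" and ee: "\<And>h. h \<in> carrier H \<Longrightarrow> e (e h) = e h" using e by (auto simp: idem_def)
  note gr = rlinD[OF proj_map_rlin[OF g]] and er = rlinD[OF proj_map_rlin[OF eP]]
  note gN = funpow_proj_map[OF g]
  have gNr: "(g ^^ N) \<in> module_homs k H H" for N using rlinD(1)[OF gN(1)] .
  define U where "U = (\<lambda>N. (g ^^ N) ` A)"
  have U_sub: "submodule (U N) k H" for N
  proof (rule module.submoduleI[OF H_module])
    note l = module_homsD[OF gNr[of N]] and z = hom_zero_minus[OF H_ab H_ab gNr[of N]]
    show "U N \<subseteq> carrier H" using gN(2) AD(5) by (auto simp: U_def)
    show "\<zero>\<^bsub>H\<^esub> \<in> U N" unfolding U_def using z(1) A_zero by (metis imageI)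
    fix a assume "a \<in> U N"
    then obtain x where x: "x \<in> A" "a = (g ^^ N) x" by (auto simp: U_def)
    show "\<ominus>\<^bsub>H\<^esub> a \<in> U N" unfolding U_def
      using x z(2)[of x] AD(5) module.submoduleE(3)[OF H_module AD(1) x(1)] by (metis imageI)
    show "c \<odot>\<^bsub>H\<^esub> a \<in> U N" if "c \<in> carrier k" for c
      unfolding U_def using x l(3)[OF that, of x] AD(5,7) that by (metis imageI)
    fix b assume "b \<in> U N"
    then obtain y where y: "y \<in> A" "b = (g ^^ N) y" by (auto simp: U_def)
    show "a \<oplus>\<^bsub>H\<^esub> b \<in> U N" unfolding U_def using x y l(2)[of x y] AD(5,6) by (metis imageI)
  qed
  have UA: "U N \<subseteq> A" for N using gN(2) by (auto simp: U_def)
  have Ub: "\<exists>n a \<phi>. dual_sys k H {..<n::nat} a \<phi> \<and> (\<forall>i<n. a i \<in> U N) \<and> (\<forall>x\<in>U N. (\<Oplus>\<^bsub>H\<^esub>i\<in>{..<n}. \<phi> i x \<odot>\<^bsub>H\<^esub> a i) = x)" for N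
  proof -
    have "U N \<subseteq> lin_span k H {..<m} w" using UA A_span by blast
    then show ?thesis using field.dual_basis[OF k_field H_module U_sub finite_lessThan, of m w N] w_closed
      by (metis lessThan_iff)
  qed
  \<comment> \<open>The least n is the dimension of the stable image of g. Images are indexed by
    \<open>Suc N\<close> so that the stable image lies in the range of g, where e vanishes.\<close>
  define Q where "Q = (\<lambda>n. \<exists>N a \<phi>. dual_sys k H {..<n::nat} a \<phi> \<and> (\<forall>i<n. a i \<in> U (Suc N)) \<and>
      (\<forall>x\<in>U (Suc N). (\<Oplus>\<^bsub>H\<^esub>i\<in>{..<n}. \<phi> i x \<odot>\<^bsub>H\<^esub> a i) = x))"
  have "\<exists>n. Q n" unfolding Q_def using Ub by blast
  then have "Q (LEAST n. Q n)" by (rule LeastI_ex)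
  then obtain n where n: "Q n" "\<And>n'. Q n' \<Longrightarrow> n \<le> n'" using Least_le by blast
  then obtain N u \<phi> where u: "dual_sys k H {..<n} u \<phi>" "\<And>i. i < n \<Longrightarrow> u i \<in> U (Suc N)"
    "\<And>x. x \<in> U (Suc N) \<Longrightarrow> (\<Oplus>\<^bsub>H\<^esub>i\<in>{..<n}. \<phi> i x \<odot>\<^bsub>H\<^esub> u i) = x" unfolding Q_def by blast
  let ?U = "U (Suc N)"
  note uD = dual_sysD[OF u(1)]
  have UH: "x \<in> carrier H" if "x \<in> ?U" for x using UA that AD(5) by blast
  have Uspan: "?U \<subseteq> lin_span k H {..<n} u"
  proof
    fix x assume x: "x \<in> ?U"
    have "\<forall>i\<in>{..<n}. \<phi> i x \<in> carrier k" using uD(4) UH[OF x] by simp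
    then show "x \<in> lin_span k H {..<n} u" unfolding lin_span_def
      by (intro CollectI exI[of _ "\<lambda>i. \<phi> i x"]) (use u(3)[OF x] in simp)
  qed
  have gU: "g x \<in> ?U" if "x \<in> ?U" for x
  proof -
    obtain y where y: "y \<in> A" "x = (g ^^ Suc N) y" using \<open>x \<in> ?U\<close> by (auto simp: U_def)
    have "g x = (g ^^ Suc N) (g y)" unfolding y(2) by (simp add: funpow_swap1)
    then show ?thesis unfolding U_def using proj_map_range[OF g AD(5)[OF y(1)]] by blast
  qed
  \<comment> \<open>The next image is contained in the present one and, by the choice of n, has at
    least the same dimension; hence the two are equal.\<close>
  have surj: "\<exists>y\<in>?U. g y = x" if x: "x \<in> ?U" for x
  proof -
    obtain n' v \<psi> where v: "dual_sys k H {..<n'::nat} v \<psi>" "\<forall>i<n'. v i \<in> U (Suc (Suc N))"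
      "\<forall>x\<in>U (Suc (Suc N)). (\<Oplus>\<^bsub>H\<^esub>i\<in>{..<n'}. \<psi> i x \<odot>\<^bsub>H\<^esub> v i) = x" using Ub[of "Suc (Suc N)"] by blast
    then have "Q n'" unfolding Q_def by (intro exI[of _ "Suc N"] exI[of _ v] exI[of _ \<psi>] conjI)
    then have nn: "n \<le> n'" by (rule n(2))
    have sub: "U (Suc (Suc N)) \<subseteq> ?U"
    proof
      fix z assume "z \<in> U (Suc (Suc N))"
      then obtain y where "y \<in> A" "z = g ((g ^^ Suc N) y)" by (auto simp: U_def)
      then show "z \<in> ?U" using gU[of "(g ^^ Suc N) y"] by (auto simp: U_def)
    qed
    have "x \<in> lin_span k H {..<n'} v"
      using v(2) sub nn uD by (intro field.full_dual_sys_spans[OF k_field H_module U_sub finite_lessThan _ Uspan v(1) _ _ x]) auto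
    moreover have "lin_span k H {..<n'} v \<subseteq> U (Suc (Suc N))"
      using v(2) by (intro lin_span_least[OF H_module U_sub]) auto
    ultimately have "x \<in> U (Suc (Suc N))" by blast
    then obtain y where "y \<in> A" "x = g ((g ^^ Suc N) y)" by (auto simp: U_def)
    then show ?thesis unfolding U_def by blast
  qed
  have "\<forall>i\<in>{..<n}. \<exists>y. y \<in> ?U \<and> g y = u i" using surj u(2) by blast
  from bchoice[OF this] obtain v where v: "\<And>i. i < n \<Longrightarrow> v i \<in> ?U" "\<And>i. i < n \<Longrightarrow> g (v i) = u i" by auto
  \<comment> \<open>Preimages of a basis under g, with the coordinates composed with g, again form a
    dual system of full length. Thus they span the stable image, and expansion in them shows that g
    is injective on it.\<close>
  have vd: "dual_sys k H {..<n} v (\<lambda>i x. \<phi> i (g x))"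
    unfolding dual_sys_def using v UH uD by (auto intro!: lin_comp[OF uD(3) gr(1)])
  have inj: "x = \<zero>\<^bsub>H\<^esub>" if x: "x \<in> ?U" and gx: "g x = \<zero>\<^bsub>H\<^esub>" for x
  proof -
    have "x \<in> lin_span k H {..<n} v"
      using v(1) uD by (intro field.full_dual_sys_spans[OF k_field H_module U_sub finite_lessThan _ Uspan vd _ _ x]) auto
    then have "(\<Oplus>\<^bsub>H\<^esub>i\<in>{..<n}. \<phi> i (g x) \<odot>\<^bsub>H\<^esub> v i) = x" by (rule dual_sys_expand[OF H_module vd])
    moreover have "(\<Oplus>\<^bsub>H\<^esub>i\<in>{..<n}. \<phi> i (g x) \<odot>\<^bsub>H\<^esub> v i) = (\<Oplus>\<^bsub>H\<^esub>i\<in>{..<n}. \<zero>\<^bsub>H\<^esub>)"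
      using gx v(1) UH hom_zero_minus(1)[OF H_ab module_abelian[OF k_module] uD(3)]
      by (intro M.finsum_cong') (auto simp: smult_l_null)
    ultimately show ?thesis by simp
  qed
  have injN: "x = \<zero>\<^bsub>H\<^esub>" if "x \<in> ?U" "(g ^^ M) x = \<zero>\<^bsub>H\<^esub>" for x M
    using that
  proof (induction M arbitrary: x)
    case (Suc M)
    then have "(g ^^ M) (g x) = \<zero>\<^bsub>H\<^esub>" by (simp add: funpow_swap1)
    then have "g x = \<zero>\<^bsub>H\<^esub>" using Suc.IH gU Suc.prems(1) by blast
    then show ?case using inj Suc.prems(1) by blast
  qed simp
  have surjN: "\<exists>y\<in>?U. (g ^^ M) y = x" if "x \<in> ?U" for x M
    using that
  proof (induction M arbitrary: x)
    case (Suc M)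
    obtain y where y: "y \<in> ?U" "g y = x" using surj Suc.prems by blast
    obtain z where "z \<in> ?U" "(g ^^ M) z = y" using Suc.IH[OF y(1)] by blast
    then show ?case using y by (intro bexI[of _ z]) auto
  qed auto
  let ?G = "g ^^ Suc (Suc N)"
  note GL = module_homsD[OF gNr[of "Suc (Suc N)"]]
  have inj2: "x = y" if "x \<in> ?U" "y \<in> ?U" "?G x = ?G y" for x y
  proof -
    have d: "x \<ominus>\<^bsub>H\<^esub> y \<in> ?U"
      using module.submoduleE(3,5)[OF H_module U_sub] that by (simp add: a_minus_def)
    have "?G (x \<ominus>\<^bsub>H\<^esub> y) = ?G x \<ominus>\<^bsub>H\<^esub> ?G y" using that UH by (intro hom_zero_minus(3)[OF H_ab H_ab gNr])
    also have "\<dots> = \<zero>\<^bsub>H\<^esub>" using that GL(1) UH abelian_group.minus_eq_zero_iff[OF H_ab] by simp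
    finally show ?thesis using injN[OF d] abelian_group.minus_eq_zero_iff[OF H_ab] UH that by blast
  qed
  \<comment> \<open>\<open>d (g h)\<close> is the unique y in the stable image with ?G y = ?G h,
    which is the Fitting projection along the kernel of ?G. The outermost factor g is separated so
    that \<open>proj_map_postcomp\<close> applies to d.\<close>
  define d where "d = (\<lambda>x. SOME y. y \<in> ?U \<and> ?G y = (g ^^ Suc N) x)"
  have d: "d x \<in> ?U" "?G (d x) = (g ^^ Suc N) x" if "x \<in> A" for x
  proof -
    have "(g ^^ Suc N) x \<in> ?U" using that by (auto simp: U_def)
    from surjN[OF this, of "Suc (Suc N)"] have "\<exists>y. y \<in> ?U \<and> ?G y = (g ^^ Suc N) x" by blast
    from someI_ex[OF this] show "d x \<in> ?U" "?G (d x) = (g ^^ Suc N) x" by (auto simp: d_def)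
  qed
  have dI: "d x = y" if "x \<in> A" "y \<in> ?U" "?G y = (g ^^ Suc N) x" for x y
    using inj2[OF d(1)[OF that(1)] that(2)] d(2)[OF that(1)] that(3) by simp
  have Ub_closed: "y \<bullet> b \<in> ?U" if "y \<in> ?U" "b \<in> B" for y b
  proof -
    obtain x where "x \<in> A" "y = (g ^^ Suc N) x" using \<open>y \<in> ?U\<close> by (auto simp: U_def)
    then show ?thesis unfolding U_def
      using rlinD(2)[OF gN(1)[of "Suc N"], of x b] AD(3,5) that(2) BA by (metis imageI subsetD)
  qed
  have dP: "proj_map (\<lambda>h. d (g h))"
  proof (rule proj_map_postcomp[OF g])
    show "d x \<in> A" if "x \<in> A" for x using d(1)[OF that] UA by blast
    show "d (x \<oplus>\<^bsub>H\<^esub> y) = d x \<oplus>\<^bsub>H\<^esub> d y" if xy: "x \<in> A" "y \<in> A" for x y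
    proof (rule dI)
      show "d x \<oplus>\<^bsub>H\<^esub> d y \<in> ?U" using module.submoduleE(5)[OF H_module U_sub] d(1) xy by blast
      show "?G (d x \<oplus>\<^bsub>H\<^esub> d y) = (g ^^ Suc N) (x \<oplus>\<^bsub>H\<^esub> y)"
        using GL(2) UH d xy AD(5) module_homsD(2)[OF gNr[of "Suc N"]] by simp
    qed (use xy AD(6) in blast)
    show "d (x \<bullet> b) = d x \<bullet> b" if xb: "x \<in> A" "b \<in> B" for x b
    proof (rule dI)
      show "d x \<bullet> b \<in> ?U" using Ub_closed d(1) xb by blast
      show "?G (d x \<bullet> b) = (g ^^ Suc N) (x \<bullet> b)"
        using rlinD(2)[OF gN(1)] UH d xb AD(5) by metis
      show "x \<bullet> b \<in> A" using xb AD(3) BA by blast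
    qed
  qed
  let ?e = "\<lambda>h. d (g h)"
  note er' = rlinD[OF proj_map_rlin[OF dP]]
  have e'U: "?e h \<in> ?U" if "h \<in> carrier H" for h using d(1) proj_map_range[OF g that] by blast
  have e'_id: "?e x = x" if "x \<in> ?U" for x
  proof (rule dI[OF proj_map_range[OF g UH[OF that]] that])
    show "?G x = (g ^^ Suc N) (g x)" by (simp add: funpow_swap1)
  qed
  have eU: "e x = \<zero>\<^bsub>H\<^esub>" if x: "x \<in> ?U" for x
  proof -
    obtain y where "y \<in> A" "x = g ((g ^^ N) y)" using x by (auto simp: U_def)
    then show ?thesis using eg(1) rlinD(3)[OF gN(1)] AD(5) by auto
  qed
  have e'e: "?e (e h) = \<zero>\<^bsub>H\<^esub>" if "h \<in> carrier H" for h
  proof -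
    have zU: "\<zero>\<^bsub>H\<^esub> \<in> ?U"
      using e'_id e'U eg(2) module.submoduleE(2)[OF H_module U_sub] by (metis U_def A_zero hom_zero_minus(1)[OF H_ab H_ab gNr] imageI)
    then show ?thesis using eg(2)[OF that] dI[OF A_zero zU] hom_zero_minus(1)[OF H_ab H_ab gNr]
        hom_zero_minus(1)[OF H_ab H_ab gr(1)] by simp
  qed
  have "?U \<subseteq> {\<zero>\<^bsub>H\<^esub>}"
  proof (rule ccontr)
    assume "\<not> ?U \<subseteq> {\<zero>\<^bsub>H\<^esub>}"
    then obtain x where x: "x \<in> ?U" "x \<noteq> \<zero>\<^bsub>H\<^esub>" by blast
    \<comment> \<open>The two idempotents are orthogonal: e vanishes on the stable image because e g
      = 0, and the Fitting projection vanishes on e h because g e = 0. Their sum is therefore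
      idempotent.\<close>
    let ?f = "\<lambda>h. e h \<oplus>\<^bsub>H\<^esub> ?e h"
    have "proj_map ?f" by (intro proj_map.add eP dP)
    moreover have "?f (?f h) = ?f h" if h: "h \<in> carrier H" for h
    proof -
      have 1: "e (?f h) = e h"
        using module_homsD(2)[OF er(1), of "e h" "?e h"] er(3) er'(3) h ee[OF h] eU[OF e'U[OF h]] by simp
      have "?e (?f h) = ?e (e h) \<oplus>\<^bsub>H\<^esub> ?e (?e h)"
        using module_homsD(2)[OF er'(1), of "e h" "?e h"] er(3) er'(3) h by simp
      also have "\<dots> = ?e h" using e'e[OF h] e'_id[OF e'U[OF h]] er'(3)[OF h] by simp
      finally show ?thesis using 1 by simp
    qed
    ultimately have "idem ?f" by (simp add: idem_def)
    moreover have "fix_dim_ge ?f (Suc p)"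
    proof -
      obtain a \<phi> where a: "dual_sys k H {..<p} a \<phi>" "\<forall>i<p. e (a i) = a i" using p by (auto simp: fix_dim_ge_def)
      note aD = dual_sysD[OF a(1)]
      have "submodule {\<zero>\<^bsub>H\<^esub>} k H" by (rule module.submoduleI[OF H_module]) auto
      then obtain f where f: "f \<in> module_homs k H (self_module k)" "f x = \<one>\<^bsub>k\<^esub>"
        using field.functional_separation[OF k_field H_module _ UH[OF x(1)]] x(2) by blast
      define b where "b = (\<lambda>i. if i = p then x else a i)"
      \<comment> \<open>Composition with e and with the Fitting projection separates the two blocks:
        e kills the new vector x, the projection kills every a i.\<close>
      define \<psi> where "\<psi> = (\<lambda>i. if i = p then (\<lambda>h. f (?e h)) else (\<lambda>h. \<phi> i (e h)))"
      have fz: "f \<zero>\<^bsub>H\<^esub> = \<zero>\<^bsub>k\<^esub>" using hom_zero_minus(1)[OF H_ab module_abelian[OF k_module] f(1)] by simp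
      have \<phi>z: "\<phi> i \<zero>\<^bsub>H\<^esub> = \<zero>\<^bsub>k\<^esub>" if "i < p" for i
        using hom_zero_minus(1)[OF H_ab module_abelian[OF k_module] aD(3)] that by simp
      have e'a: "?e (a i) = \<zero>\<^bsub>H\<^esub>" if "i < p" for i using e'e[of "a i"] a(2) that aD(2) by simp
      have "dual_sys k H {..<Suc p} b \<psi>"
        unfolding dual_sys_def
      proof (intro conjI ballI)
        fix i assume i: "i \<in> {..<Suc p}"
        show "b i \<in> carrier H" using i aD(2) UH[OF x(1)] by (auto simp: b_def)
        show "\<psi> i \<in> module_homs k H (self_module k)"
          using i aD(3) by (auto simp: \<psi>_def intro!: lin_comp[OF f(1) er'(1)] lin_comp[OF _ er(1)])
        fix j assume j: "j \<in> {..<Suc p}"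
        show "\<psi> i (b j) = (if i = j then \<one>\<^bsub>k\<^esub> else \<zero>\<^bsub>k\<^esub>)"
          using i j a(2) aD(5) fz \<phi>z e'a eU[OF x(1)] e'_id[OF x(1)] f(2)
          by (auto simp: \<psi>_def b_def less_Suc_eq)
      qed simp
      moreover have "\<forall>i<Suc p. ?f (b i) = b i"
        using a(2) e'a eU[OF x(1)] e'_id[OF x(1)] aD(2) UH[OF x(1)] by (auto simp: b_def less_Suc_eq)
      ultimately show ?thesis unfolding fix_dim_ge_def by blast
    qed
    ultimately show False using max[of ?f "Suc p"] by simp
  qed
  moreover have "?G h \<in> ?U" if "h \<in> carrier H" for h
  proof -
    have "?G h = (g ^^ Suc N) (g h)" by (simp add: funpow_swap1)
    then show ?thesis unfolding U_def using proj_map_range[OF g that] by blast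
  qed
  ultimately have "\<forall>h\<in>carrier H. ?G h = \<zero>\<^bsub>H\<^esub>" by blast
  then show ?thesis by blast
qed

text \<open>\<Xi> is 1 + g + ... up to exponent N - 1, built in Horner form X (i+1) = 1 + X i g. The
  telescoped identity 1 + X i g = X i + g^i becomes \<Xi> (1 - g) = 1 once the last power
  vanishes.\<close>

lemma geometric_series:
  assumes g: "rlin B g" and nil: "\<And>h. h \<in> carrier H \<Longrightarrow> (g ^^ N) h = \<zero>\<^bsub>H\<^esub>"
  obtains \<Xi> where "rlin B \<Xi>" "\<And>h. h \<in> carrier H \<Longrightarrow> \<Xi> (h \<ominus>\<^bsub>H\<^esub> g h) = h"
proof -
  note gr = rlinD[OF g]
  define X where "X = rec_nat (\<lambda>x. \<zero>\<^bsub>H\<^esub>) (\<lambda>_ f x. x \<oplus>\<^bsub>H\<^esub> f (g x))"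
  have X0: "X 0 x = \<zero>\<^bsub>H\<^esub>" and XS: "X (Suc i) x = x \<oplus>\<^bsub>H\<^esub> X i (g x)" for i x by (simp_all add: X_def)
  have r: "rlin B (X i)" for i
  proof (induction i)
    case 0
    have "X 0 = (\<lambda>x. \<zero>\<^bsub>H\<^esub>)" by (simp add: fun_eq_iff X0)
    moreover have "\<zero>\<^bsub>H\<^esub> \<bullet> b = \<zero>\<^bsub>H\<^esub>" if "b \<in> B" for b
      using BD(5)[OF that] ring.ring_simprules(24)[OF H_ring] by simp
    ultimately show ?case using lin_zero[OF H_module H_module] by (simp add: rlin_def)
  next
    case (Suc i)
    note IH = rlinD[OF Suc]
    have "(\<lambda>x. x \<oplus>\<^bsub>H\<^esub> X i (g x)) \<in> module_homs k H H"
      by (intro lin_add lin_id lin_comp[OF IH(1)] gr(1) H_module)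
    moreover have "X (Suc i) = (\<lambda>x. x \<oplus>\<^bsub>H\<^esub> X i (g x))" by (simp add: fun_eq_iff XS)
    ultimately show ?case using IH gr BD(5) by (simp add: rlin_def H_l_distr)
  qed
  have "X i x \<oplus>\<^bsub>H\<^esub> (g ^^ i) x = x \<oplus>\<^bsub>H\<^esub> X i (g x)" if "x \<in> carrier H" for i x
    using that
  proof (induction i arbitrary: x)
    case 0
    then show ?case by (simp add: X0)
  next
    case (Suc i)
    have gx: "g x \<in> carrier H" using gr(3) Suc.prems by blast
    have c: "X i (g x) \<in> carrier H" "(g ^^ i) (g x) \<in> carrier H"
      using rlinD(3)[OF r gx] gx by (simp, induction i) (auto intro: gr(3))
    have "X (Suc i) x \<oplus>\<^bsub>H\<^esub> (g ^^ Suc i) x = x \<oplus>\<^bsub>H\<^esub> (X i (g x) \<oplus>\<^bsub>H\<^esub> (g ^^ i) (g x))"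
      using c Suc.prems by (simp add: XS funpow_swap1 M.a_assoc)
    then show ?case using Suc.IH[OF gx] by (simp add: XS)
  qed
  then have "X N x = x \<oplus>\<^bsub>H\<^esub> X N (g x)" if "x \<in> carrier H" for x
    using that nil[OF that] rlinD(3)[OF r that, of N] by (metis M.r_zero)
  moreover have "X N (x \<ominus>\<^bsub>H\<^esub> g x) = X N x \<ominus>\<^bsub>H\<^esub> X N (g x)" if "x \<in> carrier H" for x
    using that gr(3) by (intro hom_zero_minus(3)[OF H_ab H_ab rlinD(1)[OF r]])
  ultimately have "X N (x \<ominus>\<^bsub>H\<^esub> g x) = x" if "x \<in> carrier H" for x
    using that rlinD(3)[OF r gr(3)[OF that], of N] by (simp add: a_minus_def M.a_assoc M.r_neg)
  then show thesis using that r by blast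
qed

end

lemma (in abelian_group) add_minus_minus:
  assumes "x \<in> carrier G" "y \<in> carrier G" "r \<in> carrier G"
  shows "(x \<oplus> r) \<ominus> (x \<ominus> y) = y \<oplus> r"
proof -
  have "(x \<oplus> r) \<ominus> (x \<ominus> y) = (x \<oplus> \<ominus> x) \<oplus> (y \<oplus> r)"
    using assms by (simp add: a_minus_def minus_add a_ac)
  then show ?thesis using assms by (simp add: r_neg)
qed

lemma submodule_finsum:
  assumes "module R V" "submodule N R V" "finite I" "\<And>i. i \<in> I \<Longrightarrow> g i \<in> N"
  shows "finsum V g I \<in> N"
proof -
  interpret V: module R V by fact
  note subE = V.submoduleE[OF assms(2)]
  have "\<zero>\<^bsub>V\<^esub> \<in> N" using assms(2) subgroup.one_closed[of N "add_monoid V"] by (simp add: submodule_def)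
  from assms(3,4) this show ?thesis
  proof (induction I rule: finite_induct)
    case (insert i I)
    have "g \<in> I \<rightarrow> carrier V" "g i \<in> carrier V" using insert.prems(1) subE(1) by auto
    then show ?case using insert subE(5) by simp
  qed simp
qed

section \<open>The tensor square of A over B, with the diagonal action\<close>

context hopf_pair
begin

abbreviation "TA \<equiv> tensor_span k H H A A"

lemma TA_closed: "t \<in> TA \<Longrightarrow> t \<in> carrier HH"
  using tensor_span_closed[OF H_module H_module _ _] AD(5) by (metis subsetI)

lemma HH_ab: "abelian_group HH" by (rule module_abelian[OF HH_module])

lemmas HH_add_closed = abelian_groupE(1)[OF HH_ab]
lemmas HH_smult_closed = module.smult_closed[OF HH_module]

text \<open>Right \<open>B\<close>-linear maps from \<open>H \<otimes> H\<close> or \<open>H\<close> to \<open>H \<otimes> H\<close> or \<open>H\<close>, where \<open>B\<close> acts diagonally on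
  \<open>H \<otimes> H\<close> and by multiplication on \<open>H\<close>.\<close>

definition bTT where "bTT f \<longleftrightarrow> f \<in> module_homs k HH HH \<and> (\<forall>t\<in>carrier HH. \<forall>b\<in>B. f (dact t b) = dact (f t) b)"
definition bTH where "bTH f \<longleftrightarrow> f \<in> module_homs k HH H \<and> (\<forall>t\<in>carrier HH. \<forall>b\<in>B. f (dact t b) = f t \<bullet> b)"
definition bHT where "bHT f \<longleftrightarrow> f \<in> module_homs k H HH \<and> (\<forall>h\<in>carrier H. \<forall>b\<in>B. f (h \<bullet> b) = dact (f h) b)"

lemma bTTD:
  assumes "bTT f"
  shows "f \<in> module_homs k HH HH" "t \<in> carrier HH \<Longrightarrow> b \<in> B \<Longrightarrow> f (dact t b) = dact (f t) b"
    "t \<in> carrier HH \<Longrightarrow> f t \<in> carrier HH"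
  using assms module_homsD(1)[of f k HH HH] by (auto simp: bTT_def)

lemma bTHD:
  assumes "bTH f"
  shows "f \<in> module_homs k HH H" "t \<in> carrier HH \<Longrightarrow> b \<in> B \<Longrightarrow> f (dact t b) = f t \<bullet> b"
    "t \<in> carrier HH \<Longrightarrow> f t \<in> carrier H"
  using assms module_homsD(1)[of f k HH H] by (auto simp: bTH_def)

lemma bHTD:
  assumes "bHT f"
  shows "f \<in> module_homs k H HH" "h \<in> carrier H \<Longrightarrow> b \<in> B \<Longrightarrow> f (h \<bullet> b) = dact (f h) b"
    "h \<in> carrier H \<Longrightarrow> f h \<in> carrier HH"
  using assms module_homsD(1)[of f k H HH] by (auto simp: bHT_def)

lemma bTT_comp:
  assumes f: "bTT f" and g: "bTT g"
  shows "bTT (\<lambda>t. f (g t))"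
  using lin_comp[OF bTTD(1)[OF f] bTTD(1)[OF g]] bTTD(2,3)[OF f] bTTD(2,3)[OF g] by (simp add: bTT_def)

lemma bTT_add:
  assumes "bTT f" "bTT g" shows "bTT (\<lambda>t. f t \<oplus>\<^bsub>HH\<^esub> g t)"
proof -
  have "(\<lambda>t. f t \<oplus>\<^bsub>HH\<^esub> g t) \<in> module_homs k HH HH"
    by (intro lin_add HH_module bTTD(1) assms)
  moreover have "f (dact t b) \<oplus>\<^bsub>HH\<^esub> g (dact t b) = dact (f t \<oplus>\<^bsub>HH\<^esub> g t) b"
    if "t \<in> carrier HH" "b \<in> B" for t b
    using that bTTD(2,3)[OF assms(1)] bTTD(2,3)[OF assms(2)] module_homsD(2)[OF bilinD(2)[OF dact_bilin]] BD(5)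
    by simp
  ultimately show ?thesis by (simp add: bTT_def)
qed

lemma bHT_comp:
  assumes f: "bTT f" and g: "bHT g"
  shows "bHT (\<lambda>t. f (g t))"
  using lin_comp[OF bTTD(1)[OF f] bHTD(1)[OF g]] bTTD(2,3)[OF f] bHTD(2,3)[OF g] by (simp add: bHT_def)

lemma bHT_rlin:
  assumes f: "bHT f" and g: "rlin B g"
  shows "bHT (\<lambda>t. f (g t))"
  using lin_comp[OF bHTD(1)[OF f] rlinD(1)[OF g]] bHTD(2,3)[OF f] rlinD(2,3)[OF g] by (simp add: bHT_def)

lemma bTT_HT:
  assumes f: "bHT f" and g: "bTH g"
  shows "bTT (\<lambda>t. f (g t))"
  using lin_comp[OF bHTD(1)[OF f] bTHD(1)[OF g]] bHTD(2,3)[OF f] bTHD(2,3)[OF g] by (simp add: bTT_def)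

lemma bTH_comp:
  assumes f: "bTH f" and g: "bTT g"
  shows "bTH (\<lambda>t. f (g t))"
  using lin_comp[OF bTHD(1)[OF f] bTTD(1)[OF g]] bTHD(2,3)[OF f] bTTD(2,3)[OF g] by (simp add: bTH_def)

lemma rlin_bTH:
  assumes f: "rlin B f" and g: "bTH g"
  shows "bTH (\<lambda>t. f (g t))"
  using lin_comp[OF rlinD(1)[OF f] bTHD(1)[OF g]] rlinD(2,3)[OF f] bTHD(2,3)[OF g] by (simp add: bTH_def)

lemma dact_TA:
  assumes "t \<in> TA" "b \<in> A"
  shows "dact t b \<in> TA"
  using assms(1)
proof induction
  case (pure x y)
  have "SW HH (\<lambda>b1 b2. (x \<bullet> b1) \<boxtimes> (y \<bullet> b2)) b \<in> TA"
  proof (rule sw_sub_closed[OF A HH_module])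
    show "bilin k H H HH (\<lambda>b1 b2. (x \<bullet> b1) \<boxtimes> (y \<bullet> b2))"
      using pure AD(5) by (intro hopf_lin) auto
    show "(x \<bullet> v) \<boxtimes> (y \<bullet> w) \<in> TA" if "v \<in> A" "w \<in> A" for v w
      using that pure AD(3) by (intro tensor_span.pure)
  qed (rule assms(2), rule tensor_span.add)
  then show ?case using dact_pure pure AD(5) assms(2) by simp
next
  case (add s t)
  then show ?case using module_homsD(2)[OF bilinD(2)[OF dact_bilin]] AD(5) assms(2) TA_closed
    by (simp add: tensor_span.add)
qed

text \<open>The counterpart of \<open>proj_map\<close> for the diagonal action: \<Omega> takes
  values in B, and t0 is the image of the unit under a map from B to A \<otimes> A.\<close>

inductive proj_map_T where
  base: "t0 \<in> TA \<Longrightarrow> bTH \<Omega> \<Longrightarrow> (\<And>t. t \<in> carrier HH \<Longrightarrow> \<Omega> t \<in> B) \<Longrightarrow> proj_map_T (\<lambda>t. dact t0 (\<Omega> t))"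
| add: "proj_map_T g \<Longrightarrow> proj_map_T g' \<Longrightarrow> proj_map_T (\<lambda>h. g h \<oplus>\<^bsub>HH\<^esub> g' h)"
| ext: "proj_map_T g \<Longrightarrow> (\<And>t. t \<in> carrier HH \<Longrightarrow> g' t = g t) \<Longrightarrow> proj_map_T g'"

lemma proj_map_T_bTT: "proj_map_T g \<Longrightarrow> bTT g"
proof (induction rule: proj_map_T.induct)
  case (base t0 \<Omega>)
  have "(\<lambda>t. dact t0 (\<Omega> t)) \<in> module_homs k HH HH"
    using base bTHD(1) TA_closed by (intro lin_dact_r) auto
  then show ?case using base bTHD[OF base(2)] TA_closed BD(5) by (simp add: bTT_def dact_assoc)
next
  case (add g g')
  then show ?case by (intro bTT_add)
next
  case (ext g g')
  have "g' \<in> module_homs k HH HH"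
    using ext.hyps(2) module_homsD[OF bTTD(1)[OF ext.IH]]
    by (intro module_homsI) (auto simp: HH_add_closed HH_smult_closed)
  then show ?case using ext BD(5) by (simp add: bTT_def)
qed

lemma proj_map_T_range: "proj_map_T g \<Longrightarrow> t \<in> carrier HH \<Longrightarrow> g t \<in> TA"
proof (induction rule: proj_map_T.induct)
  case (base t0 \<Omega>)
  then show ?case using BA by (intro dact_TA) auto
qed (auto intro: tensor_span.add)

lemma proj_map_T_precomp: "proj_map_T g \<Longrightarrow> bTT d \<Longrightarrow> proj_map_T (\<lambda>t. g (d t))"
proof (induction rule: proj_map_T.induct)
  case (base t0 \<Omega>)
  show ?case
    by (rule proj_map_T.base[OF base(1) bTH_comp[OF base(2) base.prems]]) (rule base(3)[OF bTTD(3)[OF base.prems]])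
next
  case (add g g')
  then show ?case by (intro proj_map_T.add)
next
  case (ext g g')
  show ?case
    by (rule proj_map_T.ext[OF ext.IH[OF ext.prems]]) (rule ext.hyps(2)[OF bTTD(3)[OF ext.prems]])
qed

text \<open>By B-linearity of p, a generating map t0 \<Omega> becomes p(t0) \<Omega>(d h), which is
  a generating map on H. Endomorphisms of A that pass through a projective endomorphism of A
  \<otimes> A thereby fall under Fitting's lemma.\<close>

lemma proj_map_T_proj_map:
  assumes "proj_map_T g" "bHT d" "bTH p" "\<And>t. t \<in> TA \<Longrightarrow> p t \<in> A"
  shows "proj_map (\<lambda>h. p (g (d h)))"
  using assms(1)
proof (induction rule: proj_map_T.induct)
  case (base t0 \<Omega>)
  note d = bHTD[OF assms(2)] and p = bTHD[OF assms(3)]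
  have "rlinB B (\<lambda>h. \<Omega> (d h))"
    using base(3) d bTHD(2,3)[OF base(2)] lin_comp[OF bTHD(1)[OF base(2)] d(1)] by (simp add: rlinB_def rlin_def)
  then have "proj_map (\<lambda>h. p t0 \<bullet> \<Omega> (d h))" using base assms(4) by (intro proj_map.base)
  then show ?case by (rule proj_map.ext) (use p(2) base d TA_closed in auto)
next
  case (add g g')
  show ?case
    by (rule proj_map.ext[OF proj_map.add[OF add.IH]])
      (use proj_map_T_range[OF add.hyps(1)] proj_map_T_range[OF add.hyps(2)] TA_closed bHTD(3)[OF assms(2)]
        module_homsD(2)[OF bTHD(1)[OF assms(3)]] in auto)
next
  case (ext g g')
  show ?case by (rule proj_map.ext[OF ext.IH]) (use ext.hyps bHTD(3)[OF assms(2)] in auto)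
qed

lemma proj_map_T_finsum:
  assumes "\<And>j. j < (n::nat) \<Longrightarrow> proj_map_T (g j)"
  shows "proj_map_T (\<lambda>t. \<Oplus>\<^bsub>HH\<^esub>j\<in>{..<n}. g j t)"
  using assms
proof (induction n)
  case 0
    have u: "\<one>\<^sub>H \<boxtimes> \<one>\<^sub>H \<in> TA" using AD(2) by (intro tensor_span.pure)
  have z: "\<zero>\<^bsub>H\<^esub> \<in> B" using BD(7)[of "\<zero>\<^bsub>k\<^esub>", OF _ BD(2)] by (simp add: smult_l_null)
  have "\<zero>\<^bsub>H\<^esub> \<bullet> b = \<zero>\<^bsub>H\<^esub>" if "b \<in> B" for b
    using BD(5)[OF that] ring.ring_simprules(24)[OF H_ring] by simp
  then have "bTH (\<lambda>t. \<zero>\<^bsub>H\<^esub>)" using lin_zero[OF H_module HH_module] by (simp add: bTH_def)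
  then have "proj_map_T (\<lambda>t. dact (\<one>\<^sub>H \<boxtimes> \<one>\<^sub>H) \<zero>\<^bsub>H\<^esub>)" using proj_map_T.base[OF u, of "\<lambda>t. \<zero>\<^bsub>H\<^esub>"] z by simp
  moreover have "dact (\<one>\<^sub>H \<boxtimes> \<one>\<^sub>H) \<zero>\<^bsub>H\<^esub> = \<zero>\<^bsub>HH\<^esub>"
    by (rule hom_zero_minus(1)[OF H_ab HH_ab bilinD(1)[OF dact_bilin]]) simp
  ultimately show ?case by simp
next
  case (Suc n)
    have "proj_map_T (\<lambda>t. g n t \<oplus>\<^bsub>HH\<^esub> (\<Oplus>\<^bsub>HH\<^esub>j\<in>{..<n}. g j t))" using Suc by (intro proj_map_T.add) auto
  then show ?case
    by (rule proj_map_T.ext) (use proj_map_T_range[OF Suc.prems] TA_closed in \<open>auto simp: lessThan_Suc abelian_monoid.finsum_insert[OF abelian_group.axioms(1)[OF HH_ab]] Pi_def\<close>)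
qed

end

section \<open>A \<otimes> A in terms of a basis of A\<close>

locale hopf_basis = hopf_pair k H A B m w
  for k :: "('k, 'z) ring_scheme" and H :: "('k, 'h, 'y) hopf_scheme" and A B m w +
  fixes n :: nat and a :: "nat \<Rightarrow> 'h" and \<phi> :: "nat \<Rightarrow> 'h \<Rightarrow> 'k"
  assumes a: "dual_sys k H {..<n} a \<phi>" and aA: "\<And>i. i < n \<Longrightarrow> a i \<in> A"
    and ax: "\<And>x. x \<in> A \<Longrightarrow> (\<Oplus>\<^bsub>H\<^esub>j\<in>{..<n}. \<phi> j x \<odot>\<^bsub>H\<^esub> a j) = x"
begin

lemma \<phi>_lin: "j < n \<Longrightarrow> \<phi> j \<in> module_homs k H (self_module k)"
  and \<phi>_closed: "j < n \<Longrightarrow> x \<in> carrier H \<Longrightarrow> \<phi> j x \<in> carrier k"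
  and aH: "j < n \<Longrightarrow> a j \<in> carrier H"
  using dual_sysD[OF a] by simp_all

text \<open>The tensor product of a projective module with any module is projective for the diagonal
  action. For y \<pi>, the sum of (y \<otimes> a j) acted on by \<open>omL\<close> factors through B
  termwise, and \<open>dact_basis_sum\<close> identifies it with y \<pi> tensored with the identity
  on A \<otimes> A.\<close>

lemma left_extension:
  assumes "proj_map g"
  shows "\<exists>E. proj_map_T E \<and> (\<forall>x\<in>A. \<forall>z\<in>A. E (x \<boxtimes> z) = g x \<boxtimes> z)"
  using assms
proof (induction rule: proj_map.induct)
  case (base y \<pi>)
  note p = rlinD[OF rlinBD(1)[OF base(2)]]
  have yH: "y \<in> carrier H" using base AD by blast
  have om: "omL (\<phi> j) \<pi> t \<in> B" if j: "j < n" and t: "t \<in> carrier HH" for j t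
    using t[unfolded tensor_span_carrier[OF H_module H_module]]
  proof induction
    case (pure x z)
    have "SW H (\<lambda>b1 b2. \<phi> j (z \<bullet> S b2) \<odot>\<^bsub>H\<^esub> b1) (\<pi> x) \<in> B"
      using pure BD(5,6,7) rlinBD(2)[OF base(2)] j
      by (intro sw_sub_closed[OF B H_module]) (auto intro!: hopf_lin lin_comp[OF \<phi>_lin] simp: \<phi>_closed smult_closed)
    then show ?case using pure omL_pure[OF \<phi>_lin[OF j] p(1)] by simp
  next
    case (add s t)
    have "s \<in> carrier HH" "t \<in> carrier HH" using add.hyps tensor_span_carrier[OF H_module H_module] by auto
    then show ?case using add.IH BD(6) module_homsD(2)[OF omL_hom[OF \<phi>_lin[OF j] p(1)]] by simp
  qed
  let ?E = "\<lambda>t. \<Oplus>\<^bsub>HH\<^esub>j\<in>{..<n}. dact (y \<boxtimes> a j) (omL (\<phi> j) \<pi> t)"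
  have "proj_map_T ?E"
  proof (rule proj_map_T_finsum, rule proj_map_T.base)
    fix j assume j: "j < n"
    show "y \<boxtimes> a j \<in> TA" using base aA[OF j] by (intro tensor_span.pure)
    show "bTH (omL (\<phi> j) \<pi>)" unfolding bTH_def
      using omL_hom[OF \<phi>_lin[OF j] p(1)] omL_rlin[OF B \<phi>_lin[OF j] rlinBD(1)[OF base(2)]] by blast
    show "omL (\<phi> j) \<pi> t \<in> B" if "t \<in> carrier HH" for t using om[OF j that] .
  qed
  moreover have "?E (x \<boxtimes> z) = (y \<bullet> \<pi> x) \<boxtimes> z" if xz: "x \<in> A" "z \<in> A" for x z
  proof -
    have xzH: "x \<in> carrier H" "z \<in> carrier H" using xz AD by blast+
    have "?E (x \<boxtimes> z) = (\<Oplus>\<^bsub>HH\<^esub>j\<in>{..<n}. dact (y \<boxtimes> a j) (SW H (\<lambda>b1 b2. \<phi> j (z \<bullet> S b2) \<odot>\<^bsub>H\<^esub> b1) (\<pi> x)))"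
      using xzH yH aH p(3) omL_pure[OF \<phi>_lin p(1)]
      by (intro abelian_monoid.finsum_cong'[OF abelian_group.axioms(1)[OF HH_ab]])
        (auto intro!: dact_closed sw_closed hopf_lin lin_comp[OF \<phi>_lin] simp: \<phi>_closed)
    also have "\<dots> = (y \<bullet> \<pi> x) \<boxtimes> z"
      using rlinBD(2)[OF base(2) xzH(1)] BA xz yH by (intro dact_basis_sum(2)[OF A a ax]) auto
    finally show ?thesis .
  qed
  ultimately show ?case by blast
next
  case (add g g')
  obtain E where E: "proj_map_T E" "\<And>x z. x \<in> A \<Longrightarrow> z \<in> A \<Longrightarrow> E (x \<boxtimes> z) = g x \<boxtimes> z" using add.IH(1) by blast
  obtain E' where E': "proj_map_T E'" "\<And>x z. x \<in> A \<Longrightarrow> z \<in> A \<Longrightarrow> E' (x \<boxtimes> z) = g' x \<boxtimes> z" using add.IH(2) by blast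
  have "E (x \<boxtimes> z) \<oplus>\<^bsub>HH\<^esub> E' (x \<boxtimes> z) = (g x \<oplus>\<^bsub>H\<^esub> g' x) \<boxtimes> z" if "x \<in> A" "z \<in> A" for x z
    using that E(2) E'(2) module_homsD(2)[OF bilinD(2)[OF HH_bilin], of z "g x" "g' x"] AD(5)
      proj_map_range[OF add.hyps(1)] proj_map_range[OF add.hyps(2)] by simp
  then show ?case using proj_map_T.add[OF E(1) E'(1)] by blast
next
  case (ext g g')
  then show ?case using AD(5) by metis
qed

text \<open>The mirror image of the previous lemma, with the projective factor on the right and
  \<open>omR\<close> as the untwisting.\<close>

lemma right_extension:
  assumes "proj_map g"
  shows "\<exists>E. proj_map_T E \<and> (\<forall>x\<in>A. \<forall>z\<in>A. E (x \<boxtimes> z) = x \<boxtimes> g z)"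
  using assms
proof (induction rule: proj_map.induct)
  case (base y \<pi>)
  note p = rlinD[OF rlinBD(1)[OF base(2)]]
  have yH: "y \<in> carrier H" using base AD by blast
  have om: "omR (\<phi> j) \<pi> t \<in> B" if j: "j < n" and t: "t \<in> carrier HH" for j t
    using t[unfolded tensor_span_carrier[OF H_module H_module]]
  proof induction
    case (pure x z)
    have "SW H (\<lambda>b1 b2. \<phi> j (x \<bullet> S b1) \<odot>\<^bsub>H\<^esub> b2) (\<pi> z) \<in> B"
      using pure BD(5,6,7) rlinBD(2)[OF base(2)] j
      by (intro sw_sub_closed[OF B H_module]) (auto intro!: hopf_lin lin_comp[OF \<phi>_lin] simp: \<phi>_closed smult_closed)
    then show ?case using pure omR_pure[OF \<phi>_lin[OF j] p(1)] by simp
  next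
    case (add s t)
    have "s \<in> carrier HH" "t \<in> carrier HH" using add.hyps tensor_span_carrier[OF H_module H_module] by auto
    then show ?case using add.IH BD(6) module_homsD(2)[OF omR_hom[OF \<phi>_lin[OF j] p(1)]] by simp
  qed
  let ?E = "\<lambda>t. \<Oplus>\<^bsub>HH\<^esub>j\<in>{..<n}. dact (a j \<boxtimes> y) (omR (\<phi> j) \<pi> t)"
  have "proj_map_T ?E"
  proof (rule proj_map_T_finsum, rule proj_map_T.base)
    fix j assume j: "j < n"
    show "a j \<boxtimes> y \<in> TA" using base aA[OF j] by (intro tensor_span.pure)
    show "bTH (omR (\<phi> j) \<pi>)" unfolding bTH_def
      using omR_hom[OF \<phi>_lin[OF j] p(1)] omR_rlin[OF B \<phi>_lin[OF j] rlinBD(1)[OF base(2)]] by blast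
    show "omR (\<phi> j) \<pi> t \<in> B" if "t \<in> carrier HH" for t using om[OF j that] .
  qed
  moreover have "?E (x \<boxtimes> z) = x \<boxtimes> (y \<bullet> \<pi> z)" if xz: "x \<in> A" "z \<in> A" for x z
  proof -
    have xzH: "x \<in> carrier H" "z \<in> carrier H" using xz AD by blast+
    have "?E (x \<boxtimes> z) = (\<Oplus>\<^bsub>HH\<^esub>j\<in>{..<n}. dact (a j \<boxtimes> y) (SW H (\<lambda>b1 b2. \<phi> j (x \<bullet> S b1) \<odot>\<^bsub>H\<^esub> b2) (\<pi> z)))"
      using xzH yH aH p(3) omR_pure[OF \<phi>_lin p(1)]
      by (intro abelian_monoid.finsum_cong'[OF abelian_group.axioms(1)[OF HH_ab]])
        (auto intro!: dact_closed sw_closed hopf_lin lin_comp[OF \<phi>_lin] simp: \<phi>_closed)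
    also have "\<dots> = x \<boxtimes> (y \<bullet> \<pi> z)"
      using rlinBD(2)[OF base(2) xzH(2)] BA xz yH by (intro dact_basis_sum(1)[OF A a ax]) auto
    finally show ?thesis .
  qed
  ultimately show ?case by blast
next
  case (add g g')
  obtain E where E: "proj_map_T E" "\<And>x z. x \<in> A \<Longrightarrow> z \<in> A \<Longrightarrow> E (x \<boxtimes> z) = x \<boxtimes> g z" using add.IH(1) by blast
  obtain E' where E': "proj_map_T E'" "\<And>x z. x \<in> A \<Longrightarrow> z \<in> A \<Longrightarrow> E' (x \<boxtimes> z) = x \<boxtimes> g' z" using add.IH(2) by blast
  have "E (x \<boxtimes> z) \<oplus>\<^bsub>HH\<^esub> E' (x \<boxtimes> z) = x \<boxtimes> (g z \<oplus>\<^bsub>H\<^esub> g' z)" if "x \<in> A" "z \<in> A" for x z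
    using that E(2) E'(2) module_homsD(2)[OF bilinD(1)[OF HH_bilin], of x "g z" "g' z"] AD(5)
      proj_map_range[OF add.hyps(1)] proj_map_range[OF add.hyps(2)] by simp
  then show ?case using proj_map_T.add[OF E(1) E'(1)] by blast
next
  case (ext g g')
  then show ?case using AD(5) by metis
qed

text \<open>The coordinates of the untwisting x \<otimes> z \<mapsto> \<Sum> x S(z') \<otimes> z''
  in the basis a of the first factor. Together with the maps \<open>inc j\<close> they present A
  \<otimes> A, with its diagonal action, as n copies of the right B-module A.\<close>

definition "pr j = omR (\<phi> j) (\<lambda>h. h)"
definition "inc j y = dact (a j \<boxtimes> \<one>\<^sub>H) y"

lemma pr:
  assumes j: "j < n"
  shows "bTH (pr j)" "t \<in> TA \<Longrightarrow> pr j t \<in> A"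
proof -
  have id: "rlin B (\<lambda>h. h)" by (simp add: rlin_def)
  note l = rlinD(1)[OF id]
  show "bTH (pr j)" unfolding bTH_def pr_def
    using omR_hom[OF \<phi>_lin[OF j] l] omR_rlin[OF B \<phi>_lin[OF j] id] by blast
  show "pr j t \<in> A" if "t \<in> TA"
    using that
  proof induction
    case (pure x z)
    have "SW H (\<lambda>b1 b2. \<phi> j (x \<bullet> S b1) \<odot>\<^bsub>H\<^esub> b2) z \<in> A"
      using pure AD(5,6,7) j
      by (intro sw_sub_closed[OF A H_module]) (auto intro!: hopf_lin lin_comp[OF \<phi>_lin] simp: \<phi>_closed smult_closed)
    then show ?case using pure AD(5) omR_pure[OF \<phi>_lin[OF j] l] by (simp add: pr_def)
  next
    case (add s t)
    then show ?case using AD(6) TA_closed module_homsD(2)[OF omR_hom[OF \<phi>_lin[OF j] l]] by (simp add: pr_def)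
  qed
qed

lemma inc: "j < n \<Longrightarrow> bHT (inc j)"
  unfolding bHT_def inc_def using aH BD(5) by (auto intro!: lin_dact_r simp: dact_assoc)

lemma inc_pr:
  assumes t: "t \<in> TA"
  shows "(\<Oplus>\<^bsub>HH\<^esub>j\<in>{..<n}. inc j (pr j t)) = t"
proof -
  have AH: "A \<subseteq> carrier H" using AD(5) by blast
  have l: "(\<lambda>t. \<Oplus>\<^bsub>HH\<^esub>j\<in>{..<n}. inc j (pr j t)) \<in> module_homs k HH HH"
    using bTTD(1)[OF bTT_HT[OF inc pr(1)]] by (intro lin_finsum HH_module) auto
  have "(\<Oplus>\<^bsub>HH\<^esub>j\<in>{..<n}. inc j (pr j (x \<boxtimes> z))) = x \<boxtimes> z" if xz: "x \<in> A" "z \<in> A" for x z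
  proof -
    have H: "x \<in> carrier H" "z \<in> carrier H" using xz AD(5) by simp_all
  have "(\<Oplus>\<^bsub>HH\<^esub>j\<in>{..<n}. inc j (pr j (x \<boxtimes> z))) =
    (\<Oplus>\<^bsub>HH\<^esub>j\<in>{..<n}. dact (a j \<boxtimes> \<one>\<^sub>H) (SW H (\<lambda>b1 b2. \<phi> j (x \<bullet> S b1) \<odot>\<^bsub>H\<^esub> b2) z))"
    using H aH omR_pure[OF \<phi>_lin lin_id] unfolding inc_def pr_def
    by (intro abelian_monoid.finsum_cong'[OF abelian_group.axioms(1)[OF HH_ab]])
      (auto intro!: dact_closed sw_closed hopf_lin lin_comp[OF \<phi>_lin] simp: \<phi>_closed)
  also have "\<dots> = x \<boxtimes> (\<one>\<^sub>H \<bullet> z)" using xz by (intro dact_basis_sum(1)[OF A a ax]) auto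
  finally show ?thesis using H by (simp add: H_l_one)
  qed
  then show ?thesis by (rule tensor_span_ext[OF H_module H_module AH AH l lin_id _ t])
qed

text \<open>On n copies of A this applies e to the coordinates below s and leaves the others alone.
  For s = n every coordinate has been moved into e A.\<close>

definition comb :: "('h \<Rightarrow> 'h) \<Rightarrow> nat \<Rightarrow> ('h \<times> 'h \<Rightarrow> 'k) set \<Rightarrow> ('h \<times> 'h \<Rightarrow> 'k) set"
  where "comb e s t = (\<Oplus>\<^bsub>HH\<^esub>j\<in>{..<n}. inc j (if j < s then e (pr j t) else pr j t))"

text \<open>Cancellation of the factors \<open>(1 - e) A\<close>, one at a time: a projective summand \<open>f (A \<otimes> A)\<close> of
  \<open>A \<otimes> A \<cong> A\<^sup>n\<close> already embeds in \<open>(e A)\<^sup>n\<close>.\<close>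

lemma peel:
  assumes e: "idem e" "fix_dim_ge e p" "\<And>e' p'. idem e' \<Longrightarrow> fix_dim_ge e' p' \<Longrightarrow> p' \<le> p"
    and f: "proj_map_T f" and ff: "\<And>t. t \<in> TA \<Longrightarrow> f (f t) = f t" and s: "s \<le> n"
  shows "\<exists>c. bTT c \<and> (\<forall>t\<in>TA. c (comb e s (f t)) = f t)"
  using s
proof (induction s)
  case 0
  have "comb e 0 (f t) = f t" if "t \<in> TA" for t
    using inc_pr[OF proj_map_T_range[OF f TA_closed[OF that]]] by (simp add: comb_def)
  moreover have "bTT (\<lambda>t. t)" by (simp add: bTT_def)
  ultimately show ?case by (intro exI[of _ "\<lambda>t. t"]) simp
next
  case (Suc s)
  then obtain c where c: "bTT c" "\<And>t. t \<in> TA \<Longrightarrow> c (comb e s (f t)) = f t" by auto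
  have sn: "s < n" using Suc.prems by simp
  have eP: "proj_map e" and ee: "\<And>h. h \<in> carrier H \<Longrightarrow> e (e h) = e h" using e(1) by (auto simp: idem_def)
  note er = proj_map_rlin[OF eP]
  note eD = rlinD[OF er] and cD = bTTD[OF c(1)] and fT = proj_map_T_bTT[OF f]
  note fD = bTTD[OF fT] and pD = bTHD[OF pr(1)] and iD = bHTD[OF inc]
  note HHe = abelian_group.minus_eq_zero_iff[OF HH_ab]
  let ?E = "\<lambda>h. h \<ominus>\<^bsub>H\<^esub> e h"
  have El: "?E \<in> module_homs k H H" by (intro lin_minus H_module lin_id eD(1))
  have "?E (h \<bullet> b) = ?E h \<bullet> b" if "h \<in> carrier H" "b \<in> B" for h b
    using that eD(2,3) BD(5) hom_zero_minus(3)[OF H_ab H_ab lin_mul_l[OF _ lin_id], of b h "e h"] by simp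
  then have E: "rlin B ?E" using El by (simp add: rlin_def)
  note ED = rlinD[OF E]
  have EA: "?E x \<in> A" if "x \<in> A" for x using A_minus[OF that] proj_map_range[OF eP AD(5)[OF that]] by simp
  have EE: "?E (?E h) = ?E h" if "h \<in> carrier H" for h
    using that eD(3) ee hom_zero_minus(3)[OF H_ab H_ab eD(1), of h "e h"]
    by (simp add: a_minus_def M.r_neg abelian_group.a_inv_zero[OF H_ab])
  have eE: "e (?E h) = \<zero>\<^bsub>H\<^esub>" "?E (e h) = \<zero>\<^bsub>H\<^esub>" if "h \<in> carrier H" for h
    using that eD(3) ee hom_zero_minus(3)[OF H_ab H_ab eD(1), of h "e h"] by (simp_all add: a_minus_def M.r_neg)
  \<comment> \<open>Only coordinate s changes. v extracts the part of f t in (1 - e) A there, and u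
    sends such a part back through c and f. Their composite \<theta> = v c inc_s (1 - e) passes
    through the projective map f and is killed by e on both sides, so it is nilpotent and 1 -
    \<theta> has a left inverse \<Xi>.\<close>
  define u where "u = (\<lambda>h. f (c (inc s (?E h))))"
  define v where "v = (\<lambda>t. ?E (pr s (f t)))"
  define \<theta> where "\<theta> = (\<lambda>h. v (c (inc s (?E h))))"
  have dH: "bHT (\<lambda>h. c (inc s (?E h)))" by (rule bHT_comp[OF c(1) bHT_rlin[OF inc[OF sn] E]])
  have "proj_map (\<lambda>h. (\<lambda>t. ?E (pr s t)) (f (c (inc s (?E h)))))"
    by (rule proj_map_T_proj_map[OF f dH rlin_bTH[OF E pr(1)[OF sn]]]) (intro EA pr(2) sn)
  then have \<theta>P: "proj_map \<theta>" by (simp add: \<theta>_def v_def)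
  have e\<theta>: "e (\<theta> h) = \<zero>\<^bsub>H\<^esub>" if "h \<in> carrier H" for h
    unfolding \<theta>_def v_def using that by (intro eE pD(3) sn fD(3) cD(3) iD(3) ED(3))
  have z: "pr s \<zero>\<^bsub>HH\<^esub> = \<zero>\<^bsub>H\<^esub>" "f \<zero>\<^bsub>HH\<^esub> = \<zero>\<^bsub>HH\<^esub>" "c \<zero>\<^bsub>HH\<^esub> = \<zero>\<^bsub>HH\<^esub>" "inc s \<zero>\<^bsub>H\<^esub> = \<zero>\<^bsub>HH\<^esub>" "?E \<zero>\<^bsub>H\<^esub> = \<zero>\<^bsub>H\<^esub>"
    using hom_zero_minus(1)[OF HH_ab H_ab pD(1)[OF sn]] hom_zero_minus(1)[OF HH_ab HH_ab fD(1)]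
      hom_zero_minus(1)[OF HH_ab HH_ab cD(1)] hom_zero_minus(1)[OF H_ab HH_ab iD(1)[OF sn]]
      hom_zero_minus(1)[OF H_ab H_ab El] by simp_all
  have \<theta>e: "\<theta> (e h) = \<zero>\<^bsub>H\<^esub>" if "h \<in> carrier H" for h
    unfolding \<theta>_def v_def eE(2)[OF that] z ..
  have "\<exists>N. \<forall>h\<in>carrier H. (\<theta> ^^ N) h = \<zero>\<^bsub>H\<^esub>"
    by (rule nilpotent[OF e(1,2) _ \<theta>P]) (rule e(3) e\<theta> \<theta>e; assumption)+
  then obtain N where N: "\<And>h. h \<in> carrier H \<Longrightarrow> (\<theta> ^^ N) h = \<zero>\<^bsub>H\<^esub>" by blast
  obtain \<Xi> where \<Xi>: "rlin B \<Xi>" "\<And>h. h \<in> carrier H \<Longrightarrow> \<Xi> (h \<ominus>\<^bsub>H\<^esub> \<theta> h) = h"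
    using geometric_series[OF proj_map_rlin[OF \<theta>P] N] by blast
  have vT: "bTH v" unfolding v_def by (rule rlin_bTH[OF E bTH_comp[OF pr(1)[OF sn] fT]])
  have uH: "bHT u" unfolding u_def by (rule bHT_comp[OF fT dH])
  \<comment> \<open>Applying e on coordinate s loses inc_s (v t), so f c returns f t - u (v t),
    while v c returns v t - \<theta> (v t). \<Xi> recovers v t from the latter, and the second
    summand restores the missing u (v t).\<close>
  define c' where "c' = (\<lambda>t. f (c t) \<oplus>\<^bsub>HH\<^esub> u (\<Xi> (v (c t))))"
  have "bTT c'" unfolding c'_def
    by (intro bTT_add bTT_comp[OF fT c(1)] bTT_HT[OF uH rlin_bTH[OF \<Xi>(1) bTH_comp[OF vT c(1)]]])
  moreover have "c' (comb e (Suc s) (f t)) = f t" if t: "t \<in> TA" for t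
  proof -
    have ft: "f t \<in> TA" "f t \<in> carrier HH" using proj_map_T_range[OF f TA_closed[OF t]] TA_closed by blast+
    have pc: "pr j (f t) \<in> carrier H" if "j < n" for j using pD(3)[OF that ft(2)] .
    have vt: "v t \<in> carrier H" using bTHD(3)[OF vT TA_closed[OF t]] .
    let ?g = "\<lambda>s j. inc j (if j < s then e (pr j (f t)) else pr j (f t))"
    have gc: "?g s' j \<in> carrier HH" if "j < n" for s' j
      using that iD(3) pc eD(3) by auto
    have split: "comb e s' (f t) = ?g s' s \<oplus>\<^bsub>HH\<^esub> (\<Oplus>\<^bsub>HH\<^esub>j\<in>{..<n} - {s}. ?g s' j)" for s'
    proof -
      have "{..<n} = insert s ({..<n} - {s})" using sn by auto
      then have "comb e s' (f t) = (\<Oplus>\<^bsub>HH\<^esub>j\<in>insert s ({..<n} - {s}). ?g s' j)" by (simp add: comb_def)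
      also have "\<dots> = ?g s' s \<oplus>\<^bsub>HH\<^esub> (\<Oplus>\<^bsub>HH\<^esub>j\<in>{..<n} - {s}. ?g s' j)"
        using gc sn by (intro abelian_monoid.finsum_insert[OF abelian_group.axioms(1)[OF HH_ab]]) auto
      finally show ?thesis .
    qed
    have rest: "(\<Oplus>\<^bsub>HH\<^esub>j\<in>{..<n} - {s}. ?g (Suc s) j) = (\<Oplus>\<^bsub>HH\<^esub>j\<in>{..<n} - {s}. ?g s j)" (is "?R' = ?R")
    proof (rule abelian_monoid.finsum_cong'[OF abelian_group.axioms(1)[OF HH_ab]])
      show "?g (Suc s) j = ?g s j" if "j \<in> {..<n} - {s}" for j using that by (simp add: less_Suc_eq)
    qed (use gc in auto)
    have Rc: "?R \<in> carrier HH"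
      using gc by (intro abelian_monoid.finsum_closed[OF abelian_group.axioms(1)[OF HH_ab]]) auto
    have vts: "inc s (v t) = inc s (pr s (f t)) \<ominus>\<^bsub>HH\<^esub> inc s (e (pr s (f t)))"
      unfolding v_def using pc[OF sn] eD(3) by (intro hom_zero_minus(3)[OF H_ab HH_ab iD(1)[OF sn]])
    have cs: "comb e s (f t) = inc s (pr s (f t)) \<oplus>\<^bsub>HH\<^esub> ?R" using split[of s] by simp
    have cS: "comb e (Suc s) (f t) = inc s (e (pr s (f t))) \<oplus>\<^bsub>HH\<^esub> ?R" using split[of "Suc s"] rest by simp
    have cl: "inc s (pr s (f t)) \<in> carrier HH" "inc s (e (pr s (f t))) \<in> carrier HH" "inc s (v t) \<in> carrier HH"
      using iD(3)[OF sn] pc[OF sn] eD(3) vt by auto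
    have combc: "comb e s (f t) \<in> carrier HH" unfolding cs using cl Rc HH_add_closed by blast
    have "comb e (Suc s) (f t) = comb e s (f t) \<ominus>\<^bsub>HH\<^esub> inc s (v t)"
      unfolding cs cS vts by (rule abelian_group.add_minus_minus[OF HH_ab cl(1,2) Rc, symmetric])
    then have T1: "c (comb e (Suc s) (f t)) = f t \<ominus>\<^bsub>HH\<^esub> c (inc s (v t))"
      using hom_zero_minus(3)[OF HH_ab HH_ab cD(1) combc cl(3)] c(2)[OF t] by simp
    have Ev: "?E (v t) = v t" unfolding v_def using EE pc[OF sn] by simp
    have civ: "c (inc s (v t)) \<in> carrier HH" using cD(3) cl(3) by blast
    have uv: "u (v t) = f (c (inc s (v t)))" unfolding u_def Ev ..
    have tv: "\<theta> (v t) = v (c (inc s (v t)))" unfolding \<theta>_def Ev ..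
    have F: "f (c (comb e (Suc s) (f t))) = f t \<ominus>\<^bsub>HH\<^esub> u (v t)"
      unfolding T1 uv using hom_zero_minus(3)[OF HH_ab HH_ab fD(1) ft(2) civ] ff[OF t] by simp
    have "v (f t) = v t" unfolding v_def ff[OF t] ..
    then have "v (c (comb e (Suc s) (f t))) = v t \<ominus>\<^bsub>H\<^esub> \<theta> (v t)"
      unfolding T1 tv using hom_zero_minus(3)[OF HH_ab H_ab bTHD(1)[OF vT] ft(2) civ] by simp
    then have V: "u (\<Xi> (v (c (comb e (Suc s) (f t))))) = u (v t)" using \<Xi>(2)[OF vt] by simp
    have "u (v t) \<in> carrier HH" using bHTD(3)[OF uH vt] .
    then show ?thesis unfolding c'_def F V using ft(2)
      by (simp add: a_minus_def HHM.M.a_assoc HHM.M.l_neg)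
  qed
  ultimately show ?case by blast
qed

text \<open>This is 1 - (1 - e) \<otimes> (1 - e), the projection onto e A \<otimes> A + A \<otimes>
  e A. Written as E1 + E2 (1 - E1), with E1 and E2 extending e \<otimes> id and id \<otimes> e, it
  visibly stays among the projective maps.\<close>

lemma diagonal_idem:
  assumes "idem e"
  shows "\<exists>f. proj_map_T f \<and> (\<forall>x\<in>A. \<forall>z\<in>A. f (x \<boxtimes> z) = e x \<boxtimes> z \<oplus>\<^bsub>HH\<^esub> (x \<ominus>\<^bsub>H\<^esub> e x) \<boxtimes> e z)"
proof -
  have eP: "proj_map e" and ee: "\<And>h. h \<in> carrier H \<Longrightarrow> e (e h) = e h" using assms by (auto simp: idem_def)
  note eD = rlinD[OF proj_map_rlin[OF eP]]
  obtain E1 where E1: "proj_map_T E1" "\<And>x z. x \<in> A \<Longrightarrow> z \<in> A \<Longrightarrow> E1 (x \<boxtimes> z) = e x \<boxtimes> z"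
    using left_extension[OF eP] by blast
  obtain E2 where E2: "proj_map_T E2" "\<And>x z. x \<in> A \<Longrightarrow> z \<in> A \<Longrightarrow> E2 (x \<boxtimes> z) = x \<boxtimes> e z"
    using right_extension[OF eP] by blast
  note l1 = bTTD[OF proj_map_T_bTT[OF E1(1)]]
  let ?D = "\<lambda>t. t \<ominus>\<^bsub>HH\<^esub> E1 t"
  have "?D (dact t b) = dact (?D t) b" if "t \<in> carrier HH" "b \<in> B" for t b
    using that l1(2,3) BD(5) hom_zero_minus(3)[OF HH_ab HH_ab lin_dact_l[OF _ lin_id], of b t "E1 t"] by simp
  moreover have "?D \<in> module_homs k HH HH" by (intro lin_minus HH_module lin_id l1(1))
  ultimately have D: "bTT ?D" by (simp add: bTT_def)
  have "E1 (x \<boxtimes> z) \<oplus>\<^bsub>HH\<^esub> E2 (?D (x \<boxtimes> z)) = e x \<boxtimes> z \<oplus>\<^bsub>HH\<^esub> (x \<ominus>\<^bsub>H\<^esub> e x) \<boxtimes> e z" if xz: "x \<in> A" "z \<in> A" for x z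
  proof -
    have H: "x \<in> carrier H" "z \<in> carrier H" using xz AD by blast+
    have "?D (x \<boxtimes> z) = (x \<ominus>\<^bsub>H\<^esub> e x) \<boxtimes> z"
      using E1(2)[OF xz] hom_zero_minus(3)[OF H_ab HH_ab lin_HH_l[OF _ lin_id], of z x "e x"] H eD(3) by simp
    moreover have "x \<ominus>\<^bsub>H\<^esub> e x \<in> A" using A_minus[OF xz(1)] proj_map_range[OF eP H(1)] by simp
    ultimately show ?thesis using E1(2) E2(2) xz by simp
  qed
  then show ?thesis using proj_map_T.add[OF E1(1) proj_map_T_precomp[OF E2(1) D]] by blast
qed

end

text \<open>Take an idempotent e with p = dim e A as large as possible and put n = dim A. If p < n,
  the diagonal idempotent fixes at least n p + 1 independent tensors, while \<open>peel\<close>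
  embeds its image in n copies of e A, of dimension n p.\<close>

lemma (in hopf_pair) projective: "\<exists>e. proj_map e \<and> (\<forall>x\<in>A. e x = x)"
proof -
  define P where "P = (\<lambda>p. \<exists>e. idem e \<and> fix_dim_ge e p)"
  have "P 1" using idem_exists by (simp add: P_def)
  moreover have "p \<le> m" if "P p" for p using that fix_dim_ge_bound by (auto simp: P_def idem_def)
  ultimately obtain p where Pp: "P p" and Pmax: "\<And>p'. P p' \<Longrightarrow> p' \<le> p"
    using ex_has_greatest_nat[of P 1 "\<lambda>n. n" "Suc m"] by (auto simp: less_Suc_eq_le)
  have p1: "1 \<le> p" using Pmax[OF \<open>P 1\<close>] .
  obtain e where e: "idem e" "fix_dim_ge e p" using Pp by (auto simp: P_def)
  have max: "p' \<le> p" if "idem e'" "fix_dim_ge e' p'" for e' p' using that Pmax by (auto simp: P_def)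
  have eP: "proj_map e" and ee: "\<And>h. h \<in> carrier H \<Longrightarrow> e (e h) = e h" using e(1) by (auto simp: idem_def)
  note eD = rlinD[OF proj_map_rlin[OF eP]] and el = module_homsD[OF rlinD(1)[OF proj_map_rlin[OF eP]]]
  define W where "W = {x \<in> A. e x = x}"
  have W: "submodule W k H"
  proof (rule module.submoduleI[OF H_module])
    show "W \<subseteq> carrier H" using AD(5) by (auto simp: W_def)
    show "\<zero>\<^bsub>H\<^esub> \<in> W" using A_zero hom_zero_minus(1)[OF H_ab H_ab eD(1)] by (simp add: W_def)
    show "\<ominus>\<^bsub>H\<^esub> x \<in> W" if "x \<in> W" for x
      using that hom_zero_minus(2)[OF H_ab H_ab eD(1)] AD(5) module.submoduleE(3)[OF H_module AD(1)] by (simp add: W_def)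
  qed (use AD el in \<open>auto simp: W_def\<close>)
  have WA: "W \<subseteq> A" by (auto simp: W_def)
  then have WH: "x \<in> carrier H" if "x \<in> W" for x using that AD(5) by blast
  obtain a0 \<phi>0 where a0: "dual_sys k H {..<p} a0 \<phi>0" "\<And>i. i < p \<Longrightarrow> a0 i \<in> W"
  proof -
    obtain a0 \<phi>0 where a0: "dual_sys k H {..<p} a0 \<phi>0" "\<forall>i<p. e (a0 i) = a0 i"
      using e(2) unfolding fix_dim_ge_def by blast
    have "a0 i \<in> W" if "i < p" for i
      using proj_map_range[OF eP, of "a0 i"] a0(2) dual_sysD(2)[OF a0(1)] that by (simp add: W_def)
    then show thesis using that a0(1) by blast
  qed
  have wc: "\<And>j. j \<in> {..<m} \<Longrightarrow> w j \<in> carrier H" using w_closed by simp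
  have Wspan: "W \<subseteq> lin_span k H {..<m} w" using WA A_span by blast
  obtain n0 b \<psi> where b: "p \<le> n0" "dual_sys k H {..<n0::nat} b \<psi>" "\<And>i. i < n0 \<Longrightarrow> b i \<in> W"
    "\<And>i. i < p \<Longrightarrow> b i = a0 i" "\<And>x. x \<in> W \<Longrightarrow> (\<Oplus>\<^bsub>H\<^esub>i\<in>{..<n0}. \<psi> i x \<odot>\<^bsub>H\<^esub> b i) = x"
    by (rule field.dual_basis_extend[OF k_field H_module W finite_lessThan wc Wspan a0]) (assumption, assumption, rule that)
  \<comment> \<open>Any basis of W is a witness for \<open>fix_dim_ge\<close>, so maximality makes p
    the exact dimension of W and not just a lower bound.\<close>
  have "fix_dim_ge e n0" unfolding fix_dim_ge_def using b(2,3) by (auto simp: W_def)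
  then have n0: "n0 = p" using max[OF e(1), of n0] b(1) by (intro le_antisym)
  note b = b(2,3,5)[unfolded n0]
  have bA: "\<And>i. i < p \<Longrightarrow> b i \<in> A" using b(2) WA by blast
  obtain n a \<phi> where a: "p \<le> n" "dual_sys k H {..<n::nat} a \<phi>" "\<And>i. i < n \<Longrightarrow> a i \<in> A"
    "\<And>i. i < p \<Longrightarrow> a i = b i" "\<And>x. x \<in> A \<Longrightarrow> (\<Oplus>\<^bsub>H\<^esub>i\<in>{..<n}. \<phi> i x \<odot>\<^bsub>H\<^esub> a i) = x"
    by (rule field.dual_basis_extend[OF k_field H_module AD(1) finite_lessThan wc A_span b(1) bA]) (assumption, assumption, rule that)
  interpret hb: hopf_basis k H A B m w n a \<phi> by unfold_locales (use a in auto)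
  note aD = dual_sysD[OF a(2)]
  have aW: "a i \<in> W" if "i < p" for i using that a(4) b(2) by simp
  have ea: "e (a i) = a i" if "i < p" for i using aW[OF that] by (simp add: W_def)
  have aH: "a i \<in> carrier H" if "i < n" for i using hb.aH that .
  have "n \<le> p"
  proof (rule ccontr)
    assume "\<not> n \<le> p"
    then have pn: "p < n" by simp
    obtain f where f: "proj_map_T f" "\<And>x z. x \<in> A \<Longrightarrow> z \<in> A \<Longrightarrow> f (x \<boxtimes> z) = e x \<boxtimes> z \<oplus>\<^bsub>HH\<^esub> (x \<ominus>\<^bsub>H\<^esub> e x) \<boxtimes> e z"
      using hb.diagonal_idem[OF e(1)] by blast
    note fD = bTTD[OF proj_map_T_bTT[OF f(1)]]
    have Eminus: "x \<ominus>\<^bsub>H\<^esub> e x \<in> A" if "x \<in> A" for x using A_minus[OF that] proj_map_range[OF eP AD(5)[OF that]] by simp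
    have z0: "\<zero>\<^bsub>H\<^esub> \<boxtimes> y = \<zero>\<^bsub>HH\<^esub>" if "y \<in> carrier H" for y
      using hom_zero_minus(1)[OF H_ab HH_ab bilinD(2)[OF HH_bilin that]] .
    have f1: "f (x \<boxtimes> z) = x \<boxtimes> z" if "x \<in> A" "z \<in> A" "e x = x" for x z
      using f(2)[OF that(1,2)] that AD(5) eD(3) z0 by (simp add: a_minus_def M.r_neg)
    have f2: "f (x \<boxtimes> z) = x \<boxtimes> z" if "x \<in> A" "z \<in> A" "e z = z" for x z
    proof -
      have H: "x \<in> carrier H" "z \<in> carrier H" using that AD(5) by simp_all
      have "e x \<boxtimes> z \<oplus>\<^bsub>HH\<^esub> (x \<ominus>\<^bsub>H\<^esub> e x) \<boxtimes> z = (e x \<oplus>\<^bsub>H\<^esub> (x \<ominus>\<^bsub>H\<^esub> e x)) \<boxtimes> z"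
        using H eD(3) by (intro module_homsD(2)[OF bilinD(2)[OF HH_bilin H(2)], symmetric]) auto
      also have "e x \<oplus>\<^bsub>H\<^esub> (x \<ominus>\<^bsub>H\<^esub> e x) = x"
        using H eD(3)[OF H(1)] by (simp add: a_minus_def M.a_ac M.r_neg1 M.r_neg2 M.r_neg)
      finally show ?thesis using f(2)[OF that(1,2)] that(3) by simp
    qed
    have AH: "A \<subseteq> carrier H" using AD(5) by blast
    have ff: "f (f t) = f t" if t: "t \<in> TA" for t
    proof (rule tensor_span_ext[OF H_module H_module AH AH lin_comp[OF fD(1) fD(1)] fD(1) _ t])
      fix x z assume xz: "x \<in> A" "z \<in> A"
      then have H: "x \<in> carrier H" "z \<in> carrier H" using AD(5) by simp_all
      have exA: "e x \<in> A" "e z \<in> A" using proj_map_range[OF eP] H by blast+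
      have "f (f (x \<boxtimes> z)) = f (e x \<boxtimes> z) \<oplus>\<^bsub>HH\<^esub> f ((x \<ominus>\<^bsub>H\<^esub> e x) \<boxtimes> e z)"
        unfolding f(2)[OF xz] using H exA AD(5) Eminus[OF xz(1)] by (intro module_homsD(2)[OF fD(1)]) auto
      also have "f (e x \<boxtimes> z) = e x \<boxtimes> z" using exA xz ee[OF H(1)] by (intro f1)
      also have "f ((x \<ominus>\<^bsub>H\<^esub> e x) \<boxtimes> e z) = (x \<ominus>\<^bsub>H\<^esub> e x) \<boxtimes> e z" using exA Eminus[OF xz(1)] ee[OF H(2)] by (intro f2)
      finally show "f (f (x \<boxtimes> z)) = f (x \<boxtimes> z)" using f(2)[OF xz] by simp
    qed
    have pl: "\<exists>c. bTT c \<and> (\<forall>t\<in>TA. c (hb.comb e n (f t)) = f t)"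
    proof (rule hb.peel)
      show "idem e" "fix_dim_ge e p" "proj_map_T f" by (fact e f)+
      show "p' \<le> p" if "idem e'" "fix_dim_ge e' p'" for e' p' using max that by blast
      show "f (f t) = f t" if "t \<in> TA" for t using ff that by blast
    qed simp
    obtain c where c: "bTT c" "\<And>t. t \<in> TA \<Longrightarrow> c (hb.comb e n (f t)) = f t"
      using pl by blast
    \<comment> \<open>\<open>comb e n\<close> is factored as G F through A \<otimes> e A, whose
      dimension n p is visible: F records the coordinates e (pr j t) against the basis vectors a j,
      and G puts them back by \<open>inc j\<close>.\<close>
    define F where "F = (\<lambda>t. \<Oplus>\<^bsub>HH\<^esub>j\<in>{..<n}. a j \<boxtimes> e (hb.pr j t))"
    define G where "G = tensor_lift k HH (\<lambda>x y. \<Oplus>\<^bsub>HH\<^esub>j\<in>{..<n}. hb.inc j (\<phi> j x \<odot>\<^bsub>H\<^esub> y))"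
    define \<Phi> where "\<Phi> = (\<lambda>q. tensor_lift k (self_module k) (\<lambda>x y. \<phi> (fst q) x \<odot>\<^bsub>self_module k\<^esub> \<phi> (snd q) y))"
    have pD: "hb.pr j t \<in> carrier H" if "j < n" "t \<in> carrier HH" for j t using bTHD(3)[OF hb.pr(1)] that .
    have Gb: "bilin k H H HH (\<lambda>x y. \<Oplus>\<^bsub>HH\<^esub>j\<in>{..<n}. hb.inc j (\<phi> j x \<odot>\<^bsub>H\<^esub> y))"
      using hb.\<phi>_closed hb.\<phi>_lin
      by (intro bilinI lin_finsum HH_module H_module lin_comp[OF bHTD(1)[OF hb.inc]] lin_smult lin_smult_l lin_id) auto
    note Gl = tensor_lift_hom[OF H_module H_module HH_module Gb, folded G_def]
      and Gp = tensor_lift_pure[OF H_module H_module HH_module Gb, folded G_def]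
    have Ga: "G (a j \<boxtimes> y) = hb.inc j y" if j: "j < n" and y: "y \<in> carrier H" for j y
    proof -
      have "G (a j \<boxtimes> y) = (\<Oplus>\<^bsub>HH\<^esub>l\<in>{..<n}. if j = l then hb.inc l y else \<zero>\<^bsub>HH\<^esub>)"
        unfolding Gp[OF aH[OF j] y]
      proof (rule abelian_monoid.finsum_cong'[OF abelian_group.axioms(1)[OF HH_ab] refl])
        show "(\<lambda>l. if j = l then hb.inc l y else \<zero>\<^bsub>HH\<^esub>) \<in> {..<n} \<rightarrow> carrier HH"
          using bHTD(3)[OF hb.inc] y abelian_groupE(2)[OF HH_ab] by auto
        show "hb.inc l (\<phi> l (a j) \<odot>\<^bsub>H\<^esub> y) = (if j = l then hb.inc l y else \<zero>\<^bsub>HH\<^esub>)" if l: "l \<in> {..<n}" for l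
          using aD(5)[of l j] l j y smult_l_null[OF y] hom_zero_minus(1)[OF H_ab HH_ab bHTD(1)[OF hb.inc]] by auto
      qed
      also have "\<dots> = hb.inc j y"
        using j y bHTD(3)[OF hb.inc]
        by (intro abelian_monoid.finsum_singleton[OF abelian_group.axioms(1)[OF HH_ab]]) auto
      finally show ?thesis .
    qed
    have GF: "G (F t) = hb.comb e n t" if t: "t \<in> carrier HH" for t
    proof -
      have "G (F t) = (\<Oplus>\<^bsub>HH\<^esub>j\<in>{..<n}. G (a j \<boxtimes> e (hb.pr j t)))"
        unfolding F_def using aH pD t eD(3) by (intro hom_finsum[OF HH_ab HH_ab Gl]) auto
      also have "\<dots> = hb.comb e n t" unfolding hb.comb_def
        using t pD eD(3) bHTD(3)[OF hb.inc]
        by (intro abelian_monoid.finsum_cong'[OF abelian_group.axioms(1)[OF HH_ab]]) (auto simp: Ga)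
      finally show ?thesis .
    qed
    have \<Phi>b: "bilin k H H (self_module k) (\<lambda>x y. \<phi> i x \<odot>\<^bsub>self_module k\<^esub> \<phi> j y)" if "i < n" "j < n" for i j
      using that hb.\<phi>_closed hb.\<phi>_lin
      by (intro bilinI lin_smult lin_smult_l k_module) auto
    \<comment> \<open>The n p pairs with second index below p, and one more. The tensor for (0, p)
      is fixed because a 0 lies in e A, which uses p \<ge> 1; the index p exists in the basis
      because p < n.\<close>
    define I where "I = insert (0, p) ({..<n} \<times> {..<p})"
    have In: "i < n \<and> j < n" if "(i, j) \<in> I" for i j using that pn by (auto simp: I_def)
    have fixed: "f (a i \<boxtimes> a j) = a i \<boxtimes> a j" if ij: "(i, j) \<in> I" for i j
    proof (cases "j < p")
      case True
      then show ?thesis using In[OF ij] a(3) ea by (intro f2) auto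
    next
      case False
      then show ?thesis using ij p1 pn a(3) ea[of 0] by (intro f1) (auto simp: I_def)
    qed
    have taa: "a i \<boxtimes> a j \<in> TA" if "i < n" "j < n" for i j using a(3) that by (intro tensor_span.pure)
    have Fl: "F \<in> module_homs k HH HH" unfolding F_def
      by (intro lin_finsum HH_module lin_HH_r lin_comp[OF eD(1)] bTHD(1)[OF hb.pr(1)]) (auto simp: aH)
    have cGF: "c (G (F (a i \<boxtimes> a j))) = a i \<boxtimes> a j" if ij: "(i, j) \<in> I" for i j
      using c(2)[OF taa, of i j] fixed[OF ij] GF[OF TA_closed[OF taa]] In[OF ij] by simp
    \<comment> \<open>On these fixed tensors c G undoes F. Pulling the functionals \<phi> i
      \<otimes> \<phi> j back along c G therefore makes them dual to the images under F.\<close>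
    have "dual_sys k HH I (\<lambda>q. F (a (fst q) \<boxtimes> a (snd q))) (\<lambda>q t. \<Phi> q (c (G t)))"
      unfolding dual_sys_def
    proof (intro conjI ballI)
      show "finite I" by (simp add: I_def)
      fix q assume q: "q \<in> I"
      obtain i j where ij: "q = (i, j)" "i < n" "j < n" using q In by (cases q) auto
      show "F (a (fst q) \<boxtimes> a (snd q)) \<in> carrier HH"
        using ij aH by (intro module_homsD(1)[OF Fl]) auto
      note \<Phi>l = tensor_lift_hom[OF H_module H_module k_module \<Phi>b[OF ij(2,3)]]
        and \<Phi>p = tensor_lift_pure[OF H_module H_module k_module \<Phi>b[OF ij(2,3)]]
      have \<Phi>q: "\<Phi> q = tensor_lift k (self_module k) (\<lambda>x y. \<phi> i x \<odot>\<^bsub>self_module k\<^esub> \<phi> j y)"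
        by (simp add: \<Phi>_def ij(1))
      show "(\<lambda>t. \<Phi> q (c (G t))) \<in> module_homs k HH (self_module k)"
        unfolding \<Phi>q by (intro lin_comp[OF \<Phi>l] lin_comp[OF bTTD(1)[OF c(1)]] Gl)
      fix r assume r: "r \<in> I"
      obtain i' j' where ij': "r = (i', j')" "i' < n" "j' < n" using r In by (cases r) auto
      have "\<Phi> q (c (G (F (a (fst r) \<boxtimes> a (snd r))))) = \<Phi> q (a i' \<boxtimes> a j')"
        using cGF[of i' j'] r ij'(1) by simp
      also have "\<dots> = \<phi> i (a i') \<otimes>\<^bsub>k\<^esub> \<phi> j (a j')" unfolding \<Phi>q using \<Phi>p[OF aH[OF ij'(2)] aH[OF ij'(3)]] by simp
      also have "\<dots> = (if q = r then \<one>\<^bsub>k\<^esub> else \<zero>\<^bsub>k\<^esub>)"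
        using aD(5)[of i i'] aD(5)[of j j'] ij ij' by (auto simp: k_rules)
      finally show "\<Phi> q (c (G (F (a (fst r) \<boxtimes> a (snd r))))) = (if q = r then \<one>\<^bsub>k\<^esub> else \<zero>\<^bsub>k\<^esub>)" .
    qed
    moreover have "F t \<in> lin_span k HH ({..<n} \<times> {..<p}) (\<lambda>q. a (fst q) \<boxtimes> a (snd q))" if t: "t \<in> TA" for t
    proof -
      let ?L = "lin_span k HH ({..<n} \<times> {..<p}) (\<lambda>q. a (fst q) \<boxtimes> a (snd q))"
      have L: "submodule ?L k HH" using aH pn by (intro lin_span_submodule HH_module) auto
      have aL: "a j \<boxtimes> b l \<in> ?L" if "j < n" "l < p" for j l
        using lin_span_incl[OF HH_module, of "{..<n} \<times> {..<p}" "\<lambda>q. a (fst q) \<boxtimes> a (snd q)" "(j, l)"]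
          that aH pn pure_HH_closed[OF aH aH] a(4)[OF that(2)] by force
      have "a j \<boxtimes> x \<in> ?L" if j: "j < n" and x: "x \<in> W" for j x
      proof -
        note bD = dual_sysD[OF b(1)]
        have "a j \<boxtimes> x = a j \<boxtimes> (\<Oplus>\<^bsub>H\<^esub>l\<in>{..<p}. \<psi> l x \<odot>\<^bsub>H\<^esub> b l)" using b(3)[OF x] by simp
        also have "\<dots> = (\<Oplus>\<^bsub>HH\<^esub>l\<in>{..<p}. a j \<boxtimes> (\<psi> l x \<odot>\<^bsub>H\<^esub> b l))"
          using bD WH[OF x] by (intro hom_finsum[OF H_ab HH_ab bilinD(1)[OF HH_bilin aH[OF j]]]) auto
        also have "\<dots> \<in> ?L"
        proof (rule submodule_finsum[OF HH_module L])
          fix l assume l: "l \<in> {..<p}"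
          have "a j \<boxtimes> (\<psi> l x \<odot>\<^bsub>H\<^esub> b l) = \<psi> l x \<odot>\<^bsub>HH\<^esub> (a j \<boxtimes> b l)"
            using l bD WH[OF x] by (intro module_homsD(3)[OF bilinD(1)[OF HH_bilin aH[OF j]]]) auto
          then show "a j \<boxtimes> (\<psi> l x \<odot>\<^bsub>H\<^esub> b l) \<in> ?L"
            using module.submoduleE(4)[OF HH_module L] aL[OF j] bD WH[OF x] l by simp
        qed simp
        finally show ?thesis .
      qed
      moreover have "e (hb.pr j t) \<in> W" if "j < n" for j
        using proj_map_range[OF eP pD[OF that TA_closed[OF t]]] ee[OF pD[OF that TA_closed[OF t]]] by (simp add: W_def)
      ultimately show ?thesis unfolding F_def by (intro submodule_finsum[OF HH_module L]) auto
    qed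
    ultimately have "card I \<le> card ({..<n} \<times> {..<p})"
      using taa In aH pn by (intro field.dual_sys_card_le[OF k_field HH_module, where w = "\<lambda>q. a (fst q) \<boxtimes> a (snd q)"]) auto
    moreover have "card I = Suc (card ({..<n} \<times> {..<p}))" unfolding I_def by (intro card_insert_disjoint) auto
    ultimately show False by simp
  qed
  then have "n = p" using a(1) by simp
  have "e x = x" if x: "x \<in> A" for x
  proof -
    have "(\<Oplus>\<^bsub>H\<^esub>i\<in>{..<n}. \<phi> i x \<odot>\<^bsub>H\<^esub> a i) \<in> W"
      using aW \<open>n = p\<close> module.submoduleE(4)[OF H_module W] hb.\<phi>_closed AD(5)[OF x]
      by (intro submodule_finsum[OF H_module W]) auto
    then show ?thesis using a(5)[OF x] by (simp add: W_def)
  qed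
  then show ?thesis using eP by blast
qed

section \<open>Finitely presented left modules\<close>

text \<open>Finite generation and finite presentation of a submodule form their sums in a record
  with a restricted carrier. Those sums must be identified with sums in the ambient module.\<close>

lemma sub_abelian:
  assumes "abelian_group M" "subgroup N (add_monoid M)"
  shows "abelian_group (M\<lparr>carrier := N\<rparr>)"
    and "finite I \<Longrightarrow> (\<And>i. i \<in> I \<Longrightarrow> f i \<in> N) \<Longrightarrow> finsum (M\<lparr>carrier := N\<rparr>) f I = finsum M f I"
proof -
  interpret M: abelian_group M by fact
  note N = subgroup.subset[OF assms(2)] subgroup.m_closed[OF assms(2)] subgroup.one_closed[OF assms(2)]
    subgroup.m_inv_closed[OF assms(2)]
  have inv: "\<ominus>\<^bsub>M\<^esub> x \<in> N" if "x \<in> N" for x using N(4)[OF that] by (simp add: a_inv_def)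
  show A: "abelian_group (M\<lparr>carrier := N\<rparr>)"
  proof (rule abelian_groupI)
    fix x assume "x \<in> carrier (M\<lparr>carrier := N\<rparr>)"
    then show "\<exists>y\<in>carrier (M\<lparr>carrier := N\<rparr>). y \<oplus>\<^bsub>M\<lparr>carrier := N\<rparr>\<^esub> x = \<zero>\<^bsub>M\<lparr>carrier := N\<rparr>\<^esub>"
      using inv N(1) M.l_neg by (intro bexI[of _ "\<ominus>\<^bsub>M\<^esub> x"]) auto
  qed (use N in \<open>auto simp: subset_iff M.a_ac\<close>)
  show "finsum (M\<lparr>carrier := N\<rparr>) f I = finsum M f I" if I: "finite I" "\<And>i. i \<in> I \<Longrightarrow> f i \<in> N"
    using I
  proof (induction I)
    case (insert i I)
    interpret N: abelian_group "M\<lparr>carrier := N\<rparr>" by (rule A)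
    have "f \<in> I \<rightarrow> carrier M" "f i \<in> carrier M" using insert N(1) by auto
    then show ?case using insert N.finsum_insert[OF insert(1,2), of f] by (simp add: Pi_iff)
  next
    case empty
    interpret N: abelian_group "M\<lparr>carrier := N\<rparr>" by (rule A)
    show ?case using N.finsum_empty M.finsum_empty by simp
  qed
qed

lemma left_module_abelian: "left_module R M \<Longrightarrow> abelian_group M"
  by (simp add: left_module_def)

lemma left_module_ring: "left_module R M \<Longrightarrow> ring R"
  by (simp add: left_module_def)

lemma left_module_finsum_smult:
  assumes "left_module R M" "finite I" "\<And>i. i \<in> I \<Longrightarrow> f i \<in> carrier M" "a \<in> carrier R"
  shows "a \<odot>\<^bsub>M\<^esub> (\<Oplus>\<^bsub>M\<^esub>i\<in>I. f i) = (\<Oplus>\<^bsub>M\<^esub>i\<in>I. a \<odot>\<^bsub>M\<^esub> f i)"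
proof -
  note A = left_module_abelian[OF assms(1)]
  \<comment> \<open>With an empty carrier of scalars, membership in \<open>module_homs\<close> means
    additivity alone. Multiplication by a is additive but, for noncommutative R, not
    R-linear.\<close>
  have "(\<lambda>x. a \<odot>\<^bsub>M\<^esub> x) \<in> module_homs (R\<lparr>carrier := {}\<rparr>) M M"
    using left_module.lsmult_closed[OF assms(1)] left_module.lsmult_r_distr[OF assms(1)] assms(4)
    by (intro module_homsI) auto
  from hom_finsum[OF A A this assms(2,3)] show ?thesis .
qed

lemma left_lin_span:
  assumes "left_module R M" "finite I" "\<And>i. i \<in> I \<Longrightarrow> w i \<in> carrier M"
  shows "x \<in> lin_span R M I w \<Longrightarrow> y \<in> lin_span R M I w \<Longrightarrow> x \<oplus>\<^bsub>M\<^esub> y \<in> lin_span R M I w"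
    and "a \<in> carrier R \<Longrightarrow> x \<in> lin_span R M I w \<Longrightarrow> a \<odot>\<^bsub>M\<^esub> x \<in> lin_span R M I w"
proof -
  interpret M: left_module R M by fact
  { assume "x \<in> lin_span R M I w" "y \<in> lin_span R M I w"
    then obtain c d where cd: "\<forall>i\<in>I. c i \<in> carrier R" "x = (\<Oplus>\<^bsub>M\<^esub>i\<in>I. c i \<odot>\<^bsub>M\<^esub> w i)"
      "\<forall>i\<in>I. d i \<in> carrier R" "y = (\<Oplus>\<^bsub>M\<^esub>i\<in>I. d i \<odot>\<^bsub>M\<^esub> w i)"
      by (auto simp: lin_span_def)
    have "x \<oplus>\<^bsub>M\<^esub> y = (\<Oplus>\<^bsub>M\<^esub>i\<in>I. c i \<odot>\<^bsub>M\<^esub> w i \<oplus>\<^bsub>M\<^esub> d i \<odot>\<^bsub>M\<^esub> w i)"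
      unfolding cd using cd assms(3) M.lsmult_closed by (intro M.finsum_addf[symmetric]) auto
    also have "\<dots> = (\<Oplus>\<^bsub>M\<^esub>i\<in>I. (c i \<oplus>\<^bsub>R\<^esub> d i) \<odot>\<^bsub>M\<^esub> w i)"
      using cd assms(3) M.lsmult_closed M.lsmult_l_distr by (intro M.finsum_cong') auto
    finally show "x \<oplus>\<^bsub>M\<^esub> y \<in> lin_span R M I w" using cd unfolding lin_span_def by auto }
  { assume a: "a \<in> carrier R" and "x \<in> lin_span R M I w"
    then obtain c where c: "\<forall>i\<in>I. c i \<in> carrier R" "x = (\<Oplus>\<^bsub>M\<^esub>i\<in>I. c i \<odot>\<^bsub>M\<^esub> w i)"
      by (auto simp: lin_span_def)
    have "a \<odot>\<^bsub>M\<^esub> x = (\<Oplus>\<^bsub>M\<^esub>i\<in>I. a \<odot>\<^bsub>M\<^esub> (c i \<odot>\<^bsub>M\<^esub> w i))"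
      unfolding c using c assms M.lsmult_closed a by (intro left_module_finsum_smult[OF assms(1,2)]) auto
    also have "\<dots> = (\<Oplus>\<^bsub>M\<^esub>i\<in>I. (a \<otimes>\<^bsub>R\<^esub> c i) \<odot>\<^bsub>M\<^esub> w i)"
      using c a assms(3) M.lsmult_closed M.lsmult_assoc by (intro M.finsum_cong') auto
    finally show "a \<odot>\<^bsub>M\<^esub> x \<in> lin_span R M I w" using c a unfolding lin_span_def by auto }
qed

lemma (in ring) self_abelian: "abelian_group (self_module R)"
proof (rule abelian_groupI)
  fix x assume "x \<in> carrier (self_module R)"
  then show "\<exists>y\<in>carrier (self_module R). y \<oplus>\<^bsub>self_module R\<^esub> x = \<zero>\<^bsub>self_module R\<^esub>"
    by (intro bexI[of _ "\<ominus> x"]) (auto simp: l_neg)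
qed (auto simp: a_ac)

section \<open>Free left modules of finite rank, and presentations\<close>

lemma free_module_simps:
  "carrier (free_module R n) = {..<n} \<rightarrow>\<^sub>E carrier R"
  "zero (free_module R n) = (\<lambda>i\<in>{..<n}. \<zero>\<^bsub>R\<^esub>)"
  "add (free_module R n) x y = (\<lambda>i\<in>{..<n}. x i \<oplus>\<^bsub>R\<^esub> y i)"
  "smult (free_module R n) a x = (\<lambda>i\<in>{..<n}. a \<otimes>\<^bsub>R\<^esub> x i)"
  by (simp_all add: free_module_def)

lemma free_module_eqI:
  assumes "x \<in> carrier (free_module R n)" "y \<in> carrier (free_module R n)" "\<And>i. i < n \<Longrightarrow> x i = y i"
  shows "x = y"
  using assms by (intro PiE_ext[of x "{..<n}" "\<lambda>_. carrier R"]) (auto simp: free_module_simps)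

lemma (in ring) free_left_module: "left_module R (free_module R n)"
proof (intro left_module.intro left_module_axioms.intro ring_axioms)
  let ?F = "free_module R n"
  have c: "x \<oplus>\<^bsub>?F\<^esub> y \<in> carrier ?F" "\<zero>\<^bsub>?F\<^esub> \<in> carrier ?F" "a \<in> carrier R \<Longrightarrow> a \<odot>\<^bsub>?F\<^esub> x \<in> carrier ?F"
    "(\<lambda>i\<in>{..<n}. \<ominus> x i) \<in> carrier ?F"
    if "x \<in> carrier ?F" "y \<in> carrier ?F" for x y a
    using that by (auto simp: free_module_simps PiE_iff)
  show "abelian_group ?F"
  proof (rule abelian_groupI)
    fix x assume x: "x \<in> carrier ?F"
    show "\<exists>y\<in>carrier ?F. y \<oplus>\<^bsub>?F\<^esub> x = \<zero>\<^bsub>?F\<^esub>"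
      using c[OF x x] x by (intro bexI[of _ "\<lambda>i\<in>{..<n}. \<ominus> x i"] free_module_eqI[of _ R n] c)
        (auto simp: free_module_simps l_neg PiE_iff)
    show "\<zero>\<^bsub>?F\<^esub> \<oplus>\<^bsub>?F\<^esub> x = x"
      using x by (intro free_module_eqI[of _ R n] c) (auto simp: free_module_simps PiE_iff)
    fix y assume y: "y \<in> carrier ?F"
    show "x \<oplus>\<^bsub>?F\<^esub> y = y \<oplus>\<^bsub>?F\<^esub> x"
      using x y by (intro free_module_eqI[of _ R n] c) (auto simp: free_module_simps PiE_iff a_comm)
    show "x \<oplus>\<^bsub>?F\<^esub> y \<in> carrier ?F" by (rule c[OF x y])
    fix z assume z: "z \<in> carrier ?F"
    show "x \<oplus>\<^bsub>?F\<^esub> y \<oplus>\<^bsub>?F\<^esub> z = x \<oplus>\<^bsub>?F\<^esub> (y \<oplus>\<^bsub>?F\<^esub> z)"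
      using x y z by (intro free_module_eqI[of _ R n] c) (auto simp: free_module_simps PiE_iff a_assoc)
  next
    show "\<zero>\<^bsub>?F\<^esub> \<in> carrier ?F" by (auto simp: free_module_simps)
  qed
  fix x assume x: "x \<in> carrier ?F"
  show "\<one> \<odot>\<^bsub>?F\<^esub> x = x"
    using x by (intro free_module_eqI[of _ R n] c) (auto simp: free_module_simps PiE_iff)
  fix a assume a: "a \<in> carrier R"
  show "a \<odot>\<^bsub>?F\<^esub> x \<in> carrier ?F" using c x a by blast
  { fix y assume y: "y \<in> carrier ?F"
    show "a \<odot>\<^bsub>?F\<^esub> (x \<oplus>\<^bsub>?F\<^esub> y) = a \<odot>\<^bsub>?F\<^esub> x \<oplus>\<^bsub>?F\<^esub> a \<odot>\<^bsub>?F\<^esub> y"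
      using x y a by (intro free_module_eqI[of _ R n] c) (auto simp: free_module_simps PiE_iff r_distr) }
  fix b assume b: "b \<in> carrier R"
  show "(a \<oplus> b) \<odot>\<^bsub>?F\<^esub> x = a \<odot>\<^bsub>?F\<^esub> x \<oplus>\<^bsub>?F\<^esub> b \<odot>\<^bsub>?F\<^esub> x"
    using x b a by (intro free_module_eqI[of _ R n] c) (auto simp: free_module_simps PiE_iff l_distr)
  show "(a \<otimes> b) \<odot>\<^bsub>?F\<^esub> x = a \<odot>\<^bsub>?F\<^esub> (b \<odot>\<^bsub>?F\<^esub> x)"
    using x b a by (intro free_module_eqI[of _ R n] c) (auto simp: free_module_simps PiE_iff m_assoc)
qed

lemma (in ring) free_module_finsum:
  assumes "finite I" "\<And>i. i \<in> I \<Longrightarrow> f i \<in> carrier (free_module R n)" "t < n"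
  shows "(\<Oplus>\<^bsub>free_module R n\<^esub>i\<in>I. f i) t = (\<Oplus>i\<in>I. f i t)"
proof -
  have "(\<lambda>x. x t) \<in> module_homs R (free_module R n) (self_module R)"
    using assms(3) by (intro module_homsI) (auto simp: free_module_simps)
  from hom_finsum[OF left_module_abelian[OF free_left_module] self_abelian this assms(1,2)]
  show ?thesis by simp
qed

definition unit_vec :: "('r, 'z) ring_scheme \<Rightarrow> nat \<Rightarrow> nat \<Rightarrow> 'r \<Rightarrow> nat \<Rightarrow> 'r"
  where "unit_vec R n t a = (\<lambda>i\<in>{..<n}. if i = t then a else \<zero>\<^bsub>R\<^esub>)"

lemma (in ring) unit_vec:
  shows "a \<in> carrier R \<Longrightarrow> unit_vec R n t a \<in> carrier (free_module R n)"
    and "x \<in> carrier (free_module R n) \<Longrightarrow> (\<Oplus>\<^bsub>free_module R n\<^esub>t\<in>{..<n}. unit_vec R n t (x t)) = x"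
    and "a \<in> carrier R \<Longrightarrow> b \<in> carrier R \<Longrightarrow> unit_vec R n t (a \<otimes> b) = a \<odot>\<^bsub>free_module R n\<^esub> unit_vec R n t b"
proof -
  show u: "unit_vec R n t a \<in> carrier (free_module R n)" if "a \<in> carrier R" for t a
    using that by (auto simp: unit_vec_def free_module_simps)
  show "unit_vec R n t (a \<otimes> b) = a \<odot>\<^bsub>free_module R n\<^esub> unit_vec R n t b" if "a \<in> carrier R" "b \<in> carrier R"
    using that by (auto simp: unit_vec_def free_module_simps)
  interpret F: left_module R "free_module R n" by (rule free_left_module)
  show "(\<Oplus>\<^bsub>free_module R n\<^esub>t\<in>{..<n}. unit_vec R n t (x t)) = x" if x: "x \<in> carrier (free_module R n)"
  proof -
    have xt: "x t \<in> carrier R" if "t < n" for t using that x by (auto simp: free_module_simps)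
    show ?thesis
    proof (rule free_module_eqI[OF _ x])
      show "(\<Oplus>\<^bsub>free_module R n\<^esub>t\<in>{..<n}. unit_vec R n t (x t)) \<in> carrier (free_module R n)"
        using u xt by (intro F.finsum_closed) auto
      fix i assume i: "i < n"
      have "(\<Oplus>\<^bsub>free_module R n\<^esub>t\<in>{..<n}. unit_vec R n t (x t)) i = (\<Oplus>t\<in>{..<n}. unit_vec R n t (x t) i)"
        using u xt i by (intro free_module_finsum) auto
      also have "\<dots> = (\<Oplus>t\<in>{..<n}. if i = t then x t else \<zero>)"
        using i by (simp add: unit_vec_def)
      also have "\<dots> = x i"
        using i xt by (intro finsum_singleton) auto
      finally show "(\<Oplus>\<^bsub>free_module R n\<^esub>t\<in>{..<n}. unit_vec R n t (x t)) i = x i" .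
    qed
  qed
qed

lemma lin_comb_hom:
  assumes "left_module R M" "\<And>t. t < n \<Longrightarrow> w t \<in> carrier M"
  shows "(\<lambda>x. \<Oplus>\<^bsub>M\<^esub>t\<in>{..<n}. x t \<odot>\<^bsub>M\<^esub> w t) \<in> module_homs R (free_module R n) M"
proof -
  interpret M: left_module R M by fact
  have c: "a \<odot>\<^bsub>M\<^esub> w t \<in> carrier M" if "a \<in> carrier R" "t < n" for a t using that assms(2) M.lsmult_closed by simp
  show ?thesis
  proof (rule module_homsI)
    fix x assume x: "x \<in> carrier (free_module R n)"
    then have xt: "x t \<in> carrier R" if "t < n" for t using that by (auto simp: free_module_simps)
    show "(\<Oplus>\<^bsub>M\<^esub>t\<in>{..<n}. x t \<odot>\<^bsub>M\<^esub> w t) \<in> carrier M" using xt c by (intro M.finsum_closed) auto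
    { fix y assume y: "y \<in> carrier (free_module R n)"
      then have yt: "y t \<in> carrier R" if "t < n" for t using that by (auto simp: free_module_simps)
      have "(\<Oplus>\<^bsub>M\<^esub>t\<in>{..<n}. (x \<oplus>\<^bsub>free_module R n\<^esub> y) t \<odot>\<^bsub>M\<^esub> w t) = (\<Oplus>\<^bsub>M\<^esub>t\<in>{..<n}. x t \<odot>\<^bsub>M\<^esub> w t \<oplus>\<^bsub>M\<^esub> y t \<odot>\<^bsub>M\<^esub> w t)"
        using xt yt c assms(2) by (intro M.finsum_cong') (auto simp: free_module_simps M.lsmult_l_distr)
      also have "\<dots> = (\<Oplus>\<^bsub>M\<^esub>t\<in>{..<n}. x t \<odot>\<^bsub>M\<^esub> w t) \<oplus>\<^bsub>M\<^esub> (\<Oplus>\<^bsub>M\<^esub>t\<in>{..<n}. y t \<odot>\<^bsub>M\<^esub> w t)"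
        using xt yt c by (intro M.finsum_addf) auto
      finally show "(\<Oplus>\<^bsub>M\<^esub>t\<in>{..<n}. (x \<oplus>\<^bsub>free_module R n\<^esub> y) t \<odot>\<^bsub>M\<^esub> w t)
        = (\<Oplus>\<^bsub>M\<^esub>t\<in>{..<n}. x t \<odot>\<^bsub>M\<^esub> w t) \<oplus>\<^bsub>M\<^esub> (\<Oplus>\<^bsub>M\<^esub>t\<in>{..<n}. y t \<odot>\<^bsub>M\<^esub> w t)" . }
    fix a assume a: "a \<in> carrier R"
    have "(\<Oplus>\<^bsub>M\<^esub>t\<in>{..<n}. (a \<odot>\<^bsub>free_module R n\<^esub> x) t \<odot>\<^bsub>M\<^esub> w t) = (\<Oplus>\<^bsub>M\<^esub>t\<in>{..<n}. a \<odot>\<^bsub>M\<^esub> (x t \<odot>\<^bsub>M\<^esub> w t))"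
      using xt c a assms(2) M.lsmult_closed by (intro M.finsum_cong') (auto simp: free_module_simps M.lsmult_assoc)
    also have "\<dots> = a \<odot>\<^bsub>M\<^esub> (\<Oplus>\<^bsub>M\<^esub>t\<in>{..<n}. x t \<odot>\<^bsub>M\<^esub> w t)"
      using xt c a by (intro left_module_finsum_smult[OF assms(1), symmetric]) auto
    finally show "(\<Oplus>\<^bsub>M\<^esub>t\<in>{..<n}. (a \<odot>\<^bsub>free_module R n\<^esub> x) t \<odot>\<^bsub>M\<^esub> w t) = a \<odot>\<^bsub>M\<^esub> (\<Oplus>\<^bsub>M\<^esub>t\<in>{..<n}. x t \<odot>\<^bsub>M\<^esub> w t)" .
  qed
qed

lemma free_module_hom_eq:
  assumes "left_module R M" "\<phi> \<in> module_homs R (free_module R n) M" "x \<in> carrier (free_module R n)"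
  shows "\<phi> x = (\<Oplus>\<^bsub>M\<^esub>t\<in>{..<n}. x t \<odot>\<^bsub>M\<^esub> \<phi> (unit_vec R n t \<one>\<^bsub>R\<^esub>))"
proof -
  interpret R: ring R by (rule left_module_ring[OF assms(1)])
  interpret M: left_module R M by fact
  note F = R.free_left_module[of n]
  interpret F: left_module R "free_module R n" by (rule F)
  have xt: "x t \<in> carrier R" if "t < n" for t using that assms(3) by (auto simp: free_module_simps)
  have u: "unit_vec R n t (x t) = x t \<odot>\<^bsub>free_module R n\<^esub> unit_vec R n t \<one>\<^bsub>R\<^esub>" if "t < n" for t
    using R.unit_vec(3)[OF xt[OF that], of "\<one>\<^bsub>R\<^esub>"] xt[OF that] by simp
  have "\<phi> x = \<phi> (\<Oplus>\<^bsub>free_module R n\<^esub>t\<in>{..<n}. unit_vec R n t (x t))" using R.unit_vec(2)[OF assms(3)] by simp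
  also have "\<dots> = (\<Oplus>\<^bsub>M\<^esub>t\<in>{..<n}. \<phi> (unit_vec R n t (x t)))"
    using xt by (intro hom_finsum[OF F.abelian_group_axioms M.abelian_group_axioms assms(2)]) (auto intro: R.unit_vec(1))
  also have "\<dots> = (\<Oplus>\<^bsub>M\<^esub>t\<in>{..<n}. x t \<odot>\<^bsub>M\<^esub> \<phi> (unit_vec R n t \<one>\<^bsub>R\<^esub>))"
    using xt u R.unit_vec(1) module_homsD[OF assms(2)] M.lsmult_closed
    by (intro M.finsum_cong') auto
  finally show ?thesis .
qed

lemma a_kernel_eq: "a_kernel F M \<phi> = {x \<in> carrier F. \<phi> x = \<zero>\<^bsub>M\<^esub>}"
  by (simp add: a_kernel_def kernel_def)

lemma kernel_subgroup:
  assumes "abelian_group F" "abelian_group M" "\<phi> \<in> module_homs R F M"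
  shows "subgroup {x \<in> carrier F. \<phi> x = \<zero>\<^bsub>M\<^esub>} (add_monoid F)"
proof -
  interpret F: abelian_group F by fact
  interpret M: abelian_group M by fact
  note z = hom_zero_minus[OF assms]
  show ?thesis
    using z module_homsD[OF assms(3)]
    by unfold_locales (auto simp: a_inv_def[symmetric])
qed

text \<open>A presentation in matrix form: generators are the images of the unit vectors, and every
  relation is a left combination of the rows in Q. The finitely many entries of these rows are what
  later has to fit into B.\<close>

lemma finitely_presented_relations:
  assumes "left_module R L" "finitely_presented R L"
  obtains n :: nat and l and Q :: "(nat \<Rightarrow> 'r) set" where
    "\<And>t. t < n \<Longrightarrow> l t \<in> carrier L"
    "\<And>x. x \<in> carrier L \<Longrightarrow> \<exists>h\<in>carrier (free_module R n). x = (\<Oplus>\<^bsub>L\<^esub>t\<in>{..<n}. h t \<odot>\<^bsub>L\<^esub> l t)"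
    "finite Q" "Q \<subseteq> carrier (free_module R n)"
    "\<And>\<rho>. \<rho> \<in> Q \<Longrightarrow> (\<Oplus>\<^bsub>L\<^esub>t\<in>{..<n}. \<rho> t \<odot>\<^bsub>L\<^esub> l t) = \<zero>\<^bsub>L\<^esub>"
    "\<And>h. h \<in> carrier (free_module R n) \<Longrightarrow> (\<Oplus>\<^bsub>L\<^esub>t\<in>{..<n}. h t \<odot>\<^bsub>L\<^esub> l t) = \<zero>\<^bsub>L\<^esub> \<Longrightarrow>
      \<exists>c. (\<forall>\<rho>\<in>Q. c \<rho> \<in> carrier R) \<and> (\<forall>t<n. h t = (\<Oplus>\<^bsub>R\<^esub>\<rho>\<in>Q. c \<rho> \<otimes>\<^bsub>R\<^esub> \<rho> t))"
proof -
  interpret R: ring R by (rule left_module_ring[OF assms(1)])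
  interpret L: left_module R L by fact
  obtain n \<phi> where \<phi>: "\<phi> \<in> module_homs R (free_module R n) L"
      "\<phi> ` carrier (free_module R n) = carrier L"
      "finitely_generated R ((free_module R n)\<lparr>carrier := a_kernel (free_module R n) L \<phi>\<rparr>)"
    using assms(2) unfolding finitely_presented_def by blast
  let ?F = "free_module R n" and ?K = "a_kernel (free_module R n) L \<phi>"
  note eq = free_module_hom_eq[OF assms(1) \<phi>(1), symmetric] and F = R.free_left_module[of n]
  interpret F: left_module R ?F by (rule F)
  note K = kernel_subgroup[OF F.abelian_group_axioms L.abelian_group_axioms \<phi>(1), folded a_kernel_eq]
  obtain Q where Q: "finite Q" "Q \<subseteq> ?K"
    "?K = {(\<Oplus>\<^bsub>?F\<lparr>carrier := ?K\<rparr>\<^esub>s\<in>Q. c s \<odot>\<^bsub>?F\<^esub> s) | c. c \<in> Q \<rightarrow> carrier R}"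
    using \<phi>(3) unfolding finitely_generated_def by auto
  have QF: "Q \<subseteq> carrier ?F" using Q(2) by (auto simp: a_kernel_eq)
  show thesis
  proof (rule that[of n "\<lambda>t. \<phi> (unit_vec R n t \<one>\<^bsub>R\<^esub>)" Q])
    show "\<phi> (unit_vec R n t \<one>\<^bsub>R\<^esub>) \<in> carrier L" for t
      using module_homsD(1)[OF \<phi>(1)] R.unit_vec(1) by simp
    show "\<exists>h\<in>carrier ?F. x = (\<Oplus>\<^bsub>L\<^esub>t\<in>{..<n}. h t \<odot>\<^bsub>L\<^esub> \<phi> (unit_vec R n t \<one>\<^bsub>R\<^esub>))" if "x \<in> carrier L" for x
    proof -
      have "x \<in> \<phi> ` carrier ?F" using that unfolding \<phi>(2) .
      then obtain h where h: "x = \<phi> h" "h \<in> carrier ?F" by (rule imageE)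
      show ?thesis unfolding h(1) by (rule bexI[OF _ h(2)]) (rule eq[OF h(2), symmetric])
    qed
    show "(\<Oplus>\<^bsub>L\<^esub>t\<in>{..<n}. \<rho> t \<odot>\<^bsub>L\<^esub> \<phi> (unit_vec R n t \<one>\<^bsub>R\<^esub>)) = \<zero>\<^bsub>L\<^esub>" if "\<rho> \<in> Q" for \<rho>
      using that Q(2) eq[of \<rho>] by (auto simp: a_kernel_eq)
    fix h assume h: "h \<in> carrier ?F" "(\<Oplus>\<^bsub>L\<^esub>t\<in>{..<n}. h t \<odot>\<^bsub>L\<^esub> \<phi> (unit_vec R n t \<one>\<^bsub>R\<^esub>)) = \<zero>\<^bsub>L\<^esub>"
    then have "h \<in> ?K" using eq[OF h(1)] by (simp add: a_kernel_eq)
    then obtain c where c: "c \<in> Q \<rightarrow> carrier R" "h = (\<Oplus>\<^bsub>?F\<lparr>carrier := ?K\<rparr>\<^esub>s\<in>Q. c s \<odot>\<^bsub>?F\<^esub> s)"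
      using Q(3) by blast
    have cs: "c s \<odot>\<^bsub>?F\<^esub> s \<in> ?K" if "s \<in> Q" for s
    proof -
      have "c s \<in> carrier R" "s \<in> carrier ?F" "\<phi> s = \<zero>\<^bsub>L\<^esub>" using c(1) that Q(2) by (auto simp: a_kernel_eq)
      \<comment> \<open>That a scalar kills zero is read off from distributivity over the empty
        sum.\<close>
      moreover have "c s \<odot>\<^bsub>L\<^esub> \<zero>\<^bsub>L\<^esub> = \<zero>\<^bsub>L\<^esub>"
        using left_module_finsum_smult[OF assms(1), of "{}" undefined "c s"] calculation by simp
      ultimately show ?thesis using module_homsD(3)[OF \<phi>(1)] F.lsmult_closed by (simp add: a_kernel_eq)
    qed
    have h': "h = (\<Oplus>\<^bsub>?F\<^esub>s\<in>Q. c s \<odot>\<^bsub>?F\<^esub> s)"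
      unfolding c(2) by (rule sub_abelian(2)[OF F.abelian_group_axioms K Q(1) cs])
    have "h t = (\<Oplus>\<^bsub>R\<^esub>\<rho>\<in>Q. c \<rho> \<otimes>\<^bsub>R\<^esub> \<rho> t)" if t: "t < n" for t
    proof -
      have "h t = (\<Oplus>\<^bsub>R\<^esub>s\<in>Q. (c s \<odot>\<^bsub>?F\<^esub> s) t)"
        unfolding h' using cs t by (intro R.free_module_finsum[OF Q(1)]) (auto simp: a_kernel_eq)
      also have "\<dots> = (\<Oplus>\<^bsub>R\<^esub>\<rho>\<in>Q. c \<rho> \<otimes>\<^bsub>R\<^esub> \<rho> t)" using t by (simp add: free_module_simps)
      finally show ?thesis .
    qed
    then show "\<exists>c. (\<forall>\<rho>\<in>Q. c \<rho> \<in> carrier R) \<and> (\<forall>t<n. h t = (\<Oplus>\<^bsub>R\<^esub>\<rho>\<in>Q. c \<rho> \<otimes>\<^bsub>R\<^esub> \<rho> t))"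
      using c(1) by (intro exI[of _ c]) auto
  qed (use Q QF in auto)
qed

lemma finitely_generated_enum:
  assumes "abelian_group M" "\<And>a x. a \<in> carrier R \<Longrightarrow> x \<in> carrier M \<Longrightarrow> a \<odot>\<^bsub>M\<^esub> x \<in> carrier M" "finitely_generated R M"
  obtains n :: nat and w where "\<And>i. i < n \<Longrightarrow> w i \<in> carrier M" "carrier M \<subseteq> lin_span R M {..<n} w"
proof -
  interpret M: abelian_group M by fact
  obtain S where S: "finite S" "S \<subseteq> carrier M" "carrier M = {(\<Oplus>\<^bsub>M\<^esub>s\<in>S. c s \<odot>\<^bsub>M\<^esub> s) | c. c \<in> S \<rightarrow> carrier R}"
    using assms(3) unfolding finitely_generated_def by blast
  obtain w where w: "bij_betw w {0..<card S} S" using ex_bij_betw_nat_finite[OF S(1)] by blast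
  then have wS: "S = w ` {..<card S}" "inj_on w {..<card S}" by (auto simp: bij_betw_def atLeast0LessThan)
  show thesis
  proof (rule that)
    show "w i \<in> carrier M" if "i < card S" for i using wS(1) S(2) that by blast
    show "carrier M \<subseteq> lin_span R M {..<card S} w"
    proof
      fix x assume "x \<in> carrier M"
      then obtain c where c: "c \<in> S \<rightarrow> carrier R" "x = (\<Oplus>\<^bsub>M\<^esub>s\<in>S. c s \<odot>\<^bsub>M\<^esub> s)" using S(3) by blast
      have "x = (\<Oplus>\<^bsub>M\<^esub>s\<in>w ` {..<card S}. c s \<odot>\<^bsub>M\<^esub> s)" using c(2) wS(1) by simp
      also have "\<dots> = (\<Oplus>\<^bsub>M\<^esub>i\<in>{..<card S}. c (w i) \<odot>\<^bsub>M\<^esub> w i)"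
        using wS(1) c(1) S(2) assms(2) by (intro M.finsum_reindex[OF _ wS(2)]) (auto simp: Pi_iff subset_iff)
      finally show "x \<in> lin_span R M {..<card S} w"
        using c(1) wS(1) unfolding lin_span_def by (intro CollectI exI[of _ "\<lambda>i. c (w i)"]) auto
    qed
  qed
qed

text \<open>The definition of finite generation sums over a set of generators, so an indexed family
  has to be injective: repeated members would be counted once.\<close>

lemma finitely_generatedI:
  assumes "abelian_group M" "\<And>a x. a \<in> carrier R \<Longrightarrow> x \<in> carrier M \<Longrightarrow> a \<odot>\<^bsub>M\<^esub> x \<in> carrier M"
    and "finite I" "inj_on w I" "\<And>i. i \<in> I \<Longrightarrow> w i \<in> carrier M" "carrier M \<subseteq> lin_span R M I w"
  shows "finitely_generated R M"
  unfolding finitely_generated_def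
proof (intro exI[of _ "w ` I"] conjI)
  interpret M: abelian_group M by fact
  have re: "(\<Oplus>\<^bsub>M\<^esub>s\<in>w ` I. c s \<odot>\<^bsub>M\<^esub> s) = (\<Oplus>\<^bsub>M\<^esub>i\<in>I. c (w i) \<odot>\<^bsub>M\<^esub> w i)" if "\<And>i. i \<in> I \<Longrightarrow> c (w i) \<in> carrier R" for c
    using that assms(2,5) by (intro M.finsum_reindex[OF _ assms(4)]) auto
  show "carrier M = {(\<Oplus>\<^bsub>M\<^esub>s\<in>w ` I. c s \<odot>\<^bsub>M\<^esub> s) | c. c \<in> w ` I \<rightarrow> carrier R}" (is "_ = ?S")
  proof (intro equalityI subsetI)
    fix x assume "x \<in> carrier M"
    then obtain c where c: "\<forall>i\<in>I. c i \<in> carrier R" "x = (\<Oplus>\<^bsub>M\<^esub>i\<in>I. c i \<odot>\<^bsub>M\<^esub> w i)"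
      using assms(6) by (auto simp: lin_span_def)
    let ?c = "\<lambda>s. c (the_inv_into I w s)"
    have i: "?c (w i) = c i" if "i \<in> I" for i using the_inv_into_f_f[OF assms(4) that] by simp
    have "(\<Oplus>\<^bsub>M\<^esub>s\<in>w ` I. ?c s \<odot>\<^bsub>M\<^esub> s) = (\<Oplus>\<^bsub>M\<^esub>i\<in>I. ?c (w i) \<odot>\<^bsub>M\<^esub> w i)"
      using i c(1) by (intro re) auto
    also have "\<dots> = x" unfolding c(2) using i c(1) assms(2,5) by (intro M.finsum_cong') auto
    finally show "x \<in> ?S" using i c(1) by (intro CollectI exI[of _ ?c]) auto
  next
    fix x assume "x \<in> ?S"
    then obtain c where c: "c \<in> w ` I \<rightarrow> carrier R" "x = (\<Oplus>\<^bsub>M\<^esub>s\<in>w ` I. c s \<odot>\<^bsub>M\<^esub> s)" by blast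
    then show "x \<in> carrier M" using assms(2,5) by (auto intro!: M.finsum_closed)
  qed
qed (use assms in auto)

section \<open>The diagonal action\<close>

text \<open>The homomorphism theorem for the surjection c. Preimages are chosen by
  \<open>inv_into\<close>, and f does not depend on the choice because two preimages differ by an
  element of the kernel of c.\<close>

lemma hom_factor:
  assumes "abelian_group F" "abelian_group X" "abelian_group U" "c \<in> module_homs R F X" "f \<in> module_homs R F U"
    and "c ` carrier F = carrier X" "\<And>h. h \<in> carrier F \<Longrightarrow> c h = \<zero>\<^bsub>X\<^esub> \<Longrightarrow> f h = \<zero>\<^bsub>U\<^esub>"
    and smult: "\<And>a h. a \<in> carrier R \<Longrightarrow> h \<in> carrier F \<Longrightarrow> a \<odot>\<^bsub>F\<^esub> h \<in> carrier F"
  shows "h \<in> carrier F \<Longrightarrow> f (inv_into (carrier F) c (c h)) = f h"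
    and "(\<lambda>x. f (inv_into (carrier F) c x)) \<in> module_homs R X U"
proof -
  interpret F: abelian_group F by fact
  interpret X: abelian_group X by fact
  interpret U: abelian_group U by fact
  note c = module_homsD[OF assms(4)] and f = module_homsD[OF assms(5)]
  have r: "inv_into (carrier F) c x \<in> carrier F" "c (inv_into (carrier F) c x) = x" if "x \<in> carrier X" for x
    using inv_into_into[of x c "carrier F"] f_inv_into_f[of x c "carrier F"] that assms(6) by auto
  have eq: "f h = f h'" if "h \<in> carrier F" "h' \<in> carrier F" "c h = c h'" for h h'
  proof -
    have "c (h \<ominus>\<^bsub>F\<^esub> h') = \<zero>\<^bsub>X\<^esub>"
      using hom_zero_minus(3)[OF assms(1,2,4)] that c(1) X.minus_eq_zero_iff by simp
    then have "f (h \<ominus>\<^bsub>F\<^esub> h') = \<zero>\<^bsub>U\<^esub>" using assms(7) that by simp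
    then show ?thesis using hom_zero_minus(3)[OF assms(1,3,5)] that f(1) U.minus_eq_zero_iff by simp
  qed
  show "f (inv_into (carrier F) c (c h)) = f h" if "h \<in> carrier F" for h
    using that r[OF c(1)[OF that]] by (intro eq) auto
  let ?r = "inv_into (carrier F) c"
  show "(\<lambda>x. f (?r x)) \<in> module_homs R X U"
  proof (rule module_homsI)
    show "f (?r x) \<in> carrier U" if "x \<in> carrier X" for x using r[OF that] f(1) by simp
    show "f (?r (x \<oplus>\<^bsub>X\<^esub> y)) = f (?r x) \<oplus>\<^bsub>U\<^esub> f (?r y)" if "x \<in> carrier X" "y \<in> carrier X" for x y
    proof -
      have "f (?r (x \<oplus>\<^bsub>X\<^esub> y)) = f (?r x \<oplus>\<^bsub>F\<^esub> ?r y)"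
        using r[OF that(1)] r[OF that(2)] r[OF X.a_closed[OF that]] c(2) by (intro eq) auto
      then show ?thesis using f(2) r that by simp
    qed
    show "f (?r (a \<odot>\<^bsub>X\<^esub> x)) = a \<odot>\<^bsub>U\<^esub> f (?r x)" if a: "a \<in> carrier R" and x: "x \<in> carrier X" for a x
    proof -
      have "a \<odot>\<^bsub>X\<^esub> x \<in> carrier X" using c(3)[OF a r(1)[OF x]] c(1)[OF smult[OF a r(1)[OF x]]] r(2)[OF x] by simp
      then have "f (?r (a \<odot>\<^bsub>X\<^esub> x)) = f (a \<odot>\<^bsub>F\<^esub> ?r x)"
        using r[OF x] r[of "a \<odot>\<^bsub>X\<^esub> x"] c(3)[OF a r(1)[OF x]] smult[OF a r(1)[OF x]] by (intro eq) auto
      then show ?thesis using f(3)[OF a r(1)[OF x]] by simp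
    qed
  qed
qed

section \<open>Restriction of scalars along k \<rightarrow> H\<close>

context hopf
begin

abbreviation rs :: "('h, 'x, 'w) module_scheme \<Rightarrow> ('k, 'x) module" where "rs \<equiv> restrict_scalars H"

lemma rs_simps [simp]:
  "carrier (rs X) = carrier X" "add (rs X) = add X" "zero (rs X) = zero X"
  "finsum (rs X) f I = finsum X f I" "smult (rs X) c x = (c \<odot>\<^bsub>H\<^esub> \<one>\<^sub>H) \<odot>\<^bsub>X\<^esub> x"
  by (simp_all add: restrict_scalars_def finsum_def finprod_def)

lemma smult_one_mul: "c \<in> carrier k \<Longrightarrow> x \<in> carrier H \<Longrightarrow> (c \<odot>\<^bsub>H\<^esub> \<one>\<^sub>H) \<bullet> x = c \<odot>\<^bsub>H\<^esub> x"
  "c \<in> carrier k \<Longrightarrow> x \<in> carrier H \<Longrightarrow> x \<bullet> (c \<odot>\<^bsub>H\<^esub> \<one>\<^sub>H) = c \<odot>\<^bsub>H\<^esub> x"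
  by (simp_all add: smult_mult_left smult_mult_right H_l_one H_r_one)

lemma rs_module:
  assumes "left_module H X"
  shows "module k (rs X)"
proof -
  interpret X: left_module H X by fact
  have s: "c \<odot>\<^bsub>H\<^esub> \<one>\<^sub>H \<in> carrier H" if "c \<in> carrier k" for c using that by (simp add: smult_closed)
  have ab: "abelian_group (rs X)"
  proof (rule abelian_groupI)
    fix x assume "x \<in> carrier (rs X)"
    then show "\<exists>y\<in>carrier (rs X). y \<oplus>\<^bsub>rs X\<^esub> x = \<zero>\<^bsub>rs X\<^esub>"
      by (intro bexI[of _ "\<ominus>\<^bsub>X\<^esub> x"]) (auto simp: X.l_neg)
  qed (auto simp: X.a_ac)
  show ?thesis
  proof (rule moduleI[OF _ ab])
    show "cring k" by unfold_locales
    fix a x assume ax: "a \<in> carrier k" "x \<in> carrier (rs X)"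
    then show "a \<odot>\<^bsub>rs X\<^esub> x \<in> carrier (rs X)" using s X.lsmult_closed by simp
    fix b assume b: "b \<in> carrier k"
    then show "(a \<oplus>\<^bsub>k\<^esub> b) \<odot>\<^bsub>rs X\<^esub> x = a \<odot>\<^bsub>rs X\<^esub> x \<oplus>\<^bsub>rs X\<^esub> b \<odot>\<^bsub>rs X\<^esub> x"
      using ax s X.lsmult_l_distr by (simp add: smult_l_distr)
    have "(a \<otimes>\<^bsub>k\<^esub> b) \<odot>\<^bsub>H\<^esub> \<one>\<^sub>H = (a \<odot>\<^bsub>H\<^esub> \<one>\<^sub>H) \<bullet> (b \<odot>\<^bsub>H\<^esub> \<one>\<^sub>H)"
      using ax b s by (simp add: smult_one_mul(1) smult_assoc1)
    then show "a \<otimes>\<^bsub>k\<^esub> b \<odot>\<^bsub>rs X\<^esub> x = a \<odot>\<^bsub>rs X\<^esub> (b \<odot>\<^bsub>rs X\<^esub> x)"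
      using ax b s X.lsmult_assoc by simp
  next
    show "\<one>\<^bsub>k\<^esub> \<odot>\<^bsub>rs X\<^esub> x = x" if "x \<in> carrier (rs X)" for x using that X.lsmult_one by simp
    show "a \<odot>\<^bsub>rs X\<^esub> (x \<oplus>\<^bsub>rs X\<^esub> y) = a \<odot>\<^bsub>rs X\<^esub> x \<oplus>\<^bsub>rs X\<^esub> a \<odot>\<^bsub>rs X\<^esub> y"
      if "a \<in> carrier k" "x \<in> carrier (rs X)" "y \<in> carrier (rs X)" for a x y
      using that s X.lsmult_r_distr by simp
  qed
qed

lemma rs_hom: "f \<in> module_homs H X Y \<Longrightarrow> f \<in> module_homs k (rs X) (rs Y)"
  by (auto simp: module_homs_def smult_closed)

text \<open>Scalars act through multiples of the unit of H. These are central in H, so the action of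
  any h commutes with them.\<close>

lemma act_bilin:
  assumes "left_module H X"
  shows "bilin k H (rs X) (rs X) (smult X)"
proof -
  interpret X: left_module H X by fact
  have s: "c \<odot>\<^bsub>H\<^esub> \<one>\<^sub>H \<in> carrier H" if "c \<in> carrier k" for c using that by (simp add: smult_closed)
  show ?thesis
  proof (intro bilinI module_homsI)
    fix h c x assume h: "h \<in> carrier H" "c \<in> carrier k" "x \<in> carrier (rs X)"
    then have "h \<odot>\<^bsub>X\<^esub> (c \<odot>\<^bsub>rs X\<^esub> x) = (h \<bullet> (c \<odot>\<^bsub>H\<^esub> \<one>\<^sub>H)) \<odot>\<^bsub>X\<^esub> x"
      using s X.lsmult_assoc by simp
    also have "\<dots> = ((c \<odot>\<^bsub>H\<^esub> \<one>\<^sub>H) \<bullet> h) \<odot>\<^bsub>X\<^esub> x" using h by (simp add: smult_one_mul)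
    finally show "h \<odot>\<^bsub>X\<^esub> (c \<odot>\<^bsub>rs X\<^esub> x) = c \<odot>\<^bsub>rs X\<^esub> (h \<odot>\<^bsub>X\<^esub> x)"
      using h s X.lsmult_assoc by simp
  next
    fix x c h assume h: "x \<in> carrier (rs X)" "c \<in> carrier k" "h \<in> carrier H"
    then show "(c \<odot>\<^bsub>H\<^esub> h) \<odot>\<^bsub>X\<^esub> x = c \<odot>\<^bsub>rs X\<^esub> (h \<odot>\<^bsub>X\<^esub> x)"
      using s X.lsmult_assoc[of "c \<odot>\<^bsub>H\<^esub> \<one>\<^sub>H" h x] by (simp add: smult_one_mul)
  qed (use X.lsmult_closed X.lsmult_l_distr X.lsmult_r_distr in auto)
qed

lemma lin_unit_vec: "(\<lambda>x. unit_vec H n t x) \<in> module_homs k H (rs (free_module H n))"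
proof (rule module_homsI)
  note u = ring.unit_vec(1)[OF H_ring]
  show "unit_vec H n t x \<in> carrier (rs (free_module H n))" if "x \<in> carrier H" for x using u[OF that] by simp
  show "unit_vec H n t (x \<oplus>\<^bsub>H\<^esub> y) = unit_vec H n t x \<oplus>\<^bsub>rs (free_module H n)\<^esub> unit_vec H n t y"
    if "x \<in> carrier H" "y \<in> carrier H" for x y
    using that by (auto simp: unit_vec_def free_module_simps)
  show "unit_vec H n t (c \<odot>\<^bsub>H\<^esub> x) = c \<odot>\<^bsub>rs (free_module H n)\<^esub> unit_vec H n t x"
    if "c \<in> carrier k" "x \<in> carrier H" for c x
    using that ring.unit_vec(3)[OF H_ring, of "c \<odot>\<^bsub>H\<^esub> \<one>\<^sub>H" x n t] by (simp add: smult_one_mul smult_closed)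
qed

lemma lin_coord: "t < n \<Longrightarrow> (\<lambda>x. x t) \<in> module_homs k (rs (free_module H n)) H"
  by (rule module_homsI) (auto simp: free_module_simps smult_one_mul PiE_iff)

end

section \<open>The left H-module L \<otimes> M\<close>

locale diagonal_action = inv_hopf k H
  for k :: "('k, 'z) ring_scheme" and H :: "('k, 'h) hopf" +
  fixes L :: "('h, 'l) module" and M :: "('h, 'm) module"
  assumes L: "left_module H L" and M: "left_module H M"
begin

abbreviation T where "T \<equiv> tensor_prod k (rs L) (rs M)"
abbreviation D where "D \<equiv> diagonal_tensor k H L M"
abbreviation pure_T (infixl "\<otimes>\<^sub>T" 72) where "x \<otimes>\<^sub>T y \<equiv> pure_tensor k (rs L) (rs M) x y"
abbreviation act_L (infixr "\<cdot>\<^sub>L" 75) where "h \<cdot>\<^sub>L x \<equiv> h \<odot>\<^bsub>L\<^esub> x"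
abbreviation act_M (infixr "\<cdot>\<^sub>M" 75) where "h \<cdot>\<^sub>M x \<equiv> h \<odot>\<^bsub>M\<^esub> x"
abbreviation act_D (infixr "\<cdot>" 71) where "h \<cdot> t \<equiv> h \<odot>\<^bsub>D\<^esub> t"

lemma L_module [simp]: "module k (rs L)" and M_module [simp]: "module k (rs M)" and T_module [simp]: "module k T"
  using rs_module[OF L] rs_module[OF M] tensor_module by auto

lemmas L_ab = left_module_abelian[OF L] and T_ab = module_abelian[OF T_module]

lemma act_closed [simp]:
  "h \<in> carrier H \<Longrightarrow> x \<in> carrier L \<Longrightarrow> h \<cdot>\<^sub>L x \<in> carrier L"
  "h \<in> carrier H \<Longrightarrow> y \<in> carrier M \<Longrightarrow> h \<cdot>\<^sub>M y \<in> carrier M"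
  using left_module.lsmult_closed[OF L] left_module.lsmult_closed[OF M] by simp_all

lemma T_bilin: "bilin k (rs L) (rs M) T (\<otimes>\<^sub>T)" by (intro pure_bilin) simp_all

lemma T_closed [simp]: "x \<in> carrier L \<Longrightarrow> y \<in> carrier M \<Longrightarrow> x \<otimes>\<^sub>T y \<in> carrier T"
  using bilin_closed[OF T_bilin] by simp

lemmas lin_L_l = lin_bil_l[OF act_bilin[OF L], unfolded rs_simps]
  and lin_L_r = lin_bil_r[OF act_bilin[OF L]]
  and lin_M_l = lin_bil_l[OF act_bilin[OF M], unfolded rs_simps]
  and lin_M_r = lin_bil_r[OF act_bilin[OF M]]
  and lin_T_l = lin_bil_l[OF T_bilin, unfolded rs_simps]
  and lin_T_r = lin_bil_r[OF T_bilin, unfolded rs_simps]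

lemmas lin_T = lin_T_l lin_T_r lin_L_l lin_L_r lin_M_l lin_M_r

lemma tensor_act:
  assumes "a \<in> carrier H" "b \<in> carrier H"
  shows "tensor_map k (rs L) (rs M) (smult L a) (smult M b) \<in> module_homs k T T"
    and "x \<in> carrier L \<Longrightarrow> y \<in> carrier M \<Longrightarrow>
      tensor_map k (rs L) (rs M) (smult L a) (smult M b) (x \<otimes>\<^sub>T y) = (a \<cdot>\<^sub>L x) \<otimes>\<^sub>T (b \<cdot>\<^sub>M y)"
  using tensor_map_hom[of k "rs L" "rs M" "rs L" "rs M" "smult L a" "smult M b"]
    bilinD(1)[OF act_bilin[OF L] assms(1)] bilinD(1)[OF act_bilin[OF M] assms(2)] by simp_all

lemma tensor_act_bilin:
  assumes "t \<in> carrier T"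
  shows "bilin k H H T (\<lambda>a b. tensor_map k (rs L) (rs M) (smult L a) (smult M b) t)"
  unfolding tensor_map_def using assms
  by (intro bilinI lin_lift_param L_module M_module T_module H_module lin_T lin_id) auto

lemma D_simps [simp]:
  "carrier D = carrier T" "add D = add T" "zero D = zero T" "finsum D f I = finsum T f I"
  "h \<cdot> t = SW T (\<lambda>a b. tensor_map k (rs L) (rs M) (smult L a) (smult M b) t) h"
  by (simp_all add: diagonal_tensor_def Let_def sw_def finsum_def finprod_def)

lemmas act_D_def = D_simps(5)
declare D_simps(5) [simp del]

lemma act_D_pure:
  assumes "h \<in> carrier H" "x \<in> carrier L" "y \<in> carrier M"
  shows "h \<cdot> x \<otimes>\<^sub>T y = SW T (\<lambda>a b. (a \<cdot>\<^sub>L x) \<otimes>\<^sub>T (b \<cdot>\<^sub>M y)) h"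
  unfolding act_D_def using assms
  by (intro sw_cong[symmetric] tensor_act_bilin) (simp_all add: tensor_act)

lemma act_D_bilin: "bilin k H T T (smult D)"
  unfolding act_D_def
  by (intro bilinI lin_sw_param sw_hom tensor_act tensor_act_bilin) simp_all

lemma act_D_closed [simp]: "h \<in> carrier H \<Longrightarrow> t \<in> carrier T \<Longrightarrow> h \<cdot> t \<in> carrier T"
  using bilin_closed[OF act_D_bilin] .

lemmas lin_D_l = lin_bil_l[OF act_D_bilin] and lin_D_r = lin_bil_r[OF act_D_bilin]

lemma pure_act_bilin:
  assumes "x \<in> carrier L" "y \<in> carrier M"
  shows "bilin k H H T (\<lambda>a b. (a \<cdot>\<^sub>L x) \<otimes>\<^sub>T (b \<cdot>\<^sub>M y))"
  using assms by (intro bilinI lin_T lin_id) auto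

text \<open>Everything reduces to pure tensors. The unit law is the formula for the coproduct of 1;
  associativity is multiplicativity of the coproduct, after the independent sums over the components
  of g and h are exchanged.\<close>

lemma D_left_module: "left_module H D"
proof (intro left_module.intro left_module_axioms.intro H_ring)
  interpret T: abelian_group T by (rule T_ab)
  show "abelian_group D"
  proof (rule abelian_groupI)
    fix x assume "x \<in> carrier D"
    then show "\<exists>y\<in>carrier D. y \<oplus>\<^bsub>D\<^esub> x = \<zero>\<^bsub>D\<^esub>"
      by (intro bexI[of _ "\<ominus>\<^bsub>T\<^esub> x"]) (auto simp: T.l_neg)
  qed (auto simp: T.a_ac)
  fix t assume t: "t \<in> carrier D"
  show "\<one>\<^sub>H \<cdot> t = t"
  proof (rule tensor_ext[OF L_module M_module bilinD(1)[OF act_D_bilin H_one_closed] lin_id])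
    fix x y assume "x \<in> carrier (rs L)" "y \<in> carrier (rs M)"
    then show "\<one>\<^sub>H \<cdot> x \<otimes>\<^sub>T y = x \<otimes>\<^sub>T y"
      using left_module.lsmult_one[OF L] left_module.lsmult_one[OF M]
      by (simp add: act_D_pure sw_one[OF T_module pure_act_bilin])
  qed (use t in simp)
  fix g assume g: "g \<in> carrier H"
  show "g \<cdot> t \<in> carrier D" using g t by simp
  { fix s assume "s \<in> carrier D"
    then show "g \<cdot> (t \<oplus>\<^bsub>D\<^esub> s) = g \<cdot> t \<oplus>\<^bsub>D\<^esub> g \<cdot> s"
      using module_homsD(2)[OF bilinD(1)[OF act_D_bilin g]] t by simp }
  fix h assume h: "h \<in> carrier H"
  show "(g \<oplus>\<^bsub>H\<^esub> h) \<cdot> t = g \<cdot> t \<oplus>\<^bsub>D\<^esub> h \<cdot> t"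
    using module_homsD(2)[OF bilinD(2)[OF act_D_bilin]] g h t by simp
  show "(g \<bullet> h) \<cdot> t = g \<cdot> h \<cdot> t"
  proof (rule tensor_ext[OF L_module M_module bilinD(1)[OF act_D_bilin H_closed[OF g h]]
        lin_comp[OF bilinD(1)[OF act_D_bilin g] bilinD(1)[OF act_D_bilin h]]])
    fix x y assume "x \<in> carrier (rs L)" "y \<in> carrier (rs M)"
    then have xy: "x \<in> carrier L" "y \<in> carrier M" by simp_all
    let ?f = "\<lambda>a b c d. ((a \<bullet> c) \<cdot>\<^sub>L x) \<otimes>\<^sub>T ((b \<bullet> d) \<cdot>\<^sub>M y)"
    have f: "bilin k H H T (\<lambda>c d. ?f a b c d)" "bilin k H H T (\<lambda>c d. ?f c d a b)"
      if "a \<in> carrier H" "b \<in> carrier H" for a b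
      using xy that by (intro bilinI lin_T lin_mul_l lin_mul_r lin_id; simp)+
    have "(g \<bullet> h) \<cdot> x \<otimes>\<^sub>T y = SW T (\<lambda>a b. SW T (\<lambda>c d. ?f a b c d) h) g"
      using xy g h by (simp add: act_D_pure sw_mult[OF T_module pure_act_bilin[OF xy]])
    also have "\<dots> = SW T (\<lambda>c d. SW T (\<lambda>a b. ?f a b c d) g) h"
      using g h f by (intro sw_swap) auto
    also have "\<dots> = SW T (\<lambda>c d. g \<cdot> (c \<cdot>\<^sub>L x) \<otimes>\<^sub>T (d \<cdot>\<^sub>M y)) h"
    proof (rule sw_cong[symmetric])
      fix c d assume cd: "c \<in> carrier H" "d \<in> carrier H"
      have cxy: "c \<cdot>\<^sub>L x \<in> carrier L" "d \<cdot>\<^sub>M y \<in> carrier M" using cd xy by simp_all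
      show "g \<cdot> (c \<cdot>\<^sub>L x) \<otimes>\<^sub>T (d \<cdot>\<^sub>M y) = SW T (\<lambda>a b. ?f a b c d) g"
        unfolding act_D_pure[OF g cxy]
        by (rule sw_cong[OF T_module f(2)[OF cd] g])
          (use cd xy left_module.lsmult_assoc[OF L] left_module.lsmult_assoc[OF M] in simp)
    next
      show "bilin k H H T (\<lambda>c d. SW T (\<lambda>a b. ?f a b c d) g)"
        using xy g f by (intro bilinI lin_sw_param lin_T lin_mul_l lin_mul_r lin_id T_module H_module) auto
    qed (use h in auto)
    also have "\<dots> = g \<cdot> h \<cdot> x \<otimes>\<^sub>T y"
      using xy h sw_comp[OF T_module T_module pure_act_bilin[OF xy] bilinD(1)[OF act_D_bilin g] h]
      by (simp add: act_D_pure[OF h xy])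
    finally show "(g \<bullet> h) \<cdot> x \<otimes>\<^sub>T y = g \<cdot> h \<cdot> x \<otimes>\<^sub>T y" .
  qed (use t in simp)
qed

text \<open>For \<open>L = H\<close> and \<open>x = 1\<close> this is \<open>\<pi> \<otimes> id\<close> conjugated by the automorphism \<open>h \<otimes> y \<mapsto> h (1 \<otimes> y)\<close> of
  \<open>H \<otimes> M\<close>, whose inverse is \<open>h \<otimes> y \<mapsto> \<Sum> h' \<otimes> S(h'') y\<close>.\<close>

definition Q :: "('h \<Rightarrow> 'h) \<Rightarrow> 'l \<Rightarrow> 'h \<Rightarrow> 'm \<Rightarrow> ('l \<times> 'm \<Rightarrow> 'k) set"
  where "Q \<pi> x h y = SW T (\<lambda>a b. \<pi> a \<cdot> x \<otimes>\<^sub>T (S b \<cdot>\<^sub>M y)) h"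

lemma Q_bilin:
  assumes "\<pi> \<in> module_homs k H H" "x \<in> carrier L" "y \<in> carrier M"
  shows "bilin k H H T (\<lambda>a b. \<pi> a \<cdot> x \<otimes>\<^sub>T (S b \<cdot>\<^sub>M y))"
  using assms module_homsD(1)[OF assms(1)]
  by (intro bilinI lin_D_l lin_D_r lin_T lin_comp[OF antipode_linear] lin_id) auto

lemma Q_hom:
  assumes "\<pi> \<in> module_homs k H H"
  shows "x \<in> carrier L \<Longrightarrow> y \<in> carrier M \<Longrightarrow> (\<lambda>h. Q \<pi> x h y) \<in> module_homs k H T"
    and "y \<in> carrier M \<Longrightarrow> h \<in> carrier H \<Longrightarrow> (\<lambda>x. Q \<pi> x h y) \<in> module_homs k (rs L) T"
    and "x \<in> carrier L \<Longrightarrow> h \<in> carrier H \<Longrightarrow> (\<lambda>y. Q \<pi> x h y) \<in> module_homs k (rs M) T"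
  unfolding Q_def using assms module_homsD(1)[OF assms]
  by (intro sw_hom lin_sw_param Q_bilin lin_D_r lin_T lin_comp[OF antipode_linear] lin_id; simp)+

lemma Q_closed:
  "\<pi> \<in> module_homs k H H \<Longrightarrow> x \<in> carrier L \<Longrightarrow> y \<in> carrier M \<Longrightarrow> h \<in> carrier H \<Longrightarrow> Q \<pi> x h y \<in> carrier T"
  using module_homsD(1)[OF Q_hom(1)] .

text \<open>Written out, the left side is \<Sum> b1 x \<otimes> b2 S(b3) y. It expresses that the
  untwisting and its inverse compose to the identity.\<close>

lemma sw_act_antipode:
  assumes x: "x \<in> carrier L" and y: "y \<in> carrier M" and b: "b \<in> carrier H"
  shows "SW T (\<lambda>p q. p \<cdot> x \<otimes>\<^sub>T (S q \<cdot>\<^sub>M y)) b = (b \<cdot>\<^sub>L x) \<otimes>\<^sub>T y"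
proof -
  let ?f = "\<lambda>c z. (c \<cdot>\<^sub>L x) \<otimes>\<^sub>T (z \<cdot>\<^sub>M y)"
  have "SW T (\<lambda>p q. p \<cdot> x \<otimes>\<^sub>T (S q \<cdot>\<^sub>M y)) b = SW T (\<lambda>p q. SW T (\<lambda>c d. ?f c (d \<bullet> S q)) p) b"
  proof (rule sw_cong[symmetric])
    fix p q assume pq: "p \<in> carrier H" "q \<in> carrier H"
    then have Sy: "S q \<cdot>\<^sub>M y \<in> carrier M" using y by simp
    show "SW T (\<lambda>c d. ?f c (d \<bullet> S q)) p = p \<cdot> x \<otimes>\<^sub>T (S q \<cdot>\<^sub>M y)"
      unfolding act_D_pure[OF pq(1) x Sy]
      by (rule sw_cong[OF T_module pure_act_bilin[OF x Sy] pq(1)])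
        (use pq y left_module.lsmult_assoc[OF M] in simp)
  qed (use Q_bilin[OF lin_id x y] b in auto)
  also have "\<dots> = ?f b \<one>\<^sub>H"
    by (rule sw_cancel23(2)[OF cancelling_S(2) T_module pure_act_bilin[OF x y] b])
  finally show ?thesis using y left_module.lsmult_one[OF M] by simp
qed

text \<open>Elements of B can be moved from the coefficient h to the module element x. Right
  B-linearity extracts b1 from \<pi>, and the remaining \<Sum> b1 (x \<otimes> S(b2) S(c2) y)
  collapses by \<open>sw_act_antipode\<close>. Relations with entries in B can then be evaluated
  inside L.\<close>

lemma Q_mult:
  assumes B: "subhopf B" and \<pi>: "rlin B \<pi>" and x: "x \<in> carrier L" and y: "y \<in> carrier M"
    and c: "c \<in> carrier H" and b: "b \<in> B"
  shows "Q \<pi> x (c \<bullet> b) y = Q \<pi> (b \<cdot>\<^sub>L x) c y"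
proof -
  note p = rlinD[OF \<pi>] and BD = subhopfD[OF B]
  have bH: "b \<in> carrier H" using BD(5)[OF b] .
  have "Q \<pi> x (c \<bullet> b) y = SW T (\<lambda>c1 c2. SW T (\<lambda>b1 b2. \<pi> (c1 \<bullet> b1) \<cdot> x \<otimes>\<^sub>T (S (c2 \<bullet> b2) \<cdot>\<^sub>M y)) b) c"
    unfolding Q_def by (rule sw_mult[OF T_module Q_bilin[OF p(1) x y] c bH])
  also have "\<dots> = Q \<pi> (b \<cdot>\<^sub>L x) c y"
    unfolding Q_def
  proof (rule sw_cong)
    fix c1 c2 assume cc: "c1 \<in> carrier H" "c2 \<in> carrier H"
    have y2: "S c2 \<cdot>\<^sub>M y \<in> carrier M" using cc y by simp
    have "SW T (\<lambda>b1 b2. \<pi> (c1 \<bullet> b1) \<cdot> x \<otimes>\<^sub>T (S (c2 \<bullet> b2) \<cdot>\<^sub>M y)) b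
        = SW T (\<lambda>b1 b2. \<pi> c1 \<cdot> b1 \<cdot> x \<otimes>\<^sub>T (S b2 \<cdot>\<^sub>M S c2 \<cdot>\<^sub>M y)) b"
    proof (rule sw_sub_cong[OF B T_module])
      fix v w assume vw: "v \<in> B" "w \<in> B"
      then have H: "v \<in> carrier H" "w \<in> carrier H" using BD(5) by simp_all
      have "x \<otimes>\<^sub>T (S (c2 \<bullet> w) \<cdot>\<^sub>M y) = x \<otimes>\<^sub>T (S w \<cdot>\<^sub>M S c2 \<cdot>\<^sub>M y)"
        using H cc y left_module.lsmult_assoc[OF M] by (simp add: S_mult)
      then show "\<pi> (c1 \<bullet> v) \<cdot> x \<otimes>\<^sub>T (S (c2 \<bullet> w) \<cdot>\<^sub>M y) = \<pi> c1 \<cdot> v \<cdot> x \<otimes>\<^sub>T (S w \<cdot>\<^sub>M S c2 \<cdot>\<^sub>M y)"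
        using H cc x y vw p left_module.lsmult_assoc[OF D_left_module] by simp
    next
      show "bilin k H H T (\<lambda>b1 b2. \<pi> (c1 \<bullet> b1) \<cdot> x \<otimes>\<^sub>T (S (c2 \<bullet> b2) \<cdot>\<^sub>M y))"
        using cc x y p(3) by (intro bilinI lin_D_l lin_D_r lin_T lin_comp[OF p(1)] lin_comp[OF antipode_linear] lin_mul_r lin_id) auto
      show "bilin k H H T (\<lambda>b1 b2. \<pi> c1 \<cdot> b1 \<cdot> x \<otimes>\<^sub>T (S b2 \<cdot>\<^sub>M S c2 \<cdot>\<^sub>M y))"
        using cc x y2 p(3) by (intro bilinI lin_D_r lin_D_l lin_T lin_comp[OF antipode_linear] lin_id) auto
    qed (rule b)
    also have "\<dots> = \<pi> c1 \<cdot> SW T (\<lambda>b1 b2. b1 \<cdot> x \<otimes>\<^sub>T (S b2 \<cdot>\<^sub>M S c2 \<cdot>\<^sub>M y)) b"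
      using sw_comp[OF T_module T_module Q_bilin[OF lin_id x y2] bilinD(1)[OF act_D_bilin p(3)[OF cc(1)]] bH] by simp
    also have "\<dots> = \<pi> c1 \<cdot> (b \<cdot>\<^sub>L x) \<otimes>\<^sub>T (S c2 \<cdot>\<^sub>M y)"
      using sw_act_antipode[OF x y2 bH] by simp
    finally show "SW T (\<lambda>b1 b2. \<pi> (c1 \<bullet> b1) \<cdot> x \<otimes>\<^sub>T (S (c2 \<bullet> b2) \<cdot>\<^sub>M y)) b = \<pi> c1 \<cdot> (b \<cdot>\<^sub>L x) \<otimes>\<^sub>T (S c2 \<cdot>\<^sub>M y)" .
  qed (use x y c bH Q_bilin[OF p(1)] in auto)
  finally show ?thesis .
qed

text \<open>The left side is \<Sum> \<pi>(h1) (x \<otimes> S(h2) h3 y), and S(h2) h3 cancels. This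
  turns \<open>Q\<close> back into the action of \<pi> h.\<close>

lemma sw_Q:
  assumes \<pi>: "\<pi> \<in> module_homs k H H" and x: "x \<in> carrier L" and y: "y \<in> carrier M" and h: "h \<in> carrier H"
  shows "SW T (\<lambda>a b. Q \<pi> x a (b \<cdot>\<^sub>M y)) h = \<pi> h \<cdot> x \<otimes>\<^sub>T y"
proof -
  let ?f = "\<lambda>c z. \<pi> c \<cdot> x \<otimes>\<^sub>T (z \<cdot>\<^sub>M y)"
  have f: "bilin k H H T ?f"
    using x y module_homsD(1)[OF \<pi>] by (intro bilinI lin_D_l lin_D_r lin_T \<pi> lin_id) auto
  have "SW T (\<lambda>a b. Q \<pi> x a (b \<cdot>\<^sub>M y)) h = SW T (\<lambda>a b. SW T (\<lambda>c d. ?f c (S d \<bullet> b)) a) h"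
  proof (rule sw_cong[symmetric])
    fix a b assume ab: "a \<in> carrier H" "b \<in> carrier H"
    then show "SW T (\<lambda>c d. ?f c (S d \<bullet> b)) a = Q \<pi> x a (b \<cdot>\<^sub>M y)"
      unfolding Q_def
      using x y left_module.lsmult_assoc[OF M] Q_bilin[OF \<pi> x] by (intro sw_cong) auto
  next
    show "bilin k H H T (\<lambda>a b. Q \<pi> x a (b \<cdot>\<^sub>M y))"
      using x y \<pi> by (intro bilinI Q_hom lin_comp[OF Q_hom(3)] lin_M_l lin_id) auto
  qed (use h in auto)
  also have "\<dots> = ?f h \<one>\<^sub>H"
    by (rule sw_cancel23(2)[OF cancelling_S(1) T_module f h])
  finally show ?thesis using y left_module.lsmult_one[OF M] by simp
qed

end

section \<open>Linear maps on L \<otimes> M induced by right B-linear maps\<close>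

context diagonal_action
begin

text \<open>On generators \<Omega> is forced to be (a l_t) \<otimes> y \<mapsto>
  \<open>Q \<pi> (l t) a y\<close>. It descends from coefficient vectors to L because the relations
  have entries in B, across which \<open>Q\<close> is balanced.\<close>

lemma projection_lift:
  assumes l: "\<And>t. t < n \<Longrightarrow> l t \<in> carrier L"
    and gen: "\<And>x. x \<in> carrier L \<Longrightarrow> \<exists>h\<in>carrier (free_module H n). x = (\<Oplus>\<^bsub>L\<^esub>t\<in>{..<n}. h t \<cdot>\<^sub>L l t)"
    and R: "finite R" "R \<subseteq> carrier (free_module H n)"
      "\<And>\<rho>. \<rho> \<in> R \<Longrightarrow> (\<Oplus>\<^bsub>L\<^esub>t\<in>{..<n}. \<rho> t \<cdot>\<^sub>L l t) = \<zero>\<^bsub>L\<^esub>"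
      "\<And>h. h \<in> carrier (free_module H n) \<Longrightarrow> (\<Oplus>\<^bsub>L\<^esub>t\<in>{..<n}. h t \<cdot>\<^sub>L l t) = \<zero>\<^bsub>L\<^esub> \<Longrightarrow>
        \<exists>c. (\<forall>\<rho>\<in>R. c \<rho> \<in> carrier H) \<and> (\<forall>t<n. h t = (\<Oplus>\<^bsub>H\<^esub>\<rho>\<in>R. c \<rho> \<bullet> \<rho> t))"
    and B: "subhopf B" and RB: "\<And>\<rho> t. \<rho> \<in> R \<Longrightarrow> t < n \<Longrightarrow> \<rho> t \<in> B" and \<pi>: "rlin B \<pi>"
  obtains \<Omega> where "\<Omega> \<in> module_homs k T T"
    "\<And>h s. h \<in> carrier H \<Longrightarrow>
      s \<in> tensor_span k (rs L) (rs M) {\<Oplus>\<^bsub>L\<^esub>t\<in>{..<n}. b t \<cdot>\<^sub>L l t | b. \<forall>t<n. b t \<in> B} (carrier M) \<Longrightarrow>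
      \<Omega> (h \<cdot> s) = \<pi> h \<cdot> s"
proof -
  let ?F = "free_module H n"
  note p = rlinD[OF \<pi>] and BD = subhopfD[OF B]
  have F: "left_module H ?F" by (rule ring.free_left_module[OF H_ring])
  have Fm: "module k (rs ?F)" by (rule rs_module[OF F])
  have ht: "h t \<in> carrier H" if "h \<in> carrier ?F" "t < n" for h t using that by (auto simp: free_module_simps)
  interpret L: abelian_group L by (rule L_ab)
  interpret T: abelian_group T by (rule T_ab)
  define cmb where "cmb = (\<lambda>h. \<Oplus>\<^bsub>L\<^esub>t\<in>{..<n}. h t \<cdot>\<^sub>L l t)"
  define pre where "pre = (\<lambda>y h. \<Oplus>\<^bsub>T\<^esub>t\<in>{..<n}. Q \<pi> (l t) (h t) y)"
  have cmb: "cmb \<in> module_homs k (rs ?F) (rs L)"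
    unfolding cmb_def using l by (intro rs_hom lin_comb_hom[OF L]) auto
  have pre: "pre y \<in> module_homs k (rs ?F) T" if "y \<in> carrier M" for y
    unfolding pre_def using l that p(1) by (intro lin_finsum lin_comp[OF Q_hom(1) lin_coord] Fm) auto
  have pre_y: "(\<lambda>y. pre y h) \<in> module_homs k (rs M) T" if "h \<in> carrier ?F" for h
    unfolding pre_def using l that p(1) ht by (intro lin_finsum Q_hom) auto
  \<comment> \<open>A vector h in the kernel has coordinates \<Sum> c \<rho> \<rho> t. By
    \<open>Q_mult\<close> the entries \<rho> t move onto the l t, and after the two sums are
    exchanged each \<rho> contributes \<open>Q\<close> at \<Sum> \<rho> t l t, which is
    zero.\<close>
  have vanish: "pre y h = \<zero>\<^bsub>T\<^esub>" if h: "h \<in> carrier ?F" "cmb h = \<zero>\<^bsub>L\<^esub>" and y: "y \<in> carrier M" for y h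
  proof -
    obtain c where c: "\<forall>\<rho>\<in>R. c \<rho> \<in> carrier H" "\<forall>t<n. h t = (\<Oplus>\<^bsub>H\<^esub>\<rho>\<in>R. c \<rho> \<bullet> \<rho> t)"
      using R(4)[OF h(1)] h(2) unfolding cmb_def by blast
    have RH: "\<rho> t \<in> carrier H" if "\<rho> \<in> R" "t < n" for \<rho> t using RB[OF that] BD(5) by simp
    have "Q \<pi> (l t) (h t) y = (\<Oplus>\<^bsub>T\<^esub>\<rho>\<in>R. Q \<pi> (\<rho> t \<cdot>\<^sub>L l t) (c \<rho>) y)" if t: "t < n" for t
    proof -
      have "Q \<pi> (l t) (h t) y = (\<Oplus>\<^bsub>T\<^esub>\<rho>\<in>R. Q \<pi> (l t) (c \<rho> \<bullet> \<rho> t) y)"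
        using c t RH[OF _ t] hom_finsum[OF H_ab T_ab Q_hom(1)[OF p(1) l[OF t] y] R(1), of "\<lambda>\<rho>. c \<rho> \<bullet> \<rho> t"]
        by simp
      also have "\<dots> = (\<Oplus>\<^bsub>T\<^esub>\<rho>\<in>R. Q \<pi> (\<rho> t \<cdot>\<^sub>L l t) (c \<rho>) y)"
        using c t RH[OF _ t] RB[OF _ t] l[OF t] y p(1)
        by (intro T.finsum_cong') (auto simp: Q_mult[OF B \<pi>] intro!: Q_closed)
      finally show ?thesis .
    qed
    then have "pre y h = (\<Oplus>\<^bsub>T\<^esub>t\<in>{..<n}. \<Oplus>\<^bsub>T\<^esub>\<rho>\<in>R. Q \<pi> (\<rho> t \<cdot>\<^sub>L l t) (c \<rho>) y)"
      unfolding pre_def using c l y p(1) RH by (intro T.finsum_cong') (auto intro!: Q_closed T.finsum_closed)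
    also have "\<dots> = (\<Oplus>\<^bsub>T\<^esub>\<rho>\<in>R. \<Oplus>\<^bsub>T\<^esub>t\<in>{..<n}. Q \<pi> (\<rho> t \<cdot>\<^sub>L l t) (c \<rho>) y)"
      using c l y p(1) RH R(1) by (intro T.finsum_swap) (auto intro!: Q_closed)
    also have "\<dots> = (\<Oplus>\<^bsub>T\<^esub>\<rho>\<in>R. \<zero>\<^bsub>T\<^esub>)"
    proof (rule T.finsum_cong'[OF refl])
      fix \<rho> assume \<rho>: "\<rho> \<in> R"
      then have c\<rho>: "c \<rho> \<in> carrier H" using c by blast
      note q = Q_hom(2)[OF p(1) y c\<rho>]
      have "(\<Oplus>\<^bsub>T\<^esub>t\<in>{..<n}. Q \<pi> (\<rho> t \<cdot>\<^sub>L l t) (c \<rho>) y) = Q \<pi> (\<Oplus>\<^bsub>L\<^esub>t\<in>{..<n}. \<rho> t \<cdot>\<^sub>L l t) (c \<rho>) y"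
        using hom_finsum[OF module_abelian[OF L_module] T_ab q finite_lessThan, of n "\<lambda>t. \<rho> t \<cdot>\<^sub>L l t"] RH[OF \<rho>] l by simp
      also have "\<dots> = \<zero>\<^bsub>T\<^esub>"
        using hom_zero_minus(1)[OF module_abelian[OF L_module] T_ab q] R(3)[OF \<rho>] by simp
      finally show "(\<Oplus>\<^bsub>T\<^esub>t\<in>{..<n}. Q \<pi> (\<rho> t \<cdot>\<^sub>L l t) (c \<rho>) y) = \<zero>\<^bsub>T\<^esub>" .
    qed simp
    finally show ?thesis by simp
  qed
  \<comment> \<open>A coefficient vector for an element of L. By \<open>vanish\<close> the value of
    \<open>pre\<close> does not depend on which one is chosen.\<close>
  let ?rep = "inv_into (carrier ?F) cmb"
  have surj: "cmb ` carrier ?F = carrier L"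
  proof (intro equalityI subsetI)
    show "x \<in> carrier L" if "x \<in> cmb ` carrier ?F" for x using that module_homsD(1)[OF cmb] by auto
    show "x \<in> cmb ` carrier ?F" if "x \<in> carrier L" for x using gen[OF that] unfolding cmb_def by auto
  qed
  note fac = hom_factor[OF module_abelian[OF Fm] module_abelian[OF L_module] T_ab cmb pre, unfolded rs_simps,
      OF _ surj vanish left_module.lsmult_closed[OF F]]
  have fac1: "pre y (?rep (cmb h)) = pre y h" if "y \<in> carrier M" "h \<in> carrier ?F" for y h
    using that smult_closed by (intro fac) auto
  have fac2: "(\<lambda>x. pre y (?rep x)) \<in> module_homs k (rs L) T" if "y \<in> carrier M" for y
    using that smult_closed by (intro fac) auto
  have \<beta>: "bilin k (rs L) (rs M) T (\<lambda>x y. pre y (?rep x))"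
  proof (rule bilinI)
    fix x assume "x \<in> carrier (rs L)"
    then have "?rep x \<in> carrier ?F" using inv_into_into[of x cmb "carrier ?F"] surj by simp
    then show "(\<lambda>y. pre y (?rep x)) \<in> module_homs k (rs M) T" by (rule pre_y)
  qed (use fac2 in simp)
  define \<Omega> where "\<Omega> = tensor_lift k T (\<lambda>x y. pre y (?rep x))"
  note \<Omega>h = tensor_lift_hom[OF L_module M_module T_module \<beta>, folded \<Omega>_def]
    and \<Omega>p = tensor_lift_pure[OF L_module M_module T_module \<beta>, folded \<Omega>_def, unfolded rs_simps]
  have \<Omega>l: "\<Omega> ((a \<cdot>\<^sub>L l t) \<otimes>\<^sub>T y) = Q \<pi> (l t) a y" if a: "a \<in> carrier H" and y: "y \<in> carrier M" and t: "t < n" for a t y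
  proof -
    let ?u = "unit_vec H n t a"
    have u: "?u \<in> carrier ?F" by (rule ring.unit_vec(1)[OF H_ring a])
    have z: "\<zero>\<^bsub>H\<^esub> \<cdot>\<^sub>L l i = \<zero>\<^bsub>L\<^esub>" "Q \<pi> (l i) \<zero>\<^bsub>H\<^esub> y = \<zero>\<^bsub>T\<^esub>" if "i < n" for i
      using hom_zero_minus(1)[OF H_ab module_abelian[OF L_module] bilinD(2)[OF act_bilin[OF L]], of "l i"] l[OF that]
        hom_zero_minus(1)[OF H_ab T_ab Q_hom(1)[OF p(1) l[OF that] y]] by simp_all
    have "cmb ?u = (\<Oplus>\<^bsub>L\<^esub>i\<in>{..<n}. if t = i then a \<cdot>\<^sub>L l i else \<zero>\<^bsub>L\<^esub>)"
      unfolding cmb_def using l z a by (intro L.finsum_cong') (auto simp: unit_vec_def)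
    also have "\<dots> = a \<cdot>\<^sub>L l t" using t l a by (intro L.finsum_singleton) auto
    finally have cu: "cmb ?u = a \<cdot>\<^sub>L l t" .
    have "pre y ?u = (\<Oplus>\<^bsub>T\<^esub>i\<in>{..<n}. if t = i then Q \<pi> (l i) a y else \<zero>\<^bsub>T\<^esub>)"
      unfolding pre_def using l z a y p(1) by (intro T.finsum_cong') (auto simp: unit_vec_def intro!: Q_closed)
    also have "\<dots> = Q \<pi> (l t) a y" using t l a y p(1) by (intro T.finsum_singleton) (auto intro!: Q_closed)
    finally show ?thesis using fac1[OF y u] cu a l[OF t] y by (simp add: \<Omega>p)
  qed
  \<comment> \<open>The coproduct of h turns the argument into \<Sum> h1 b l_t \<otimes> h2 y. There
    \<Omega> is \<open>Q\<close> with coefficient h1 b; \<open>Q_mult\<close> shifts b onto l_t, and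
    \<open>sw_Q\<close> collects the sum.\<close>
  have key: "\<Omega> (h \<cdot> (b \<cdot>\<^sub>L l t) \<otimes>\<^sub>T y) = \<pi> h \<cdot> (b \<cdot>\<^sub>L l t) \<otimes>\<^sub>T y"
    if h: "h \<in> carrier H" and b: "b \<in> B" and y: "y \<in> carrier M" and t: "t < n" for h b y t
  proof -
    have bl: "b \<cdot>\<^sub>L l t \<in> carrier L" using l[OF t] BD(5)[OF b] by simp
    have "\<Omega> (h \<cdot> (b \<cdot>\<^sub>L l t) \<otimes>\<^sub>T y) = SW T (\<lambda>h1 h2. \<Omega> ((h1 \<cdot>\<^sub>L b \<cdot>\<^sub>L l t) \<otimes>\<^sub>T (h2 \<cdot>\<^sub>M y))) h"
      unfolding act_D_pure[OF h bl y]
      by (rule sw_comp[OF T_module T_module pure_act_bilin[OF bl y] \<Omega>h h])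
    also have "\<dots> = SW T (\<lambda>h1 h2. Q \<pi> (b \<cdot>\<^sub>L l t) h1 (h2 \<cdot>\<^sub>M y)) h"
    proof (rule sw_cong)
      fix h1 h2 assume hh: "h1 \<in> carrier H" "h2 \<in> carrier H"
      have "h1 \<cdot>\<^sub>L b \<cdot>\<^sub>L l t = (h1 \<bullet> b) \<cdot>\<^sub>L l t"
        using left_module.lsmult_assoc[OF L hh(1) BD(5)[OF b] l[OF t]] by simp
      then show "\<Omega> ((h1 \<cdot>\<^sub>L b \<cdot>\<^sub>L l t) \<otimes>\<^sub>T (h2 \<cdot>\<^sub>M y)) = Q \<pi> (b \<cdot>\<^sub>L l t) h1 (h2 \<cdot>\<^sub>M y)"
        using \<Omega>l[of "h1 \<bullet> b" "h2 \<cdot>\<^sub>M y" t] hh y t BD(5)[OF b] Q_mult[OF B \<pi> l[OF t] _ hh(1) b, of "h2 \<cdot>\<^sub>M y"] by simp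
    next
      show "bilin k H H T (\<lambda>h1 h2. Q \<pi> (b \<cdot>\<^sub>L l t) h1 (h2 \<cdot>\<^sub>M y))"
        using bl y p(1) by (intro bilinI Q_hom lin_comp[OF Q_hom(3)] lin_M_l lin_id) auto
    qed (use h in auto)
    also have "\<dots> = \<pi> h \<cdot> (b \<cdot>\<^sub>L l t) \<otimes>\<^sub>T y" by (rule sw_Q[OF p(1) bl y h])
    finally show ?thesis .
  qed
  let ?X = "{\<Oplus>\<^bsub>L\<^esub>t\<in>{..<n}. b t \<cdot>\<^sub>L l t | b. \<forall>t<n. b t \<in> B}"
  have XL: "?X \<subseteq> carrier (rs L)" using l BD(5) by (auto intro!: L.finsum_closed)
  have key2: "\<Omega> (h \<cdot> x \<otimes>\<^sub>T y) = \<pi> h \<cdot> x \<otimes>\<^sub>T y" if h: "h \<in> carrier H" and x: "x \<in> ?X" and y: "y \<in> carrier M" for h x y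
  proof -
    obtain b where b: "\<forall>t<n. b t \<in> B" "x = (\<Oplus>\<^bsub>L\<^esub>t\<in>{..<n}. b t \<cdot>\<^sub>L l t)" using x by blast
    have bl: "b t \<cdot>\<^sub>L l t \<in> carrier L" if "t < n" for t using b(1) that l BD(5) by simp
    have f: "(\<lambda>x. \<Omega> (h \<cdot> x \<otimes>\<^sub>T y)) \<in> module_homs k (rs L) T" "(\<lambda>x. \<pi> h \<cdot> x \<otimes>\<^sub>T y) \<in> module_homs k (rs L) T"
      using h y p(3) by (intro lin_comp[OF \<Omega>h] lin_D_r lin_T lin_id; simp)+
    have "\<Omega> (h \<cdot> x \<otimes>\<^sub>T y) = (\<Oplus>\<^bsub>T\<^esub>t\<in>{..<n}. \<Omega> (h \<cdot> (b t \<cdot>\<^sub>L l t) \<otimes>\<^sub>T y))"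
      unfolding b(2) using bl hom_finsum[OF module_abelian[OF L_module] T_ab f(1) finite_lessThan, of n "\<lambda>t. b t \<cdot>\<^sub>L l t"] by simp
    also have "\<dots> = (\<Oplus>\<^bsub>T\<^esub>t\<in>{..<n}. \<pi> h \<cdot> (b t \<cdot>\<^sub>L l t) \<otimes>\<^sub>T y)"
      using b(1) h y bl p(3) by (intro T.finsum_cong') (auto simp: key)
    also have "\<dots> = \<pi> h \<cdot> x \<otimes>\<^sub>T y"
      unfolding b(2) using bl hom_finsum[OF module_abelian[OF L_module] T_ab f(2) finite_lessThan, of n "\<lambda>t. b t \<cdot>\<^sub>L l t"] by simp
    finally show ?thesis .
  qed
  show thesis
  proof (rule that[OF \<Omega>h])
    fix h s assume h: "h \<in> carrier H" and s: "s \<in> tensor_span k (rs L) (rs M) ?X (carrier M)"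
    show "\<Omega> (h \<cdot> s) = \<pi> h \<cdot> s"
      by (rule tensor_span_ext[OF L_module M_module XL _ lin_comp[OF \<Omega>h bilinD(1)[OF act_D_bilin h]]
            bilinD(1)[OF act_D_bilin p(3)[OF h]] key2[OF h] s]) simp_all
  qed
qed

text \<open>A tensor is a finite sum of pure tensors, and each first factor has finitely many
  coefficients with respect to the generators. E collects these coefficients, so any B that contains
  E works.\<close>

lemma tensor_span_finite_support:
  assumes l: "\<And>t. t < n \<Longrightarrow> l t \<in> carrier L"
    and gen: "\<And>x. x \<in> carrier L \<Longrightarrow> \<exists>h\<in>carrier (free_module H n). x = (\<Oplus>\<^bsub>L\<^esub>t\<in>{..<n}. h t \<cdot>\<^sub>L l t)"
    and s: "s \<in> carrier T"
  shows "\<exists>E. finite E \<and> E \<subseteq> carrier H \<and> (\<forall>B. E \<subseteq> B \<longrightarrow>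
    s \<in> tensor_span k (rs L) (rs M) {\<Oplus>\<^bsub>L\<^esub>t\<in>{..<n}. b t \<cdot>\<^sub>L l t | b. \<forall>t<n. b t \<in> B} (carrier M))"
proof -
  have "s \<in> tensor_span k (rs L) (rs M) (carrier L) (carrier M)"
    using s tensor_span_carrier[OF L_module M_module] by simp
  then show ?thesis
  proof induction
    case (pure x y)
    obtain h where h: "h \<in> carrier (free_module H n)" "x = (\<Oplus>\<^bsub>L\<^esub>t\<in>{..<n}. h t \<cdot>\<^sub>L l t)" using gen[OF pure(1)] by blast
    show ?case
      using h pure(2) by (intro exI[of _ "h ` {..<n}"]) (auto simp: free_module_simps intro!: tensor_span.pure)
  next
    case (add s t)
    obtain E E' where "finite E" "E \<subseteq> carrier H" "\<And>B. E \<subseteq> B \<Longrightarrow>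
        s \<in> tensor_span k (rs L) (rs M) {\<Oplus>\<^bsub>L\<^esub>t\<in>{..<n}. b t \<cdot>\<^sub>L l t | b. \<forall>t<n. b t \<in> B} (carrier M)"
      "finite E'" "E' \<subseteq> carrier H" "\<And>B. E' \<subseteq> B \<Longrightarrow>
        t \<in> tensor_span k (rs L) (rs M) {\<Oplus>\<^bsub>L\<^esub>t\<in>{..<n}. b t \<cdot>\<^sub>L l t | b. \<forall>t<n. b t \<in> B} (carrier M)"
      using add.IH by (elim exE conjE) blast
    then show ?case by (intro exI[of _ "E \<union> E'"] conjI allI impI tensor_span.add) auto
  qed
qed

end

section \<open>Pseudo-coherence of the tensor product\<close>

lemma submodule_left_module:
  assumes "left_module R M" "submodule N R M"
  shows "left_module R (M\<lparr>carrier := N\<rparr>)"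
proof -
  interpret M: left_module R M by fact
  have N: "subgroup N (add_monoid M)" "\<And>a x. a \<in> carrier R \<Longrightarrow> x \<in> N \<Longrightarrow> a \<odot>\<^bsub>M\<^esub> x \<in> N"
    using assms(2) by (auto simp: submodule_def submodule_axioms_def)
  have "N \<subseteq> carrier M" using subgroup.subset[OF N(1)] by simp
  then show ?thesis
    using N(2) M.lsmult_l_distr M.lsmult_r_distr M.lsmult_assoc M.lsmult_one
    by (intro left_module.intro left_module_axioms.intro left_module_ring[OF assms(1)]
        sub_abelian(1)[OF M.abelian_group_axioms N(1)]) (auto simp: subset_iff)
qed

text \<open>The identity of A is a finite sum of maps y \<pi>. Applied to all coordinates of h at
  once, it writes h as a left combination of the projected vectors, each of which lies in G.\<close>

lemma (in hopf_pair) mem_if_projections_mem: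
  assumes G: "\<And>x y. x \<in> G \<Longrightarrow> y \<in> G \<Longrightarrow> x \<oplus>\<^bsub>free_module H r\<^esub> y \<in> G"
      "\<And>a x. a \<in> carrier H \<Longrightarrow> x \<in> G \<Longrightarrow> a \<odot>\<^bsub>free_module H r\<^esub> x \<in> G"
    and \<pi>: "\<And>\<pi>. rlinB B \<pi> \<Longrightarrow> (\<lambda>j\<in>{..<r}. \<pi> (h j)) \<in> G"
    and h: "h \<in> carrier (free_module H r)" "\<And>j. j < r \<Longrightarrow> h j \<in> A"
  shows "h \<in> G"
proof -
  have hH: "h j \<in> carrier H" if "j < r" for j using h(1) that by (auto simp: free_module_simps)
  obtain e where e: "proj_map e" "\<And>x. x \<in> A \<Longrightarrow> e x = x" using projective by blast
  have "(\<lambda>j\<in>{..<r}. g (h j)) \<in> G" if "proj_map g" for g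
    using that
  proof induction
    case (base y \<pi>)
    have "(\<lambda>j\<in>{..<r}. y \<bullet> \<pi> (h j)) = y \<odot>\<^bsub>free_module H r\<^esub> (\<lambda>j\<in>{..<r}. \<pi> (h j))"
      by (auto simp: free_module_simps)
    then show ?case using G(2)[OF AD(5)[OF base(1)] \<pi>[OF base(2)]] by simp
  next
    case (add g g')
    have eq: "(\<lambda>j\<in>{..<r}. g (h j) \<oplus>\<^bsub>H\<^esub> g' (h j))
        = (\<lambda>j\<in>{..<r}. g (h j)) \<oplus>\<^bsub>free_module H r\<^esub> (\<lambda>j\<in>{..<r}. g' (h j))"
      by (auto simp: free_module_simps)
    show ?case unfolding eq by (rule G(1)[OF add.IH])
  next
    case (ext g g')
    have eq: "(\<lambda>j\<in>{..<r}. g' (h j)) = (\<lambda>j\<in>{..<r}. g (h j))" using ext(2) hH by auto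
    show ?case unfolding eq by (rule ext.IH)
  qed
  from this[OF e(1)] have "(\<lambda>j\<in>{..<r}. e (h j)) \<in> G" .
  also have "(\<lambda>j\<in>{..<r}. e (h j)) = h"
    using h e(2) by (intro free_module_eqI[of _ H r]) (auto simp: free_module_simps PiE_iff)
  finally show ?thesis .
qed

text \<open>Vectors with all coordinates in B lie in a finite dimensional space, so the relations
  with entries in B admit a finite basis over k.\<close>

lemma (in hopf) free_module_sub_span:
  assumes w: "\<And>i. i < m \<Longrightarrow> w i \<in> carrier H" and B: "B \<subseteq> lin_span k H {..<m::nat} w"
    and h: "h \<in> carrier (free_module H r)" "\<And>j. j < r \<Longrightarrow> h j \<in> B"
  shows "h \<in> lin_span k (rs (free_module H r)) ({..<r} \<times> {..<m}) (\<lambda>(j, i). unit_vec H r j (w i))"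
proof -
  let ?F = "free_module H r"
  have Fm: "module k (rs ?F)" by (intro rs_module ring.free_left_module H_ring)
  interpret F: left_module H ?F by (rule ring.free_left_module[OF H_ring])
  let ?J = "{..<r} \<times> {..<m}" and ?v = "\<lambda>(j, i). unit_vec H r j (w i)"
  have v: "?v p \<in> carrier (rs ?F)" if "p \<in> ?J" for p
    using that w ring.unit_vec(1)[OF H_ring] by auto
  let ?L = "lin_span k (rs ?F) ?J ?v"
  have L: "submodule ?L k (rs ?F)" using v by (intro lin_span_submodule[OF Fm]) auto
  have u: "unit_vec H r j x \<in> ?L" if j: "j < r" and x: "x \<in> B" for j x
  proof -
    obtain c where c: "\<forall>i\<in>{..<m}. c i \<in> carrier k" "x = (\<Oplus>\<^bsub>H\<^esub>i\<in>{..<m}. c i \<odot>\<^bsub>H\<^esub> w i)"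
      using B x unfolding lin_span_def by blast
    have "unit_vec H r j x = (\<Oplus>\<^bsub>rs ?F\<^esub>i\<in>{..<m}. unit_vec H r j (c i \<odot>\<^bsub>H\<^esub> w i))"
      unfolding c(2) using c(1) w smult_closed
      by (intro hom_finsum[OF H_ab module_abelian[OF Fm] lin_unit_vec]) auto
    also have "\<dots> \<in> ?L"
    proof (rule submodule_finsum[OF Fm L])
      fix i assume i: "i \<in> {..<m}"
      have "unit_vec H r j (w i) \<in> ?L"
        using lin_span_incl[OF Fm, of ?J ?v "(j, i)"] v i j by auto
      then have "c i \<odot>\<^bsub>rs ?F\<^esub> unit_vec H r j (w i) \<in> ?L"
        using module.submoduleE(4)[OF Fm L] c(1) i by blast
      then show "unit_vec H r j (c i \<odot>\<^bsub>H\<^esub> w i) \<in> ?L"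
        using module_homsD(3)[OF lin_unit_vec, of "c i" "w i" r j] c(1) i w by simp
    qed simp
    finally show ?thesis .
  qed
  have "h = (\<Oplus>\<^bsub>rs ?F\<^esub>j\<in>{..<r}. unit_vec H r j (h j))" using ring.unit_vec(2)[OF H_ring h(1)] by simp
  also have "\<dots> \<in> ?L" using u h(2) by (intro submodule_finsum[OF Fm L]) auto
  finally show ?thesis .
qed

text \<open>For generators g of N, the kernel of the induced map from the free module is generated
  over H by its elements with coordinates in one fixed B; these form a finite dimensional space over
  k, whose basis is the wanted finite generating set.\<close>

lemma (in diagonal_action) diagonal_tensor_pseudo_coherent:
  assumes fp: "finitely_presented H L"
    and K: "\<And>A. A \<in> \<K> \<Longrightarrow> subhopf A"
      "\<And>A. A \<in> \<K> \<Longrightarrow> \<exists>m w. (\<forall>i<m::nat. w i \<in> carrier H) \<and> A \<subseteq> lin_span k H {..<m} w"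
    and dir: "\<And>E. finite E \<Longrightarrow> E \<subseteq> carrier H \<Longrightarrow> \<exists>A\<in>\<K>. E \<subseteq> A"
      "\<And>A E. A \<in> \<K> \<Longrightarrow> finite E \<Longrightarrow> E \<subseteq> carrier H \<Longrightarrow> \<exists>A'\<in>\<K>. A \<subseteq> A' \<and> E \<subseteq> A'"
  shows "pseudo_coherent H D"
  unfolding pseudo_coherent_def
proof (intro conjI allI impI D_left_module)
  fix N assume N: "submodule N H D" and fg: "finitely_generated H (D\<lparr>carrier := N\<rparr>)"
  let ?N = "D\<lparr>carrier := N\<rparr>"
  interpret T: abelian_group T by (rule T_ab)
  have NT: "N \<subseteq> carrier T" "subgroup N (add_monoid D)" "\<And>a x. a \<in> carrier H \<Longrightarrow> x \<in> N \<Longrightarrow> a \<cdot> x \<in> N"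
    using N subgroup.subset[of N "add_monoid D"] by (auto simp: submodule_def submodule_axioms_def)
  have Nl: "left_module H ?N" by (rule submodule_left_module[OF D_left_module N])
  obtain r g where g: "\<And>j. j < r \<Longrightarrow> g j \<in> carrier ?N" "carrier ?N \<subseteq> lin_span H ?N {..<r::nat} g"
    using finitely_generated_enum[OF left_module_abelian[OF Nl] left_module.lsmult_closed[OF Nl] fg] by blast
  obtain n l R where l: "\<And>t. t < n \<Longrightarrow> l t \<in> carrier L"
    and gen: "\<And>x. x \<in> carrier L \<Longrightarrow> \<exists>h\<in>carrier (free_module H n). x = (\<Oplus>\<^bsub>L\<^esub>t\<in>{..<n::nat}. h t \<cdot>\<^sub>L l t)"
    and R: "finite R" "R \<subseteq> carrier (free_module H n)"
      "\<And>\<rho>. \<rho> \<in> R \<Longrightarrow> (\<Oplus>\<^bsub>L\<^esub>t\<in>{..<n}. \<rho> t \<cdot>\<^sub>L l t) = \<zero>\<^bsub>L\<^esub>"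
      "\<And>h. h \<in> carrier (free_module H n) \<Longrightarrow> (\<Oplus>\<^bsub>L\<^esub>t\<in>{..<n}. h t \<cdot>\<^sub>L l t) = \<zero>\<^bsub>L\<^esub> \<Longrightarrow>
        \<exists>c. (\<forall>\<rho>\<in>R. c \<rho> \<in> carrier H) \<and> (\<forall>t<n. h t = (\<Oplus>\<^bsub>H\<^esub>\<rho>\<in>R. c \<rho> \<bullet> \<rho> t))"
    by (rule finitely_presented_relations[OF L fp]) (rule that)
  let ?X = "\<lambda>B. {\<Oplus>\<^bsub>L\<^esub>t\<in>{..<n}. b t \<cdot>\<^sub>L l t | b. \<forall>t<n. b t \<in> B}"
  have gT: "g j \<in> carrier T" "g j \<in> N" if "j < r" for j using g(1)[OF that] NT(1) by auto
  have "\<forall>j\<in>{..<r}. \<exists>E. finite E \<and> E \<subseteq> carrier H \<and> (\<forall>B. E \<subseteq> B \<longrightarrow>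
      g j \<in> tensor_span k (rs L) (rs M) (?X B) (carrier M))"
    using tensor_span_finite_support[OF l gen gT(1)] by simp
  then have "\<exists>E. \<forall>j\<in>{..<r}. finite (E j) \<and> E j \<subseteq> carrier H \<and> (\<forall>B. E j \<subseteq> B \<longrightarrow>
      g j \<in> tensor_span k (rs L) (rs M) (?X B) (carrier M))"
    by (rule bchoice)
  then obtain E where E0: "\<forall>j\<in>{..<r}. finite (E j) \<and> E j \<subseteq> carrier H \<and> (\<forall>B. E j \<subseteq> B \<longrightarrow>
      g j \<in> tensor_span k (rs L) (rs M) (?X B) (carrier M))"
    by (rule exE)
  then have E: "finite (E j)" "E j \<subseteq> carrier H"
    "E j \<subseteq> B \<Longrightarrow> g j \<in> tensor_span k (rs L) (rs M) (?X B) (carrier M)" if "j < r" for j B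
    using that by blast+
  \<comment> \<open>B has to contain the coefficients of the generators g and the entries of the
    defining relations of L; these are the two conditions for applying
    \<open>projection_lift\<close> to g.\<close>
  let ?E = "(\<Union>j<r. E j) \<union> (\<Union>\<rho>\<in>R. \<rho> ` {..<n})"
  have fE: "finite ?E" using E(1) R(1) by simp
  have EH: "?E \<subseteq> carrier H"
  proof (rule Un_least; rule UN_least)
    show "E j \<subseteq> carrier H" if "j \<in> {..<r}" for j using E(2) that by simp
    show "\<rho> ` {..<n} \<subseteq> carrier H" if "\<rho> \<in> R" for \<rho> using that R(2) by (auto simp: free_module_simps)
  qed
  obtain B where B: "B \<in> \<K>" "?E \<subseteq> B" using dir(1)[OF fE EH] by (rule bexE)
  note sB = K(1)[OF B(1)] and BD = subhopfD[OF K(1)[OF B(1)]]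
  have gB: "g j \<in> tensor_span k (rs L) (rs M) (?X B) (carrier M)" if "j < r" for j
    using B(2) that by (intro E(3)) auto
  have RB: "\<rho> t \<in> B" if "\<rho> \<in> R" "t < n" for \<rho> t using B(2) that by blast

  let ?F = "free_module H r"
  have Fl: "left_module H ?F" by (rule ring.free_left_module[OF H_ring])
  have Fm: "module k (rs ?F)" by (rule rs_module[OF Fl])
  interpret F: left_module H ?F by (rule Fl)
  have Fj: "h j \<in> carrier H" if "h \<in> carrier ?F" "j < r" for h j using that by (auto simp: free_module_simps)
  define \<Phi> where "\<Phi> = (\<lambda>h. \<Oplus>\<^bsub>?N\<^esub>j\<in>{..<r}. h j \<odot>\<^bsub>?N\<^esub> g j)"
  have \<Phi>: "\<Phi> \<in> module_homs H ?F ?N" unfolding \<Phi>_def by (rule lin_comb_hom[OF Nl g(1)])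
  have \<Phi>T: "\<Phi> h = (\<Oplus>\<^bsub>T\<^esub>j\<in>{..<r}. h j \<cdot> g j)" if "h \<in> carrier ?F" for h
    using sub_abelian(2)[OF left_module_abelian[OF D_left_module] NT(2), of "{..<r}" "\<lambda>j. h j \<cdot> g j"]
      Fj[OF that] gT NT(3) by (simp add: \<Phi>_def)
  let ?K = "a_kernel ?F ?N \<Phi>"
  have K_eq: "?K = {h \<in> carrier ?F. \<Phi> h = \<zero>\<^bsub>T\<^esub>}" by (simp add: a_kernel_eq)
  have Ks: "subgroup ?K (add_monoid ?F)"
    unfolding a_kernel_eq by (rule kernel_subgroup[OF F.abelian_group_axioms left_module_abelian[OF Nl] \<Phi>])
  have Kz: "\<zero>\<^bsub>?F\<^esub> \<in> ?K"
    and Kadd: "x \<in> ?K \<Longrightarrow> y \<in> ?K \<Longrightarrow> x \<oplus>\<^bsub>?F\<^esub> y \<in> ?K"  for x y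
    using subgroup.one_closed[OF Ks] subgroup.m_closed[OF Ks] by auto
  have Ksm: "a \<odot>\<^bsub>?F\<^esub> x \<in> ?K" if "a \<in> carrier H" "x \<in> ?K" for a x
    using that module_homsD(3)[OF \<Phi> that(1), of x] F.lsmult_closed[OF that(1)]
      hom_zero_minus(1)[OF T_ab T_ab bilinD(1)[OF act_D_bilin that(1)]] by (simp add: K_eq)
  \<comment> \<open>The relations among the g with coordinates in B. This is a space over k only,
    which is why it is handled by restriction of scalars and linear algebra.\<close>
  let ?R = "{h \<in> ?K. \<forall>j<r. h j \<in> B}"
  have RF: "?R \<subseteq> carrier ?F" by (auto simp: K_eq)
  have Bz: "\<zero>\<^bsub>H\<^esub> \<in> B" using BD(7)[of "\<zero>\<^bsub>k\<^esub>", OF _ BD(2)] by (simp add: smult_l_null)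
  have inv_eq: "\<ominus>\<^bsub>rs ?F\<^esub> x = \<ominus>\<^bsub>?F\<^esub> x" if "x \<in> carrier ?F" for x
    using that F.l_neg[OF that] by (intro abelian_group.minus_equality[OF module_abelian[OF Fm]]) simp_all
  have Rsub: "submodule ?R k (rs ?F)"
  proof (rule module.submoduleI[OF Fm])
    show "?R \<subseteq> carrier (rs ?F)" using RF by simp
    show "\<zero>\<^bsub>rs ?F\<^esub> \<in> ?R" using Kz Bz by (simp add: free_module_simps)
    show sm: "c \<odot>\<^bsub>rs ?F\<^esub> x \<in> ?R" if "c \<in> carrier k" "x \<in> ?R" for c x
      using that Ksm[of "c \<odot>\<^bsub>H\<^esub> \<one>\<^sub>H" x] BD(2,3,7) smult_closed by (auto simp: free_module_simps)
    show "x \<oplus>\<^bsub>rs ?F\<^esub> y \<in> ?R" if "x \<in> ?R" "y \<in> ?R" for x y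
      using that Kadd BD(6) by (auto simp: free_module_simps)
    fix x assume x: "x \<in> ?R"
    have "(\<ominus>\<^bsub>k\<^esub> \<one>\<^bsub>k\<^esub>) \<odot>\<^bsub>rs ?F\<^esub> x = \<ominus>\<^bsub>rs ?F\<^esub> x"
      using x RF module.smult_l_minus[OF Fm, of "\<one>\<^bsub>k\<^esub>" x] module.smult_one[OF Fm, of x]
      by (auto simp: k_rules simp del: rs_simps(5))
    then show "\<ominus>\<^bsub>rs ?F\<^esub> x \<in> ?R" using sm[OF _ x, of "\<ominus>\<^bsub>k\<^esub> \<one>\<^bsub>k\<^esub>"] by (simp add: k_rules del: rs_simps(5))
  qed
  obtain m w where w: "\<forall>i<m::nat. w i \<in> carrier H" "B \<subseteq> lin_span k H {..<m} w" using K(2)[OF B(1)] by blast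
  let ?J = "{..<r} \<times> {..<m}" and ?v = "\<lambda>(j, i). unit_vec H r j (w i)"
  have v: "?v p \<in> carrier (rs ?F)" if "p \<in> ?J" for p
    using that w ring.unit_vec(1)[OF H_ring] by auto
  have Rv: "?R \<subseteq> lin_span k (rs ?F) ?J ?v"
    using free_module_sub_span[OF _ w(2)] w(1) RF by blast
  have fJ: "finite ?J" by simp
  obtain q a \<psi> where a: "dual_sys k (rs ?F) {..<q::nat} a \<psi>" "\<And>i. i < q \<Longrightarrow> a i \<in> ?R"
    "\<And>x. x \<in> ?R \<Longrightarrow> (\<Oplus>\<^bsub>rs ?F\<^esub>i\<in>{..<q}. \<psi> i x \<odot>\<^bsub>rs ?F\<^esub> a i) = x"
    by (rule field.dual_basis[OF k_field Fm Rsub fJ v Rv]) (assumption, rule that)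
  note aD = dual_sysD[OF a(1)]
  have aF: "a i \<in> carrier ?F" if "i < q" for i using a(2)[OF that] RF by blast
  \<comment> \<open>The H-submodule generated by a basis of ?R over k. It contains ?R because
    scalars act through multiples of the unit of H.\<close>
  let ?G = "lin_span H ?F {..<q} a"
  have RG: "x \<in> ?G" if x: "x \<in> ?R" for x
  proof -
    have "x = (\<Oplus>\<^bsub>?F\<^esub>i\<in>{..<q}. (\<psi> i x \<odot>\<^bsub>H\<^esub> \<one>\<^sub>H) \<odot>\<^bsub>?F\<^esub> a i)" using a(3)[OF x] by simp
    moreover have "\<psi> i x \<odot>\<^bsub>H\<^esub> \<one>\<^sub>H \<in> carrier H" if "i < q" for i
      using aD(4)[of i x] that x RF smult_closed by auto
    ultimately show ?thesis unfolding lin_span_def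
      by (intro CollectI exI[of _ "\<lambda>i. \<psi> i x \<odot>\<^bsub>H\<^esub> \<one>\<^sub>H"] conjI) auto
  qed
  \<comment> \<open>A is chosen only now, large enough for the coordinates of the given h. It
    provides the maps \<pi>, but the target ?G was fixed before.\<close>
  have KG: "h \<in> ?G" if h: "h \<in> ?K" for h
  proof -
    have hF: "h \<in> carrier ?F" using h by (simp add: K_eq)
    have "h ` {..<r} \<subseteq> carrier H" using Fj[OF hF] by auto
    with dir(2)[OF B(1)] have "\<exists>A\<in>\<K>. B \<subseteq> A \<and> h ` {..<r} \<subseteq> A" by blast
    then obtain A where A: "A \<in> \<K>" "B \<subseteq> A" "h ` {..<r} \<subseteq> A" by (elim bexE conjE)
    obtain m' w' where w': "\<forall>i<m'::nat. w' i \<in> carrier H" "A \<subseteq> lin_span k H {..<m'} w'" using K(2)[OF A(1)] by blast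
    interpret hp: hopf_pair k H A B m' w'
      using K(1)[OF A(1)] sB A(2) w' by unfold_locales auto
    show ?thesis
    proof (rule hp.mem_if_projections_mem[OF _ _ _ hF])
      show "x \<oplus>\<^bsub>?F\<^esub> y \<in> ?G" if "x \<in> ?G" "y \<in> ?G" for x y
        using aF that by (intro left_lin_span(1)[OF Fl]) auto
      show "b \<odot>\<^bsub>?F\<^esub> x \<in> ?G" if "b \<in> carrier H" "x \<in> ?G" for b x
        using aF that by (intro left_lin_span(2)[OF Fl]) auto
      show "h j \<in> A" if "j < r" for j using A(3) that by auto
      fix \<pi> assume "rlinB B \<pi>"
      then have \<pi>: "rlin B \<pi>" "\<And>h. h \<in> carrier H \<Longrightarrow> \<pi> h \<in> B" by (auto simp: rlinB_def)
      obtain \<Omega> where \<Omega>: "\<Omega> \<in> module_homs k T T"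
        "\<And>h s. h \<in> carrier H \<Longrightarrow> s \<in> tensor_span k (rs L) (rs M) (?X B) (carrier M) \<Longrightarrow> \<Omega> (h \<cdot> s) = \<pi> h \<cdot> s"
        by (rule projection_lift[of n l R B \<pi>])
            (erule l, erule gen, rule R(1), rule R(2), erule R(3), erule (1) R(4), rule sB, erule (1) RB, rule \<pi>(1), rule that)
      let ?h = "\<lambda>j\<in>{..<r}. \<pi> (h j)"
      have h': "?h \<in> carrier ?F" using \<pi>(2) BD(5) Fj[OF hF] by (auto simp: free_module_simps)
      \<comment> \<open>Since \<Omega>(h j g j) = \<pi>(h j) g j, applying \<Omega> to the relation
        \<Phi> h = 0 shows that the projected vector is a relation as well, now with coordinates in
        B.\<close>
      have "\<Phi> ?h = (\<Oplus>\<^bsub>T\<^esub>j\<in>{..<r}. \<Omega> (h j \<cdot> g j))"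
        unfolding \<Phi>T[OF h']
      proof (rule T.finsum_cong'[OF refl])
        show "?h j \<cdot> g j = \<Omega> (h j \<cdot> g j)" if "j \<in> {..<r}" for j
          using \<Omega>(2)[OF Fj[OF hF] gB] that by simp
        show "(\<lambda>j. \<Omega> (h j \<cdot> g j)) \<in> {..<r} \<rightarrow> carrier T"
          using module_homsD(1)[OF \<Omega>(1)] Fj[OF hF] gT(1) by simp
      qed
      also have "\<dots> = \<Omega> (\<Phi> h)"
        unfolding \<Phi>T[OF hF] using Fj[OF hF] gT(1)
        by (intro hom_finsum[OF T_ab T_ab \<Omega>(1), symmetric]) auto
      also have "\<dots> = \<zero>\<^bsub>T\<^esub>" using h hom_zero_minus(1)[OF T_ab T_ab \<Omega>(1)] by (simp add: K_eq)
      finally have "\<Phi> ?h = \<zero>\<^bsub>T\<^esub>" .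
      with h' have "?h \<in> ?K" unfolding K_eq by blast
      moreover have "\<forall>j<r. ?h j \<in> B" using \<pi>(2) Fj[OF hF] by simp
      ultimately show "?h \<in> ?G" by (intro RG CollectI conjI)
    qed
  qed
  have "finitely_generated H (?F\<lparr>carrier := ?K\<rparr>)"
  proof (rule finitely_generatedI)
    show "abelian_group (?F\<lparr>carrier := ?K\<rparr>)" by (rule sub_abelian(1)[OF F.abelian_group_axioms Ks])
    show "b \<odot>\<^bsub>?F\<lparr>carrier := ?K\<rparr>\<^esub> x \<in> carrier (?F\<lparr>carrier := ?K\<rparr>)"
      if "b \<in> carrier H" "x \<in> carrier (?F\<lparr>carrier := ?K\<rparr>)" for b x using that Ksm by simp
    show "finite {..<q}" by simp
    \<comment> \<open>Members of a dual system are distinct, because coinciding values would give 1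
      = 0 in the field.\<close>
    show "inj_on a {..<q}"
    proof (rule inj_onI)
      fix i j assume "i \<in> {..<q}" "j \<in> {..<q}" "a i = a j"
      then show "i = j" using aD(5)[of i i] aD(5)[of i j] field.is_ring[OF k_field] one_not_zero by (auto split: if_splits)
    qed
    show "a i \<in> carrier (?F\<lparr>carrier := ?K\<rparr>)" if "i \<in> {..<q}" for i using a(2) that by simp
    show "carrier (?F\<lparr>carrier := ?K\<rparr>) \<subseteq> lin_span H (?F\<lparr>carrier := ?K\<rparr>) {..<q} a"
    proof
      fix h assume "h \<in> carrier (?F\<lparr>carrier := ?K\<rparr>)"
      then have "h \<in> ?G" using KG by simp
      then obtain c where c: "\<forall>i\<in>{..<q}. c i \<in> carrier H" "h = (\<Oplus>\<^bsub>?F\<^esub>i\<in>{..<q}. c i \<odot>\<^bsub>?F\<^esub> a i)"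
        by (auto simp: lin_span_def)
      have "(\<Oplus>\<^bsub>?F\<lparr>carrier := ?K\<rparr>\<^esub>i\<in>{..<q}. c i \<odot>\<^bsub>?F\<^esub> a i) = h"
        unfolding c(2) using c(1) a(2) Ksm by (intro sub_abelian(2)[OF F.abelian_group_axioms Ks]) auto
      then show "h \<in> lin_span H (?F\<lparr>carrier := ?K\<rparr>) {..<q} a" using c(1) unfolding lin_span_def by auto
    qed
  qed
  moreover have "\<Phi> ` carrier ?F = carrier ?N"
  proof (intro equalityI subsetI)
    show "x \<in> carrier ?N" if "x \<in> \<Phi> ` carrier ?F" for x using that module_homsD(1)[OF \<Phi>] by auto
    fix x assume "x \<in> carrier ?N"
    then obtain c where c: "\<forall>j\<in>{..<r}. c j \<in> carrier H" "x = (\<Oplus>\<^bsub>?N\<^esub>j\<in>{..<r}. c j \<odot>\<^bsub>?N\<^esub> g j)"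
      using g(2) unfolding lin_span_def by blast
    have "(\<lambda>j\<in>{..<r}. c j) \<in> carrier ?F" using c(1) by (simp add: free_module_simps)
    moreover have "\<Phi> (\<lambda>j\<in>{..<r}. c j) = x"
      unfolding \<Phi>_def c(2) using c(1) g(1) left_module.lsmult_closed[OF Nl]
      by (intro abelian_monoid.finsum_cong'[OF abelian_group.axioms(1)[OF left_module_abelian[OF Nl]]]) auto
    ultimately show "x \<in> \<Phi> ` carrier ?F" by blast
  qed
  ultimately show "finitely_presented H ?N"
    unfolding finitely_presented_def using \<Phi> by blast
qed

text \<open>Pseudo-coherence is applied to L as a submodule of itself; the update of its carrier by
  the same carrier changes nothing.\<close>

lemma coherent_finitely_presented:
  assumes "left_module R L" "coherent R L"
  shows "finitely_presented R L"
proof -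
  interpret L: left_module R L by fact
  have "subgroup (carrier L) (add_monoid L)"
    by unfold_locales (auto simp: a_inv_def[symmetric])
  then have "submodule (carrier L) R L" using L.lsmult_closed by (simp add: submodule_def submodule_axioms_def)
  then have "finitely_generated R (L\<lparr>carrier := carrier L\<rparr>) \<longrightarrow> finitely_presented R (L\<lparr>carrier := carrier L\<rparr>)"
    using assms(2) unfolding coherent_def pseudo_coherent_def by blast
  moreover have "L\<lparr>carrier := carrier L\<rparr> = L" by (cases L) simp
  ultimately show ?thesis using assms(2) by (simp add: coherent_def)
qed

theorem proposition6p3:
  fixes k :: "'k ring" and H :: "('k, 'h) hopf"
    and \<Lambda> :: "'i set" and leq :: "'i \<Rightarrow> 'i \<Rightarrow> bool" and i0 :: 'i
    and L :: "('h, 'l) module" and M :: "('h, 'm) module"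
  assumes "field k"
    and "locally_frobenius_hopf_algebra k H \<Lambda> leq i0"
    and "left_module H L" and "coherent H L"
    and "left_module H M" and "coherent H M"
  shows "pseudo_coherent H (diagonal_tensor k H L M)"
proof -
  from assms(2) have "hopf_algebra k H" and shape: "shape \<Lambda> leq i0"
    by (simp_all add: locally_frobenius_hopf_algebra_def)
  then interpret hopf k H by (simp add: hopf_def)
  obtain K :: "'i \<Rightarrow> 'h set" where
    K: "\<forall>\<mu>\<in>\<Lambda>. sub_hopf_algebra k H (K \<mu>) \<and> finitely_generated k (H\<lparr>carrier := K \<mu>\<rparr>)"
      "\<forall>\<mu>\<in>\<Lambda>. \<forall>\<nu>\<in>\<Lambda>. leq \<mu> \<nu> \<and> \<mu> \<noteq> \<nu> \<longrightarrow> K \<mu> \<subset> K \<nu>"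
      "carrier H = (\<Union>\<mu>\<in>\<Lambda>. K \<mu>)"
      "\<forall>\<mu>\<in>\<Lambda>. involutive (H\<lparr>carrier := K \<mu>\<rparr>) \<and> unimodular (H\<lparr>carrier := K \<mu>\<rparr>)"
    using assms(2) unfolding locally_frobenius_hopf_algebra_def by (elim conjE exE) (rule that)
  interpret diagonal_action k H L M
  proof (intro diagonal_action.intro inv_hopf.intro inv_hopf_axioms.intro diagonal_action_axioms.intro hopf_axioms)
    \<comment> \<open>Every element of H lies in some K \<mu>, and the antipode there is the
      restriction of that of H.\<close>
    show "S (S h) = h" if h: "h \<in> carrier H" for h
    proof -
      obtain \<mu> where \<mu>: "\<mu> \<in> \<Lambda>" "h \<in> K \<mu>" using h unfolding K(3) by blast
      have "involutive (H\<lparr>carrier := K \<mu>\<rparr>)" using K(4) \<mu>(1) by simp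
      then show ?thesis using \<mu>(2) by (simp add: involutive_def)
    qed
  qed (fact assms)+
  \<comment> \<open>Strict inclusions are given only for distinct indices, so equal indices are
    treated apart.\<close>
  have mono: "K \<mu> \<subseteq> K \<kappa>" if "\<mu> \<in> \<Lambda>" "\<kappa> \<in> \<Lambda>" "leq \<mu> \<kappa>" for \<mu> \<kappa>
    using K(2) that by (cases "\<mu> = \<kappa>") auto
  have ub: "\<exists>\<kappa>\<in>\<Lambda>. K \<mu> \<subseteq> K \<kappa> \<and> K \<nu> \<subseteq> K \<kappa>" if \<mu>\<nu>: "\<mu> \<in> \<Lambda>" "\<nu> \<in> \<Lambda>" for \<mu> \<nu>
  proof -
    have "\<forall>\<mu>\<in>\<Lambda>. \<forall>\<nu>\<in>\<Lambda>. \<exists>\<kappa>\<in>\<Lambda>. leq \<mu> \<kappa> \<and> leq \<nu> \<kappa>" using shape by (simp add: shape_def)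
    then obtain \<kappa> where "\<kappa> \<in> \<Lambda>" "leq \<mu> \<kappa>" "leq \<nu> \<kappa>" using \<mu>\<nu> by blast
    then show ?thesis using mono \<mu>\<nu> by blast
  qed
  \<comment> \<open>Directedness for pairs, extended to finite sets by induction. Starting from a
    prescribed K \<mu> serves both later demands: one member containing E (take \<mu> = i0), and one
    containing a given member together with E.\<close>
  have dir2: "\<exists>\<kappa>\<in>\<Lambda>. K \<mu> \<subseteq> K \<kappa> \<and> E \<subseteq> K \<kappa>" if "\<mu> \<in> \<Lambda>" "finite E" "E \<subseteq> carrier H" for \<mu> E
    using that(2,3)
  proof (induction E)
    case (insert x E)
    then obtain \<kappa> \<nu> where \<kappa>: "\<kappa> \<in> \<Lambda>" "K \<mu> \<subseteq> K \<kappa>" "E \<subseteq> K \<kappa>" "\<nu> \<in> \<Lambda>" "x \<in> K \<nu>" unfolding K(3) by auto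
    obtain \<tau> where "\<tau> \<in> \<Lambda>" "K \<kappa> \<subseteq> K \<tau>" "K \<nu> \<subseteq> K \<tau>" using ub[OF \<kappa>(1,4)] by blast
    then show ?case using \<kappa> by (intro bexI[of _ \<tau>]) auto
  qed (use that(1) in auto)
  show ?thesis
  proof (rule diagonal_tensor_pseudo_coherent[of "K ` \<Lambda>"])
    show "finitely_presented H L" by (rule coherent_finitely_presented) (fact assms)+
    show "subhopf A" if "A \<in> K ` \<Lambda>" for A using that K(1) by (auto intro: sub_hopf_algebra_subhopf)
    show "\<exists>m w. (\<forall>i<m::nat. w i \<in> carrier H) \<and> A \<subseteq> lin_span k H {..<m} w" if "A \<in> K ` \<Lambda>" for A
    proof -
      obtain \<mu> where \<mu>: "\<mu> \<in> \<Lambda>" "A = K \<mu>" using \<open>A \<in> K ` \<Lambda>\<close> by blast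
      have A: "submodule A k H" and fA: "finitely_generated k (H\<lparr>carrier := A\<rparr>)"
        using K(1) \<mu> by (auto simp: sub_hopf_algebra_def)
      have sg: "subgroup A (add_monoid H)" "\<And>c x. c \<in> carrier k \<Longrightarrow> x \<in> A \<Longrightarrow> c \<odot>\<^bsub>H\<^esub> x \<in> A"
        using A by (auto simp: submodule_def submodule_axioms_def)
      have AH: "A \<subseteq> carrier H" using subgroup.subset[OF sg(1)] by simp
      obtain m w where w: "\<And>i. i < m \<Longrightarrow> w i \<in> carrier (H\<lparr>carrier := A\<rparr>)"
        "carrier (H\<lparr>carrier := A\<rparr>) \<subseteq> lin_span k (H\<lparr>carrier := A\<rparr>) {..<m::nat} w"
      proof (rule finitely_generated_enum[OF sub_abelian(1)[OF H_ab sg(1)] _ fA])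
        show "c \<odot>\<^bsub>H\<lparr>carrier := A\<rparr>\<^esub> x \<in> carrier (H\<lparr>carrier := A\<rparr>)"
          if "c \<in> carrier k" "x \<in> carrier (H\<lparr>carrier := A\<rparr>)" for c x using sg(2) that by simp
      qed (rule that)
      have "A \<subseteq> lin_span k H {..<m} w"
      proof
        fix x assume "x \<in> A"
        then obtain c where c: "\<forall>i\<in>{..<m}. c i \<in> carrier k" "x = (\<Oplus>\<^bsub>H\<lparr>carrier := A\<rparr>\<^esub>i\<in>{..<m}. c i \<odot>\<^bsub>H\<^esub> w i)"
          using w(2) by (auto simp: lin_span_def)
        have "x = (\<Oplus>\<^bsub>H\<^esub>i\<in>{..<m}. c i \<odot>\<^bsub>H\<^esub> w i)"
          unfolding c(2) using c(1) w(1) sg(2) by (intro sub_abelian(2)[OF H_ab sg(1)]) auto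
        then show "x \<in> lin_span k H {..<m} w" using c(1) unfolding lin_span_def by auto
      qed
      then show ?thesis using w(1) AH by (intro exI[of _ m] exI[of _ w]) auto
    qed
    show "\<exists>A\<in>K ` \<Lambda>. E \<subseteq> A" if "finite E" "E \<subseteq> carrier H" for E
      using dir2[OF _ that, of i0] shape by (auto simp: shape_def)
    show "\<exists>A'\<in>K ` \<Lambda>. A \<subseteq> A' \<and> E \<subseteq> A'" if "A \<in> K ` \<Lambda>" "finite E" "E \<subseteq> carrier H" for A E
    proof -
      obtain \<mu> where \<mu>: "\<mu> \<in> \<Lambda>" "A = K \<mu>" using \<open>A \<in> K ` \<Lambda>\<close> by blast
      show ?thesis using dir2[OF \<mu>(1) that(2,3)] \<mu>(2) by auto
    qed
  qed
qed

end
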